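(* Let $(A,\mathfrak{m})$ be a Cohen–Macaulay local ring with $\dim A=3$. Let $I\subseteq J$ be $\mathfrak{m}$-primary ideals of $A$ with $I$ a reduction of $J$. Suppose $Gr_I(A)$ is Cohen–Macaulay and $J$ is asymptotically normal. If $e_3^J(A)=e_3^I(A)$, then $Gr_{J^n}(A)$ is Cohen–Macaulay for all $n\gg0$.
   Context: $Gr_K(A)=\bigoplus_{n\ge0}K^n/K^{n+1}$ for an ideal $K$. $J$ is asymptotically normal if $J^n$ is integrally closed for all $n\gg0$. For an $\mathfrak{m}$-primary ideal $K$, the Hilbert coefficients $e_i^K(A)$ are the integers with $\lambda(A/K^{n+1})=\sum_{i=0}^3(-1)^ie_i^K(A)\binom{n+3-i}{3-i}$ for $n\gg0$. A reduction: $I J^n=J^{n+1}$ for large $n$. *)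

theory Defs
  imports "HOL-Algebra.Algebra"
begin

primrec ipow :: "'a ring \<Rightarrow> 'a set \<Rightarrow> nat \<Rightarrow> 'a set" where
  "ipow R K 0 = carrier R"
| "ipow R K (Suc n) = ideal_prod R K (ipow R K n)"

definition local_ring :: "'a ring \<Rightarrow> 'a set \<Rightarrow> bool" where
  "local_ring R m \<longleftrightarrow> cring R \<and> maximalideal m R \<and> (\<forall>P. maximalideal P R \<longrightarrow> P = m)"

definition prime_chain :: "'a ring \<Rightarrow> (nat \<Rightarrow> 'a set) \<Rightarrow> nat \<Rightarrow> bool" where
  "prime_chain R C n \<longleftrightarrow> (\<forall>i\<le>n. primeideal (C i) R) \<and> (\<forall>i<n. C i \<subset> C (Suc i))"

definition krull_dim_is :: "'a ring \<Rightarrow> nat \<Rightarrow> bool" where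
  "krull_dim_is R d \<longleftrightarrow> (\<exists>C. prime_chain R C d) \<and> \<not> (\<exists>C. prime_chain R C (Suc d))"

definition regular_seq :: "'a ring \<Rightarrow> 'a list \<Rightarrow> bool" where
  "regular_seq R xs \<longleftrightarrow> set xs \<subseteq> carrier R \<and> Idl\<^bsub>R\<^esub> (set xs) \<noteq> carrier R \<and>
     (\<forall>i < length xs. \<forall>y \<in> carrier R.
        xs ! i \<otimes>\<^bsub>R\<^esub> y \<in> Idl\<^bsub>R\<^esub> (set (take i xs)) \<longrightarrow> y \<in> Idl\<^bsub>R\<^esub> (set (take i xs)))"

(* Cohen-Macaulay ring: Noetherian, and for every maximal ideal P,
   depth R_P = grade(P,R) \<ge> ht P = dim R_P.  Here "grade(P,R) \<ge> ht P" is written as: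
   every chain of primes of length n ending at P yields an R-regular sequence of length n in P. *)
definition cohen_macaulay :: "'a ring \<Rightarrow> bool" where
  "cohen_macaulay R \<longleftrightarrow> cring R \<and> noetherian_ring R \<and>
     (\<forall>P. maximalideal P R \<longrightarrow>
        (\<forall>C n. prime_chain R C n \<and> C n = P \<longrightarrow>
           (\<exists>xs. length xs = n \<and> set xs \<subseteq> P \<and> regular_seq R xs)))"

definition m_primary :: "'a ring \<Rightarrow> 'a set \<Rightarrow> 'a set \<Rightarrow> bool" where
  "m_primary R m K \<longleftrightarrow> ideal K R \<and> K \<subseteq> m \<and> (\<forall>x\<in>m. \<exists>n. x [^]\<^bsub>R\<^esub> (n::nat) \<in> K)"

definition ideal_chain_to_top :: "'a ring \<Rightarrow> 'a set \<Rightarrow> (nat \<Rightarrow> 'a set) \<Rightarrow> nat \<Rightarrow> bool" where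
  "ideal_chain_to_top R K C n \<longleftrightarrow> C 0 = K \<and> C n = carrier R \<and> (\<forall>i\<le>n. ideal (C i) R) \<and>
     (\<forall>i<n. C i \<subset> C (Suc i))"

definition colength :: "'a ring \<Rightarrow> 'a set \<Rightarrow> nat" where
  "colength R K = (GREATEST n. \<exists>C. ideal_chain_to_top R K C n)"

(* Hilbert coefficients e_0,...,e_3 (dimension 3), extended by 0 for i > 3 *)
definition hilbert_coeffs :: "'a ring \<Rightarrow> 'a set \<Rightarrow> nat \<Rightarrow> int" where
  "hilbert_coeffs R K = (THE e. (\<forall>i>3. e i = 0) \<and>
     (\<forall>\<^sub>F n in sequentially. int (colength R (ipow R K (n + 1))) =
        (\<Sum>i\<le>3. (-1) ^ i * e i * int ((n + 3 - i) choose (3 - i)))))"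

definition is_reduction :: "'a ring \<Rightarrow> 'a set \<Rightarrow> 'a set \<Rightarrow> bool" where
  "is_reduction R I J \<longleftrightarrow> I \<subseteq> J \<and>
     (\<exists>N. \<forall>n\<ge>N. ideal_prod R I (ipow R J n) = ipow R J (Suc n))"

definition ideal_int_closure :: "'a ring \<Rightarrow> 'a set \<Rightarrow> 'a set" where
  "ideal_int_closure R K = {x \<in> carrier R. \<exists>n::nat. n \<ge> 1 \<and> (\<exists>a. (\<forall>i\<in>{1..n}. a i \<in> ipow R K i) \<and>
      x [^]\<^bsub>R\<^esub> n \<oplus>\<^bsub>R\<^esub> finsum R (\<lambda>i. a i \<otimes>\<^bsub>R\<^esub> x [^]\<^bsub>R\<^esub> (n - i)) {1..n} = \<zero>\<^bsub>R\<^esub>)}"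

definition integrally_closed_ideal :: "'a ring \<Rightarrow> 'a set \<Rightarrow> bool" where
  "integrally_closed_ideal R K \<longleftrightarrow> ideal_int_closure R K \<subseteq> K"

definition asymptotically_normal :: "'a ring \<Rightarrow> 'a set \<Rightarrow> bool" where
  "asymptotically_normal R J \<longleftrightarrow> (\<exists>N. \<forall>n\<ge>N. integrally_closed_ideal R (ipow R J n))"

(* Associated graded ring Gr_K(R) = \<Oplus>_n K^n/K^(n+1).
   An element is represented by f with f n \<in> K^n and f n \<in> K^(n+1) for almost all n;
   two representatives are identified when f n - g n \<in> K^(n+1) for all n. *)
definition gr_reps :: "'a ring \<Rightarrow> 'a set \<Rightarrow> (nat \<Rightarrow> 'a) set" where
  "gr_reps R K = {f. (\<forall>n. f n \<in> ipow R K n) \<and> (\<exists>N. \<forall>n\<ge>N. f n \<in> ipow R K (Suc n))}"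

definition gr_rel :: "'a ring \<Rightarrow> 'a set \<Rightarrow> ((nat \<Rightarrow> 'a) \<times> (nat \<Rightarrow> 'a)) set" where
  "gr_rel R K = {(f, g). f \<in> gr_reps R K \<and> g \<in> gr_reps R K \<and>
                        (\<forall>n. f n \<ominus>\<^bsub>R\<^esub> g n \<in> ipow R K (Suc n))}"

definition gr_class :: "'a ring \<Rightarrow> 'a set \<Rightarrow> (nat \<Rightarrow> 'a) \<Rightarrow> (nat \<Rightarrow> 'a) set" where
  "gr_class R K f = gr_rel R K `` {f}"

definition gr_rep :: "(nat \<Rightarrow> 'a) set \<Rightarrow> (nat \<Rightarrow> 'a)" where
  "gr_rep S = (SOME h. h \<in> S)"

definition assoc_graded :: "'a ring \<Rightarrow> 'a set \<Rightarrow> (nat \<Rightarrow> 'a) set ring" where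
  "assoc_graded R K = \<lparr> carrier = gr_reps R K // gr_rel R K,
     monoid.mult = (\<lambda>U V. gr_class R K (\<lambda>n. finsum R (\<lambda>i. gr_rep U i \<otimes>\<^bsub>R\<^esub> gr_rep V (n - i)) {..n})),
     monoid.one = gr_class R K (\<lambda>n. if n = 0 then \<one>\<^bsub>R\<^esub> else \<zero>\<^bsub>R\<^esub>),
     ring.zero = gr_class R K (\<lambda>n. \<zero>\<^bsub>R\<^esub>),
     ring.add = (\<lambda>U V. gr_class R K (\<lambda>n. gr_rep U n \<oplus>\<^bsub>R\<^esub> gr_rep V n)) \<rparr>"

end

theory Submission
  imports Defs
begin

text \<open>
  Since \<open>Gr\<^sub>I\<close> is Cohen--Macaulay, for all large \<open>n\<close> there are \<open>x, y, z\<close> in \<open>I\<^sup>n\<close> whose initial forms are a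
  regular sequence generating everything in large degree. Put \<open>Q = (x, y, z)\<close>, \<open>K = J\<^sup>n\<close>. Then \<open>K\<^sup>4 = Q K\<^sup>3\<close>, and
  Itoh's theorem (all powers of \<open>K\<close> being integrally closed) gives \<open>Q \<inter> K\<^sup>2 = Q K\<close>; the same holds for
  \<open>I\<^sup>n\<close>. Computing colons yields \<open>\<lambda>(A/QK\<^sup>2) = \<lambda>(A/Q) + 3 \<lambda>(A/K\<^sup>2) - 3 \<lambda>(A/K)\<close> in both cases, so the third
  difference of the Hilbert polynomial gives \<open>\<lambda>(A/QK\<^sup>2) - \<lambda>(A/K\<^sup>3) = e\<^sub>3 - n\<^sup>3e\<^sub>0 + \<lambda>(A/Q)\<close>. As \<open>e\<^sub>0\<close> and \<open>e\<^sub>3\<close>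
  agree for \<open>I\<close> and \<open>J\<close>, comparison with \<open>Q \<inter> I\<^sup>3\<^sup>n = Q I\<^sup>2\<^sup>n\<close> forces \<open>Q \<inter> K\<^sup>3 = Q K\<^sup>2\<close>. Hence
  \<open>Q \<inter> K\<^sup>i = Q K\<^sup>i\<^sup>-\<^sup>1\<close> for all \<open>i\<close>, and the initial forms of \<open>x, y, z\<close> are a regular sequence of \<open>Gr\<^sub>K\<close>. By growth
  of lengths, prime chains of \<open>Gr\<^sub>K\<close> have length at most 3, and every maximal ideal contains elements with
  leading forms \<open>x\<^sup>e, y\<^sup>e, z\<^sup>e\<close> for some \<open>e\<close>; these are again a regular sequence.

  Itoh's theorem is proved without local cohomology: if \<open>xb + yc + zd \<in> K\<^sup>2\<close>, then raising \<open>zd\<close> to high powers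
  shows that \<open>b\<^sup>k\<^sup>+\<^sup>1, c\<^sup>k\<^sup>+\<^sup>1 \<in> K\<^sup>k\<close> implies \<open>d\<^sup>k\<^sup>+\<^sup>2 \<in> K\<^sup>k\<^sup>+\<^sup>1\<close>, so \<open>b, c, d\<close> are integral over \<open>K\<close>.
\<close>

text \<open>Two demands shape the proof. First, the bound \<open>t\<close> beyond which the initial
  forms of \<open>x, y, z\<close> generate everything must not depend on \<open>n\<close>. Forms
  chosen afresh for each \<open>n\<close> would not give this; products of forms from two
  consecutive degrees do. With \<open>J^(i+r) = I^i J^r\<close> the inequality
  \<open>4n - r >= t + 3n\<close> then yields the exponent 4, so that only the exponents 2 and 3 of
  the intersection condition have to be fought for: 2 by integral closedness, 3 by lengths. The
  number \<open>e_3\<close> enters because the polynomial of \<open>length(A/K^n)\<close> has the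
  value \<open>-e_3\<close> at 0, the fourth node of a third difference over
  \<open>n, 2n, 3n\<close>. Second, Cohen-Macaulayness is demanded at all maximal ideals of the
  graded ring, also at inhomogeneous ones. No localisation is formed: there, regular elements are
  recognised by their forms of highest degree, and heights are bounded by counting lengths.\<close>

locale cr = cring R for R :: "'a ring" (structure)

section \<open>Arithmetic of ideals in a commutative ring\<close>

context cr
begin

abbreviation sumI :: "'a set \<Rightarrow> 'a set \<Rightarrow> 'a set" (infixl "\<boxplus>" 65) where
  "U \<boxplus> V \<equiv> set_add R U V"

abbreviation \<A> :: "'a set" where "\<A> \<equiv> carrier R"

abbreviation idl :: "'a set \<Rightarrow> bool" where "idl U \<equiv> ideal U R"

definition smul :: "'a \<Rightarrow> 'a set \<Rightarrow> 'a set" where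
  "smul x U = {x \<otimes> u | u. u \<in> U}"

definition colon :: "'a set \<Rightarrow> 'a \<Rightarrow> 'a set" where
  "colon U x = {a \<in> \<A>. x \<otimes> a \<in> U}"

text \<open>Also true for the unit ideal \<open>U\<close> and for units \<open>x\<close>. Properness
  of quotients is tracked separately, by containment in a maximal ideal.\<close>

definition nzd :: "'a set \<Rightarrow> 'a \<Rightarrow> bool" where
  "nzd U x \<longleftrightarrow> (\<forall>y\<in>\<A>. x \<otimes> y \<in> U \<longrightarrow> y \<in> U)"

lemma idl_carr: "idl U \<Longrightarrow> a \<in> U \<Longrightarrow> a \<in> \<A>"
  by (rule ideal.Icarr)

lemma idl_sub: "idl U \<Longrightarrow> U \<subseteq> \<A>"
  using idl_carr by blast

lemma idl_zero: "idl U \<Longrightarrow> \<zero> \<in> U"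
  by (simp add: additive_subgroup.zero_closed ideal.axioms(1))

lemma idl_add: "idl U \<Longrightarrow> a \<in> U \<Longrightarrow> b \<in> U \<Longrightarrow> a \<oplus> b \<in> U"
  by (simp add: additive_subgroup.a_closed ideal.axioms(1))

lemma idl_neg: "idl U \<Longrightarrow> a \<in> U \<Longrightarrow> \<ominus> a \<in> U"
  by (simp add: additive_subgroup.a_inv_closed ideal.axioms(1) ideal.axioms(2) ring.is_abelian_group)

lemma idl_minus: "idl U \<Longrightarrow> a \<in> U \<Longrightarrow> b \<in> U \<Longrightarrow> a \<ominus> b \<in> U"
  unfolding a_minus_def by (simp add: idl_add idl_neg)

lemma idl_l: "idl U \<Longrightarrow> a \<in> U \<Longrightarrow> x \<in> \<A> \<Longrightarrow> x \<otimes> a \<in> U"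
  by (rule ideal.I_l_closed)

lemma idl_r: "idl U \<Longrightarrow> a \<in> U \<Longrightarrow> x \<in> \<A> \<Longrightarrow> a \<otimes> x \<in> U"
  by (rule ideal.I_r_closed)

lemma idl_cancel:
  assumes "idl U" "a \<in> U" "a \<oplus> b \<in> U" "b \<in> \<A>" shows "b \<in> U"
proof -
  have a: "a \<in> \<A>" using assms idl_carr by blast
  have "b = (a \<oplus> b) \<ominus> a" using a assms(4) by algebra
  thus ?thesis using idl_minus[OF assms(1) assms(3) assms(2)] by simp
qed

lemma idl_cancel_minus:
  assumes "idl U" "a \<ominus> b \<in> U" "b \<in> U" "a \<in> \<A>" shows "a \<in> U"
proof -
  have b: "b \<in> \<A>" using assms idl_carr by blast
  have "a = b \<oplus> (a \<ominus> b)" using b assms(4) by algebra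
  thus ?thesis using idl_add[OF assms(1) assms(3) assms(2)] by simp
qed

lemma idl_one: "idl U \<Longrightarrow> \<one> \<in> U \<Longrightarrow> U = \<A>"
  by (simp add: ideal.one_imp_carrier)

lemma idlI:
  assumes "U \<subseteq> \<A>" "\<zero> \<in> U" "\<And>a b. a \<in> U \<Longrightarrow> b \<in> U \<Longrightarrow> a \<oplus> b \<in> U"
    "\<And>a x. a \<in> U \<Longrightarrow> x \<in> \<A> \<Longrightarrow> x \<otimes> a \<in> U"
  shows "idl U"
proof (rule idealI[OF ring_axioms])
  have neg: "\<ominus> a \<in> U" if "a \<in> U" for a
  proof -
    have "\<ominus> a = (\<ominus> \<one>) \<otimes> a" using that assms(1) l_minus[of \<one> a] by auto
    thus ?thesis using assms(4)[OF that, of "\<ominus> \<one>"] by simp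
  qed
  show "subgroup U (add_monoid R)"
    using assms neg by (intro subgroup.intro) (auto simp: a_inv_def)
  show "x \<otimes> a \<in> U" if "a \<in> U" "x \<in> \<A>" for a x using assms that by blast
  show "a \<otimes> x \<in> U" if "a \<in> U" "x \<in> \<A>" for a x
  proof -
    have "a \<in> \<A>" using that assms(1) by blast
    thus ?thesis using assms(4)[OF that] m_comm[of a x] that by simp
  qed
qed

lemma idl_finsum: "idl U \<Longrightarrow> (\<And>i. i \<in> A \<Longrightarrow> f i \<in> U) \<Longrightarrow> finsum R f A \<in> U"
proof (induction A rule: infinite_finite_induct)
  case (infinite A)
  then show ?case by (simp add: finsum_def finprod_def idl_zero)
next
  case empty
  then show ?case by (simp add: idl_zero)
next
  case (insert x F)
  have "f \<in> insert x F \<rightarrow> \<A>" using insert.prems idl_carr by blast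
  then have "finsum R f (insert x F) = f x \<oplus> finsum R f F"
    using insert.hyps by (simp add: finsum_insert)
  with insert show ?case by (simp add: idl_add)
qed

lemma sum_mem: "a \<in> U \<Longrightarrow> b \<in> V \<Longrightarrow> a \<oplus> b \<in> U \<boxplus> V"
  unfolding set_add_def' by blast

lemma sumE:
  assumes "a \<in> U \<boxplus> V" obtains u v where "u \<in> U" "v \<in> V" "a = u \<oplus> v"
  using assms unfolding set_add_def' by blast

lemma sum_l:
  assumes "idl U" "idl V" shows "U \<subseteq> U \<boxplus> V"
proof
  fix a assume a: "a \<in> U"
  have "a \<oplus> \<zero> \<in> U \<boxplus> V" by (rule sum_mem[OF a idl_zero[OF assms(2)]])
  then show "a \<in> U \<boxplus> V" using idl_carr[OF assms(1) a] by simp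
qed

lemma sum_r:
  assumes "idl U" "idl V" shows "V \<subseteq> U \<boxplus> V"
proof
  fix a assume a: "a \<in> V"
  have "\<zero> \<oplus> a \<in> U \<boxplus> V" by (rule sum_mem[OF idl_zero[OF assms(1)] a])
  then show "a \<in> U \<boxplus> V" using idl_carr[OF assms(2) a] by simp
qed

lemma sum_least:
  assumes "idl W" "U \<subseteq> W" "V \<subseteq> W" shows "U \<boxplus> V \<subseteq> W"
proof
  fix a assume "a \<in> U \<boxplus> V"
  then obtain u v where "u \<in> U" "v \<in> V" "a = u \<oplus> v" by (rule sumE)
  then show "a \<in> W" using assms(2,3) idl_add[OF assms(1)] by blast
qed

lemma sum_mono: "U \<subseteq> U' \<Longrightarrow> V \<subseteq> V' \<Longrightarrow> U \<boxplus> V \<subseteq> U' \<boxplus> V'"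
  unfolding set_add_def' by blast

lemma sum_absorb:
  assumes "idl U" "idl V" "V \<subseteq> U" shows "U \<boxplus> V = U"
  using sum_l[OF assms(1,2)] sum_least[OF assms(1) order_refl assms(3)] by (rule subset_antisym[rotated])

lemma sum_idl: "idl U \<Longrightarrow> idl V \<Longrightarrow> idl (U \<boxplus> V)"
  by (rule add_ideals)

lemma sum_comm: "U \<subseteq> \<A> \<Longrightarrow> V \<subseteq> \<A> \<Longrightarrow> U \<boxplus> V = V \<boxplus> U"
  by (rule set_add_comm)

lemma sum_assoc: "U \<subseteq> \<A> \<Longrightarrow> V \<subseteq> \<A> \<Longrightarrow> W \<subseteq> \<A> \<Longrightarrow> (U \<boxplus> V) \<boxplus> W = U \<boxplus> (V \<boxplus> W)"
proof (intro subset_antisym subsetI)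
  fix a assume c: "U \<subseteq> \<A>" "V \<subseteq> \<A>" "W \<subseteq> \<A>"
  {
    assume "a \<in> (U \<boxplus> V) \<boxplus> W"
    then obtain u v w where "u \<in> U" "v \<in> V" "w \<in> W" "a = (u \<oplus> v) \<oplus> w" by (auto elim!: sumE)
    moreover have "(u \<oplus> v) \<oplus> w = u \<oplus> (v \<oplus> w)" using c calculation by (intro a_assoc) auto
    ultimately show "a \<in> U \<boxplus> (V \<boxplus> W)" by (simp add: sum_mem)
  next
    assume "a \<in> U \<boxplus> (V \<boxplus> W)"
    then obtain u v w where "u \<in> U" "v \<in> V" "w \<in> W" "a = u \<oplus> (v \<oplus> w)" by (auto elim!: sumE)
    moreover have "(u \<oplus> v) \<oplus> w = u \<oplus> (v \<oplus> w)" using c calculation by (intro a_assoc) auto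
    moreover have "(u \<oplus> v) \<oplus> w \<in> (U \<boxplus> V) \<boxplus> W" using calculation by (intro sum_mem) auto
    ultimately show "a \<in> (U \<boxplus> V) \<boxplus> W" by simp
  }
qed

abbreviation PI3 :: "'a \<Rightarrow> 'a \<Rightarrow> 'a \<Rightarrow> 'a set" where "PI3 x y z \<equiv> PIdl x \<boxplus> PIdl y \<boxplus> PIdl z"

lemma PI_idl: "x \<in> \<A> \<Longrightarrow> idl (PIdl x)"
  by (rule cgenideal_ideal)

lemma PI_self: "x \<in> \<A> \<Longrightarrow> x \<in> PIdl x"
  by (rule cgenideal_self)

lemma PI_iff: "x \<in> \<A> \<Longrightarrow> a \<in> PIdl x \<longleftrightarrow> (\<exists>r\<in>\<A>. a = x \<otimes> r)"
  unfolding cgenideal_def using m_comm by blast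

lemma sumPIE:
  assumes "a \<in> U \<boxplus> PIdl x" "x \<in> \<A>"
  obtains u r where "u \<in> U" "r \<in> \<A>" "a = u \<oplus> x \<otimes> r"
proof -
  obtain u v where uv: "u \<in> U" "v \<in> PIdl x" "a = u \<oplus> v" using assms(1) by (rule sumE)
  obtain r where "r \<in> \<A>" "v = x \<otimes> r" using uv(2) PI_iff[OF assms(2)] by blast
  then show thesis using that uv by blast
qed

lemma sumPI_mem: "u \<in> U \<Longrightarrow> r \<in> \<A> \<Longrightarrow> x \<in> \<A> \<Longrightarrow> u \<oplus> x \<otimes> r \<in> U \<boxplus> PIdl x"
  using PI_iff[of x "x \<otimes> r"] by (intro sum_mem) auto

lemma PI_smul: "x \<in> \<A> \<Longrightarrow> PIdl x = smul x (\<A>)"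
  unfolding smul_def using PI_iff by blast

lemma PI_least: "idl U \<Longrightarrow> x \<in> U \<Longrightarrow> PIdl x \<subseteq> U"
  by (simp add: cgenideal_minimal)

lemma smul_mem: "u \<in> U \<Longrightarrow> x \<otimes> u \<in> smul x U"
  unfolding smul_def by blast

lemma sum_smulE:
  assumes "a \<in> U \<boxplus> smul x V"
  obtains u v where "u \<in> U" "v \<in> V" "a = u \<oplus> x \<otimes> v"
  using assms unfolding smul_def by (auto elim!: sumE)

lemma sum_smul_mem: "u \<in> U \<Longrightarrow> v \<in> V \<Longrightarrow> u \<oplus> x \<otimes> v \<in> U \<boxplus> smul x V"
  by (intro sum_mem smul_mem)

lemma smul_mono: "U \<subseteq> V \<Longrightarrow> smul x U \<subseteq> smul x V"
  unfolding smul_def by blast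

lemma smul_idl:
  assumes "x \<in> \<A>" "idl U" shows "idl (smul x U)"
proof (rule idlI)
  show "smul x U \<subseteq> \<A>" unfolding smul_def using assms idl_carr by blast
  show "\<zero> \<in> smul x U" using smul_mem[OF idl_zero[OF assms(2)], of x] assms by simp
next
  fix a b assume "a \<in> smul x U" "b \<in> smul x U"
  then obtain u v where u: "u \<in> U" "v \<in> U" "a = x \<otimes> u" "b = x \<otimes> v" unfolding smul_def by blast
  then have "a \<oplus> b = x \<otimes> (u \<oplus> v)" using assms idl_carr r_distr by simp
  then show "a \<oplus> b \<in> smul x U" using u assms by (simp add: smul_mem idl_add)
next
  fix a r assume "a \<in> smul x U" and r: "r \<in> \<A>"
  then obtain u where u: "u \<in> U" "a = x \<otimes> u" unfolding smul_def by blast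
  then have uc: "u \<in> \<A>" using assms idl_carr by blast
  have "r \<otimes> a = x \<otimes> (r \<otimes> u)" using u(2) uc r assms(1) m_lcomm by simp
  then show "r \<otimes> a \<in> smul x U" using u assms r by (simp add: smul_mem idl_l)
qed

lemma smul_sub_PI: "x \<in> \<A> \<Longrightarrow> U \<subseteq> \<A> \<Longrightarrow> smul x U \<subseteq> PIdl x"
  unfolding PI_smul by (rule smul_mono)

lemma colon_idl:
  assumes "idl U" "x \<in> \<A>" shows "idl (colon U x)"
  unfolding colon_def
proof (rule idlI)
  show "\<zero> \<in> {a \<in> \<A>. x \<otimes> a \<in> U}" using assms idl_zero by simp
next
  fix a b assume "a \<in> {a \<in> \<A>. x \<otimes> a \<in> U}" "b \<in> {a \<in> \<A>. x \<otimes> a \<in> U}"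
  then show "a \<oplus> b \<in> {a \<in> \<A>. x \<otimes> a \<in> U}"
    using assms by (simp add: r_distr idl_add)
next
  fix a r assume "a \<in> {a \<in> \<A>. x \<otimes> a \<in> U}" "r \<in> \<A>"
  then show "r \<otimes> a \<in> {a \<in> \<A>. x \<otimes> a \<in> U}"
    using assms by (simp add: m_lcomm idl_l)
qed auto

lemma colon_sup: "idl U \<Longrightarrow> x \<in> \<A> \<Longrightarrow> U \<subseteq> colon U x"
  unfolding colon_def using idl_l idl_carr by blast

lemma nzdD: "nzd U x \<Longrightarrow> x \<otimes> y \<in> U \<Longrightarrow> y \<in> \<A> \<Longrightarrow> y \<in> U"
  unfolding nzd_def by blast

lemma nzd_mult:
  assumes "nzd U x" "nzd U y" "x \<in> \<A>" "y \<in> \<A>"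
  shows "nzd U (x \<otimes> y)"
  unfolding nzd_def
proof (intro ballI impI)
  fix a assume a: "a \<in> \<A>" "x \<otimes> y \<otimes> a \<in> U"
  then have "x \<otimes> (y \<otimes> a) \<in> U" using assms m_assoc by simp
  then show "a \<in> U" using assms a nzdD[of U x "y \<otimes> a"] nzdD[of U y a] by simp
qed

lemma prod_mem: "a \<in> U \<Longrightarrow> b \<in> V \<Longrightarrow> a \<otimes> b \<in> U \<cdot> V"
  by (rule ideal_prod.prod)

lemma prod_least:
  assumes "idl W" "\<And>a b. a \<in> U \<Longrightarrow> b \<in> V \<Longrightarrow> a \<otimes> b \<in> W" shows "U \<cdot> V \<subseteq> W"
proof
  fix s assume "s \<in> U \<cdot> V" then show "s \<in> W"
  proof (induct s rule: ideal_prod.induct)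
    case (prod i j) then show ?case by (rule assms(2))
  next
    case (sum s1 s2) then show ?case using idl_add[OF assms(1)] by blast
  qed
qed

lemma prod_mono: "U \<subseteq> U' \<Longrightarrow> V \<subseteq> V' \<Longrightarrow> U \<cdot> V \<subseteq> U' \<cdot> V'"
proof
  fix s assume "U \<subseteq> U'" "V \<subseteq> V'" "s \<in> U \<cdot> V"
  from this(3,1,2) show "s \<in> U' \<cdot> V'"
  proof (induct s rule: ideal_prod.induct)
    case (prod i j) then show ?case by (intro prod_mem) auto
  next
    case (sum s1 s2) then show ?case by (intro ideal_prod.sum) auto
  qed
qed

lemma prod_idl: "idl U \<Longrightarrow> idl V \<Longrightarrow> idl (U \<cdot> V)"
  by (rule ideal_prod_is_ideal)

lemma prod_PI:
  assumes "x \<in> \<A>" "idl U" shows "(PIdl x) \<cdot> U = smul x U"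
proof
  show "(PIdl x) \<cdot> U \<subseteq> smul x U"
  proof (rule prod_least[OF smul_idl[OF assms]])
    fix a b assume "a \<in> PIdl x" and b: "b \<in> U"
    then obtain r where r: "r \<in> \<A>" "a = x \<otimes> r" using assms PI_iff by blast
    then have "a \<otimes> b = x \<otimes> (r \<otimes> b)" using assms b idl_carr m_assoc by simp
    then show "a \<otimes> b \<in> smul x U" using b r assms by (simp add: smul_mem idl_l)
  qed
  show "smul x U \<subseteq> (PIdl x) \<cdot> U" unfolding smul_def using prod_mem[OF PI_self[OF assms(1)]] by auto
qed

lemma prod_sum_l:
  assumes "idl U" "idl V" "idl W" shows "(U \<boxplus> V) \<cdot> W = U \<cdot> W \<boxplus> V \<cdot> W"
proof -
  have "(U \<boxplus> V) \<cdot> W = W \<cdot> (U \<boxplus> V)" by (rule ideal_prod_commute[OF sum_idl[OF assms(1,2)] assms(3)])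
  also have "\<dots> = W \<cdot> U \<boxplus> W \<cdot> V" by (rule ideal_prod_r_distr[OF assms(3,1,2)])
  finally show ?thesis by (simp only: ideal_prod_commute[OF assms(3,1)] ideal_prod_commute[OF assms(3,2)])
qed

lemma smul_sum:
  assumes "x \<in> \<A>" "idl U" "idl V" shows "smul x (U \<boxplus> V) = smul x U \<boxplus> smul x V"
  using ideal_prod_r_distr[OF PI_idl[OF assms(1)] assms(2,3)]
  unfolding prod_PI[OF assms(1) assms(2)] prod_PI[OF assms(1) assms(3)] prod_PI[OF assms(1) sum_idl[OF assms(2,3)]] .

lemma smul_smul:
  assumes "x \<in> \<A>" "y \<in> \<A>" "U \<subseteq> \<A>" shows "smul x (smul y U) = smul (x \<otimes> y) U"
proof -
  have "x \<otimes> (y \<otimes> u) = x \<otimes> y \<otimes> u" if "u \<in> U" for u using assms m_assoc[of x y u] that by auto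
  then have "(\<lambda>u. x \<otimes> (y \<otimes> u)) ` U = (\<lambda>u. x \<otimes> y \<otimes> u) ` U" by (intro image_cong) auto
  then show ?thesis unfolding smul_def by (simp add: Setcompr_eq_image image_image)
qed

abbreviation pw :: "'a set \<Rightarrow> nat \<Rightarrow> 'a set" where "pw K n \<equiv> ipow R K n"

lemma pw_idl: "idl K \<Longrightarrow> idl (pw K n)"
  by (induction n) (auto simp: oneideal prod_idl)

lemma pw_one: "idl K \<Longrightarrow> pw K 1 = K"
  by (simp add: ideal_prod_one)

lemma pw_add: "idl K \<Longrightarrow> pw K (m + n) = pw K m \<cdot> pw K n"
proof (induction m)
  case 0
  have "\<A> \<cdot> pw K n = pw K n"
    by (rule trans[OF ideal_prod_commute[OF oneideal pw_idl[OF 0], of n] ideal_prod_one[OF pw_idl[OF 0], of n]])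
  then show ?case by simp
next
  case (Suc m)
  then show ?case by (simp add: ideal_prod_assoc pw_idl)
qed

lemma pw_pw: "idl K \<Longrightarrow> pw (pw K m) n = pw K (m * n)"
  by (induction n) (simp_all add: pw_add)

lemma pw_mono: "K \<subseteq> L \<Longrightarrow> pw K n \<subseteq> pw L n"
proof (induction n)
  case (Suc n)
  then show ?case using prod_mono[of K L "pw K n" "pw L n"] by simp
qed simp

lemma pw_antimono: "idl K \<Longrightarrow> m \<le> n \<Longrightarrow> pw K n \<subseteq> pw K m"
proof -
  assume K: "idl K" "m \<le> n"
  have "pw K n = pw K m \<cdot> pw K (n - m)" using K pw_add[of K m "n-m"] by simp
  then show ?thesis using ideal_prod_inter[OF pw_idl[OF K(1)] pw_idl[OF K(1)], of m "n - m"] by simp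
qed

lemma pw_mem_add: "idl K \<Longrightarrow> a \<in> pw K m \<Longrightarrow> b \<in> pw K n \<Longrightarrow> a \<otimes> b \<in> pw K (m + n)"
  by (simp add: pw_add prod_mem)

lemma pw_mem_sub:
  assumes "idl K" "a \<in> pw K d" "b \<in> pw K (m - d)" shows "a \<otimes> b \<in> pw K m"
  using pw_mem_add[OF assms] pw_antimono[OF assms(1), of m "d + (m - d)"] by fastforce

lemma pw_carr: "idl K \<Longrightarrow> a \<in> pw K m \<Longrightarrow> a \<in> \<A>"
  using pw_idl idl_carr by blast

lemma pw_nat_pow: "idl K \<Longrightarrow> a \<in> pw K m \<Longrightarrow> a [^] (i::nat) \<in> pw K (m * i)"
proof (induction i)
  case 0 then show ?case by simp
next
  case (Suc i)
  then have "a [^] i \<otimes> a \<in> pw K (m * i + m)" using pw_mem_add by blast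
  then show ?case by (simp add: add.commute)
qed

lemma pw_smul_sub: "idl K \<Longrightarrow> x \<in> pw K d \<Longrightarrow> smul x (pw K (m - d)) \<subseteq> pw K m"
  unfolding smul_def using pw_mem_sub by blast

lemma prime_pow: "primeideal P R \<Longrightarrow> a \<in> \<A> \<Longrightarrow> a [^] (n::nat) \<in> P \<Longrightarrow> a \<in> P"
proof (induction n)
  case 0 then show ?case using primeideal.I_notcarr primeideal.axioms(1) idl_one by fastforce
next
  case (Suc n) then show ?case using primeideal.I_prime[OF Suc.prems(1), of "a [^] n" a] by auto
qed

lemma Idl_insert:
  assumes "S \<subseteq> \<A>" "x \<in> \<A>" shows "Idl (insert x S) = Idl S \<boxplus> PIdl x"
proof
  have i: "idl (Idl S)" "idl (PIdl x)" using assms genideal_ideal PI_idl by auto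
  show "Idl (insert x S) \<subseteq> Idl S \<boxplus> PIdl x"
    by (rule genideal_minimal[OF sum_idl[OF i]])
      (use sum_l[OF i] sum_r[OF i] PI_self assms genideal_self in blast)
  have j: "idl (Idl (insert x S))" using assms genideal_ideal by simp
  show "Idl S \<boxplus> PIdl x \<subseteq> Idl (insert x S)"
    by (rule sum_least[OF j])
      (use PI_least[OF j] genideal_self[of "insert x S"] subset_Idl_subset[of "insert x S" S] assms in auto)
qed

lemma Idl_empty: "Idl {} = {\<zero>}"
  using genideal_minimal[OF zeroideal, of "{}"] genideal_ideal[of "{}"] idl_zero by blast

end

section \<open>Noetherian rings and maximal annihilators\<close>

locale ncr = cr + assumes noeth: "noetherian_ring R"
begin

lemma fg: "idl U \<Longrightarrow> \<exists>S. S \<subseteq> \<A> \<and> finite S \<and> U = Idl S"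
  using noetherian_ring.finetely_gen[OF noeth] by blast

lemma max_ideal_exists:
  assumes "FF \<noteq> {}" "\<And>U. U \<in> FF \<Longrightarrow> idl U"
  shows "\<exists>M\<in>FF. \<forall>N\<in>FF. M \<subseteq> N \<longrightarrow> N = M"
proof (rule subset_Zorn)
  fix C assume C: "subset.chain FF C"
  show "\<exists>U\<in>FF. \<forall>Y\<in>C. Y \<subseteq> U"
  proof (cases "C = {}")
    case True then show ?thesis using assms(1) by blast
  next
    case False
    have "subset.chain {I. idl I} C" using C assms(2) unfolding subset.chain_def by blast
    then have "\<Union>C \<in> C" using noetherian_ring.ideal_chain_is_trivial[OF noeth False] by blast
    moreover have "C \<subseteq> FF" using C unfolding subset.chain_def by blast
    ultimately show ?thesis by blast
  qed
qed

lemma acc: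
  fixes U :: "nat \<Rightarrow> 'a set"
  assumes "\<And>n. idl (U n)" "\<And>n. U n \<subseteq> U (Suc n)"
  shows "\<exists>N. \<forall>n\<ge>N. U n = U N"
proof -
  obtain M where M: "M \<in> range U" "\<forall>N\<in>range U. M \<subseteq> N \<longrightarrow> N = M"
    using max_ideal_exists[of "range U"] assms(1) by blast
  then obtain N where N: "M = U N" by blast
  have "U n = U N" if "n \<ge> N" for n
  proof -
    have "U N \<subseteq> U n" using lift_Suc_mono_le[of U, OF assms(2) that] .
    then show ?thesis using M N by blast
  qed
  then show ?thesis by blast
qed

text \<open>Maximal annihilators of nonzero classes of \<open>R/U\<close>. They are prime, finite in
  number, and their union contains the zerodivisors of \<open>R/U\<close>; for prime avoidance this
  does the work of primary decomposition.\<close>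

definition maxann :: "'a set \<Rightarrow> 'a set \<Rightarrow> bool" where
  "maxann U P \<longleftrightarrow> (\<exists>u\<in>\<A>. u \<notin> U \<and> P = colon U u \<and>
     (\<forall>v\<in>\<A>. v \<notin> U \<longrightarrow> P \<subseteq> colon U v \<longrightarrow> colon U v = P))"

lemma maxann_prime:
  assumes "idl U" "maxann U P" shows "primeideal P R"
proof -
  obtain u where u: "u \<in> \<A>" "u \<notin> U" "P = colon U u"
    "\<And>v. v \<in> \<A> \<Longrightarrow> v \<notin> U \<Longrightarrow> P \<subseteq> colon U v \<Longrightarrow> colon U v = P"
    using assms(2) unfolding maxann_def by blast
  show ?thesis
  proof (rule primeidealI)
    show "ideal P R" using u assms colon_idl by simp
    show "cring R" by (rule is_cring)
    have "\<one> \<notin> P" using u unfolding colon_def by simp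
    then show "\<A> \<noteq> P" by blast
  next
    fix a b assume ab: "a \<in> \<A>" "b \<in> \<A>" "a \<otimes> b \<in> P"
    show "a \<in> P \<or> b \<in> P"
    proof (cases "a \<in> P")
      case False
      then have ua: "u \<otimes> a \<notin> U" using u ab unfolding colon_def by simp
      have "P \<subseteq> colon U (u \<otimes> a)"
      proof
        fix r assume r: "r \<in> P"
        then have rc: "r \<in> \<A>" "u \<otimes> r \<in> U" using u(3) unfolding colon_def by auto
        have "u \<otimes> a \<otimes> r = a \<otimes> (u \<otimes> r)" using u(1) ab rc m_comm[of u a] m_assoc by simp
        then show "r \<in> colon U (u \<otimes> a)" unfolding colon_def using rc ab idl_l[OF assms(1)] by simp
      qed
      then have "colon U (u \<otimes> a) = P" using u(4)[of "u \<otimes> a"] ua u(1) ab by simp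
      moreover have "b \<in> colon U (u \<otimes> a)"
        using ab u unfolding colon_def by (simp add: m_assoc)
      ultimately show ?thesis by simp
    qed simp
  qed
qed

lemma prime_contains_Inter:
  assumes "finite F" "primeideal P R" "\<And>Q. Q \<in> F \<Longrightarrow> idl Q"
    "\<And>r. r \<in> \<A> \<Longrightarrow> (\<forall>Q\<in>F. r \<in> Q) \<Longrightarrow> r \<in> P"
  shows "\<exists>Q\<in>F. Q \<subseteq> P"
  using assms(1,3,4)
proof (induction F)
  case empty
  then have "\<one> \<in> P" by simp
  then show ?case using primeideal.I_notcarr[OF assms(2)] idl_one[OF primeideal.axioms(1)[OF assms(2)]] by simp
next
  case (insert Q F)
  show ?case
  proof (cases "Q \<subseteq> P")
    case False
    then obtain q where q: "q \<in> Q" "q \<notin> P" by blast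
    have iQ: "idl Q" using insert.prems(1) by simp
    have qc: "q \<in> \<A>" using idl_carr[OF iQ q(1)] .
    have "\<exists>Q\<in>F. Q \<subseteq> P"
    proof (rule insert.IH)
      fix r assume r: "r \<in> \<A>" "\<forall>Q\<in>F. r \<in> Q"
      have "q \<otimes> r \<in> P"
      proof (rule insert.prems(2))
        show "\<forall>Q\<in>insert Q F. q \<otimes> r \<in> Q"
          using r qc q(1) idl_r[OF iQ q(1) r(1)] idl_l[OF insert.prems(1)] by blast
      qed (use qc r in simp)
      then show "r \<in> P" using primeideal.I_prime[OF assms(2) qc r(1)] q by blast
    qed (use insert.prems(1) in blast)
    then show ?thesis by blast
  qed blast
qed

text \<open>By the Noetherian property the ideal generated by finitely many witnesses
  \<open>w Q\<close>, with \<open>Q\<close> in \<open>F\<close>, contains every witness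
  \<open>w P\<close>. An element lying in all \<open>Q\<close> of \<open>F\<close> kills all these
  \<open>w Q\<close> modulo \<open>U\<close>, hence also \<open>w P\<close>; so the prime
  \<open>P\<close> contains some \<open>Q\<close>, and maximality of \<open>Q\<close> gives
  \<open>P = Q\<close>.\<close>

lemma maxann_finite:
  assumes U: "idl U" shows "finite {P. maxann U P}"
proof -
  define w where "w P = (SOME u. u \<in> \<A> \<and> u \<notin> U \<and> P = colon U u)" for P
  have w: "w P \<in> \<A> \<and> w P \<notin> U \<and> P = colon U (w P)" if "maxann U P" for P
    unfolding w_def by (rule someI_ex) (use that in \<open>auto simp: maxann_def\<close>)
  define FF where "FF = {Idl (w ` F) | F. finite F \<and> F \<subseteq> {P. maxann U P}}"
  have sub: "w ` F \<subseteq> \<A>" if "F \<subseteq> {P. maxann U P}" for F using w that by blast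
  have "FF \<noteq> {}" unfolding FF_def by blast
  moreover have "idl V" if "V \<in> FF" for V
  proof -
    obtain F where "V = Idl (w ` F)" "F \<subseteq> {P. maxann U P}" using \<open>V \<in> FF\<close> unfolding FF_def by blast
    then show ?thesis using genideal_ideal[OF sub] by simp
  qed
  ultimately obtain W where W: "W \<in> FF" "\<forall>N\<in>FF. W \<subseteq> N \<longrightarrow> N = W"
    using max_ideal_exists[of FF] by blast
  then obtain F where F: "finite F" "F \<subseteq> {P. maxann U P}" "W = Idl (w ` F)" unfolding FF_def by blast
  have "P \<in> F" if P: "maxann U P" for P
  proof -
    have s2: "w ` insert P F \<subseteq> \<A>" using sub[of "insert P F"] F P by simp
    have "Idl (w ` insert P F) \<in> FF" unfolding FF_def using F P by (intro CollectI exI[of _ "insert P F"]) auto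
    moreover have "W \<subseteq> Idl (w ` insert P F)" unfolding F(3) by (rule subset_Idl_subset[OF s2]) auto
    ultimately have eq: "Idl (w ` insert P F) = W" using W(2) by blast
    have wP: "w P \<in> W" using genideal_self[OF s2] eq by auto
    have "\<exists>Q\<in>F. Q \<subseteq> P"
    proof (rule prime_contains_Inter[OF F(1) maxann_prime[OF U P]])
      show "idl Q" if "Q \<in> F" for Q using that F(2) w[of Q] colon_idl[OF U, of "w Q"] by auto
    next
      fix r assume r: "r \<in> \<A>" "\<forall>Q\<in>F. r \<in> Q"
      have "w ` F \<subseteq> colon U r"
      proof
        fix a assume "a \<in> w ` F"
        then obtain Q where Q: "Q \<in> F" "a = w Q" by blast
        then have "r \<in> colon U (w Q)" "w Q \<in> \<A>" using r F(2) w by auto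
        then show "a \<in> colon U r" unfolding colon_def Q(2) using m_comm[of r "w Q"] r(1) by simp
      qed
      then have "W \<subseteq> colon U r" unfolding F(3) by (rule genideal_minimal[OF colon_idl[OF U r(1)]])
      then have "r \<otimes> w P \<in> U" using wP unfolding colon_def by blast
      then have "r \<in> colon U (w P)" unfolding colon_def using r w[OF P] m_comm[of r "w P"] by simp
      then show "r \<in> P" using w[OF P] by simp
    qed
    then obtain Q where Q: "Q \<in> F" "Q \<subseteq> P" by blast
    then have "maxann U Q" using F by blast
    then have "P = Q" using Q(2) w[OF P] unfolding maxann_def by metis
    then show ?thesis using Q by simp
  qed
  then show ?thesis using F(1) by (metis (mono_tags) finite_subset mem_Collect_eq subsetI)
qed

lemma maxann_above:
  assumes U: "idl U" and y: "y \<in> \<A>" "y \<notin> U"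
  shows "\<exists>P. maxann U P \<and> colon U y \<subseteq> P"
proof -
  define FF where "FF = {colon U v | v. v \<in> \<A> \<and> v \<notin> U \<and> colon U y \<subseteq> colon U v}"
  have "FF \<noteq> {}" unfolding FF_def using y by blast
  moreover have "\<And>V. V \<in> FF \<Longrightarrow> idl V" unfolding FF_def using colon_idl[OF U] by blast
  ultimately obtain P where P: "P \<in> FF" "\<forall>N\<in>FF. P \<subseteq> N \<longrightarrow> N = P" using max_ideal_exists[of FF] by blast
  then obtain v where v: "v \<in> \<A>" "v \<notin> U" "colon U y \<subseteq> colon U v" "P = colon U v" unfolding FF_def by blast
  have "maxann U P" unfolding maxann_def
  proof (rule bexI[OF _ v(1)], intro conjI ballI impI)
    fix v' assume "v' \<in> \<A>" "v' \<notin> U" "P \<subseteq> colon U v'"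
    then have "colon U v' \<in> FF" unfolding FF_def using v by blast
    then show "colon U v' = P" using P(2) \<open>P \<subseteq> colon U v'\<close> by blast
  qed (use v in auto)
  then show ?thesis using v by blast
qed

lemma zero_divisor_maxann:
  assumes U: "idl U" and x: "x \<in> \<A>" "\<not> nzd U x"
  shows "\<exists>P. maxann U P \<and> x \<in> P"
proof -
  obtain y where y: "y \<in> \<A>" "y \<notin> U" "x \<otimes> y \<in> U" using x unfolding nzd_def by blast
  then have "x \<in> colon U y" unfolding colon_def using x m_comm[of x y] by simp
  then show ?thesis using maxann_above[OF U y(1,2)] by blast
qed

text \<open>Localisation at \<open>Q\<close> without fractions. A maximal \<open>B\<close> among the
  ideals \<open>colon U s\<close>, \<open>s\<close> outside \<open>Q\<close>, is the kernel of the
  map from \<open>R\<close> to \<open>R/U\<close> localised at \<open>Q\<close>. Elements outside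
  \<open>Q\<close> are regular modulo \<open>B\<close>, so a maximal annihilator of
  \<open>R/B\<close> must lie inside \<open>Q\<close>; it equals
  \<open>colon U (s u)\<close>.\<close>

lemma assoc_prime_below:
  assumes U: "idl U" and Q: "primeideal Q R" "U \<subseteq> Q"
  shows "\<exists>w\<in>\<A>. w \<notin> U \<and> primeideal (colon U w) R \<and> colon U w \<subseteq> Q"
proof -
  have iQ: "idl Q" using primeideal.axioms(1)[OF Q(1)] .
  have oneQ: "\<one> \<notin> Q" using primeideal.I_notcarr[OF Q(1)] idl_one[OF iQ] by blast
  define FF where "FF = {colon U s | s. s \<in> \<A> \<and> s \<notin> Q}"
  have "FF \<noteq> {}" unfolding FF_def using oneQ by blast
  moreover have "\<And>V. V \<in> FF \<Longrightarrow> idl V" unfolding FF_def using colon_idl[OF U] by blast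
  ultimately obtain B where B: "B \<in> FF" "\<forall>N\<in>FF. B \<subseteq> N \<longrightarrow> N = B" using max_ideal_exists[of FF] by blast
  then obtain s where s: "s \<in> \<A>" "s \<notin> Q" "B = colon U s" unfolding FF_def by blast
  have iB: "idl B" using s colon_idl[OF U] by simp
  have reg: "a \<in> B" if t: "t \<in> \<A>" "t \<notin> Q" and a: "a \<in> \<A>" "t \<otimes> a \<in> B" for t a
  proof -
    have st: "s \<otimes> t \<in> \<A>" "s \<otimes> t \<notin> Q" using s t primeideal.I_prime[OF Q(1)] by auto
    have "B \<subseteq> colon U (s \<otimes> t)"
    proof
      fix r assume "r \<in> B"
      then have r: "r \<in> \<A>" "s \<otimes> r \<in> U" using s(3) unfolding colon_def by auto
      have "s \<otimes> t \<otimes> r = t \<otimes> (s \<otimes> r)" using s t r m_comm[of s t] m_assoc by simp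
      then show "r \<in> colon U (s \<otimes> t)" unfolding colon_def using r t idl_l[OF U] by simp
    qed
    moreover have "colon U (s \<otimes> t) \<in> FF" unfolding FF_def using st by blast
    ultimately have "colon U (s \<otimes> t) = B" using B by blast
    moreover have "a \<in> colon U (s \<otimes> t)" using a s t unfolding colon_def by (simp add: m_assoc)
    ultimately show ?thesis by simp
  qed
  have "\<one> \<notin> B" using s Q unfolding colon_def by auto
  then obtain P where P: "maxann B P" using maxann_above[OF iB one_closed] by blast
  then obtain u where u: "u \<in> \<A>" "u \<notin> B" "P = colon B u" unfolding maxann_def by blast
  have eq: "colon U (s \<otimes> u) = P" unfolding u(3) s(3) colon_def using s u by (auto simp: m_assoc)
  have "P \<subseteq> Q"
  proof
    fix a assume "a \<in> P"
    then have a: "a \<in> \<A>" "u \<otimes> a \<in> B" using u(3) unfolding colon_def by auto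
    show "a \<in> Q"
    proof (rule ccontr)
      assume "a \<notin> Q"
      then have "u \<in> B" using reg[of a u] a u m_comm[of u a] by simp
      then show False using u by simp
    qed
  qed
  moreover have "s \<otimes> u \<notin> U" using u s unfolding colon_def by auto
  ultimately show ?thesis using eq maxann_prime[OF iB P] s u by (intro bexI[of _ "s \<otimes> u"]) auto
qed

end

section \<open>Regular sequences, homogeneous prime avoidance and depth\<close>

context cr
begin

text \<open>The half of permuting a regular sequence \<open>f, g\<close> that holds in every ring:
  if \<open>f a = u + g b\<close>, then \<open>b\<close> is a multiple of \<open>f\<close> modulo
  \<open>U\<close>, and \<open>f\<close> cancels. The other half, regularity of \<open>g\<close>
  modulo \<open>U\<close>, is \<open>nzd_perm\<close>.\<close>

lemma nzd_swap:
  assumes U: "idl U" and c: "f \<in> \<A>" "g \<in> \<A>" and f: "nzd U f" and g: "nzd (U \<boxplus> PIdl f) g"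
  shows "nzd (U \<boxplus> PIdl g) f"
  unfolding nzd_def
proof (intro ballI impI)
  fix a assume a: "a \<in> \<A>" "f \<otimes> a \<in> U \<boxplus> PIdl g"
  obtain u b where u: "u \<in> U" "b \<in> \<A>" "f \<otimes> a = u \<oplus> g \<otimes> b" by (rule sumPIE[OF a(2) c(2)])
  have uc: "u \<in> \<A>" using u U idl_carr by blast
  have "g \<otimes> b = \<ominus> u \<oplus> f \<otimes> a" unfolding u(3) using u(2) uc c by algebra
  moreover have "\<ominus> u \<oplus> f \<otimes> a \<in> U \<boxplus> PIdl f" using sum_mem[OF idl_neg[OF U u(1)]] PI_iff[OF c(1)] a by blast
  ultimately have "b \<in> U \<boxplus> PIdl f" using nzdD[OF g] u(2) by simp
  then obtain u' d where d: "u' \<in> U" "d \<in> \<A>" "b = u' \<oplus> f \<otimes> d" using c(1) by (rule sumPIE)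
  have u'c: "u' \<in> \<A>" using d U idl_carr by blast
  have "f \<otimes> (a \<ominus> g \<otimes> d) = f \<otimes> a \<ominus> f \<otimes> (g \<otimes> d)" using a c d by algebra
  also have "\<dots> = u \<oplus> g \<otimes> u'" unfolding u(3) d(3) using uc u'c c d by algebra
  also have "\<dots> \<in> U" using idl_add[OF U u(1) idl_l[OF U d(1) c(2)]] .
  finally have "a \<ominus> g \<otimes> d \<in> U" using nzdD[OF f] a c d by simp
  then have "(a \<ominus> g \<otimes> d) \<oplus> g \<otimes> d \<in> U \<boxplus> PIdl g" using PI_iff[OF c(2)] d by (intro sum_mem) auto
  moreover have "(a \<ominus> g \<otimes> d) \<oplus> g \<otimes> d = a" using a c d by algebra
  ultimately show "a \<in> U \<boxplus> PIdl g" by simp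
qed

lemma sum_PI_swap: "idl U \<Longrightarrow> f \<in> \<A> \<Longrightarrow> g \<in> \<A> \<Longrightarrow>
   U \<boxplus> PIdl f \<boxplus> PIdl g = U \<boxplus> PIdl g \<boxplus> PIdl f"
  using sum_assoc[of U "PIdl f" "PIdl g"] sum_assoc[of U "PIdl g" "PIdl f"] sum_comm[of "PIdl f" "PIdl g"]
    idl_sub[of U] idl_sub[OF PI_idl] by simp

lemma sum_PI_idl: "idl U \<Longrightarrow> f \<in> \<A> \<Longrightarrow> idl (U \<boxplus> PIdl f)"
  by (simp add: sum_idl PI_idl)

end

text \<open>One setting for two situations. In a graded ring \<open>H d\<close> consists of the
  forms of degree \<open>d\<close> and \<open>M\<close> is the homogeneous maximal ideal; in a local
  ring every \<open>H d\<close> is the maximal ideal itself. The last assumption says that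
  \<open>H 1\<close> generates \<open>M\<close> up to radical.\<close>

locale avs = ncr +
  fixes M :: "'a set" and H :: "nat \<Rightarrow> 'a set"
  assumes M: "idl M"
    and HM: "\<And>d. d \<ge> 1 \<Longrightarrow> H d \<subseteq> M"
    and H0: "\<And>d. \<zero> \<in> H d"
    and Hadd: "\<And>d a b. a \<in> H d \<Longrightarrow> b \<in> H d \<Longrightarrow> a \<oplus> b \<in> H d"
    and Hmult: "\<And>i j a b. a \<in> H i \<Longrightarrow> b \<in> H j \<Longrightarrow> a \<otimes> b \<in> H (i + j)"
    and H1: "\<And>P. primeideal P R \<Longrightarrow> H 1 \<subseteq> P \<Longrightarrow> M \<subseteq> P"
begin

lemma Mc: "a \<in> M \<Longrightarrow> a \<in> \<A>"
  using M idl_carr by blast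

lemma Hc: "d \<ge> 1 \<Longrightarrow> a \<in> H d \<Longrightarrow> a \<in> \<A>"
  using HM Mc by blast

lemma Hpow:
  assumes "a \<in> H d" "d \<ge> 1" "n \<ge> 1" shows "a [^] (n::nat) \<in> H (n * d)"
  using assms(3)
proof (induction n rule: dec_induct)
  case base then show ?case using assms Hc by simp
next
  case (step n) then show ?case using Hmult[OF step.IH assms(1)] by (simp add: add.commute)
qed

lemma avoid:
  assumes "finite PP" "\<And>P. P \<in> PP \<Longrightarrow> primeideal P R \<and> \<not> M \<subseteq> P"
  shows "\<exists>d0. \<forall>d\<ge>d0. \<exists>f\<in>H d. \<forall>P\<in>PP. f \<notin> P"
  using assms
proof (induction "card PP" arbitrary: PP rule: less_induct)
  case less
  show ?case
  proof (cases "\<exists>P\<in>PP. \<exists>Q\<in>PP. P \<noteq> Q \<and> (\<forall>d\<ge>1. Q \<inter> H d \<subseteq> P)")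
    case True
    then obtain P Q where PQ: "P \<in> PP" "Q \<in> PP" "P \<noteq> Q" "\<And>d. d \<ge> 1 \<Longrightarrow> Q \<inter> H d \<subseteq> P" by blast
    have "card (PP - {Q}) < card PP" using PQ less.prems(1) by (metis card_Diff1_less)
    from less.hyps[OF this] less.prems obtain d0 where d0: "\<forall>d\<ge>d0. \<exists>f\<in>H d. \<forall>P\<in>PP-{Q}. f \<notin> P" by auto
    have "\<exists>f\<in>H d. \<forall>P\<in>PP. f \<notin> P" if d: "d \<ge> max 1 d0" for d
    proof -
      obtain f where f: "f \<in> H d" "\<forall>P\<in>PP-{Q}. f \<notin> P" using d0 d by auto
      have "f \<notin> Q" using f PQ(1,3) PQ(4)[of d] d by auto
      then show ?thesis using f by blast
    qed
    then show ?thesis by blast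
  next
    case False
    show ?thesis
    proof (cases "PP = {}")
      case True then show ?thesis using H0 by blast
    next
      case F2: False
      then obtain P where P: "P \<in> PP" by blast
      have pP: "primeideal P R" "\<not> M \<subseteq> P" using less.prems P by auto
      have iP: "idl P" using primeideal.axioms(1)[OF pP(1)] .
      have "card (PP - {P}) < card PP" using P less.prems(1) by (metis card_Diff1_less)
      from less.hyps[OF this] less.prems obtain d0 where d0: "\<forall>d\<ge>d0. \<exists>f\<in>H d. \<forall>Q\<in>PP-{P}. f \<notin> Q" by auto
      obtain u where u: "u \<in> H 1" "u \<notin> P" using H1[OF pP(1)] pP(2) by blast
      have "\<exists>D\<ge>1. \<exists>g\<in>H D. g \<notin> P \<and> (\<forall>Q\<in>F. g \<in> Q)" if "finite F" "F \<subseteq> PP - {P}" for F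
        using that
      proof (induction F)
        case empty then show ?case using u by auto
      next
        case (insert Q F)
        then obtain D g where g: "D \<ge> 1" "g \<in> H D" "g \<notin> P" "\<forall>Q\<in>F. g \<in> Q" by auto
        have Q: "Q \<in> PP" "Q \<noteq> P" using insert by auto
        then obtain e h where h: "e \<ge> 1" "h \<in> H e" "h \<in> Q" "h \<notin> P" using False P by blast
        have gc: "g \<in> \<A>" "h \<in> \<A>" using g h Hc by auto
        have "g \<otimes> h \<in> H (D + e)" using Hmult g h by blast
        moreover have "g \<otimes> h \<notin> P" using primeideal.I_prime[OF pP(1) gc] g h by blast
        moreover have "\<forall>Q'\<in>insert Q F. g \<otimes> h \<in> Q'"
        proof
          fix Q' assume Q': "Q' \<in> insert Q F"
          then have i: "idl Q'" using less.prems(2) insert.prems primeideal.axioms(1) by blast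
          show "g \<otimes> h \<in> Q'" using Q' g(4) h(3) idl_l[OF i _ gc(1), of h] idl_r[OF i _ gc(2), of g] by blast
        qed
        ultimately show ?case using g(1) by (intro exI[of _ "D+e"]) auto
      qed
      then obtain D g where g: "D \<ge> 1" "g \<in> H D" "g \<notin> P" "\<forall>Q\<in>PP-{P}. g \<in> Q"
        using less.prems(1) by (meson finite_Diff order_refl)
      have "\<exists>f\<in>H d. \<forall>P\<in>PP. f \<notin> P" if d: "d \<ge> d0 + D + 1" for d
      proof -
        obtain f where f: "f \<in> H d" "\<forall>Q\<in>PP-{P}. f \<notin> Q" using d0[rule_format, of d] d by auto
        have fc: "f \<in> \<A>" using Hc[OF _ f(1)] d by simp
        show ?thesis
        proof (cases "f \<in> P")
          case False then show ?thesis using f by blast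
        next
          case True
          define g' where "g' = g \<otimes> u [^] (d - D)"
          have uc: "u \<in> \<A>" "g \<in> \<A>" using u g Hc by auto
          have up: "u [^] (d - D) \<in> H (d - D)" using Hpow[OF u(1), of "d - D"] d by simp
          have g'H: "g' \<in> H d" unfolding g'_def using Hmult[OF g(2) up] d by simp
          have "u [^] (d - D) \<notin> P" using prime_pow[OF pP(1) uc(1)] u(2) by blast
          then have g'P: "g' \<notin> P" unfolding g'_def using primeideal.I_prime[OF pP(1) uc(2)] uc g(3) by auto
          have g'Q: "g' \<in> Q" if "Q \<in> PP - {P}" for Q
          proof -
            have "idl Q" using that less.prems(2) primeideal.axioms(1) by blast
            then show ?thesis unfolding g'_def using g(4) that idl_r uc by auto
          qed
          have g'c: "g' \<in> \<A>" using uc unfolding g'_def by simp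
          have "f \<oplus> g' \<in> H d" using Hadd f(1) g'H by blast
          moreover have "f \<oplus> g' \<notin> Q" if Q: "Q \<in> PP" for Q
          proof
            assume fg: "f \<oplus> g' \<in> Q"
            have iQ: "idl Q" using Q less.prems(2) primeideal.axioms(1) by blast
            show False
            proof (cases "Q = P")
              case True
              then show ?thesis using idl_cancel[OF iP \<open>f \<in> P\<close>, of g'] fg g'c g'P by blast
            next
              case False
              then have "g' \<in> Q" "f \<notin> Q" using g'Q f(2) Q by auto
              then show ?thesis using idl_cancel[OF iQ, of g' f] fg fc g'c a_comm[of f g'] by simp
            qed
          qed
          ultimately show ?thesis by blast
        qed
      qed
      then show ?thesis by blast
    qed
  qed
qed

text \<open>No nonzero class of \<open>R/U\<close> is killed by \<open>M\<close>: the socle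
  vanishes. Hence no maximal annihilator contains \<open>M\<close>, and regular elements exist in
  all large degrees.\<close>

definition nsoc :: "'a set \<Rightarrow> bool" where
  "nsoc U \<longleftrightarrow> (\<forall>u\<in>\<A>. (\<forall>y\<in>M. y \<otimes> u \<in> U) \<longrightarrow> u \<in> U)"

lemma nzd_nsoc: "nzd U g \<Longrightarrow> g \<in> M \<Longrightarrow> nsoc U"
  unfolding nsoc_def nzd_def by blast

lemma avoid_all:
  assumes "finite UU" "\<And>U. U \<in> UU \<Longrightarrow> idl U \<and> nsoc U"
  shows "\<exists>d0. \<forall>d\<ge>d0. \<exists>f\<in>H d. \<forall>U\<in>UU. nzd U f"
proof -
  define PP where "PP = (\<Union>U\<in>UU. {P. maxann U P})"
  have "finite PP" unfolding PP_def using assms maxann_finite by blast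
  moreover have "primeideal P R \<and> \<not> M \<subseteq> P" if "P \<in> PP" for P
  proof -
    obtain U where U: "U \<in> UU" "maxann U P" using \<open>P \<in> PP\<close> unfolding PP_def by blast
    then have i: "idl U" "nsoc U" using assms by auto
    obtain u where u: "u \<in> \<A>" "u \<notin> U" "P = colon U u" using U(2) unfolding maxann_def by blast
    have "\<not> M \<subseteq> P"
    proof
      assume "M \<subseteq> P"
      then have "\<forall>y\<in>M. y \<otimes> u \<in> U" unfolding u(3) colon_def using m_comm u(1) by auto
      then show False using i(2) u unfolding nsoc_def by blast
    qed
    then show ?thesis using maxann_prime[OF i(1) U(2)] by blast
  qed
  ultimately obtain d0 where d0: "\<forall>d\<ge>d0. \<exists>f\<in>H d. \<forall>P\<in>PP. f \<notin> P" using avoid[of PP] by blast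
  have "\<exists>f\<in>H d. \<forall>U\<in>UU. nzd U f" if hd: "d \<ge> max 1 d0" for d
  proof -
    obtain f where f: "f \<in> H d" "\<forall>P\<in>PP. f \<notin> P" using d0[rule_format, of d] hd by auto
    have "nzd U f" if U: "U \<in> UU" for U
    proof (rule ccontr)
      assume "\<not> nzd U f"
      then obtain P where "maxann U P" "f \<in> P" using zero_divisor_maxann[of U f] assms(2)[OF U] Hc[OF _ f(1)] \<open>d \<ge> max 1 d0\<close> by auto
      then show False using f(2) U unfolding PP_def by blast
    qed
    then show ?thesis using f by blast
  qed
  then show ?thesis by blast
qed

text \<open>A weak form of "grade of \<open>M\<close> on \<open>R/U\<close> is at least
  \<open>k\<close>": some regular sequence of length \<open>k\<close> exists.
  \<open>exchange\<close> turns it into the strong form, in which every regular element can start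
  such a sequence.\<close>

primrec dep :: "nat \<Rightarrow> 'a set \<Rightarrow> bool" where
  "dep 0 U \<longleftrightarrow> True"
| "dep (Suc k) U \<longleftrightarrow> (\<exists>g\<in>M. nzd U g \<and> dep k (U \<boxplus> PIdl g))"

lemma dep_nsoc: "dep (Suc k) U \<Longrightarrow> nsoc U"
  using nzd_nsoc by auto

text \<open>The socles of \<open>R/(U + (f))\<close> and \<open>R/(U + (x))\<close> are both
  isomorphic to \<open>Ext^1(R/M, R/U)\<close>. Concretely \<open>u\<close> corresponds to the
  \<open>v\<close> with \<open>f u = x v\<close> modulo \<open>U\<close>.\<close>

lemma socle_transfer:
  assumes U: "idl U" and f: "f \<in> M" "nzd U f" and x: "x \<in> M" "nzd U x" and s: "nsoc (U \<boxplus> PIdl f)"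
  shows "nsoc (U \<boxplus> PIdl x)"
  unfolding nsoc_def
proof (intro ballI impI)
  fix u assume u: "u \<in> \<A>" "\<forall>y\<in>M. y \<otimes> u \<in> U \<boxplus> PIdl x"
  have fc: "f \<in> \<A>" and xc: "x \<in> \<A>" using f x Mc by auto
  obtain w v where w: "w \<in> U" "v \<in> \<A>" "f \<otimes> u = w \<oplus> x \<otimes> v"
    by (rule sumPIE[OF u(2)[rule_format, OF f(1)] xc])
  have wc: "w \<in> \<A>" using w U idl_carr by blast
  have "y \<otimes> v \<in> U \<boxplus> PIdl f" if y: "y \<in> M" for y
  proof -
    have yc: "y \<in> \<A>" using y Mc by blast
    obtain w' t where w': "w' \<in> U" "t \<in> \<A>" "y \<otimes> u = w' \<oplus> x \<otimes> t"
      by (rule sumPIE[OF u(2)[rule_format, OF y] xc])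
    have w'c: "w' \<in> \<A>" using w' U idl_carr by blast
    have 1: "x \<otimes> v = f \<otimes> u \<ominus> w" unfolding w(3) using wc xc w(2) by algebra
    have "x \<otimes> (y \<otimes> v \<ominus> f \<otimes> t) = y \<otimes> (x \<otimes> v) \<ominus> x \<otimes> (f \<otimes> t)" using xc yc w(2) fc w'(2) by algebra
    also have "\<dots> = f \<otimes> (y \<otimes> u) \<ominus> y \<otimes> w \<ominus> x \<otimes> (f \<otimes> t)" unfolding 1 using fc u(1) wc yc xc w'(2) by algebra
    also have "\<dots> = f \<otimes> w' \<ominus> y \<otimes> w" unfolding w'(3) using fc wc yc xc w'(2) w'c by algebra
    also have "\<dots> \<in> U" using idl_minus[OF U idl_l[OF U w'(1) fc] idl_l[OF U w(1) yc]] .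
    finally have "y \<otimes> v \<ominus> f \<otimes> t \<in> U" using nzdD[OF x(2)] yc w(2) fc w'(2) by simp
    then have "(y \<otimes> v \<ominus> f \<otimes> t) \<oplus> f \<otimes> t \<in> U \<boxplus> PIdl f" using PI_iff[OF fc] w' by (intro sum_mem) auto
    moreover have "(y \<otimes> v \<ominus> f \<otimes> t) \<oplus> f \<otimes> t = y \<otimes> v" using yc w(2) fc w'(2) by algebra
    ultimately show ?thesis by simp
  qed
  then have "v \<in> U \<boxplus> PIdl f" using s w(2) unfolding nsoc_def by blast
  then obtain w2 t where t: "w2 \<in> U" "t \<in> \<A>" "v = w2 \<oplus> f \<otimes> t" using fc by (rule sumPIE)
  have w2c: "w2 \<in> \<A>" using t U idl_carr by blast
  have "f \<otimes> (u \<ominus> x \<otimes> t) = f \<otimes> u \<ominus> f \<otimes> (x \<otimes> t)" using fc u xc t by algebra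
  also have "\<dots> = w \<oplus> x \<otimes> w2" unfolding w(3) t(3) using fc xc wc w2c t(2) by algebra
  also have "\<dots> \<in> U" using idl_add[OF U w(1) idl_l[OF U t(1) xc]] .
  finally have "u \<ominus> x \<otimes> t \<in> U" using nzdD[OF f(2)] u xc t by simp
  then have "(u \<ominus> x \<otimes> t) \<oplus> x \<otimes> t \<in> U \<boxplus> PIdl x" using PI_iff[OF xc] t by (intro sum_mem) auto
  moreover have "(u \<ominus> x \<otimes> t) \<oplus> x \<otimes> t = u" using u xc t by algebra
  ultimately show "u \<in> U \<boxplus> PIdl x" by simp
qed

text \<open>A third element \<open>g\<close>, regular modulo \<open>U\<close>,
  \<open>U + (f)\<close> and \<open>U + (x)\<close> at once, mediates between the given
  \<open>f\<close> and the desired \<open>x\<close>: pass from \<open>f, g\<close> to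
  \<open>g, f\<close>, then by induction to \<open>g, x\<close>, then to \<open>x, g\<close>. That
  \<open>U + (x)\<close> admits a regular element at all is \<open>socle_transfer\<close>.\<close>

lemma exchange:
  assumes "idl U" "dep (Suc k) U" "x \<in> M" "nzd U x"
  shows "dep k (U \<boxplus> PIdl x)"
  using assms
proof (induction k arbitrary: U x)
  case 0 then show ?case by simp
next
  case (Suc k)
  obtain f where f: "f \<in> M" "nzd U f" "dep (Suc k) (U \<boxplus> PIdl f)" using Suc.prems(2) by auto
  have fc: "f \<in> \<A>" and xc: "x \<in> \<A>" using f Suc.prems Mc by auto
  note U = Suc.prems(1)
  have iF: "idl (U \<boxplus> PIdl f)" "idl (U \<boxplus> PIdl x)" using U fc xc by (simp_all add: sum_PI_idl)
  have nf: "nsoc (U \<boxplus> PIdl f)" using dep_nsoc[OF f(3)] .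
  have nx: "nsoc (U \<boxplus> PIdl x)" using socle_transfer[OF U f(1,2) Suc.prems(3,4) nf] .
  have nU: "nsoc U" using nzd_nsoc[OF f(2,1)] .
  obtain d0 where d0: "\<forall>d\<ge>d0. \<exists>g\<in>H d. \<forall>V\<in>{U, U \<boxplus> PIdl f, U \<boxplus> PIdl x}. nzd V g"
    using avoid_all[of "{U, U \<boxplus> PIdl f, U \<boxplus> PIdl x}"] nf nx nU U iF by auto
  then obtain g where g: "g \<in> H (Suc d0)" "nzd U g" "nzd (U \<boxplus> PIdl f) g" "nzd (U \<boxplus> PIdl x) g"
    by (metis insertCI le_SucI order_refl)
  have gM: "g \<in> M" using g(1) HM[of "Suc d0"] by auto
  then have gc: "g \<in> \<A>" using Mc by blast
  have iG: "idl (U \<boxplus> PIdl g)" using U gc by (simp add: sum_PI_idl)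
  have "dep k (U \<boxplus> PIdl f \<boxplus> PIdl g)" using Suc.IH[OF iF(1) f(3) gM g(3)] .
  then have "dep k (U \<boxplus> PIdl g \<boxplus> PIdl f)" using sum_PI_swap[OF U fc gc] by simp
  then have "dep (Suc k) (U \<boxplus> PIdl g)" using nzd_swap[OF U fc gc f(2) g(3)] f(1) by auto
  then have "dep k (U \<boxplus> PIdl g \<boxplus> PIdl x)"
    using Suc.IH[OF iG _ Suc.prems(3) nzd_swap[OF U xc gc Suc.prems(4) g(4)]] by simp
  then have "dep k (U \<boxplus> PIdl x \<boxplus> PIdl g)" using sum_PI_swap[OF U xc gc] by simp
  then show ?case using g(4) gM by auto
qed

primrec rsq :: "'a set \<Rightarrow> 'a list \<Rightarrow> bool" where
  "rsq U [] \<longleftrightarrow> True"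
| "rsq U (x # xs) \<longleftrightarrow> x \<in> M \<and> nzd U x \<and> rsq (U \<boxplus> PIdl x) xs"

primrec gi :: "'a set \<Rightarrow> 'a list \<Rightarrow> 'a set" where
  "gi U [] = U"
| "gi U (x # xs) = gi (U \<boxplus> PIdl x) xs"

lemma gi_snoc: "gi U (xs @ [x]) = gi U xs \<boxplus> PIdl x"
  by (induction xs arbitrary: U) auto

lemma rsq_snoc: "rsq U (xs @ [x]) \<longleftrightarrow> rsq U xs \<and> x \<in> M \<and> nzd (gi U xs) x"
  by (induction xs arbitrary: U) auto

lemma exchange_list: "idl U \<Longrightarrow> dep (length xs + k) U \<Longrightarrow> rsq U xs \<Longrightarrow> dep k (gi U xs)"
proof (induction xs arbitrary: U)
  case (Cons x xs)
  then have "dep (length xs + k) (U \<boxplus> PIdl x)" using exchange[of U "length xs + k" x] by auto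
  then show ?case using Cons Mc sum_PI_idl by auto
qed simp

text \<open>A regular sequence inside \<open>Q\<close> bounds the height of \<open>Q\<close> from
  below: below the first prime of the chain for \<open>U + (x)\<close> there is an associated prime
  of \<open>R/U\<close>, and it cannot contain the regular element \<open>x\<close>.\<close>

lemma rsq_prime_chain:
  assumes "idl U" "rsq U xs" "primeideal Q R" "gi U xs \<subseteq> Q"
  shows "\<exists>C. prime_chain R C (length xs) \<and> C (length xs) = Q \<and> U \<subseteq> C 0"
  using assms
proof (induction xs arbitrary: U)
  case Nil
  then show ?case by (intro exI[of _ "\<lambda>_. Q"]) (auto simp: prime_chain_def)
next
  case (Cons x xs)
  have xM: "x \<in> M" "nzd U x" "rsq (U \<boxplus> PIdl x) xs" using Cons.prems by auto
  have xc: "x \<in> \<A>" using xM Mc by blast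
  obtain C where C: "prime_chain R C (length xs)" "C (length xs) = Q" "U \<boxplus> PIdl x \<subseteq> C 0"
    using Cons.IH[OF sum_PI_idl[OF Cons.prems(1) xc] xM(3) Cons.prems(3)] Cons.prems(4) by auto
  have p0: "primeideal (C 0) R" using C(1) unfolding prime_chain_def by simp
  have U0: "U \<subseteq> C 0" using C(3) sum_l[OF Cons.prems(1) PI_idl[OF xc]] by blast
  have x0: "x \<in> C 0" using C(3) sum_r[OF Cons.prems(1) PI_idl[OF xc]] PI_self[OF xc] by blast
  obtain w where w: "w \<in> \<A>" "w \<notin> U" "primeideal (colon U w) R" "colon U w \<subseteq> C 0"
    using assoc_prime_below[OF Cons.prems(1) p0 U0] by blast
  have "x \<notin> colon U w" using w xM(2) xc m_comm[of w x] unfolding colon_def nzd_def by auto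
  then have st: "colon U w \<subset> C 0" using w(4) x0 by blast
  have "prime_chain R (case_nat (colon U w) C) (Suc (length xs))"
    using C(1) w(3) st unfolding prime_chain_def by (auto split: nat.splits)
  then show ?case using C(2) colon_sup[OF Cons.prems(1) w(1)] by (intro exI[of _ "case_nat (colon U w) C"]) auto
qed

lemma regular_seq_dep:
  assumes "regular_seq R xs" "set xs \<subseteq> M" shows "dep (length xs) {\<zero>}"
proof -
  have xc: "set xs \<subseteq> \<A>" using assms(1) unfolding regular_seq_def by blast
  have "dep k (Idl (set (take (length xs - k) xs)))" if "k \<le> length xs" for k
    using that
  proof (induction k)
    case (Suc k)
    define i where "i = length xs - Suc k"
    have i: "i < length xs" "length xs - k = Suc i" using Suc.prems unfolding i_def by auto
    have tk: "set (take (Suc i) xs) = insert (xs ! i) (set (take i xs))"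
      using i by (simp add: take_Suc_conv_app_nth)
    have xi: "xs ! i \<in> set xs" using i by simp
    have "Idl (set (take (Suc i) xs)) = Idl (set (take i xs)) \<boxplus> PIdl (xs ! i)"
      unfolding tk using xc xi by (intro Idl_insert) (auto dest: in_set_takeD)
    moreover have "nzd (Idl (set (take i xs))) (xs ! i)"
      using assms(1) i unfolding regular_seq_def nzd_def by blast
    ultimately show ?case using Suc i assms(2) xi unfolding i_def[symmetric] by (auto intro!: bexI[of _ "xs ! i"])
  qed simp
  from this[of "length xs"] show ?thesis by (simp add: Idl_empty)
qed

end

section \<open>Powers of ideals, Nakayama's lemma and Krull's intersection theorem\<close>

context cr
begin

lemma pw_sum_sub:
  assumes U: "idl U" and V: "idl V" shows "pw (U \<boxplus> V) (a + b) \<subseteq> pw U a \<boxplus> pw V b"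
proof (induction "a + b" arbitrary: a b)
  case 0
  then show ?case using sum_l[OF pw_idl[OF U] pw_idl[OF V], of 0 0] by simp
next
  case (Suc n)
  have UV: "idl (U \<boxplus> V)" using sum_idl[OF U V] .
  have iS: "idl (pw U a \<boxplus> pw V b)" using sum_idl[OF pw_idl[OF U] pw_idl[OF V]] .
  show ?case
  proof (cases "a = 0 \<or> b = 0")
    case True
    then have "pw U a \<boxplus> pw V b = \<A>"
      using sum_l[OF pw_idl[OF U] pw_idl[OF V], of a b] sum_r[OF pw_idl[OF U] pw_idl[OF V], of b a] idl_sub[OF iS] by auto
    then show ?thesis using idl_sub[OF pw_idl[OF UV]] by simp
  next
    case False
    then obtain a' b' where ab: "a = Suc a'" "b = Suc b'" by (meson not0_implies_Suc)
    let ?X = "pw (U \<boxplus> V) n"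
    have iX: "idl ?X" using pw_idl[OF UV] .
    have 1: "?X \<subseteq> pw U a' \<boxplus> pw V b" using Suc.hyps(1)[of a' b] Suc.hyps(2) ab by simp
    have 2: "?X \<subseteq> pw U a \<boxplus> pw V b'" using Suc.hyps(1)[of a b'] Suc.hyps(2) ab by simp
    have "U \<cdot> ?X \<subseteq> U \<cdot> (pw U a' \<boxplus> pw V b)" using prod_mono[OF order_refl 1] .
    also have "\<dots> = pw U a \<boxplus> U \<cdot> pw V b" using ideal_prod_r_distr[OF U pw_idl[OF U] pw_idl[OF V], of a' b] ab(1) by simp
    also have "\<dots> \<subseteq> pw U a \<boxplus> pw V b" using ideal_prod_inter[OF U pw_idl[OF V]] by (intro sum_mono) auto
    finally have A: "U \<cdot> ?X \<subseteq> pw U a \<boxplus> pw V b" .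
    have "V \<cdot> ?X \<subseteq> V \<cdot> (pw U a \<boxplus> pw V b')" using prod_mono[OF order_refl 2] .
    also have "\<dots> = V \<cdot> pw U a \<boxplus> pw V b" using ideal_prod_r_distr[OF V pw_idl[OF U] pw_idl[OF V], of a b'] ab(2) by simp
    also have "\<dots> \<subseteq> pw U a \<boxplus> pw V b" using ideal_prod_inter[OF V pw_idl[OF U]] by (intro sum_mono) auto
    finally have B: "V \<cdot> ?X \<subseteq> pw U a \<boxplus> pw V b" .
    have "pw (U \<boxplus> V) (a + b) = U \<cdot> ?X \<boxplus> V \<cdot> ?X"
      using prod_sum_l[OF U V iX] Suc.hyps(2)[symmetric] by simp
    then show ?thesis using sum_least[OF iS A B] by simp
  qed
qed

lemma pw_PI: "x \<in> \<A> \<Longrightarrow> pw (PIdl x) n = PIdl (x [^] n)"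
proof (induction n)
  case 0
  have "PIdl \<one> = \<A>" using idl_one[OF PI_idl PI_self] by simp
  then show ?case by simp
next
  case (Suc n)
  have "pw (PIdl x) (Suc n) = smul x (smul (x [^] n) (\<A>))"
    using Suc prod_PI[OF Suc.prems PI_idl[of "x [^] n"]] PI_smul[of "x [^] n"] by simp
  also have "\<dots> = PIdl (x \<otimes> x [^] n)" using Suc.prems by (simp add: smul_smul PI_smul)
  finally show ?case using Suc.prems m_comm[of x "x [^] n"] by simp
qed

end

context ncr
begin

lemma rad_pow_finite:
  assumes C: "idl C" and S: "finite S" "S \<subseteq> \<A>" "\<And>s. s \<in> S \<Longrightarrow> \<exists>n. s [^] (n::nat) \<in> C"
  shows "\<exists>k. pw (Idl S) k \<subseteq> C"
  using S
proof (induction S)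
  case empty
  have "pw (Idl {}) 1 = {\<zero>}" using pw_one[OF zeroideal] by (simp only: Idl_empty)
  then have "pw (Idl {}) 1 \<subseteq> C" using idl_zero[OF C] by simp
  then show ?case by blast
next
  case (insert s S)
  obtain k where k: "pw (Idl S) k \<subseteq> C" using insert by auto
  obtain n where n: "s [^] (n::nat) \<in> C" using insert.prems by auto
  have s: "s \<in> \<A>" "S \<subseteq> \<A>" using insert.prems by auto
  have "pw (Idl (insert s S)) (k + n) = pw (Idl S \<boxplus> PIdl s) (k + n)" by (simp only: Idl_insert[OF s(2,1)])
  also have "\<dots> \<subseteq> pw (Idl S) k \<boxplus> pw (PIdl s) n"
    by (rule pw_sum_sub[OF genideal_ideal[OF s(2)] PI_idl[OF s(1)]])
  also have "\<dots> \<subseteq> C" using sum_least[OF C k] PI_least[OF C n] pw_PI[OF s(1)] by simp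
  finally show ?case by blast
qed

lemma rad_pow:
  assumes C: "idl C" and U: "idl U" "\<And>s. s \<in> U \<Longrightarrow> \<exists>n. s [^] (n::nat) \<in> C"
  shows "\<exists>k. pw U k \<subseteq> C"
proof -
  obtain S where S: "S \<subseteq> \<A>" "finite S" "U = Idl S" using fg[OF U(1)] by blast
  then have "S \<subseteq> U" using genideal_self by blast
  then show ?thesis using rad_pow_finite[OF C S(2,1)] U(2) S(3) by blast
qed

lemma maximal_above:
  assumes "idl U" "U \<noteq> \<A>" shows "\<exists>P. maximalideal P R \<and> U \<subseteq> P"
proof -
  define FF where "FF = {V. idl V \<and> U \<subseteq> V \<and> V \<noteq> \<A>}"
  obtain P where P: "P \<in> FF" "\<forall>N\<in>FF. P \<subseteq> N \<longrightarrow> N = P"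
    using max_ideal_exists[of FF] assms unfolding FF_def by blast
  have "maximalideal P R"
  proof (rule maximalidealI)
    show "ideal P R" "\<A> \<noteq> P" using P unfolding FF_def by auto
  next
    fix J assume J: "ideal J R" "P \<subseteq> J" "J \<subseteq> \<A>"
    then show "J = P \<or> J = \<A>" using P unfolding FF_def by blast
  qed
  then show ?thesis using P unfolding FF_def by blast
qed

end

locale lcr = ncr + fixes m :: "'a set" assumes loc: "local_ring R m"
begin

lemma m_max: "maximalideal m R"
  using loc unfolding local_ring_def by blast

lemma m_idl: "idl m"
  using maximalideal.axioms(1)[OF m_max] .

lemma m_c: "a \<in> m \<Longrightarrow> a \<in> \<A>"
  using m_idl idl_carr by blast

lemma m_prime: "primeideal m R"
  using maximalideal_prime[OF m_max] .

lemma one_notin_m: "\<one> \<notin> m"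
  using maximalideal.I_notcarr[OF m_max] idl_one[OF m_idl] by blast

lemma proper_sub_m: "idl U \<Longrightarrow> U \<noteq> \<A> \<Longrightarrow> U \<subseteq> m"
  using maximal_above loc unfolding local_ring_def by blast

lemma unit_not_m:
  assumes "x \<in> \<A>" "x \<notin> m" shows "\<exists>y\<in>\<A>. y \<otimes> x = \<one>"
proof -
  have "PIdl x = \<A>" using proper_sub_m[OF PI_idl[OF assms(1)]] PI_self[OF assms(1)] assms(2) by blast
  then have "\<one> \<in> PIdl x" by simp
  then show ?thesis unfolding cgenideal_def by force
qed

lemma unit_cancel:
  assumes "x \<in> \<A>" "x \<notin> m" "idl U" "a \<in> \<A>" "x \<otimes> a \<in> U" shows "a \<in> U"
proof -
  obtain y where y: "y \<in> \<A>" "y \<otimes> x = \<one>" using unit_not_m assms by blast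
  have "y \<otimes> (x \<otimes> a) = a" using y assms m_assoc[of y x a] by simp
  then show ?thesis using idl_l[OF assms(3,5) y(1)] by simp
qed

lemma nakayama:
  assumes U: "idl U" and N: "idl N" and sub: "N \<subseteq> U \<boxplus> m \<cdot> N" shows "N \<subseteq> U"
proof -
  \<comment> \<open>If \<open>s\<close> generates \<open>N\<close> modulo \<open>V\<close>, then
    \<open>s = v + s y\<close> with \<open>y\<close> in \<open>m\<close>, and \<open>1 - y\<close>
    is a unit, so \<open>s\<close> is redundant. Discarding generators one at a time replaces the
    determinant argument.\<close>
  have step: "N \<subseteq> V" if V: "idl V" and s: "s \<in> N" and h: "N \<subseteq> V \<boxplus> PIdl s" "N \<subseteq> V \<boxplus> m \<cdot> N" for V s
  proof -
    have sc: "s \<in> \<A>" using idl_carr[OF N s] .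
    have "m \<cdot> N \<subseteq> V \<boxplus> smul s m"
    proof (rule prod_least[OF sum_idl[OF V smul_idl[OF sc m_idl]]])
      fix y n assume y: "y \<in> m" and n: "n \<in> N"
      obtain v r where v: "v \<in> V" "r \<in> \<A>" "n = v \<oplus> s \<otimes> r" by (rule sumPIE[OF subsetD[OF h(1) n] sc])
      have vc: "v \<in> \<A>" "y \<in> \<A>" using v V idl_carr y m_c by auto
      have "y \<otimes> n = y \<otimes> v \<oplus> s \<otimes> (r \<otimes> y)" unfolding v(3) using v(2) vc sc by algebra
      then show "y \<otimes> n \<in> V \<boxplus> smul s m"
        using sum_mem[OF idl_l[OF V v(1) vc(2)] smul_mem[OF idl_l[OF m_idl y v(2)]]] by simp
    qed
    then have "V \<boxplus> m \<cdot> N \<subseteq> V \<boxplus> smul s m"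
      by (intro sum_least[OF sum_idl[OF V smul_idl[OF sc m_idl]]] sum_l[OF V smul_idl[OF sc m_idl]])
    then have "s \<in> V \<boxplus> smul s m" using h(2) s by blast
    then obtain v y where v: "v \<in> V" "y \<in> m" "s = v \<oplus> s \<otimes> y" unfolding smul_def by (auto elim!: sumE)
    have vc: "v \<in> \<A>" "y \<in> \<A>" using v V idl_carr m_c by auto
    have "(\<one> \<ominus> y) \<otimes> s = s \<ominus> s \<otimes> y" using vc sc by algebra
    also have "\<dots> = (v \<oplus> s \<otimes> y) \<ominus> s \<otimes> y" using v(3) by simp
    also have "\<dots> = v" using vc sc by algebra
    finally have eq: "(\<one> \<ominus> y) \<otimes> s \<in> V" using v by simp
    have "\<one> \<ominus> y \<notin> m" using idl_cancel_minus[OF m_idl _ v(2) one_closed] one_notin_m by blast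
    then have "s \<in> V" using unit_cancel[OF _ _ V sc eq] vc by simp
    then show ?thesis using h(1) sum_absorb[OF V PI_idl[OF sc] PI_least[OF V]] by simp
  qed
  obtain S where S: "S \<subseteq> \<A>" "finite S" "N = Idl S" using fg[OF N] by blast
  have SN: "S \<subseteq> N" using S genideal_self by blast
  have "N \<subseteq> U" if "finite T" "T \<subseteq> S" "N \<subseteq> U \<boxplus> Idl T" for T
    using that
  proof (induction T)
    case empty
    then show ?case using sum_absorb[OF U zeroideal] idl_zero[OF U] by (simp add: Idl_empty)
  next
    case (insert t T)
    have T: "T \<subseteq> \<A>" "t \<in> \<A>" "t \<in> N" using insert.prems S SN by auto
    have iT: "idl (U \<boxplus> Idl T)" using sum_idl[OF U genideal_ideal[OF T(1)]] .
    have "N \<subseteq> U \<boxplus> Idl T"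
    proof (rule step[OF iT T(3)])
      show "N \<subseteq> U \<boxplus> Idl T \<boxplus> PIdl t" using insert.prems(2)
          sum_assoc[OF idl_sub[OF U] idl_sub[OF genideal_ideal[OF T(1)]] idl_sub[OF PI_idl[OF T(2)]]]
        by (simp add: Idl_insert[OF T(1,2)])
      show "N \<subseteq> U \<boxplus> Idl T \<boxplus> m \<cdot> N"
        using sub sum_mono[OF sum_l[OF U genideal_ideal[OF T(1)]] order_refl[of "m \<cdot> N"]] by blast
    qed
    then show ?case using insert by simp
  qed
  from this[OF S(2) order_refl] show ?thesis using sum_r[OF U genideal_ideal[OF S(1)]] S(3) by simp
qed

text \<open>Take \<open>C\<close> maximal among the ideals containing \<open>D = U + m N\<close>
  with \<open>C\<close> and \<open>N\<close> meeting inside \<open>D\<close>. For \<open>r\<close>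
  in \<open>m\<close> the ideals \<open>colon C (r^n)\<close> become stationary; then
  \<open>C + (r^n)\<close> still meets \<open>N\<close> inside \<open>D\<close>, so
  \<open>r^n\<close> lies in \<open>C\<close>. Hence a power of \<open>m\<close> lies in
  \<open>C\<close>, whence \<open>N\<close> lies in \<open>D\<close>, and Nakayama's lemma
  finishes.\<close>

lemma krull_intersection_m:
  assumes U: "idl U" and a: "\<And>n. a \<in> U \<boxplus> pw m n" shows "a \<in> U"
proof -
  define N where "N = (\<Inter>n. U \<boxplus> pw m n)"
  have iN: "idl N" unfolding N_def
    using i_Intersect[of "range (\<lambda>n. U \<boxplus> pw m n)"] sum_idl[OF U pw_idl[OF m_idl]] by auto
  define D where "D = U \<boxplus> m \<cdot> N"
  have imN: "idl (m \<cdot> N)" using prod_idl[OF m_idl iN] .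
  have iD: "idl D" unfolding D_def using sum_idl[OF U imN] .
  define FF where "FF = {C. idl C \<and> D \<subseteq> C \<and> C \<inter> N \<subseteq> D}"
  obtain C where C: "C \<in> FF" "\<forall>E\<in>FF. C \<subseteq> E \<longrightarrow> E = C"
    using max_ideal_exists[of FF] iD unfolding FF_def by blast
  have iC: "idl C" "D \<subseteq> C" "C \<inter> N \<subseteq> D" using C unfolding FF_def by auto
  have "\<exists>n. r [^] (n::nat) \<in> C" if r: "r \<in> m" for r
  proof -
    have rc: "r \<in> \<A>" using r m_c by blast
    have inc: "colon C (r [^] n) \<subseteq> colon C (r [^] Suc n)" for n
    proof
      fix b assume "b \<in> colon C (r [^] n)"
      then have b: "b \<in> \<A>" "r [^] n \<otimes> b \<in> C" unfolding colon_def by auto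
      have "r [^] Suc n \<otimes> b = r \<otimes> (r [^] n \<otimes> b)" using rc b m_comm[of "r [^] n" r] m_assoc by simp
      then show "b \<in> colon C (r [^] Suc n)" unfolding colon_def using b idl_l[OF iC(1) b(2) rc] by simp
    qed
    obtain n :: nat where n: "\<forall>k\<ge>n. colon C (r [^] k) = colon C (r [^] n)"
      using acc[of "\<lambda>n. colon C (r [^] n)", OF colon_idl[OF iC(1) nat_pow_closed[OF rc]] inc] by blast
    have rn: "r [^] n \<in> \<A>" using rc by simp
    define E where "E = C \<boxplus> PIdl (r [^] n)"
    have iE: "idl E" unfolding E_def using sum_PI_idl[OF iC(1) rn] .
    have CE: "C \<subseteq> E" unfolding E_def using sum_l[OF iC(1) PI_idl[OF rn]] .
    have "E \<inter> N \<subseteq> D"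
    proof
      fix a assume a: "a \<in> E \<inter> N"
      then obtain c b where cb: "c \<in> C" "b \<in> \<A>" "a = c \<oplus> r [^] n \<otimes> b"
        unfolding E_def using PI_iff[OF rn] by (auto elim!: sumE)
      have cc: "c \<in> \<A>" using idl_carr[OF iC(1) cb(1)] .
      have "r \<otimes> a \<in> m \<cdot> N" using prod_mem[OF r] a by blast
      then have ra: "r \<otimes> a \<in> C" using iC(2) sum_r[OF U imN] unfolding D_def by blast
      have "q \<otimes> r \<otimes> b = r \<otimes> (c \<oplus> q \<otimes> b) \<ominus> r \<otimes> c" if "q \<in> \<A>" for q
        using that rc cc cb(2) by algebra
      then have "r [^] Suc n \<otimes> b = (r \<otimes> a) \<ominus> r \<otimes> c" unfolding cb(3) nat_pow_Suc using rn by blast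
      also have "\<dots> \<in> C" using idl_minus[OF iC(1) ra idl_l[OF iC(1) cb(1) rc]] .
      finally have "b \<in> colon C (r [^] Suc n)" unfolding colon_def using cb by simp
      then have "b \<in> colon C (r [^] n)" using n[rule_format, OF le_SucI[OF order_refl]] by (simp only:)
      then have "a \<in> C" unfolding cb(3) colon_def using idl_add[OF iC(1) cb(1)] by simp
      then show "a \<in> D" using a iC(3) by blast
    qed
    then have "E = C" using C(2) iE CE iC(2) unfolding FF_def by blast
    moreover have "r [^] n \<in> E" unfolding E_def using sum_r[OF iC(1) PI_idl[OF rn]] PI_self[OF rn] by blast
    ultimately show ?thesis by blast
  qed
  then obtain k where k: "pw m k \<subseteq> C" using rad_pow[OF iC(1) m_idl] by blast
  have "N \<subseteq> U \<boxplus> pw m k" unfolding N_def by blast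
  also have "\<dots> \<subseteq> C" using sum_least[OF iC(1) _ k] iC(2) sum_l[OF U imN] unfolding D_def by blast
  finally have "N \<subseteq> D" using iC(3) by blast
  then have "N \<subseteq> U" using nakayama[OF U iN] unfolding D_def by simp
  moreover have "a \<in> N" unfolding N_def using a by blast
  ultimately show ?thesis by blast
qed

lemma krull_intersection:
  assumes U: "idl U" and I: "I \<subseteq> m" and a: "\<And>n. a \<in> U \<boxplus> pw I n" shows "a \<in> U"
  by (rule krull_intersection_m[OF U]) (use a sum_mono[OF order_refl pw_mono[OF I]] in blast)

text \<open>The half of permuting a regular sequence that needs a local ring:
  \<open>N = colon U y\<close> satisfies \<open>N <= U + m N\<close>, because an element killed by
  \<open>y\<close> modulo \<open>U\<close> is a multiple of \<open>x\<close> modulo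
  \<open>U\<close>, and the cofactor is killed by \<open>y\<close> again.\<close>

lemma nzd_perm:
  assumes U: "idl U" and x: "x \<in> m" "y \<in> m" and nz: "nzd U x" "nzd (U \<boxplus> PIdl x) y"
  shows "nzd U y"
proof -
  have xc: "x \<in> \<A>" "y \<in> \<A>" using x m_c by auto
  define N where "N = colon U y"
  have iN: "idl N" unfolding N_def using colon_idl[OF U xc(2)] .
  have "N \<subseteq> U \<boxplus> m \<cdot> N"
  proof
    fix a assume "a \<in> N"
    then have a: "a \<in> \<A>" "y \<otimes> a \<in> U" unfolding N_def colon_def by auto
    then have "a \<in> U \<boxplus> PIdl x" using nzdD[OF nz(2)] sum_l[OF U PI_idl[OF xc(1)]] by blast
    then obtain u b where u: "u \<in> U" "b \<in> \<A>" "a = u \<oplus> x \<otimes> b" using PI_iff[OF xc(1)] by (auto elim!: sumE)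
    have uc: "u \<in> \<A>" using idl_carr[OF U u(1)] .
    have "x \<otimes> (y \<otimes> b) = y \<otimes> a \<ominus> y \<otimes> u" unfolding u(3) using xc uc u(2) by algebra
    also have "\<dots> \<in> U" using idl_minus[OF U a(2) idl_l[OF U u(1) xc(2)]] .
    finally have "y \<otimes> b \<in> U" using nzdD[OF nz(1)] xc u(2) by simp
    then have "b \<in> N" unfolding N_def colon_def using u by simp
    then show "a \<in> U \<boxplus> m \<cdot> N" unfolding u(3) by (intro sum_mem u(1) prod_mem x(1))
  qed
  then have "N \<subseteq> U" using nakayama[OF U iN] by blast
  then show ?thesis unfolding nzd_def N_def colon_def by blast
qed

definition reg3 :: "'a \<Rightarrow> 'a \<Rightarrow> 'a \<Rightarrow> bool" where
  "reg3 x y z \<longleftrightarrow> x \<in> m \<and> y \<in> m \<and> z \<in> m \<and> nzd {\<zero>} x \<and> nzd (PIdl x) y \<and> nzd (PIdl x \<boxplus> PIdl y) z"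

lemma zero_sum: "idl U \<Longrightarrow> {\<zero>} \<boxplus> U = U"
  using sum_absorb[OF _ zeroideal, of U] idl_zero[of U] sum_comm[of "{\<zero>}" U] idl_sub[of U] by auto

lemma reg3_swap12: assumes "reg3 x y z" shows "reg3 y x z"
proof -
  have c: "x \<in> \<A>" "y \<in> \<A>" using assms m_c unfolding reg3_def by auto
  have e: "{\<zero>} \<boxplus> PIdl x = PIdl x" "{\<zero>} \<boxplus> PIdl y = PIdl y" using zero_sum PI_idl c by auto
  have "nzd {\<zero>} y" using nzd_perm[OF zeroideal, of x y] assms e unfolding reg3_def by simp
  moreover have "nzd (PIdl y) x" using nzd_swap[OF zeroideal c] assms e unfolding reg3_def by simp
  moreover have "PIdl x \<boxplus> PIdl y = PIdl y \<boxplus> PIdl x" using sum_comm idl_sub[OF PI_idl] c by simp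
  ultimately show ?thesis using assms unfolding reg3_def by simp
qed

lemma reg3_swap23: assumes "reg3 x y z" shows "reg3 x z y"
proof -
  have c: "x \<in> \<A>" "y \<in> \<A>" "z \<in> \<A>" using assms m_c unfolding reg3_def by auto
  have "nzd (PIdl x) z" using nzd_perm[OF PI_idl[OF c(1)], of y z] assms unfolding reg3_def by simp
  moreover have "nzd (PIdl x \<boxplus> PIdl z) y" using nzd_swap[OF PI_idl[OF c(1)] c(2,3)] assms unfolding reg3_def by simp
  ultimately show ?thesis using assms unfolding reg3_def by simp
qed

end

section \<open>Artin-Rees by a Hilbert basis argument\<close>

context ncr
begin

text \<open>The \<open>W i\<close> are the components of a homogeneous ideal of the Rees algebra of
  \<open>K\<close>. \<open>AR K\<close> says that each such ideal is generated in bounded degree,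
  which is the form in which Noetherianity of the Rees algebra is used.\<close>

definition fam :: "'a set \<Rightarrow> (nat \<Rightarrow> 'a set) \<Rightarrow> bool" where
  "fam K W \<longleftrightarrow> (\<forall>i. idl (W i) \<and> W i \<subseteq> pw K i \<and> K \<cdot> W i \<subseteq> W (Suc i))"

definition AR :: "'a set \<Rightarrow> bool" where
  "AR K \<longleftrightarrow> (\<forall>W. fam K W \<longrightarrow> (\<exists>N. \<forall>i\<ge>N. W (Suc i) \<subseteq> K \<cdot> W i))"

text \<open>The sum of the \<open>u^t K^(i-t)\<close> for \<open>t < s\<close>: the part of
  \<open>(K + (u))^i\<close> of \<open>u\<close>-degree below \<open>s\<close>. Subtraction is
  truncated, so a term with \<open>t > i\<close> is all of \<open>u^t R\<close>; the degree
  bookkeeping is reliable for \<open>s <= i + 1\<close>.\<close>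

primrec Lam :: "'a set \<Rightarrow> 'a \<Rightarrow> nat \<Rightarrow> nat \<Rightarrow> 'a set" where
  "Lam K u 0 i = {\<zero>}"
| "Lam K u (Suc s) i = Lam K u s i \<boxplus> smul (u [^] s) (pw K (i - s))"

lemma Lam_idl: "idl K \<Longrightarrow> u \<in> \<A> \<Longrightarrow> idl (Lam K u s i)"
  by (induction s) (simp_all add: zeroideal sum_idl smul_idl pw_idl)

lemma Lam_mono: "idl K \<Longrightarrow> u \<in> \<A> \<Longrightarrow> Lam K u s i \<subseteq> Lam K u (Suc s) i"
  using sum_l[OF Lam_idl smul_idl[OF _ pw_idl]] by simp

lemma Lam_K:
  assumes K: "idl K" and u: "u \<in> \<A>" and s: "s \<le> Suc i"
  shows "K \<cdot> Lam K u s i \<subseteq> Lam K u s (Suc i)"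
  using s
proof (induction s)
  case 0 then show ?case using ideal_prod_zero[OF K] by simp
next
  case (Suc s)
  have us: "u [^] s \<in> \<A>" using u by simp
  have i1: "idl (smul (u [^] s) (pw K (i - s)))" using smul_idl[OF us pw_idl[OF K]] .
  have "K \<cdot> smul (u [^] s) (pw K (i - s)) \<subseteq> smul (u [^] s) (pw K (Suc i - s))"
  proof (rule prod_least[OF smul_idl[OF us pw_idl[OF K]]])
    fix a b assume a: "a \<in> K" and "b \<in> smul (u [^] s) (pw K (i - s))"
    then obtain c where c: "c \<in> pw K (i - s)" "b = u [^] s \<otimes> c" unfolding smul_def by blast
    have cc: "c \<in> \<A>" "a \<in> \<A>" using pw_carr[OF K c(1)] idl_carr[OF K a] by auto
    have "a \<otimes> b = u [^] s \<otimes> (a \<otimes> c)" unfolding c(2) using cc us m_lcomm by simp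
    moreover have "a \<otimes> c \<in> pw K (Suc i - s)"
      using prod_mem[OF a c(1)] Suc.prems by (simp add: Suc_diff_le)
    ultimately show "a \<otimes> b \<in> smul (u [^] s) (pw K (Suc i - s))" by (simp add: smul_mem)
  qed
  then have "K \<cdot> Lam K u s i \<boxplus> K \<cdot> smul (u [^] s) (pw K (i - s)) \<subseteq> Lam K u (Suc s) (Suc i)"
    using Suc sum_mono by simp
  then show ?case using ideal_prod_r_distr[OF K Lam_idl[OF K u] i1] by simp
qed

lemma Lam_u:
  assumes K: "idl K" and u: "u \<in> \<A>"
  shows "smul u (Lam K u s i) \<subseteq> Lam K u (Suc s) (Suc i)"
proof (induction s)
  case 0
  have "smul u {\<zero>} = {\<zero>}" unfolding smul_def using u by auto
  then show ?case using idl_zero[OF Lam_idl[OF K u]] by (metis Lam.simps(1) empty_subsetI insert_subset)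
next
  case (Suc s)
  have us: "u [^] s \<in> \<A>" using u by simp
  have "smul u (Lam K u (Suc s) i) = smul u (Lam K u s i) \<boxplus> smul u (smul (u [^] s) (pw K (i - s)))"
    using smul_sum[OF u Lam_idl[OF K u] smul_idl[OF us pw_idl[OF K]]] by simp
  also have "smul u (smul (u [^] s) (pw K (i - s))) = smul (u [^] Suc s) (pw K (Suc i - Suc s))"
    using smul_smul[OF u us idl_sub[OF pw_idl[OF K]]] m_comm[OF u us] by simp
  also have "smul u (Lam K u s i) \<boxplus> \<dots> \<subseteq> Lam K u (Suc s) (Suc i) \<boxplus> \<dots>"
    using Suc by (intro sum_mono) auto
  finally show ?case by simp
qed

lemma pw_Lam:
  assumes K: "idl K" and u: "u \<in> \<A>"
  shows "pw (K \<boxplus> PIdl u) i \<subseteq> Lam K u (Suc i) i"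
proof (induction i)
  case 0
  have "smul \<one> (\<A>) = \<A>" unfolding smul_def by force
  then show ?case using sum_r[OF zeroideal oneideal] by simp
next
  case (Suc i)
  let ?L = "Lam K u (Suc i) i"
  have iL: "idl ?L" using Lam_idl[OF K u] .
  have "pw (K \<boxplus> PIdl u) (Suc i) \<subseteq> (K \<boxplus> PIdl u) \<cdot> ?L" using prod_mono[OF order_refl Suc] by simp
  also have "\<dots> = K \<cdot> ?L \<boxplus> smul u ?L" using prod_sum_l[OF K PI_idl[OF u] iL] prod_PI[OF u iL] by simp
  also have "\<dots> \<subseteq> Lam K u (Suc (Suc i)) (Suc i)"
    using Lam_K[OF K u, of "Suc i" i] Lam_u[OF K u, of "Suc i" i] Lam_mono[OF K u, of "Suc i" "Suc i"]
    by (intro sum_least[OF Lam_idl[OF K u]]) auto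
  finally show ?case .
qed

lemma AR_zero: "AR {\<zero>}"
  unfolding AR_def
proof (intro allI impI)
  fix W assume W: "fam {\<zero>} W"
  have "W (Suc i) \<subseteq> {\<zero>} \<cdot> W i" for i
  proof -
    have "pw {\<zero>} (Suc i) \<subseteq> {\<zero>}" using ideal_prod_inter[OF zeroideal pw_idl[OF zeroideal]] by auto
    then have "W (Suc i) \<subseteq> {\<zero>}" using W unfolding fam_def by blast
    moreover have "idl ({\<zero>} \<cdot> W i)" using prod_idl[OF zeroideal] W unfolding fam_def by blast
    ultimately show ?thesis using idl_zero by blast
  qed
  then show "\<exists>N. \<forall>i\<ge>N. W (Suc i) \<subseteq> {\<zero>} \<cdot> W i" by blast
qed

text \<open>Hilbert's basis theorem for the Rees algebra of \<open>K + (u)\<close> over that of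
  \<open>K\<close>, with \<open>u\<close> in the role of the variable: elements are reduced by their
  coefficient at the highest power of \<open>u\<close>.\<close>

lemma AR_step:
  assumes K: "idl K" and u: "u \<in> \<A>" and ar: "AR K"
  shows "AR (K \<boxplus> PIdl u)"
  unfolding AR_def
proof (intro allI impI)
  define L where "L = K \<boxplus> PIdl u"
  have L: "idl L" unfolding L_def using sum_PI_idl[OF K u] .
  have KL: "K \<subseteq> L" and uL: "u \<in> L" unfolding L_def
    using sum_l[OF K PI_idl[OF u]] sum_r[OF K PI_idl[OF u]] PI_self[OF u] by auto
  fix W assume "fam (K \<boxplus> PIdl u) W"
  then have W: "\<And>i. idl (W i)" "\<And>i. W i \<subseteq> pw L i" "\<And>i. L \<cdot> W i \<subseteq> W (Suc i)"
    unfolding fam_def L_def by auto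
  have uc: "u [^] s \<in> \<A>" for s :: nat using u by simp
  \<comment> \<open>Coefficients of \<open>u^s\<close> of the elements of \<open>W (i + s)\<close>
    whose \<open>u\<close>-degree is at most \<open>s\<close>. For fixed \<open>s\<close> they form
    a family over \<open>K\<close>, and they increase with \<open>s\<close>.\<close>
  define c where "c s i = {a \<in> pw K i. \<exists>l\<in>Lam K u s (i + s). u [^] s \<otimes> a \<oplus> l \<in> W (i + s)}" for s i
  note iLam = Lam_idl[OF K u]
  have c_idl: "idl (c s i)" for s i
  proof (rule idlI)
    show "c s i \<subseteq> \<A>" unfolding c_def using pw_carr[OF K] by blast
    show "\<zero> \<in> c s i" unfolding c_def using idl_zero[OF pw_idl[OF K]] idl_zero[OF iLam] idl_zero[OF W(1)] uc
      by (auto intro!: bexI[of _ \<zero>])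
  next
    fix a b assume "a \<in> c s i" "b \<in> c s i"
    then obtain l k where h: "a \<in> pw K i" "b \<in> pw K i" "l \<in> Lam K u s (i + s)" "k \<in> Lam K u s (i + s)"
      "u [^] s \<otimes> a \<oplus> l \<in> W (i + s)" "u [^] s \<otimes> b \<oplus> k \<in> W (i + s)" unfolding c_def by blast
    have cc: "a \<in> \<A>" "b \<in> \<A>" "l \<in> \<A>" "k \<in> \<A>"
      using h pw_carr[OF K] idl_carr[OF iLam] by auto
    have "(u [^] s \<otimes> a \<oplus> l) \<oplus> (u [^] s \<otimes> b \<oplus> k) = u [^] s \<otimes> (a \<oplus> b) \<oplus> (l \<oplus> k)"
      using cc uc[of s] by algebra
    then show "a \<oplus> b \<in> c s i" unfolding c_def using h idl_add[OF pw_idl[OF K]] idl_add[OF iLam] idl_add[OF W(1)]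
      by (metis (mono_tags, lifting) mem_Collect_eq)
  next
    fix a x assume "a \<in> c s i" and x: "x \<in> \<A>"
    then obtain l where h: "a \<in> pw K i" "l \<in> Lam K u s (i + s)"
      "u [^] s \<otimes> a \<oplus> l \<in> W (i + s)" unfolding c_def by blast
    have cc: "a \<in> \<A>" "l \<in> \<A>" using h pw_carr[OF K] idl_carr[OF iLam] by auto
    have "x \<otimes> (u [^] s \<otimes> a \<oplus> l) = u [^] s \<otimes> (x \<otimes> a) \<oplus> x \<otimes> l" using cc uc[of s] x by algebra
    then show "x \<otimes> a \<in> c s i" unfolding c_def using h x idl_l[OF pw_idl[OF K]] idl_l[OF iLam] idl_l[OF W(1)]
      by (metis (mono_tags, lifting) mem_Collect_eq)
  qed
  have c_K: "K \<cdot> c s i \<subseteq> c s (Suc i)" for s i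
  proof (rule prod_least[OF c_idl])
    fix x a assume x: "x \<in> K" and "a \<in> c s i"
    then obtain l where h: "a \<in> pw K i" "l \<in> Lam K u s (i + s)"
      "u [^] s \<otimes> a \<oplus> l \<in> W (i + s)" unfolding c_def by blast
    have cc: "a \<in> \<A>" "l \<in> \<A>" "x \<in> \<A>"
      using h pw_carr[OF K] idl_carr[OF iLam] idl_carr[OF K x] by auto
    have "x \<otimes> (u [^] s \<otimes> a \<oplus> l) = u [^] s \<otimes> (x \<otimes> a) \<oplus> x \<otimes> l" using cc uc[of s] by algebra
    moreover have "x \<otimes> (u [^] s \<otimes> a \<oplus> l) \<in> W (Suc i + s)"
      using prod_mem[of x L _ "W (i + s)"] h(3) x KL W(3)[of "i + s"] by auto
    moreover have "x \<otimes> l \<in> Lam K u s (Suc i + s)"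
      using Lam_K[OF K u, of s "i + s"] prod_mem[OF x h(2)] by auto
    moreover have "x \<otimes> a \<in> pw K (Suc i)" using prod_mem[OF x h(1)] by simp
    ultimately show "x \<otimes> a \<in> c s (Suc i)" unfolding c_def by auto
  qed
  have c_s: "c s i \<subseteq> c (Suc s) i" for s i
  proof
    fix a assume "a \<in> c s i"
    then obtain l where h: "a \<in> pw K i" "l \<in> Lam K u s (i + s)"
      "u [^] s \<otimes> a \<oplus> l \<in> W (i + s)" unfolding c_def by blast
    have cc: "a \<in> \<A>" "l \<in> \<A>" using h pw_carr[OF K] idl_carr[OF iLam] by auto
    have "u \<otimes> (u [^] s \<otimes> a \<oplus> l) = u [^] Suc s \<otimes> a \<oplus> u \<otimes> l" unfolding nat_pow_Suc using cc uc[of s] u by algebra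
    moreover have "u \<otimes> (u [^] s \<otimes> a \<oplus> l) \<in> W (i + Suc s)"
      using prod_mem[OF uL h(3)] W(3)[of "i + s"] by auto
    moreover have "u \<otimes> l \<in> Lam K u (Suc s) (i + Suc s)"
      using Lam_u[OF K u, of s "i + s"] smul_mem[OF h(2), of u] by auto
    ultimately show "a \<in> c (Suc s) i" unfolding c_def using h(1) by auto
  qed
  have c_mono: "c s i \<subseteq> c t i" if "s \<le> t" for s t i
    using lift_Suc_mono_le[of "\<lambda>s. c s i", OF c_s that] .
  have famc: "fam K (c s)" for s unfolding fam_def using c_idl c_K unfolding c_def by blast
  \<comment> \<open>For each \<open>i\<close> the union over \<open>s\<close> is reached at some
    \<open>st i\<close> that depends on \<open>i\<close>. Since \<open>ci\<close> is itself a
    family, it is generated up to degree \<open>Ni\<close>, so finitely many \<open>i\<close> decide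
    and one \<open>s0\<close> serves all \<open>i\<close>.\<close>
  define ci where "ci i = (\<Union>s. c s i)" for i
  have ex_st: "\<exists>s. \<forall>t\<ge>s. c t i = c s i" for i using acc[of "\<lambda>s. c s i"] c_idl c_s by blast
  then obtain st where st: "\<And>i t. t \<ge> st i \<Longrightarrow> c t i = c (st i) i" by metis
  have ci_eq: "ci i = c (st i) i" for i
  proof -
    have "c t i \<subseteq> c (st i) i" for t
      using c_mono[of t "max t (st i)" i] st[of i "max t (st i)"] by simp
    then show ?thesis unfolding ci_def by blast
  qed
  have ci_big: "ci i = c t i" if "t \<ge> st i" for i t using ci_eq st[OF that] by simp
  have famci: "fam K ci" unfolding fam_def
  proof (intro allI conjI)
    fix i show "idl (ci i)" using ci_eq c_idl by simp
    show "ci i \<subseteq> pw K i" unfolding ci_def c_def by blast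
    have "ci i = c (max (st i) (st (Suc i))) i" "ci (Suc i) = c (max (st i) (st (Suc i))) (Suc i)"
      using ci_big by auto
    then show "K \<cdot> ci i \<subseteq> ci (Suc i)" using c_K by simp
  qed
  obtain Ni where Ni: "\<forall>i\<ge>Ni. ci (Suc i) \<subseteq> K \<cdot> ci i" using ar famci unfolding AR_def by blast
  define s0 where "s0 = Max (st ` {..Ni})"
  have stab0: "ci i = c s0 i" if "i \<le> Ni" for i
    using ci_big[of i s0] that unfolding s0_def by simp
  have stab1: "ci i = c s0 i" if "i \<ge> Ni" for i
    using that
  proof (induction i rule: dec_induct)
    case base then show ?case using stab0 by simp
  next
    case (step i)
    have "ci (Suc i) \<subseteq> c s0 (Suc i)" using Ni[rule_format, of i] step c_K[of s0 i] by auto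
    then show ?case unfolding ci_def by blast
  qed
  have stab: "c t i = c s0 i" if "t \<ge> s0" for t i
  proof -
    have "ci i = c s0 i" using stab0 stab1 by (meson nat_le_linear)
    moreover have "c t i \<subseteq> ci i" unfolding ci_def by blast
    ultimately show ?thesis using c_mono[OF that] by blast
  qed
  have "\<forall>s. \<exists>N. \<forall>i\<ge>N. c s (Suc i) \<subseteq> K \<cdot> c s i" using ar famc unfolding AR_def by blast
  then obtain Ns where Ns: "\<And>s i. i \<ge> Ns s \<Longrightarrow> c s (Suc i) \<subseteq> K \<cdot> c s i" by metis
  define N1 where "N1 = Max (Ns ` {..s0})"
  have N1: "Ns s \<le> N1" if "s \<le> s0" for s unfolding N1_def using that by simp
  have "W (Suc i) \<subseteq> L \<cdot> W i" if i: "i \<ge> s0 + N1" for i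
  proof -
    have iLW: "idl (L \<cdot> W i)" using prod_idl[OF L W(1)] .
    have main: "w \<in> L \<cdot> W i" if "s \<le> Suc (Suc i)" "w \<in> W (Suc i)" "w \<in> Lam K u s (Suc i)" for s w
      using that
    proof (induction s arbitrary: w)
      case 0 then show ?case using idl_zero[OF iLW] by simp
    next
      case (Suc s)
      obtain l a where la: "l \<in> Lam K u s (Suc i)" "a \<in> pw K (Suc i - s)" "w = l \<oplus> u [^] s \<otimes> a"
        using Suc.prems(3) unfolding Lam.simps by (rule sum_smulE)
      have cc: "l \<in> \<A>" "a \<in> \<A>" using la pw_carr[OF K] idl_carr[OF iLam] by auto
      have wc: "w \<in> \<A>" using idl_carr[OF W(1) Suc.prems(2)] .
      \<comment> \<open>The top coefficient \<open>a\<close> of \<open>w\<close> is matched by an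
        element of \<open>L W_i\<close>. For \<open>s > s0\<close> it already occurs at
        \<open>u\<close>-degree \<open>s - 1\<close>, and multiplication by \<open>u\<close> raises
        it. For \<open>s <= s0\<close> it comes from smaller degree in \<open>K\<close>, by
        \<open>AR\<close> applied to \<open>c s\<close>.\<close>
      have "\<exists>w'\<in>L \<cdot> W i. \<exists>l'\<in>Lam K u s (Suc i). w' = u [^] s \<otimes> a \<oplus> l'"
      proof (cases "s > s0")
        case True
        then obtain s' where s': "s = Suc s'" "s' \<ge> s0" by (metis Suc_le_D less_eq_Suc_le Suc_le_mono)
        have e: "Suc i - s + s = Suc i" using Suc.prems(1) by simp
        have "u [^] s \<otimes> a \<oplus> l = w" using la cc uc[of s] a_comm by simp
        then have "a \<in> c s (Suc i - s)" unfolding c_def e using la(1,2) Suc.prems(2)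
          by (intro CollectI conjI bexI[of _ l]) simp_all
        then have "a \<in> c s' (Suc i - s)" using stab[of s "Suc i - s"] stab[of s' "Suc i - s"] s' True by simp
        moreover have "Suc i - s + s' = i" using s' Suc.prems(1) by simp
        ultimately obtain l' where l': "l' \<in> Lam K u s' i" "u [^] s' \<otimes> a \<oplus> l' \<in> W i" unfolding c_def by auto
        have l'c: "l' \<in> \<A>" using l' idl_carr[OF iLam] by blast
        have "u \<otimes> (u [^] s' \<otimes> a \<oplus> l') = u [^] s \<otimes> a \<oplus> u \<otimes> l'" unfolding s'(1) nat_pow_Suc using cc uc[of s'] u l'c by algebra
        moreover have "u \<otimes> l' \<in> Lam K u s (Suc i)" unfolding s'(1) using Lam_u[OF K u] smul_mem[OF l'(1)] by blast
        moreover have "u \<otimes> (u [^] s' \<otimes> a \<oplus> l') \<in> L \<cdot> W i" using prod_mem[OF uL l'(2)] .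
        ultimately show ?thesis by auto
      next
        case False
        have e: "Suc i - s + s = Suc i" "Suc (i - s) = Suc i - s" "i - s + s = i" using Suc.prems(1) False i by auto
        have "u [^] s \<otimes> a \<oplus> l = w" using la cc uc[of s] a_comm by simp
        then have ac: "a \<in> c s (Suc i - s)" unfolding c_def e(1) using la(1,2) Suc.prems(2)
          by (intro CollectI conjI bexI[of _ l]) simp_all
        have "i - s \<ge> Ns s" using N1[of s] False i by simp
        then have "a \<in> K \<cdot> c s (i - s)" using Ns[of s "i - s"] ac e(2) by auto
        then show ?thesis
        proof (induction a rule: ideal_prod.induct)
          case (prod x a)
          then obtain l' where l': "l' \<in> Lam K u s i" "u [^] s \<otimes> a \<oplus> l' \<in> W i" "a \<in> pw K (i - s)" unfolding c_def using e by auto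
          have c2: "l' \<in> \<A>" "a \<in> \<A>" "x \<in> \<A>" using l' idl_carr[OF iLam] pw_carr[OF K] idl_carr[OF K prod(1)] by auto
          have "x \<otimes> (u [^] s \<otimes> a \<oplus> l') = u [^] s \<otimes> (x \<otimes> a) \<oplus> x \<otimes> l'" using c2 uc[of s] by algebra
          moreover have "x \<otimes> l' \<in> Lam K u s (Suc i)" using Lam_K[OF K u, of s i] prod_mem[OF prod(1) l'(1)] False i by auto
          moreover have "x \<otimes> (u [^] s \<otimes> a \<oplus> l') \<in> L \<cdot> W i" using prod_mem[OF _ l'(2), of x L] prod(1) KL by auto
          ultimately show ?case by auto
        next
          case (sum a1 a2)
          then obtain w1 l1 w2 l2 where h: "w1 \<in> L \<cdot> W i" "w2 \<in> L \<cdot> W i" "l1 \<in> Lam K u s (Suc i)" "l2 \<in> Lam K u s (Suc i)"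
            "w1 = u [^] s \<otimes> a1 \<oplus> l1" "w2 = u [^] s \<otimes> a2 \<oplus> l2" by blast
          have "a1 \<in> \<A>" "a2 \<in> \<A>" "l1 \<in> \<A>" "l2 \<in> \<A>"
            using sum.hyps idl_carr[OF prod_idl[OF K c_idl]] h idl_carr[OF iLam] by auto
          then have "w1 \<oplus> w2 = u [^] s \<otimes> (a1 \<oplus> a2) \<oplus> (l1 \<oplus> l2)" unfolding h using uc[of s] by algebra
          then show ?case using idl_add[OF iLW h(1,2)] idl_add[OF iLam h(3,4)] by auto
        qed
      qed
      then obtain w' l' where w': "w' \<in> L \<cdot> W i" "l' \<in> Lam K u s (Suc i)" "w' = u [^] s \<otimes> a \<oplus> l'" by blast
      have l'c: "l' \<in> \<A>" using w' idl_carr[OF iLam] by blast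
      have "w \<ominus> w' = l \<ominus> l'" unfolding w'(3) la(3) using cc l'c uc[of s] by algebra
      then have "w \<ominus> w' \<in> Lam K u s (Suc i)" using idl_minus[OF iLam la(1) w'(2)] by simp
      moreover have "w \<ominus> w' \<in> W (Suc i)" using idl_minus[OF W(1) Suc.prems(2)] w'(1) W(3) by blast
      ultimately have "w \<ominus> w' \<in> L \<cdot> W i" using Suc by simp
      then show ?case using idl_cancel_minus[OF iLW _ w'(1) wc] by blast
    qed
    show ?thesis
    proof
      fix w assume w: "w \<in> W (Suc i)"
      then have "w \<in> Lam K u (Suc (Suc i)) (Suc i)" using W(2)[of "Suc i"] pw_Lam[OF K u, of "Suc i"] unfolding L_def by blast
      then show "w \<in> L \<cdot> W i" using main[OF order_refl w] by blast
    qed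
  qed
  then show "\<exists>N. \<forall>i\<ge>N. W (Suc i) \<subseteq> (K \<boxplus> PIdl u) \<cdot> W i" unfolding L_def by blast
qed

lemma AR_all: assumes "idl K" shows "AR K"
proof -
  obtain S where S: "S \<subseteq> \<A>" "finite S" "K = Idl S" using fg[OF assms] by blast
  have "AR (Idl T)" if "finite T" "T \<subseteq> \<A>" for T
    using that
  proof (induction T)
    case empty then show ?case using AR_zero by (simp add: Idl_empty)
  next
    case (insert t T)
    then show ?case using AR_step[of "Idl T" t] genideal_ideal[of T] Idl_insert[of T t] by simp
  qed
  then show ?thesis using S by simp
qed

end

text \<open>Lengths of submodules of the ring over a subset \<open>Os\<close> of scalars: the whole ring gives colengths of ideals,
  the degree 0 part gives lengths of graded pieces.\<close>

locale lenr = cr + fixes Os :: "'a set"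
  assumes Os_sub: "Os \<subseteq> \<A>" and Os_m1: "\<ominus> \<one> \<in> Os"
begin

definition sm :: "'a set \<Rightarrow> bool" where
  "sm U \<longleftrightarrow> U \<subseteq> \<A> \<and> \<zero> \<in> U \<and> (\<forall>a\<in>U. \<forall>b\<in>U. a \<oplus> b \<in> U) \<and> (\<forall>x\<in>Os. \<forall>a\<in>U. x \<otimes> a \<in> U)"

lemma sm_c: "sm U \<Longrightarrow> a \<in> U \<Longrightarrow> a \<in> \<A>" unfolding sm_def by blast
lemma sm_0: "sm U \<Longrightarrow> \<zero> \<in> U" unfolding sm_def by blast
lemma sm_add: "sm U \<Longrightarrow> a \<in> U \<Longrightarrow> b \<in> U \<Longrightarrow> a \<oplus> b \<in> U" unfolding sm_def by blast
lemma sm_sc: "sm U \<Longrightarrow> x \<in> Os \<Longrightarrow> a \<in> U \<Longrightarrow> x \<otimes> a \<in> U" unfolding sm_def by blast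

lemma sm_neg: assumes "sm U" "a \<in> U" shows "\<ominus> a \<in> U"
proof -
  have "\<ominus> \<one> \<otimes> a = \<ominus> a" using sm_c[OF assms] l_minus[of \<one> a] by simp
  then show ?thesis using sm_sc[OF assms(1) Os_m1 assms(2)] by simp
qed

lemma sm_minus: "sm U \<Longrightarrow> a \<in> U \<Longrightarrow> b \<in> U \<Longrightarrow> a \<ominus> b \<in> U"
  unfolding a_minus_def by (simp add: sm_add sm_neg)

lemma sm_sum: assumes U: "sm U" and V: "sm V" shows "sm (U \<boxplus> V)"
  unfolding sm_def
proof (intro conjI ballI)
  show "U \<boxplus> V \<subseteq> \<A>" using sm_c[OF U] sm_c[OF V] by (auto elim!: sumE)
  show "\<zero> \<in> U \<boxplus> V" using sum_mem[OF sm_0[OF U] sm_0[OF V]] by simp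
next
  fix a b assume "a \<in> U \<boxplus> V" "b \<in> U \<boxplus> V"
  then obtain u v u' v' where h: "u \<in> U" "v \<in> V" "u' \<in> U" "v' \<in> V" "a = u \<oplus> v" "b = u' \<oplus> v'" by (auto elim!: sumE)
  have "u \<in> \<A>" "v \<in> \<A>" "u' \<in> \<A>" "v' \<in> \<A>" using h sm_c[OF U] sm_c[OF V] by auto
  then have "a \<oplus> b = (u \<oplus> u') \<oplus> (v \<oplus> v')" unfolding h by algebra
  then show "a \<oplus> b \<in> U \<boxplus> V" using sum_mem[OF sm_add[OF U h(1,3)] sm_add[OF V h(2,4)]] by simp
next
  fix x a assume x: "x \<in> Os" and "a \<in> U \<boxplus> V"
  then obtain u v where h: "u \<in> U" "v \<in> V" "a = u \<oplus> v" by (auto elim!: sumE)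
  have "x \<otimes> a = x \<otimes> u \<oplus> x \<otimes> v" unfolding h using sm_c[OF U h(1)] sm_c[OF V h(2)] x Os_sub by (intro r_distr) auto
  then show "x \<otimes> a \<in> U \<boxplus> V" using sum_mem[OF sm_sc[OF U x h(1)] sm_sc[OF V x h(2)]] by simp
qed

lemma sm_int: "sm U \<Longrightarrow> sm V \<Longrightarrow> sm (U \<inter> V)"
  unfolding sm_def by blast

lemma sm_l: assumes "sm U" "sm V" shows "U \<subseteq> U \<boxplus> V"
proof
  fix a assume a: "a \<in> U"
  have "a \<oplus> \<zero> \<in> U \<boxplus> V" by (rule sum_mem[OF a sm_0[OF assms(2)]])
  then show "a \<in> U \<boxplus> V" using sm_c[OF assms(1) a] by simp
qed

lemma sm_r: assumes "sm U" "sm V" shows "V \<subseteq> U \<boxplus> V"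
proof
  fix a assume a: "a \<in> V"
  have "\<zero> \<oplus> a \<in> U \<boxplus> V" by (rule sum_mem[OF sm_0[OF assms(1)] a])
  then show "a \<in> U \<boxplus> V" using sm_c[OF assms(2) a] by simp
qed

lemma sm_least: "sm W \<Longrightarrow> U \<subseteq> W \<Longrightarrow> V \<subseteq> W \<Longrightarrow> U \<boxplus> V \<subseteq> W"
  using sm_add[of W] by (auto elim!: sumE)

lemma sm_smul: assumes "sm U" "f \<in> \<A>" shows "sm (smul f U)"
  unfolding sm_def
proof (intro conjI ballI)
  show "smul f U \<subseteq> \<A>" unfolding smul_def using sm_c[OF assms(1)] assms(2) by blast
  show "\<zero> \<in> smul f U" using smul_mem[OF sm_0[OF assms(1)], of f] assms by simp
next
  fix a b assume "a \<in> smul f U" "b \<in> smul f U"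
  then obtain u v where h: "u \<in> U" "v \<in> U" "a = f \<otimes> u" "b = f \<otimes> v" unfolding smul_def by blast
  have "a \<oplus> b = f \<otimes> (u \<oplus> v)" unfolding h using sm_c[OF assms(1)] h assms(2) r_distr by simp
  then show "a \<oplus> b \<in> smul f U" using smul_mem[OF sm_add[OF assms(1) h(1,2)]] by simp
next
  fix x a assume x: "x \<in> Os" and "a \<in> smul f U"
  then obtain u where h: "u \<in> U" "a = f \<otimes> u" unfolding smul_def by blast
  have "x \<otimes> a = f \<otimes> (x \<otimes> u)" unfolding h using sm_c[OF assms(1) h(1)] x Os_sub assms(2) m_lcomm by auto
  then show "x \<otimes> a \<in> smul f U" using smul_mem[OF sm_sc[OF assms(1) x h(1)]] by simp
qed

lemma sm_colon: assumes "sm U" "sm V" "f \<in> \<A>" shows "sm {a \<in> V. f \<otimes> a \<in> U}"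
  unfolding sm_def
proof (intro conjI ballI)
  show "{a \<in> V. f \<otimes> a \<in> U} \<subseteq> \<A>" using sm_c[OF assms(2)] by blast
  show "\<zero> \<in> {a \<in> V. f \<otimes> a \<in> U}" using sm_0[OF assms(1)] sm_0[OF assms(2)] assms(3) by simp
next
  fix a b assume "a \<in> {a \<in> V. f \<otimes> a \<in> U}" "b \<in> {a \<in> V. f \<otimes> a \<in> U}"
  then show "a \<oplus> b \<in> {a \<in> V. f \<otimes> a \<in> U}"
    using sm_add[OF assms(1)] sm_add[OF assms(2)] sm_c[OF assms(2)] assms(3) by (simp add: r_distr)
next
  fix x a assume "x \<in> Os" "a \<in> {a \<in> V. f \<otimes> a \<in> U}"
  moreover then have "f \<otimes> (x \<otimes> a) = x \<otimes> (f \<otimes> a)" using sm_c[OF assms(2)] Os_sub assms(3) m_lcomm by auto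
  ultimately show "x \<otimes> a \<in> {a \<in> V. f \<otimes> a \<in> U}" using sm_sc[OF assms(1)] sm_sc[OF assms(2)] by simp
qed

definition chn :: "(nat \<Rightarrow> 'a set) \<Rightarrow> nat \<Rightarrow> 'a set \<Rightarrow> 'a set \<Rightarrow> bool" where
  "chn C n U V \<longleftrightarrow> C 0 = U \<and> C n = V \<and> (\<forall>i\<le>n. sm (C i)) \<and> (\<forall>i<n. C i \<subset> C (Suc i))"

text \<open>Finite length is encoded as a bound on strict chains. \<open>len\<close> is a
  \<open>GREATEST\<close>, meaningful only under \<open>flen\<close>, so finiteness is always
  established alongside each length identity.\<close>

definition flen :: "'a set \<Rightarrow> 'a set \<Rightarrow> bool" where
  "flen U V \<longleftrightarrow> sm U \<and> sm V \<and> U \<subseteq> V \<and> (\<exists>B. \<forall>n C. chn C n U V \<longrightarrow> n \<le> B)"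

definition len :: "'a set \<Rightarrow> 'a set \<Rightarrow> nat" where
  "len U V = (GREATEST n. \<exists>C. chn C n U V)"

lemma flenD: "flen U V \<Longrightarrow> sm U" "flen U V \<Longrightarrow> sm V" "flen U V \<Longrightarrow> U \<subseteq> V"
  unfolding flen_def by auto

lemma chn_mono: "chn C n U V \<Longrightarrow> i \<le> j \<Longrightarrow> j \<le> n \<Longrightarrow> C i \<subseteq> C j"
proof (induction j)
  case (Suc j)
  have "C j \<subset> C (Suc j)" using Suc.prems unfolding chn_def by simp
  then show ?case using Suc by (cases "i = Suc j") auto
qed simp

lemma chn_ex: "sm U \<Longrightarrow> sm V \<Longrightarrow> U \<subseteq> V \<Longrightarrow> \<exists>n C. chn C n U V"
proof (cases "U = V")
  case True
  assume "sm U"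
  then show ?thesis using True by (intro exI[of _ 0] exI[of _ "\<lambda>_. U"]) (auto simp: chn_def)
next
  case False
  assume "sm U" "sm V" "U \<subseteq> V"
  then show ?thesis using False
    by (intro exI[of _ 1] exI[of _ "\<lambda>i. if i = 0 then U else V"]) (auto simp: chn_def)
qed

lemma len_chn: assumes "flen U V" shows "\<exists>C. chn C (len U V) U V"
  unfolding len_def
proof -
  obtain B where B: "\<forall>n C. chn C n U V \<longrightarrow> n \<le> B" using assms unfolding flen_def by blast
  obtain n0 where n0: "\<exists>C. chn C n0 U V" using chn_ex assms unfolding flen_def by blast
  show "\<exists>C. chn C (GREATEST n. \<exists>C. chn C n U V) U V"
    by (rule GreatestI_nat[where P="\<lambda>n. \<exists>C. chn C n U V", OF n0]) (use B in blast)
qed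

lemma len_ge: assumes "flen U V" "chn C n U V" shows "n \<le> len U V"
  unfolding len_def
proof -
  obtain B where B: "\<forall>n C. chn C n U V \<longrightarrow> n \<le> B" using assms unfolding flen_def by blast
  show "n \<le> (GREATEST n. \<exists>C. chn C n U V)"
    by (rule Greatest_le_nat[where P="\<lambda>n. \<exists>C. chn C n U V"]) (use B assms in blast)+
qed

lemma len_bound:
  assumes "sm U" "sm V" "U \<subseteq> V" "\<And>n C. chn C n U V \<Longrightarrow> n \<le> B"
  shows "flen U V" "len U V \<le> B"
proof -
  show f: "flen U V" using assms unfolding flen_def by blast
  show "len U V \<le> B" using len_chn[OF f] assms(4) by blast
qed

text \<open>Traces of a strict chain in a submodule or a quotient are only weakly increasing; the
  surviving strict steps are counted.\<close>

lemma weak_chn: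
  assumes "\<And>i. i \<le> n \<Longrightarrow> sm (D i)" "\<And>i. i < n \<Longrightarrow> D i \<subseteq> D (Suc i)"
  shows "\<exists>C. chn C (card {i. i < n \<and> D i \<noteq> D (Suc i)}) (D 0) (D n)"
  using assms
proof (induction n)
  case 0
  then show ?case by (intro exI[of _ D]) (auto simp: chn_def)
next
  case (Suc n)
  let ?k = "card {i. i < n \<and> D i \<noteq> D (Suc i)}"
  obtain C where C: "chn C ?k (D 0) (D n)" using Suc by auto
  show ?case
  proof (cases "D n = D (Suc n)")
    case True
    then have "{i. i < Suc n \<and> D i \<noteq> D (Suc i)} = {i. i < n \<and> D i \<noteq> D (Suc i)}" using less_Suc_eq by auto
    then show ?thesis using C True by auto
  next
    case False
    then have "{i. i < Suc n \<and> D i \<noteq> D (Suc i)} = insert n {i. i < n \<and> D i \<noteq> D (Suc i)}" using less_Suc_eq by auto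
    then have k: "card {i. i < Suc n \<and> D i \<noteq> D (Suc i)} = Suc ?k" by simp
    define C' where "C' i = (if i \<le> ?k then C i else D (Suc n))" for i
    have "chn C' (Suc ?k) (D 0) (D (Suc n))" unfolding chn_def C'_def
      using C Suc.prems False unfolding chn_def by (auto simp: le_Suc_eq less_Suc_eq)
    then show ?thesis unfolding k by blast
  qed
qed

lemma weak_le:
  assumes "flen U V" "\<And>i. i \<le> n \<Longrightarrow> sm (D i)" "\<And>i. i < n \<Longrightarrow> D i \<subseteq> D (Suc i)" "D 0 = U" "D n = V"
  shows "card {i. i < n \<and> D i \<noteq> D (Suc i)} \<le> len U V"
  using weak_chn[of n D] assms len_ge[OF assms(1)] by auto

lemma chn_concat:
  assumes "chn C n U V" "chn D k V W" shows "chn (\<lambda>i. if i \<le> n then C i else D (i - n)) (n + k) U W"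
  using assms unfolding chn_def
  by (auto simp: Suc_diff_le not_le less_Suc_eq le_Suc_eq)

text \<open>A chain from \<open>U\<close> to \<open>W\<close> is split into its intersections with
  \<open>V\<close> and its sums with \<open>V\<close>. By the modular law a strict step stays strict
  in at least one of the two.\<close>

lemma len_add:
  assumes UV: "flen U V" and VW: "flen V W"
  shows "flen U W" "len U W = len U V + len V W"
proof -
  have s: "sm U" "sm V" "sm W" "U \<subseteq> V" "V \<subseteq> W" using UV VW unfolding flen_def by auto
  have up: "n \<le> len U V + len V W" if C: "chn C n U W" for n C
  proof -
    have Cs: "sm (C i)" if "i \<le> n" for i using C that unfolding chn_def by blast
    have Ci: "C i \<subset> C (Suc i)" if "i < n" for i using C that unfolding chn_def by blast
    have C0: "C 0 = U" "C n = W" using C unfolding chn_def by auto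
    define D where "D i = C i \<inter> V" for i
    define E where "E i = C i \<boxplus> V" for i
    have 1: "card {i. i < n \<and> D i \<noteq> D (Suc i)} \<le> len U V"
    proof (rule weak_le[OF UV])
      show "sm (D i)" if "i \<le> n" for i unfolding D_def using sm_int[OF Cs[OF that] s(2)] .
      show "D i \<subseteq> D (Suc i)" if "i < n" for i unfolding D_def using Ci[OF that] by blast
      show "D 0 = U" "D n = V" unfolding D_def C0 using s by auto
    qed
    have 2: "card {i. i < n \<and> E i \<noteq> E (Suc i)} \<le> len V W"
    proof (rule weak_le[OF VW])
      show "sm (E i)" if "i \<le> n" for i unfolding E_def using sm_sum[OF Cs[OF that] s(2)] .
      show "E i \<subseteq> E (Suc i)" if "i < n" for i unfolding E_def using Ci[OF that] by (intro sum_mono) auto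
      show "E 0 = V" unfolding E_def C0 using sm_r[OF s(1,2)] sm_least[OF s(2) s(4)] by blast
      show "E n = W" unfolding E_def C0 using sm_l[OF s(3,2)] sm_least[OF s(3) order_refl s(5)] by blast
    qed
    have "{..<n} \<subseteq> {i. i < n \<and> D i \<noteq> D (Suc i)} \<union> {i. i < n \<and> E i \<noteq> E (Suc i)}"
    proof (rule subsetI, rule ccontr)
      fix i assume i: "i \<in> {..<n}" and "i \<notin> {i. i < n \<and> D i \<noteq> D (Suc i)} \<union> {i. i < n \<and> E i \<noteq> E (Suc i)}"
      then have eq: "D i = D (Suc i)" "E i = E (Suc i)" by auto
      have si: "sm (C i)" "sm (C (Suc i))" using Cs i by auto
      have "C (Suc i) \<subseteq> C i"
      proof
        fix a assume a: "a \<in> C (Suc i)"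
        then have "a \<in> E i" using eq sm_l[OF si(2) s(2)] unfolding E_def by blast
        then obtain b v where b: "b \<in> C i" "v \<in> V" "a = b \<oplus> v" unfolding E_def by (rule sumE)
        have cc: "b \<in> \<A>" "v \<in> \<A>" using sm_c[OF si(1) b(1)] sm_c[OF s(2) b(2)] by auto
        have bS: "b \<in> C (Suc i)" using b Ci i by blast
        have "v = a \<ominus> b" unfolding b(3) using cc by algebra
        then have "v \<in> C (Suc i)" using sm_minus[OF si(2) a bS] by simp
        then have "v \<in> C i" using b eq unfolding D_def by blast
        then show "a \<in> C i" unfolding b(3) using sm_add[OF si(1) b(1)] by blast
      qed
      then show False using Ci i by blast
    qed
    then have "card {..<n} \<le> card ({i. i < n \<and> D i \<noteq> D (Suc i)} \<union> {i. i < n \<and> E i \<noteq> E (Suc i)})"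
      by (intro card_mono) auto
    also have "\<dots> \<le> card {i. i < n \<and> D i \<noteq> D (Suc i)} + card {i. i < n \<and> E i \<noteq> E (Suc i)}" by (rule card_Un_le)
    finally show ?thesis using 1 2 by simp
  qed
  have US: "U \<subseteq> W" using s by blast
  show f: "flen U W" using len_bound(1)[OF s(1,3) US up] .
  obtain C D where "chn C (len U V) U V" "chn D (len V W) V W" using len_chn UV VW by blast
  then have "len U V + len V W \<le> len U W" using len_ge[OF f chn_concat] by blast
  then show "len U W = len U V + len V W" using len_bound(2)[OF s(1,3) US up] by simp
qed

lemma flen_sub:
  assumes UW: "flen U W" and V: "sm V" "U \<subseteq> V" "V \<subseteq> W"
  shows "flen U V" "flen V W"
proof -
  have s: "sm U" "sm W" using UW unfolding flen_def by auto
  obtain k D where D: "chn D k V W" using chn_ex[OF V(1) s(2) V(3)] by blast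
  obtain k' D' where D': "chn D' k' U V" using chn_ex[OF s(1) V(1,2)] by blast
  have "n \<le> len U W" if "chn C n U V" for n C using len_ge[OF UW chn_concat[OF that D]] by simp
  then show "flen U V" by (rule len_bound(1)[OF s(1) V(1,2)])
  have "n \<le> len U W" if "chn C n V W" for n C using len_ge[OF UW chn_concat[OF D' that]] by simp
  then show "flen V W" by (rule len_bound(1)[OF V(1) s(2) V(3)])
qed

lemma len_zero: "flen U V \<Longrightarrow> len U V = 0 \<Longrightarrow> U = V"
  using len_chn unfolding chn_def by fastforce

lemma len_self: "sm U \<Longrightarrow> flen U U" "sm U \<Longrightarrow> len U U = 0"
proof -
  assume s: "sm U"
  have b: "n \<le> 0" if C: "chn C n U U" for n C
  proof (rule ccontr)
    assume n: "\<not> n \<le> 0"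
    then have "C 0 \<subset> C 1" "C 1 \<subseteq> C n" using C chn_mono[OF C, of 1 n] unfolding chn_def by auto
    then show False using C unfolding chn_def by blast
  qed
  show "flen U U" "len U U = 0" using len_bound[OF s s order_refl b] by auto
qed

text \<open>Multiplication by \<open>f\<close> induces an isomorphism of \<open>V/W\<close> with
  \<open>T/U\<close>. Quotients are not formed; strict chains are carried over in both
  directions.\<close>

lemma mulmap:
  assumes U: "sm U" and V: "sm V" and f: "f \<in> \<A>"
  defines "W \<equiv> {a \<in> V. f \<otimes> a \<in> U}" and "T \<equiv> U \<boxplus> smul f V"
  shows "flen U T \<Longrightarrow> flen W V" "flen W V \<Longrightarrow> flen U T" "flen U T \<Longrightarrow> len U T = len W V"
proof -
  have W: "sm W" unfolding W_def using sm_colon[OF U V f] .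
  have T: "sm T" unfolding T_def using sm_sum[OF U sm_smul[OF V f]] .
  have WV: "W \<subseteq> V" unfolding W_def by blast
  have UT: "U \<subseteq> T" unfolding T_def using sm_l[OF U sm_smul[OF V f]] .
  have A: "\<exists>D. chn D n W V" if C: "chn C n U T" for C n
  proof -
    have Cs: "sm (C i)" if "i \<le> n" for i using C that unfolding chn_def by blast
    have Ci: "C i \<subset> C (Suc i)" if "i < n" for i using C that unfolding chn_def by blast
    have C0: "C 0 = U" "C n = T" using C unfolding chn_def by auto
    have "chn (\<lambda>i. {a \<in> V. f \<otimes> a \<in> C i}) n W V" unfolding chn_def
    proof (intro conjI allI impI)
      show "{a \<in> V. f \<otimes> a \<in> C 0} = W" unfolding C0 W_def ..
      have "f \<otimes> a \<in> T" if "a \<in> V" for a using that smul_mem sm_r[OF U sm_smul[OF V f]] unfolding T_def by blast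
      then show "{a \<in> V. f \<otimes> a \<in> C n} = V" unfolding C0 by blast
      show "sm {a \<in> V. f \<otimes> a \<in> C i}" if "i \<le> n" for i using sm_colon[OF Cs[OF that] V f] .
      show "{a \<in> V. f \<otimes> a \<in> C i} \<subset> {a \<in> V. f \<otimes> a \<in> C (Suc i)}" if i: "i < n" for i
      proof -
        have si: "sm (C i)" "sm (C (Suc i))" using Cs i by auto
        obtain x where x: "x \<in> C (Suc i)" "x \<notin> C i" using Ci[OF i] by blast
        have "x \<in> T" using x chn_mono[OF C, of "Suc i" n] i C0 by auto
        then obtain u v where uv: "u \<in> U" "v \<in> V" "x = u \<oplus> f \<otimes> v" unfolding T_def by (rule sum_smulE)
        have u: "u \<in> C i" "u \<in> C (Suc i)" using uv chn_mono[OF C, of 0 i] chn_mono[OF C, of 0 "Suc i"] i C0 by auto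
        have cc: "u \<in> \<A>" "f \<otimes> v \<in> \<A>" using sm_c[OF U uv(1)] sm_c[OF V uv(2)] f by auto
        have "f \<otimes> v = x \<ominus> u" unfolding uv(3) using cc by algebra
        then have "f \<otimes> v \<in> C (Suc i)" using sm_minus[OF si(2) x(1) u(2)] by simp
        moreover have "f \<otimes> v \<notin> C i" using x(2) sm_add[OF si(1) u(1)] uv(3) by blast
        ultimately show ?thesis using Ci[OF i] uv(2) by blast
      qed
    qed
    then show ?thesis by blast
  qed
  have B: "\<exists>D. chn D n U T" if C: "chn C n W V" for C n
  proof -
    have Cs: "sm (C i)" if "i \<le> n" for i using C that unfolding chn_def by blast
    have Ci: "C i \<subset> C (Suc i)" if "i < n" for i using C that unfolding chn_def by blast
    have C0: "C 0 = W" "C n = V" using C unfolding chn_def by auto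
    have "chn (\<lambda>i. U \<boxplus> smul f (C i)) n U T" unfolding chn_def
    proof (intro conjI allI impI)
      have "smul f W \<subseteq> U" unfolding smul_def W_def by blast
      then show "U \<boxplus> smul f (C 0) = U" unfolding C0 using sm_l[OF U sm_smul[OF W f]] sm_least[OF U order_refl] by blast
      show "U \<boxplus> smul f (C n) = T" unfolding C0 T_def ..
      show "sm (U \<boxplus> smul f (C i))" if "i \<le> n" for i using sm_sum[OF U sm_smul[OF Cs[OF that] f]] .
      show "U \<boxplus> smul f (C i) \<subset> U \<boxplus> smul f (C (Suc i))" if i: "i < n" for i
      proof -
        have si: "sm (C i)" "sm (C (Suc i))" using Cs i by auto
        obtain x where x: "x \<in> C (Suc i)" "x \<notin> C i" using Ci[OF i] by blast
        have xV: "x \<in> V" using x chn_mono[OF C, of "Suc i" n] i C0 by auto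
        have "f \<otimes> x \<in> U \<boxplus> smul f (C (Suc i))" using smul_mem[OF x(1)] sm_r[OF U sm_smul[OF si(2) f]] by blast
        moreover have "f \<otimes> x \<notin> U \<boxplus> smul f (C i)"
        proof
          assume "f \<otimes> x \<in> U \<boxplus> smul f (C i)"
          then obtain u y where uy: "u \<in> U" "y \<in> C i" "f \<otimes> x = u \<oplus> f \<otimes> y" by (rule sum_smulE)
          have cc: "u \<in> \<A>" "y \<in> \<A>" "x \<in> \<A>" using sm_c[OF U uy(1)] sm_c[OF si(1) uy(2)] sm_c[OF V xV] by auto
          have yV: "y \<in> V" using uy(2) chn_mono[OF C, of i n] i C0 by auto
          have "f \<otimes> (x \<ominus> y) = f \<otimes> x \<ominus> f \<otimes> y" using cc f by algebra
          also have "\<dots> = u" unfolding uy(3) using cc f by algebra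
          finally have "x \<ominus> y \<in> W" unfolding W_def using sm_minus[OF V xV yV] uy(1) by simp
          then have "x \<ominus> y \<in> C i" using chn_mono[OF C, of 0 i] i C0 by auto
          then have "(x \<ominus> y) \<oplus> y \<in> C i" using sm_add[OF si(1) _ uy(2)] by blast
          moreover have "(x \<ominus> y) \<oplus> y = x" using cc by algebra
          ultimately show False using x by simp
        qed
        ultimately show ?thesis using sum_mono[OF order_refl smul_mono, of "C i" "C (Suc i)" U f] Ci[OF i] by blast
      qed
    qed
    then show ?thesis by blast
  qed
  show f1: "flen W V" if "flen U T" using len_bound(1)[OF W V WV, of "len U T"] B len_ge[OF that] by blast
  show f2: "flen U T" if "flen W V" using len_bound(1)[OF U T UT, of "len W V"] A len_ge[OF that] by blast
  show "len U T = len W V" if h: "flen U T"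
  proof (rule antisym)
    show "len U T \<le> len W V" using len_bound(2)[OF U T UT, of "len W V"] A len_ge[OF f1[OF h]] by blast
    show "len W V \<le> len U T" using len_bound(2)[OF W V WV, of "len U T"] B len_ge[OF h] by blast
  qed
qed

end

section \<open>Colengths of ideals\<close>

sublocale cr \<subseteq> I: lenr R "carrier R"
  by unfold_locales auto

context cr
begin

lemma I_sm: "I.sm U \<longleftrightarrow> idl U"
  unfolding I.sm_def using idlI[of U] idl_carr[of U] idl_zero[of U] idl_add[of U] idl_l[of U] by blast

definition fin :: "'a set \<Rightarrow> bool" where "fin U \<longleftrightarrow> I.flen U (\<A>)"

abbreviation col :: "'a set \<Rightarrow> nat" where "col U \<equiv> colength R U"

lemma col_eq: "col U = I.len U (\<A>)"
  unfolding colength_def I.len_def ideal_chain_to_top_def I.chn_def I_sm ..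

lemma fin_idl: "fin U \<Longrightarrow> idl U"
  unfolding fin_def using I.flenD I_sm by blast

lemma fin_sup: "fin U \<Longrightarrow> idl V \<Longrightarrow> U \<subseteq> V \<Longrightarrow> fin V"
  unfolding fin_def using I.flen_sub(2) I_sm idl_sub by blast

lemma fin_flen: "fin U \<Longrightarrow> idl V \<Longrightarrow> U \<subseteq> V \<Longrightarrow> I.flen U V"
  unfolding fin_def using I.flen_sub(1) I_sm idl_sub by blast

lemma col_len: "fin U \<Longrightarrow> idl V \<Longrightarrow> U \<subseteq> V \<Longrightarrow> col U = col V + I.len U V"
  using I.len_add(2)[of U V "\<A>"] fin_flen[of U V] fin_sup[of U V] unfolding col_eq fin_def by simp

lemma col_mono: "fin U \<Longrightarrow> idl V \<Longrightarrow> U \<subseteq> V \<Longrightarrow> col V \<le> col U"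
  using col_len by simp

lemma col_inj: "fin U \<Longrightarrow> idl V \<Longrightarrow> U \<subseteq> V \<Longrightarrow> col U \<le> col V \<Longrightarrow> U = V"
  using col_len[of U V] I.len_zero[OF fin_flen, of U V] by simp

lemma fin_carrier: "fin (\<A>)" "col (\<A>) = 0"
  using I.len_self oneideal I_sm unfolding fin_def col_eq by auto

text \<open>Numerical form of the isomorphism in \<open>mulmap\<close>. With \<open>V\<close> the
  whole ring it becomes the colon formula \<open>col_colon\<close>, with \<open>f = 1\<close> the
  formula for sum and intersection \<open>col_diamond\<close>.\<close>

lemma col_mulmap:
  assumes U: "fin U" and V: "fin V" and f: "f \<in> \<A>"
  shows "fin (colon U f \<inter> V)" "col U + col V = col (U \<boxplus> smul f V) + col (colon U f \<inter> V)"
proof -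
  have i: "idl U" "idl V" using U V fin_idl by auto
  have W: "{a \<in> V. f \<otimes> a \<in> U} = colon U f \<inter> V" unfolding colon_def using idl_carr[OF i(2)] by blast
  have T: "idl (U \<boxplus> smul f V)" "U \<subseteq> U \<boxplus> smul f V" using sum_idl[OF i(1) smul_idl[OF f i(2)]] sum_l[OF i(1) smul_idl[OF f i(2)]] by auto
  note mm = I.mulmap[of U V f, unfolded I_sm, OF i f, unfolded W]
  have fUT: "I.flen U (U \<boxplus> smul f V)" using fin_flen[OF U T] .
  have fW: "I.flen (colon U f \<inter> V) V" using mm(1)[OF fUT] .
  show "fin (colon U f \<inter> V)" using I.len_add(1)[OF fW] V unfolding fin_def by blast
  have "col (colon U f \<inter> V) = I.len (colon U f \<inter> V) V + col V" using I.len_add(2)[OF fW] V unfolding fin_def col_eq by blast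
  moreover have "col U = col (U \<boxplus> smul f V) + I.len U (U \<boxplus> smul f V)" using col_len[OF U T] .
  ultimately show "col U + col V = col (U \<boxplus> smul f V) + col (colon U f \<inter> V)" using mm(3)[OF fUT] by simp
qed

lemma col_colon:
  assumes U: "fin U" and f: "f \<in> \<A>"
  shows "fin (colon U f)" "col U = col (U \<boxplus> PIdl f) + col (colon U f)"
proof -
  have "colon U f \<inter> \<A> = colon U f" unfolding colon_def by blast
  then show "fin (colon U f)" "col U = col (U \<boxplus> PIdl f) + col (colon U f)"
    using col_mulmap[OF U fin_carrier(1) f] fin_carrier(2) PI_smul[OF f] by auto
qed

lemma col_diamond:
  assumes U: "fin U" and V: "fin V"
  shows "fin (U \<inter> V)" "col U + col V = col (U \<boxplus> V) + col (U \<inter> V)"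
proof -
  have i: "idl U" "idl V" using U V fin_idl by auto
  have "colon U \<one> \<inter> V = U \<inter> V" unfolding colon_def using idl_carr[OF i(2)] by auto
  moreover have "smul \<one> V = V" unfolding smul_def using idl_carr[OF i(2)] by force
  ultimately show "fin (U \<inter> V)" "col U + col V = col (U \<boxplus> V) + col (U \<inter> V)"
    using col_mulmap[OF U V one_closed] by auto
qed

end

context lcr
begin

text \<open>The quotient of \<open>U + (s)\<close> by \<open>U\<close> is an image of the residue
  field, so a strict chain has at most one step.\<close>

lemma simple_step:
  assumes U: "idl U" and s: "s \<in> \<A>" and ms: "\<And>y. y \<in> m \<Longrightarrow> s \<otimes> y \<in> U"
  shows "I.flen U (U \<boxplus> PIdl s)"
proof (rule I.len_bound(1)[of _ _ 1])
  let ?T = "U \<boxplus> PIdl s"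
  have iT: "idl ?T" using sum_PI_idl[OF U s] .
  show "I.sm U" "I.sm ?T" using U iT I_sm by auto
  show "U \<subseteq> ?T" using sum_l[OF U PI_idl[OF s]] .
  fix n C assume C: "I.chn C n U ?T"
  show "n \<le> 1"
  proof (rule ccontr)
    assume n: "\<not> n \<le> 1"
    have i1: "idl (C 1)" using C n unfolding I.chn_def I_sm by auto
    have st: "U \<subset> C 1" "C 1 \<subset> C (Suc 1)" using C n unfolding I.chn_def by auto
    have le: "C 1 \<subseteq> ?T" "C (Suc 1) \<subseteq> ?T" using I.chn_mono[OF C, of 1 n] I.chn_mono[OF C, of "Suc 1" n] n C unfolding I.chn_def by auto
    obtain y where y: "y \<in> C 1" "y \<notin> U" using st by blast
    obtain u r where ur: "u \<in> U" "r \<in> \<A>" "y = u \<oplus> s \<otimes> r" using le y s by (auto elim!: sumPIE)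
    have uc: "u \<in> \<A>" using idl_carr[OF U ur(1)] .
    have "r \<notin> m" using y ur ms idl_add[OF U ur(1)] by blast
    moreover have "r \<otimes> s \<in> C 1"
    proof -
      have "r \<otimes> s = y \<ominus> u" unfolding ur(3) using ur(2) uc s by algebra
      moreover have "u \<in> C 1" using st ur by blast
      ultimately show ?thesis using idl_minus[OF i1 y(1)] by simp
    qed
    ultimately have "s \<in> C 1" using unit_cancel[OF ur(2) _ i1 s] by blast
    then have "?T \<subseteq> C 1" using sum_least[OF i1 _ PI_least[OF i1]] st by blast
    then show False using st le by blast
  qed
qed

lemma fin_pw_m: "fin (pw m k)"
proof (induction k)
  case 0 then show ?case using fin_carrier by simp
next
  case (Suc k)
  let ?U = "pw m (Suc k)"
  have iU: "idl ?U" using pw_idl[OF m_idl] .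
  obtain S where S: "S \<subseteq> \<A>" "finite S" "pw m k = Idl S" using fg[OF pw_idl[OF m_idl]] by blast
  have "I.flen ?U (?U \<boxplus> Idl T)" if "finite T" "T \<subseteq> S" for T
    using that
  proof (induction T)
    case empty
    then show ?case using I.len_self(1)[of ?U] I_sm iU sum_absorb[OF iU zeroideal] idl_zero[OF iU] by (simp add: Idl_empty)
  next
    case (insert t T)
    have T: "T \<subseteq> \<A>" "t \<in> \<A>" using insert.prems S by auto
    have tm: "t \<in> pw m k" using insert.prems S genideal_self by blast
    have iT: "idl (?U \<boxplus> Idl T)" using sum_idl[OF iU genideal_ideal[OF T(1)]] .
    have "t \<otimes> y \<in> ?U \<boxplus> Idl T" if y: "y \<in> m" for y
    proof -
      have "t \<otimes> y = y \<otimes> t" using m_comm T m_c[OF y] by simp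
      then show ?thesis using prod_mem[OF y tm] sum_l[OF iU genideal_ideal[OF T(1)]] by auto
    qed
    from simple_step[OF iT T(2) this] have "I.flen (?U \<boxplus> Idl T) (?U \<boxplus> Idl T \<boxplus> PIdl t)" .
    moreover have "?U \<boxplus> Idl T \<boxplus> PIdl t = ?U \<boxplus> Idl (insert t T)"
      using sum_assoc[OF idl_sub[OF iU] idl_sub[OF genideal_ideal[OF T(1)]] idl_sub[OF PI_idl[OF T(2)]]]
      by (simp add: Idl_insert[OF T(1,2)])
    ultimately show ?case using I.len_add(1)[of ?U "?U \<boxplus> Idl T"] insert by auto
  qed
  from this[OF S(2) order_refl] have "I.flen ?U (?U \<boxplus> pw m k)" using S(3) by simp
  moreover have "?U \<boxplus> pw m k = pw m k"
    using sum_r[OF iU pw_idl[OF m_idl]] sum_least[OF pw_idl[OF m_idl] pw_antimono[OF m_idl] order_refl, of k "Suc k"] by auto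
  ultimately show ?case using Suc I.len_add(1)[of ?U "pw m k"] unfolding fin_def by simp
qed

lemma fin_m_pow: "idl U \<Longrightarrow> pw m k \<subseteq> U \<Longrightarrow> fin U"
  using fin_sup fin_pw_m by blast

lemma m_primary_pow:
  assumes "m_primary R m K" shows "idl K" "K \<subseteq> m" "\<exists>k. pw m k \<subseteq> K"
  using assms rad_pow[OF _ m_idl, of K] unfolding m_primary_def by auto

end

section \<open>Eventually polynomial functions and Hilbert coefficients\<close>

definition dif :: "(nat \<Rightarrow> int) \<Rightarrow> nat \<Rightarrow> int" where "dif f n = f (Suc n) - f n"

text \<open>Eventual polynomiality is expressed by vanishing of some iterated difference, which
  makes closure under differences and shifts immediate.\<close>

definition evpoly :: "(nat \<Rightarrow> int) \<Rightarrow> bool" where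
  "evpoly f \<longleftrightarrow> (\<exists>k N. \<forall>n\<ge>N. (dif ^^ k) f n = 0)"

lemma dif_Suc: "(dif ^^ Suc k) f n = (dif ^^ k) f (Suc n) - (dif ^^ k) f n"
  by (simp add: dif_def)

lemma dif_diff: "(dif ^^ k) (\<lambda>n. f n - g n) = (\<lambda>n. (dif ^^ k) f n - (dif ^^ k) g n)"
  by (induction k) (auto simp: dif_def fun_eq_iff)

lemma dif_shift: "(dif ^^ k) (\<lambda>n. f (Suc n)) = (\<lambda>n. (dif ^^ k) f (Suc n))"
  by (induction k) (auto simp: dif_def fun_eq_iff)

lemma dif_cmult: "(dif ^^ k) (\<lambda>n. c * f n) = (\<lambda>n. c * (dif ^^ k) f n)"
  by (induction k) (auto simp: dif_def fun_eq_iff algebra_simps)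

lemma dif_zero_mono:
  assumes "\<forall>n\<ge>N. (dif ^^ k) f n = 0" shows "\<forall>n\<ge>N. (dif ^^ (k + j)) f n = 0"
  using assms by (induction j) (auto simp: dif_def)

lemma evpoly_diff: assumes "evpoly f" "evpoly g" shows "evpoly (\<lambda>n. f n - g n)"
proof -
  obtain k N k' N' where h: "\<forall>n\<ge>N. (dif ^^ k) f n = 0" "\<forall>n\<ge>N'. (dif ^^ k') g n = 0"
    using assms unfolding evpoly_def by blast
  have "\<forall>n\<ge>max N N'. (dif ^^ (k + k')) (\<lambda>n. f n - g n) n = 0"
    unfolding dif_diff using dif_zero_mono[OF h(1), of k'] dif_zero_mono[OF h(2), of k] by (simp add: add.commute)
  then show ?thesis unfolding evpoly_def by blast
qed

lemma evpoly_shift: assumes "evpoly f" shows "evpoly (\<lambda>n. f (Suc n))"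
proof -
  obtain k N where "\<forall>n\<ge>N. (dif ^^ k) f n = 0" using assms unfolding evpoly_def by blast
  then have "\<forall>n\<ge>N. (dif ^^ k) (\<lambda>n. f (Suc n)) n = 0" unfolding dif_shift by simp
  then show ?thesis unfolding evpoly_def by blast
qed

lemma evpoly_dif: assumes "evpoly (dif f)" shows "evpoly f"
proof -
  obtain k N where "\<forall>n\<ge>N. (dif ^^ k) (dif f) n = 0" using assms unfolding evpoly_def by blast
  then have "\<forall>n\<ge>N. (dif ^^ Suc k) f n = 0" by (simp add: funpow_swap1)
  then show ?thesis unfolding evpoly_def by blast
qed

lemma evpoly_cong: assumes "evpoly f" "\<forall>n\<ge>N. f n = g n" shows "evpoly g"
proof -
  obtain k N' where h: "\<forall>n\<ge>N'. (dif ^^ k) f n = 0" using assms unfolding evpoly_def by blast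
  have "\<forall>n\<ge>N. (dif ^^ j) f n = (dif ^^ j) g n" for j
    using assms(2) by (induction j) (auto simp: dif_def)
  then have "\<forall>n\<ge>max N N'. (dif ^^ k) g n = 0" using h by (metis max.boundedE)
  then show ?thesis unfolding evpoly_def by blast
qed

text \<open>Newton's forward difference formula with base point \<open>N\<close>.\<close>

lemma dif_newton:
  assumes "\<forall>n\<ge>N. (dif ^^ k) f n = 0"
  shows "f (N + j) = (\<Sum>i<k. (dif ^^ i) f N * int (j choose i))"
  using assms
proof (induction k arbitrary: f j)
  case 0 then show ?case by simp
next
  case (Suc k)
  have IH: "dif f (N + j) = (\<Sum>i<k. (dif ^^ i) (dif f) N * int (j choose i))" for j
    using Suc.IH[of "dif f" j] Suc.prems by (simp add: funpow_swap1)
  show ?case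
  proof (induction j)
    case 0
    have "(\<Sum>i<Suc k. (dif ^^ i) f N * int (0 choose i)) = (\<Sum>i\<in>{0}. (dif ^^ i) f N * int (0 choose i))"
      by (rule sum.mono_neutral_right) auto
    then show ?case by simp
  next
    case (Suc j)
    have "f (N + Suc j) = f (N + j) + dif f (N + j)" by (simp add: dif_def)
    also have "\<dots> = (\<Sum>i<Suc k. (dif ^^ i) f N * int (j choose i)) + (\<Sum>i<k. (dif ^^ Suc i) f N * int (j choose i))"
      unfolding Suc IH by (simp add: funpow_swap1)
    also have "\<dots> = (\<Sum>i<Suc k. (dif ^^ i) f N * int (Suc j choose i))"
      by (simp add: sum.lessThan_Suc_shift sum.distrib algebra_simps del: sum.lessThan_Suc)
    finally show ?case .
  qed
qed

text \<open>If the degree \<open>t\<close> in Newton's formula exceeded \<open>d\<close>, its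
  nonzero top term would be at least \<open>j choose t >= (j/t)^t\<close>, while all other terms and
  the assumed bound are at most a constant times \<open>j^(t-1)\<close>. This fails for large
  \<open>j\<close>.\<close>

lemma evpoly_growth:
  assumes "evpoly f" and b: "\<And>n. \<bar>f n\<bar> \<le> C * (int n + 1) ^ d"
  shows "\<exists>N. \<forall>n\<ge>N. (dif ^^ Suc d) f n = 0"
proof -
  define P where "P k \<longleftrightarrow> (\<exists>N. \<forall>n\<ge>N. (dif ^^ k) f n = 0)" for k
  have "\<exists>k. P k" using assms(1) unfolding P_def evpoly_def by blast
  define k where "k = (LEAST k. P k)"
  have Pk: "P k" unfolding k_def by (rule LeastI_ex) fact
  have "k \<le> Suc d"
  proof (rule ccontr)
    assume "\<not> k \<le> Suc d"
    then obtain t where t: "k = Suc t" "t \<ge> Suc d" by (metis Suc_le_D not_less_eq_eq)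
    obtain N where N: "\<forall>n\<ge>N. (dif ^^ k) f n = 0" using Pk unfolding P_def by blast
    define a where "a i = (dif ^^ i) f N" for i
    have new: "f (N + j) = (\<Sum>i<t. a i * int (j choose i)) + a t * int (j choose t)" for j
      using dif_newton[OF N, of j] unfolding t a_def by simp
    have at: "a t \<noteq> 0"
    proof
      assume a0: "a t = 0"
      have "(dif ^^ t) f n = 0" if "n \<ge> N" for n
        using that
      proof (induction n rule: dec_induct)
        case base then show ?case using a0 unfolding a_def .
      next
        case (step n)
        have "(dif ^^ k) f n = 0" using N step by simp
        then show ?case using step unfolding t dif_Suc by simp
      qed
      then have "P t" unfolding P_def by blast
      then have "k \<le> t" unfolding k_def by (rule Least_le)
      then show False using t by simp
    qed
    have C0: "C \<ge> 0" using b[of 0] by auto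
    define B where "B = (\<Sum>i<t. \<bar>a i\<bar>)"
    define D where "D = C * (int N + 2) ^ d"
    have key: "real j ^ t / real t ^ t \<le> (real_of_int B + D) * real j ^ (t - 1)" if j: "j \<ge> max 1 t" for j
    proof -
      have s1: "\<bar>\<Sum>i<t. a i * int (j choose i)\<bar> \<le> (\<Sum>i<t. \<bar>a i * int (j choose i)\<bar>)" by (rule sum_abs)
      have s2: "(\<Sum>i<t. \<bar>a i * int (j choose i)\<bar>) \<le> (\<Sum>i<t. \<bar>a i\<bar> * int j ^ (t - 1))"
      proof (rule sum_mono)
        fix i assume i: "i \<in> {..<t}"
        have "j choose i \<le> j ^ i" using binomial_le_pow i j by (metis le_trans less_imp_le_nat lessThan_iff max.boundedE)
        also have "\<dots> \<le> j ^ (t - 1)" using i j by (intro power_increasing) auto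
        finally have "int (j choose i) \<le> int j ^ (t - 1)" by (metis of_nat_le_iff of_nat_power)
        then show "\<bar>a i * int (j choose i)\<bar> \<le> \<bar>a i\<bar> * int j ^ (t - 1)" by (simp add: abs_mult mult_left_mono)
      qed
      have s3: "(\<Sum>i<t. \<bar>a i\<bar> * int j ^ (t - 1)) = B * int j ^ (t - 1)" unfolding B_def by (simp add: sum_distrib_right)
      have 1: "\<bar>\<Sum>i<t. a i * int (j choose i)\<bar> \<le> B * int j ^ (t - 1)" using s1 s2 s3 by linarith
      have "int (N + j) + 1 \<le> (int N + 2) * int j"
      proof -
        have "int N * 1 \<le> int N * int j" using j by (intro mult_left_mono) auto
        then show ?thesis using j by (simp add: algebra_simps)
      qed
      then have p1: "(int (N + j) + 1) ^ d \<le> ((int N + 2) * int j) ^ d" by (intro power_mono) auto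
      have p2: "(int N + 2) ^ d * int j ^ d \<le> (int N + 2) ^ d * int j ^ (t - 1)" using t j by (intro mult_left_mono power_increasing) auto
      have "(int (N + j) + 1) ^ d \<le> (int N + 2) ^ d * int j ^ (t - 1)" using p1 p2 unfolding power_mult_distrib by (rule order_trans)
      then have "C * (int (N + j) + 1) ^ d \<le> C * ((int N + 2) ^ d * int j ^ (t - 1))" using C0 by (rule mult_left_mono)
      then have "\<bar>f (N + j)\<bar> \<le> D * int j ^ (t - 1)" unfolding D_def mult.assoc using b[of "N + j"] by (rule order_trans[rotated])
      then have "\<bar>a t * int (j choose t)\<bar> \<le> (B + D) * int j ^ (t - 1)" using 1 new[of j] by (simp add: algebra_simps)
      moreover have "int (j choose t) \<le> \<bar>a t * int (j choose t)\<bar>" using mult_right_mono[of 1 "\<bar>a t\<bar>" "int (j choose t)"] at by (simp add: abs_mult)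
      ultimately have "int (j choose t) \<le> (B + D) * int j ^ (t - 1)" by simp
      then have "real_of_int (int (j choose t)) \<le> real_of_int ((B + D) * int j ^ (t - 1))" by (simp only: of_int_le_iff)
      then have "real (j choose t) \<le> (real_of_int B + D) * real j ^ (t - 1)" by simp
      moreover have "(real j / real t) ^ t \<le> real (j choose t)" using binomial_ge_n_over_k_pow_k[of t j, where 'a=real] j by simp
      ultimately show ?thesis by (simp add: power_divide)
    qed
    obtain j0 :: nat where j0: "real j0 > (real_of_int B + D) * real t ^ t" using reals_Archimedean2 by blast
    define j where "j = max j0 (max 1 t)"
    have j: "real j > (real_of_int B + D) * real t ^ t" "j \<ge> max 1 t" using j0 unfolding j_def by auto
    have tp: "real t ^ t > 0" using t by simp
    have "real j ^ t = real j * real j ^ (t - 1)" using t by (cases t) auto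
    moreover have "real j ^ t \<le> ((real_of_int B + D) * real j ^ (t - 1)) * real t ^ t"
      using key[OF j(2)] tp by (simp only: pos_divide_le_eq)
    ultimately have "real j * real j ^ (t - 1) \<le> ((real_of_int B + D) * real t ^ t) * real j ^ (t - 1)"
      by (simp only: ac_simps)
    moreover have "real j ^ (t - 1) > 0" using j by simp
    ultimately have "real j \<le> (real_of_int B + D) * real t ^ t" by (rule mult_right_le_imp_le)
    then show False using j by simp
  qed
  then obtain N where N: "\<forall>n\<ge>N. (dif ^^ k) f n = 0" using Pk unfolding P_def by blast
  then show ?thesis using dif_zero_mono[OF N, of "Suc d - k"] \<open>k \<le> Suc d\<close> by auto
qed

lemma dif_binomial: "i \<le> k \<Longrightarrow> (dif ^^ i) (\<lambda>n. int ((n + k) choose k)) = (\<lambda>n. int ((n + k) choose (k - i)))"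
proof (induction i)
  case (Suc i)
  have "dif (\<lambda>n. int ((n + k) choose (k - i))) n = int ((n + k) choose (k - Suc i))" for n
  proof -
    obtain r where r: "k - i = Suc r" "k - Suc i = r" using Suc.prems by (metis Suc_diff_Suc Suc_le_lessD)
    show ?thesis unfolding dif_def r by simp
  qed
  then have "dif (\<lambda>n. int ((n + k) choose (k - i))) = (\<lambda>n. int ((n + k) choose (k - Suc i)))" by blast
  then show ?case using Suc by simp
qed simp

lemma binomial_basis:
  assumes "\<forall>n\<ge>N. (dif ^^ Suc k) g n = 0"
  shows "\<exists>e. \<forall>n\<ge>N. g n = (\<Sum>i\<le>k. e i * int ((n + (k - i)) choose (k - i)))"
  using assms
proof (induction k arbitrary: g)
  case 0
  have gN: "g n = g N" if "n \<ge> N" for n using that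
  proof (induction n rule: dec_induct)
    case (step n)
    have "dif g n = 0" using 0 step by simp
    then show ?case using step by (simp add: dif_def)
  qed simp
  have "g n = (\<Sum>i\<le>0. (\<lambda>_. g N) i * int ((n + (0 - i)) choose (0 - i)))" if "n \<ge> N" for n
    by (subst gN[OF that]) simp
  then have "\<forall>n\<ge>N. g n = (\<Sum>i\<le>0. (\<lambda>_. g N) i * int ((n + (0 - i)) choose (0 - i)))" by blast
  then show ?case by (rule exI[where x="\<lambda>_. g N"])
next
  case (Suc k)
  define c where "c = (dif ^^ Suc k) g N"
  have cc: "(dif ^^ Suc k) g n = c" if "n \<ge> N" for n using that
  proof (induction n rule: dec_induct)
    case base then show ?case unfolding c_def ..
  next
    case (step n)
    have "(dif ^^ Suc (Suc k)) g n = 0" using Suc.prems step by blast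
    then show ?case using step unfolding dif_Suc[of "Suc k"] by simp
  qed
  define h where "h n = g n - c * int ((n + Suc k) choose Suc k)" for n
  have b1: "(dif ^^ Suc k) (\<lambda>n. int ((n + Suc k) choose Suc k)) = (\<lambda>n. 1)"
    using dif_binomial[of "Suc k" "Suc k"] by (simp del: funpow.simps)
  have "(dif ^^ Suc k) h n = (dif ^^ Suc k) g n - c" for n
    unfolding h_def dif_diff dif_cmult b1 by simp
  then have "\<forall>n\<ge>N. (dif ^^ Suc k) h n = 0" using cc by simp
  then obtain e where e: "\<forall>n\<ge>N. h n = (\<Sum>i\<le>k. e i * int ((n + (k - i)) choose (k - i)))" using Suc.IH by blast
  have "g n = (\<Sum>i\<le>Suc k. (case_nat c e) i * int ((n + (Suc k - i)) choose (Suc k - i)))" if "n \<ge> N" for n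
  proof -
    have "g n = c * int ((n + Suc k) choose Suc k) + h n" unfolding h_def by simp
    also have "h n = (\<Sum>i\<le>k. e i * int ((n + (k - i)) choose (k - i)))" using e that by blast
    finally show ?thesis unfolding sum.atMost_Suc_shift by simp
  qed
  then have "\<forall>n\<ge>N. g n = (\<Sum>i\<le>Suc k. (case_nat c e) i * int ((n + (Suc k - i)) choose (Suc k - i)))" by blast
  then show ?case by (rule exI[where x="case_nat c e"])
qed

lemma binomial_basis_unique:
  fixes e :: "nat \<Rightarrow> int"
  assumes "\<forall>n\<ge>N. (\<Sum>i\<le>k. e i * int ((n + (k - i)) choose (k - i))) = 0" "i \<le> k"
  shows "e i = 0"
  using assms
proof (induction k arbitrary: e i)
  case 0 then show ?case by auto
next
  case (Suc k)
  let ?r = "\<lambda>e n. (\<Sum>i\<le>k. e i * int ((n + (k - i)) choose (k - i)))"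
  have lin: "(dif ^^ Suc k) (?r e) = (\<lambda>n. 0)" for e :: "nat \<Rightarrow> int"
  proof -
    have gen: "(dif ^^ j) (\<lambda>n. \<Sum>i\<in>A. F i n) = (\<lambda>n. \<Sum>i\<in>A. (dif ^^ j) (F i) n)" for j A and F :: "nat \<Rightarrow> nat \<Rightarrow> int"
      by (induction j) (auto simp: dif_def fun_eq_iff sum_subtractf)
    have "(dif ^^ Suc k) (\<lambda>n. e i * int ((n + (k - i)) choose (k - i))) = (\<lambda>n. 0)" if "i \<le> k" for i
    proof -
      have z: "(dif ^^ Suc (k - i)) (\<lambda>n. int ((n + (k - i)) choose (k - i))) = (\<lambda>n. 0)"
        using dif_binomial[of "k - i" "k - i"] by (simp add: dif_def fun_eq_iff)
      have "(dif ^^ j) (\<lambda>n. 0) = (\<lambda>n. 0)" for j by (induction j) (auto simp: dif_def fun_eq_iff)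
      then have "(dif ^^ (i + Suc (k - i))) (\<lambda>n. int ((n + (k - i)) choose (k - i))) = (\<lambda>n. 0)"
        unfolding funpow_add comp_def z .
      then show ?thesis unfolding dif_cmult using that by simp
    qed
    then show ?thesis unfolding gen by (auto simp: fun_eq_iff intro!: sum.neutral)
  qed
  have s: "e 0 * int ((n + Suc k) choose Suc k) + ?r (\<lambda>i. e (Suc i)) n = 0" if "n \<ge> N" for n
    using Suc.prems(1) that by (simp add: sum.atMost_Suc_shift del: sum.atMost_Suc)
  define h where "h n = e 0 * int ((n + Suc k) choose Suc k) - (- 1) * ?r (\<lambda>i. e (Suc i)) n" for n
  have "h n = 0" if "n \<ge> N" for n using s[OF that] unfolding h_def by simp
  then have h0: "(dif ^^ j) h n = 0" if "n \<ge> N" for n j using that by (induction j arbitrary: n) (auto simp: dif_def)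
  have b1: "(dif ^^ Suc k) (\<lambda>n. int ((n + Suc k) choose Suc k)) = (\<lambda>n. 1)"
    using dif_binomial[of "Suc k" "Suc k"] by (simp del: funpow.simps)
  have "(dif ^^ Suc k) h N = e 0" unfolding h_def dif_diff dif_cmult b1 lin by simp
  then have e0: "e 0 = 0" using h0[of N "Suc k"] by simp
  then have "\<forall>n\<ge>N. ?r (\<lambda>i. e (Suc i)) n = 0" using s by simp
  from Suc.IH[OF this] have "e (Suc i) = 0" if "i \<le> k" for i using that by blast
  then show ?case using e0 Suc.prems(2) by (cases i) auto
qed

text \<open>Evaluating the Hilbert polynomial at \<open>-1\<close> yields \<open>-e\<^sub>3\<close>, so an identity for third
  differences that reaches down to the argument \<open>-1\<close> determines \<open>e\<^sub>3\<close>.\<close>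

lemma hilbert_coeffs_props:
  assumes z: "\<forall>n\<ge>N. (dif ^^ 4) (\<lambda>n. int (colength R (ipow R K n))) n = 0"
  shows "\<exists>e0 e1 e2 N. \<forall>n\<ge>N. 6 * int (colength R (ipow R K n)) =
     e0 * (int n * (int n + 1) * (int n + 2)) - 3 * e1 * (int n * (int n + 1)) + 6 * e2 * int n - 6 * hilbert_coeffs R K 3"
proof -
  define f where "f n = int (colength R (ipow R K n))" for n
  have "(dif ^^ Suc 3) (\<lambda>n. f (Suc n)) n = 0" if "n \<ge> N" for n
    using z that unfolding f_def[symmetric] dif_shift by (simp add: numeral_eq_Suc del: funpow.simps)
  then obtain e where e: "\<forall>n\<ge>N. f (Suc n) = (\<Sum>i\<le>3. e i * int ((n + (3 - i)) choose (3 - i)))"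
    using binomial_basis[of N 3 "\<lambda>n. f (Suc n)"] by blast
  \<comment> \<open>The sign convention of \<open>hilbert_coeffs\<close> is absorbed here. The value
    0 beyond index 3 is required for the definite description to be unique.\<close>
  define e' where "e' i = (if i \<le> 3 then (-1)^i * e i else 0)" for i
  have re: "n + 3 - i = n + (3 - i)" if "i \<le> 3" for i n :: nat using that by simp
  have sg: "(-1::int)^i * ((-1)^i * x) = x" for i x by (cases "even i") auto
  have eq: "(\<Sum>i\<le>3. (-1)^i * e' i * int ((n + 3 - i) choose (3 - i))) = (\<Sum>i\<le>3. e i * int ((n + (3 - i)) choose (3 - i)))" for n
  proof (rule sum.cong)
    fix i :: nat assume "i \<in> {..3}"
    then have i: "i \<le> 3" by simp
    show "(-1)^i * e' i * int ((n + 3 - i) choose (3 - i)) = e i * int ((n + (3 - i)) choose (3 - i))"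
      unfolding re[OF i] e'_def using i sg[of i "e i"] by simp
  qed simp
  have P: "(\<forall>i>3. e' i = 0) \<and> (\<forall>\<^sub>F n in sequentially. int (colength R (ipow R K (n + 1))) =
        (\<Sum>i\<le>3. (-1) ^ i * e' i * int ((n + 3 - i) choose (3 - i))))"
  proof
    show "\<forall>i>3. e' i = 0" unfolding e'_def by simp
    have "\<forall>n\<ge>N. int (colength R (ipow R K (n + 1))) = (\<Sum>i\<le>3. (-1) ^ i * e' i * int ((n + 3 - i) choose (3 - i)))"
      using e unfolding eq f_def Suc_eq_plus1 .
    then show "\<forall>\<^sub>F n in sequentially. int (colength R (ipow R K (n + 1))) =
        (\<Sum>i\<le>3. (-1) ^ i * e' i * int ((n + 3 - i) choose (3 - i)))" unfolding eventually_sequentially by blast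
  qed
  have "hilbert_coeffs R K = e'" unfolding hilbert_coeffs_def
  proof (rule the_equality)
    show "(\<forall>i>3. e' i = 0) \<and> (\<forall>\<^sub>F n in sequentially. int (colength R (ipow R K (n + 1))) =
        (\<Sum>i\<le>3. (-1) ^ i * e' i * int ((n + 3 - i) choose (3 - i))))" using P .
  next
    fix d assume d: "(\<forall>i>3. d i = 0) \<and> (\<forall>\<^sub>F n in sequentially. int (colength R (ipow R K (n + 1))) =
        (\<Sum>i\<le>3. (-1) ^ i * d i * int ((n + 3 - i) choose (3 - i))))"
    then obtain N' where N': "\<forall>n\<ge>N'. f (Suc n) = (\<Sum>i\<le>3. (-1) ^ i * d i * int ((n + 3 - i) choose (3 - i)))"
      unfolding eventually_sequentially f_def Suc_eq_plus1 by blast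
    have "\<forall>n\<ge>max N N'. (\<Sum>i\<le>3. ((-1) ^ i * d i - e i) * int ((n + (3 - i)) choose (3 - i))) = 0"
    proof (intro allI impI)
      fix n assume n: "n \<ge> max N N'"
      have "(\<Sum>i\<le>3. (-1) ^ i * d i * int ((n + 3 - i) choose (3 - i))) = (\<Sum>i\<le>3. (-1) ^ i * d i * int ((n + (3 - i)) choose (3 - i)))"
      proof (rule sum.cong)
        fix i :: nat assume "i \<in> {..3}"
        then have i: "i \<le> 3" by simp
        show "(-1) ^ i * d i * int ((n + 3 - i) choose (3 - i)) = (-1) ^ i * d i * int ((n + (3 - i)) choose (3 - i))"
          unfolding re[OF i] ..
      qed simp
      then have "(\<Sum>i\<le>3. (-1) ^ i * d i * int ((n + (3 - i)) choose (3 - i))) = (\<Sum>i\<le>3. e i * int ((n + (3 - i)) choose (3 - i)))"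
        using N'[rule_format, of n] e[rule_format, of n] n by linarith
      then show "(\<Sum>i\<le>3. ((-1) ^ i * d i - e i) * int ((n + (3 - i)) choose (3 - i))) = 0"
        by (simp add: left_diff_distrib sum_subtractf)
    qed
    from binomial_basis_unique[OF this] have "(-1) ^ i * d i = e i" if "i \<le> 3" for i using that by (metis eq_iff_diff_eq_0)
    then have "d i = e' i" for i using d sg[of i "d i"] unfolding e'_def by (cases "i \<le> 3") auto
    then show "d = e'" by blast
  qed
  then have h3: "hilbert_coeffs R K 3 = - e 3" unfolding e'_def by simp
  have b2: "2 * int ((n + 2) choose 2) = (int n + 1) * (int n + 2)" for n
    by (induction n) (auto simp: numeral_eq_Suc algebra_simps)
  have b3: "6 * int ((n + 3) choose 3) = (int n + 1) * (int n + 2) * (int n + 3)" for n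
  proof (induction n)
    case (Suc n)
    have "(Suc n + 3) choose 3 = ((n + 3) choose 3) + ((Suc n + 2) choose 2)" by (simp add: numeral_eq_Suc)
    then show ?case using Suc b2[of "Suc n"] by (simp add: algebra_simps)
  qed simp
  \<comment> \<open>The definition indexes by \<open>n'\<close> with \<open>n = n' + 1\<close>. In
    terms of the exponent \<open>n\<close> the three binomial coefficients are multiples of
    \<open>n\<close>, so the constant term is \<open>-e_3\<close>; the factor 6 clears
    denominators.\<close>
  have "6 * f n = e 0 * (int n * (int n + 1) * (int n + 2)) - 3 * (- e 1) * (int n * (int n + 1)) + 6 * e 2 * int n - 6 * hilbert_coeffs R K 3"
    if n: "n \<ge> Suc N" for n
  proof -
    obtain n' where n': "n = Suc n'" "n' \<ge> N" using n by (metis Suc_le_D Suc_le_mono)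
    have "f n = e 0 * int ((n' + 3) choose 3) + e 1 * int ((n' + 2) choose 2) + e 2 * int ((n' + 1) choose 1) + e 3"
      using e n' by (simp add: numeral_eq_Suc)
    then have "6 * f n = e 0 * (6 * int ((n' + 3) choose 3)) + 3 * e 1 * (2 * int ((n' + 2) choose 2)) + 6 * e 2 * (int n' + 1) + 6 * e 3"
      by simp
    then show ?thesis unfolding b3 b2 h3 n' by (simp add: algebra_simps)
  qed
  then show ?thesis unfolding f_def by blast
qed

section \<open>A criterion for integral dependence\<close>

context ncr
begin

lemma Lam_finsum:
  assumes K: "idl K" and u: "u \<in> \<A>" and x: "x \<in> Lam K u s i"
  shows "\<exists>a. (\<forall>t. a t \<in> pw K (i - t)) \<and> x = finsum R (\<lambda>t. u [^] t \<otimes> a t) {..<s}"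
  using x
proof (induction s arbitrary: x)
  case 0 then show ?case using idl_zero[OF pw_idl[OF K]] by (intro exI[of _ "\<lambda>_. \<zero>"]) auto
next
  case (Suc s)
  obtain y b where y: "y \<in> Lam K u s i" "b \<in> pw K (i - s)" "x = y \<oplus> u [^] s \<otimes> b"
    using Suc.prems unfolding Lam.simps by (rule sum_smulE)
  obtain a where a: "\<forall>t. a t \<in> pw K (i - t)" "y = finsum R (\<lambda>t. u [^] t \<otimes> a t) {..<s}" using Suc.IH[OF y(1)] by blast
  define a' where "a' = a(s := b)"
  have a'm: "\<forall>t. a' t \<in> pw K (i - t)" unfolding a'_def using a y by auto
  have tc: "u [^] t \<otimes> a' t \<in> \<A>" for t using u a'm pw_carr[OF K] by blast
  have "y = finsum R (\<lambda>t. u [^] t \<otimes> a' t) {..<s}" unfolding a(2)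
    by (rule finsum_cong') (use tc in \<open>auto simp: a'_def\<close>)
  moreover have "finsum R (\<lambda>t. u [^] t \<otimes> a' t) {..<Suc s} = u [^] s \<otimes> a' s \<oplus> finsum R (\<lambda>t. u [^] t \<otimes> a' t) {..<s}"
    unfolding lessThan_Suc by (rule finsum_insert) (use tc in auto)
  moreover have "y \<in> \<A>" using idl_carr[OF Lam_idl[OF K u] y(1)] .
  ultimately have "x = finsum R (\<lambda>t. u [^] t \<otimes> a' t) {..<Suc s}" unfolding y(3) using tc[of s] a_comm[of y "u [^] s \<otimes> b"] by (simp add: a'_def)
  then show ?case using a'm by blast
qed

text \<open>With \<open>L = K + (w)\<close> the hypothesis gives \<open>c L^i <= K^i\<close>, so the
  ideals \<open>c L^i\<close> form a family over \<open>K\<close>. Generation in bounded degree says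
  \<open>c L^(N+1) <= c K L^N\<close> for some \<open>N\<close>; cancelling \<open>c\<close> puts
  \<open>w^(N+1)\<close> into \<open>K L^N\<close>, and expanding \<open>L^N\<close> in powers of
  \<open>w\<close> gives an equation of integral dependence.\<close>

lemma integral_criterion:
  assumes K: "idl K" and c: "c \<in> \<A>" "nzd {\<zero>} c" and w: "w \<in> \<A>"
    and h: "\<And>i::nat. c \<otimes> w [^] i \<in> pw K i"
  shows "w \<in> ideal_int_closure R K"
proof -
  define L where "L = K \<boxplus> PIdl w"
  have L: "idl L" unfolding L_def using sum_PI_idl[OF K w] .
  have KL: "K \<subseteq> L" "w \<in> L" unfolding L_def using sum_l[OF K PI_idl[OF w]] sum_r[OF K PI_idl[OF w]] PI_self[OF w] by auto
  define W where "W i = smul c (pw L i)" for i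
  have cL: "smul c (Lam K w s i) \<subseteq> pw K i" if "s \<le> Suc i" for s i
    using that
  proof (induction s)
    case 0 then show ?case using idl_zero[OF pw_idl[OF K]] c(1) unfolding smul_def by auto
  next
    case (Suc s)
    have ws: "w [^] s \<in> \<A>" using w by simp
    have "smul c (Lam K w (Suc s) i) = smul c (Lam K w s i) \<boxplus> smul c (smul (w [^] s) (pw K (i - s)))"
      using smul_sum[OF c(1) Lam_idl[OF K w] smul_idl[OF ws pw_idl[OF K]]] by simp
    moreover have "smul c (smul (w [^] s) (pw K (i - s))) \<subseteq> pw K i"
      unfolding smul_smul[OF c(1) ws idl_sub[OF pw_idl[OF K]]] by (rule pw_smul_sub[OF K h])
    ultimately show ?case using Suc sum_least[OF pw_idl[OF K]] by simp
  qed
  have "fam K W" unfolding fam_def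
  proof (intro allI conjI)
    fix i show "idl (W i)" unfolding W_def using smul_idl[OF c(1) pw_idl[OF L]] .
    show "W i \<subseteq> pw K i" unfolding W_def using smul_mono[OF pw_Lam[OF K w], of c i] cL[of "Suc i" i] unfolding L_def by blast
    show "K \<cdot> W i \<subseteq> W (Suc i)" unfolding W_def
    proof (rule prod_least[OF smul_idl[OF c(1) pw_idl[OF L]]])
      fix a b assume a: "a \<in> K" and "b \<in> smul c (pw L i)"
      then obtain l where l: "l \<in> pw L i" "b = c \<otimes> l" unfolding smul_def by blast
      have "a \<otimes> b = c \<otimes> (a \<otimes> l)" unfolding l(2) using idl_carr[OF K a] c(1) pw_carr[OF L l(1)] m_lcomm by simp
      then show "a \<otimes> b \<in> smul c (pw L (Suc i))" using smul_mem[of "a \<otimes> l" "pw L (Suc i)" c] prod_mem[of a L l "pw L i"] a KL l by auto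
    qed
  qed
  then obtain N where N: "W (Suc N) \<subseteq> K \<cdot> W N" using AR_all[OF K] unfolding AR_def by blast
  have iL: "idl (pw L N)" using pw_idl[OF L] .
  have "K \<cdot> W N \<subseteq> smul c (K \<cdot> pw L N)" unfolding W_def
  proof (rule prod_least[OF smul_idl[OF c(1) prod_idl[OF K iL]]])
    fix a b assume a: "a \<in> K" and "b \<in> smul c (pw L N)"
    then obtain l where l: "l \<in> pw L N" "b = c \<otimes> l" unfolding smul_def by blast
    have "a \<otimes> b = c \<otimes> (a \<otimes> l)" unfolding l(2) using idl_carr[OF K a] c(1) pw_carr[OF L l(1)] m_lcomm by simp
    then show "a \<otimes> b \<in> smul c (K \<cdot> pw L N)" using smul_mem[OF prod_mem[OF a l(1)], of c] by simp
  qed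
  moreover have "c \<otimes> w [^] Suc N \<in> W (Suc N)" unfolding W_def
    using pw_nat_pow[OF L, of w 1 "Suc N"] KL(2) pw_one[OF L] by (intro smul_mem) (simp del: nat_pow_Suc)
  ultimately obtain v where v: "v \<in> K \<cdot> pw L N" "c \<otimes> w [^] Suc N = c \<otimes> v" using N unfolding smul_def by blast
  have vc: "v \<in> \<A>" using idl_carr[OF prod_idl[OF K iL] v(1)] .
  have wN: "w [^] Suc N \<in> \<A>" using w by (rule nat_pow_closed)
  have "c \<otimes> (w [^] Suc N \<ominus> v) = c \<otimes> w [^] Suc N \<ominus> c \<otimes> v" using c(1) wN vc by (simp add: a_minus_def r_distr r_minus)
  also have "\<dots> = \<zero>" unfolding v(2) using c(1) vc by (simp add: a_minus_def r_neg)
  finally have "w [^] Suc N \<ominus> v \<in> {\<zero>}" using nzdD[OF c(2)] wN vc minus_closed by simp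
  then have "w [^] Suc N = v" using wN vc by simp
  moreover have "v \<in> Lam K w (Suc N) (Suc N)"
  proof -
    have "K \<cdot> pw L N \<subseteq> K \<cdot> Lam K w (Suc N) N" unfolding L_def by (rule prod_mono[OF order_refl pw_Lam[OF K w]])
    then show ?thesis using v(1) Lam_K[OF K w, of "Suc N" N] by blast
  qed
  ultimately obtain a where a: "\<forall>t. a t \<in> pw K (Suc N - t)" "w [^] Suc N = finsum R (\<lambda>t. w [^] t \<otimes> a t) {..<Suc N}"
    using Lam_finsum[OF K w] by metis
  define b where "b i = \<ominus> a (Suc N - i)" for i
  have ac: "a t \<in> \<A>" for t using a(1) pw_carr[OF K] by blast
  have bm: "\<forall>i\<in>{1..Suc N}. b i \<in> pw K i" unfolding b_def
  proof
    fix i assume "i \<in> {1..Suc N}"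
    then have "Suc N - (Suc N - i) = i" by auto
    then show "\<ominus> a (Suc N - i) \<in> pw K i" using idl_neg[OF pw_idl[OF K]] a(1) by metis
  qed
  have inj: "inj_on (\<lambda>t. Suc N - t) {..<Suc N}" by (rule inj_onI) auto
  have im: "(\<lambda>t. Suc N - t) ` {..<Suc N} = {1..Suc N}"
  proof (intro subset_antisym subsetI)
    fix i assume "i \<in> {1..Suc N}"
    then show "i \<in> (\<lambda>t. Suc N - t) ` {..<Suc N}" by (intro image_eqI[of _ _ "Suc N - i"]) auto
  qed auto
  have "finsum R (\<lambda>i. b i \<otimes> w [^] (Suc N - i)) {1..Suc N} = finsum R (\<lambda>t. b (Suc N - t) \<otimes> w [^] (Suc N - (Suc N - t))) {..<Suc N}"
    unfolding im[symmetric] by (rule finsum_reindex[OF _ inj]) (use ac w in \<open>auto simp: b_def\<close>)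
  also have "\<dots> = finsum R (\<lambda>t. \<ominus> (w [^] t \<otimes> a t)) {..<Suc N}"
  proof (rule finsum_cong')
    fix t assume t: "t \<in> {..<Suc N}"
    then have "Suc N - (Suc N - t) = t" by auto
    then show "b (Suc N - t) \<otimes> w [^] (Suc N - (Suc N - t)) = \<ominus> (w [^] t \<otimes> a t)"
      unfolding b_def using ac w m_comm[of "a t" "w [^] t"] by (simp add: l_minus)
  qed (use ac w in auto)
  also have "\<dots> = \<ominus> finsum R (\<lambda>t. w [^] t \<otimes> a t) {..<Suc N}"
  proof -
    have "finsum R (\<lambda>t. \<ominus> (w [^] t \<otimes> a t)) A = \<ominus> finsum R (\<lambda>t. w [^] t \<otimes> a t) A" if "finite A" for A
      using that
    proof (induction A)
      case (insert t A)
      have "finsum R (\<lambda>t. \<ominus> (w [^] t \<otimes> a t)) (insert t A) = \<ominus> (w [^] t \<otimes> a t) \<oplus> finsum R (\<lambda>t. \<ominus> (w [^] t \<otimes> a t)) A"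
        by (rule finsum_insert) (use insert ac w in auto)
      moreover have "finsum R (\<lambda>t. w [^] t \<otimes> a t) (insert t A) = w [^] t \<otimes> a t \<oplus> finsum R (\<lambda>t. w [^] t \<otimes> a t) A"
        by (rule finsum_insert) (use insert ac w in auto)
      moreover have "finsum R (\<lambda>t. w [^] t \<otimes> a t) A \<in> \<A>" by (rule finsum_closed) (use ac w in auto)
      ultimately show ?case using insert ac w by (simp add: minus_add)
    qed simp
    then show ?thesis by blast
  qed
  finally have "w [^] Suc N \<oplus> finsum R (\<lambda>i. b i \<otimes> w [^] (Suc N - i)) {1..Suc N} = \<zero>"
    using a(2) wN r_neg by simp
  then show ?thesis unfolding ideal_int_closure_def using w bm
    by (intro CollectI conjI exI[of _ "Suc N"] exI[of _ b]) auto
qed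

end

section \<open>Hilbert functions of \<open>m\<close>-primary ideals\<close>

context lcr
begin

lemma fin_pw:
  assumes "m_primary R m K" shows "fin (pw K n)"
proof -
  obtain k where k: "pw m k \<subseteq> K" using m_primary_pow(3)[OF assms] by blast
  have "pw m (k * n) \<subseteq> pw K n" using pw_mono[OF k, of n] pw_pw[OF m_idl] by simp
  then show ?thesis using fin_m_pow[OF pw_idl[OF m_primary_pow(1)[OF assms]]] by blast
qed

text \<open>The quotients \<open>V i / U i\<close> are the components of a finitely generated graded
  module, on which the generators outside \<open>T\<close> act as zero. Induction on
  \<open>T\<close> removes one generator \<open>g\<close> by passing to the kernel and the cokernel
  of multiplication by \<open>g\<close>. Once all generators act as zero, the components vanish in
  large degree because \<open>V\<close> is generated in bounded degree.\<close>

lemma hilbert_serre: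
  assumes J: "idl J" "\<And>n. fin (pw J n)" and S: "finite S" "S \<subseteq> \<A>" "J = Idl S"
    and T: "finite T" "T \<subseteq> S"
    and U: "fam J U" and V: "fam J V" and UV: "\<And>i. U i \<subseteq> V i" "\<And>i. pw J (Suc i) \<subseteq> U i"
    and k: "\<And>g i. g \<in> S - T \<Longrightarrow> smul g (V i) \<subseteq> U (Suc i)"
  shows "evpoly (\<lambda>i. int (col (U i)) - int (col (V i)))"
  using T U V UV k
proof (induction T arbitrary: U V)
  case empty
  obtain N where N: "\<forall>i\<ge>N. V (Suc i) \<subseteq> J \<cdot> V i" using AR_all[OF J(1)] empty.prems(3) unfolding AR_def by blast
  have iU: "idl (U i)" "idl (V i)" for i using empty.prems unfolding fam_def by auto
  have "J \<cdot> V i \<subseteq> U (Suc i)" for i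
  proof -
    let ?X = "{x \<in> \<A>. \<forall>v\<in>V i. x \<otimes> v \<in> U (Suc i)}"
    have "idl ?X"
    proof (rule idlI)
      show "\<zero> \<in> ?X" using idl_carr[OF iU(2)] idl_zero[OF iU(1)] by auto
    next
      fix a b assume "a \<in> ?X" "b \<in> ?X"
      then show "a \<oplus> b \<in> ?X"
        using idl_add[OF iU(1), of _ "Suc i"] idl_carr[OF iU(2), of _ i] by (simp add: l_distr)
    next
      fix a x assume "a \<in> ?X" "x \<in> \<A>"
      then show "x \<otimes> a \<in> ?X"
        using idl_l[OF iU(1), of _ "Suc i"] idl_carr[OF iU(2), of _ i] by (simp add: m_assoc)
    qed auto
    moreover have "S \<subseteq> ?X" using S empty.prems(6)[of _ i] smul_mem[of _ "V i"] by blast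
    ultimately have "J \<subseteq> ?X" unfolding S(3) by (rule genideal_minimal)
    then show ?thesis by (intro prod_least[OF iU(1)]) (auto simp: smul_def)
  qed
  then have "U (Suc i) = V (Suc i)" if "i \<ge> N" for i using N that empty.prems(4)[of "Suc i"] by blast
  then have "\<forall>n\<ge>Suc N. (dif ^^ 0) (\<lambda>i. int (col (U i)) - int (col (V i))) n = 0"
    by (metis (no_types, lifting) Suc_le_D Suc_le_mono cancel_comm_monoid_add_class.diff_cancel funpow_0)
  then show ?case unfolding evpoly_def by blast
next
  case (insert g T)
  have iU: "idl (U i)" "idl (V i)" "J \<cdot> U i \<subseteq> U (Suc i)" "J \<cdot> V i \<subseteq> V (Suc i)" "U i \<subseteq> pw J i" "V i \<subseteq> pw J i" for i
    using insert.prems unfolding fam_def by auto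
  have gJ: "g \<in> J" and gc: "g \<in> \<A>" using insert.prems(1) S genideal_self by auto
  have gV: "smul g (V i) \<subseteq> V (Suc i)" for i using prod_mem[OF gJ] iU(4)[of i] unfolding smul_def by blast
  have gU: "smul g (U i) \<subseteq> U (Suc i)" for i using prod_mem[OF gJ] iU(3)[of i] unfolding smul_def by blast
  \<comment> \<open>\<open>W i / U i\<close> is the kernel of multiplication by \<open>g\<close> on
    \<open>V i / U i\<close>, and \<open>V i / U' i\<close> is the cokernel. Nothing is mapped into
    degree 0, so \<open>U' 0 = U 0\<close>.\<close>
  define W where "W i = colon (U (Suc i)) g \<inter> V i" for i
  define U' where "U' i = (case i of 0 \<Rightarrow> U 0 | Suc j \<Rightarrow> U (Suc j) \<boxplus> smul g (V j))" for i
  have iW: "idl (W i)" for i unfolding W_def using i_intersect[OF colon_idl[OF iU(1) gc] iU(2)] .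
  have UW: "U i \<subseteq> W i" for i unfolding W_def colon_def using gU[of i] insert.prems(4)[of i] idl_carr[OF iU(1)] unfolding smul_def by blast
  have iU': "idl (U' i)" for i unfolding U'_def using iU sum_idl[OF iU(1) smul_idl[OF gc iU(2)]] by (simp split: nat.split)
  have UU': "U i \<subseteq> U' i" for i unfolding U'_def using sum_l[OF iU(1) smul_idl[OF gc iU(2)]] by (simp split: nat.split)
  have U'V: "U' i \<subseteq> V i" for i unfolding U'_def using insert.prems(4) sum_least[OF iU(2) insert.prems(4) gV] by (simp split: nat.split)
  have famW: "fam J W" unfolding fam_def
  proof (intro allI conjI iW)
    fix i show "W i \<subseteq> pw J i" unfolding W_def using iU(6) by blast
    show "J \<cdot> W i \<subseteq> W (Suc i)"
    proof (rule prod_least[OF iW])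
      fix x w assume x: "x \<in> J" and w: "w \<in> W i"
      have wc: "w \<in> \<A>" "w \<in> V i" "g \<otimes> w \<in> U (Suc i)" "x \<in> \<A>" using w x idl_carr[OF J(1)] unfolding W_def colon_def by auto
      have "g \<otimes> (x \<otimes> w) = x \<otimes> (g \<otimes> w)" using gc wc m_lcomm by simp
      then have "g \<otimes> (x \<otimes> w) \<in> U (Suc (Suc i))" using prod_mem[OF x wc(3)] iU(3) by auto
      then show "x \<otimes> w \<in> W (Suc i)" unfolding W_def colon_def using prod_mem[OF x wc(2)] iU(4) wc by auto
    qed
  qed
  have famU': "fam J U'" unfolding fam_def
  proof (intro allI conjI iU')
    fix i show "U' i \<subseteq> pw J i" using U'V iU(6) by blast
    show "J \<cdot> U' i \<subseteq> U' (Suc i)"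
    proof (cases i)
      case 0 then show ?thesis using iU(3)[of 0] UU'[of 1] unfolding U'_def by auto
    next
      case (Suc j)
      have "J \<cdot> smul g (V j) \<subseteq> smul g (V (Suc j))"
      proof (rule prod_least[OF smul_idl[OF gc iU(2)]])
        fix x b assume x: "x \<in> J" and "b \<in> smul g (V j)"
        then obtain v where v: "v \<in> V j" "b = g \<otimes> v" unfolding smul_def by blast
        have "x \<otimes> b = g \<otimes> (x \<otimes> v)" unfolding v(2) using gc idl_carr[OF J(1) x] idl_carr[OF iU(2) v(1)] m_lcomm by simp
        then show "x \<otimes> b \<in> smul g (V (Suc j))" using smul_mem[of "x \<otimes> v" "V (Suc j)" g] prod_mem[OF x v(1)] iU(4)[of j] by auto
      qed
      then have "J \<cdot> U (Suc j) \<boxplus> J \<cdot> smul g (V j) \<subseteq> U (Suc (Suc j)) \<boxplus> smul g (V (Suc j))" using iU(3) by (intro sum_mono) auto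
      then show ?thesis unfolding Suc U'_def using ideal_prod_r_distr[OF J(1) iU(1) smul_idl[OF gc iU(2)]] by simp
    qed
  qed
  have e1: "evpoly (\<lambda>i. int (col (U' i)) - int (col (V i)))"
  proof (rule insert.IH[OF _ famU' insert.prems(3) U'V])
    show "T \<subseteq> S" using insert.prems by blast
    show "pw J (Suc i) \<subseteq> U' i" for i using insert.prems(5) UU' by blast
    show "smul h (V i) \<subseteq> U' (Suc i)" if "h \<in> S - T" for h i
    proof (cases "h = g")
      case True then show ?thesis unfolding U'_def using sum_r[OF iU(1) smul_idl[OF gc iU(2)]] by simp
    next
      case False then show ?thesis using insert.prems(6)[of h i] that UU' by blast
    qed
  qed
  have e2: "evpoly (\<lambda>i. int (col (U i)) - int (col (W i)))"
  proof (rule insert.IH[OF _ insert.prems(2) famW UW insert.prems(5)])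
    show "T \<subseteq> S" using insert.prems by blast
    show "smul h (W i) \<subseteq> U (Suc i)" if "h \<in> S - T" for h i
    proof (cases "h = g")
      case True then show ?thesis unfolding W_def smul_def colon_def by blast
    next
      case False then show ?thesis using insert.prems(6)[of h i] that smul_mono[of "W i" "V i" h] unfolding W_def by blast
    qed
  qed
  have finU: "fin (U i)" "fin (V i)" for i using fin_sup[OF J(2)[of "Suc i"]] iU insert.prems(4,5) by blast+
  have "dif (\<lambda>i. int (col (U i)) - int (col (V i))) i = (int (col (U' (Suc i))) - int (col (V (Suc i)))) - (int (col (U i)) - int (col (W i)))" for i
    using col_mulmap(2)[OF finU(1)[of "Suc i"] finU(2)[of i] gc] unfolding dif_def W_def U'_def by simp
  then have "evpoly (dif (\<lambda>i. int (col (U i)) - int (col (V i))))"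
    by (intro evpoly_cong[OF evpoly_diff[OF evpoly_shift[OF e1] e2], of 0]) auto
  then show ?case by (rule evpoly_dif)
qed

lemma evpoly_col:
  assumes "m_primary R m J" shows "evpoly (\<lambda>i. int (col (pw J i)))"
proof -
  have J: "idl J" using m_primary_pow(1)[OF assms] .
  obtain S where S: "S \<subseteq> \<A>" "finite S" "J = Idl S" using fg[OF J] by blast
  have famJ: "fam J (\<lambda>i. pw J i)" unfolding fam_def using pw_idl[OF J] by simp
  have famJ': "fam J (\<lambda>i. pw J (Suc i))" unfolding fam_def using pw_idl[OF J] pw_antimono[OF J] by (metis ipow.simps(2) le_SucI order_refl)
  have "evpoly (\<lambda>i. int (col (pw J (Suc i))) - int (col (pw J i)))"
    by (rule hilbert_serre[OF J fin_pw[OF assms] S(2,1,3) S(2) order_refl famJ' famJ])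
      (use pw_antimono[OF J, of i "Suc i" for i] in auto)
  then have "evpoly (dif (\<lambda>i. int (col (pw J i))))" unfolding dif_def by simp
  then show ?thesis by (rule evpoly_dif)
qed

end

declare ipow.simps(2) [simp del]

section \<open>The associated graded ring as an image of the Rees algebra\<close>

locale grd = cr + fixes K :: "'a set" assumes K: "idl K"
begin

abbreviation G :: "(nat \<Rightarrow> 'a) set ring" where "G \<equiv> assoc_graded R K"
abbreviation kp :: "nat \<Rightarrow> 'a set" where "kp n \<equiv> pw K n"

lemma kp_idl: "idl (kp n)" using pw_idl[OF K] .

lemma kp_c: "a \<in> kp n \<Longrightarrow> a \<in> \<A>" using pw_carr[OF K] .

lemma kp_Suc: "kp (Suc n) \<subseteq> kp n" using pw_antimono[OF K, of n "Suc n"] by simp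

abbreviation eqm :: "nat \<Rightarrow> 'a \<Rightarrow> 'a \<Rightarrow> bool" where "eqm n a b \<equiv> a \<ominus> b \<in> kp (Suc n)"

lemma eqm_refl: "a \<in> \<A> \<Longrightarrow> eqm n a a"
  using idl_zero[OF kp_idl] by (simp add: a_minus_def r_neg)

lemma eqm_sym: assumes "a \<in> \<A>" "b \<in> \<A>" "eqm n a b" shows "eqm n b a"
proof -
  have "b \<ominus> a = \<ominus> (a \<ominus> b)" using assms(1,2) by algebra
  then show ?thesis using idl_neg[OF kp_idl assms(3)] by simp
qed

lemma eqm_trans: assumes "a \<in> \<A>" "b \<in> \<A>" "c \<in> \<A>" "eqm n a b" "eqm n b c" shows "eqm n a c"
proof -
  have "a \<ominus> c = (a \<ominus> b) \<oplus> (b \<ominus> c)" using assms(1,2,3) by algebra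
  then show ?thesis using idl_add[OF kp_idl assms(4,5)] by simp
qed

lemma eqm_add: assumes "a \<in> \<A>" "b \<in> \<A>" "c \<in> \<A>" "d \<in> \<A>" "eqm n a b" "eqm n c d"
  shows "eqm n (a \<oplus> c) (b \<oplus> d)"
proof -
  have "(a \<oplus> c) \<ominus> (b \<oplus> d) = (a \<ominus> b) \<oplus> (c \<ominus> d)" using assms(1-4) by algebra
  then show ?thesis using idl_add[OF kp_idl assms(5,6)] by simp
qed

lemma eqm_mult:
  assumes "a \<in> kp i" "b \<in> kp i" "c \<in> kp j" "d \<in> kp j" "eqm i a b" "eqm j c d"
  shows "eqm (i + j) (a \<otimes> c) (b \<otimes> d)"
proof -
  have cc: "a \<in> \<A>" "b \<in> \<A>" "c \<in> \<A>" "d \<in> \<A>" using assms kp_c by auto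
  have "a \<otimes> c \<ominus> b \<otimes> d = (a \<ominus> b) \<otimes> c \<oplus> b \<otimes> (c \<ominus> d)" using cc by algebra
  moreover have "(a \<ominus> b) \<otimes> c \<in> kp (Suc (i + j))" using pw_mem_add[OF K assms(5,3)] by simp
  moreover have "b \<otimes> (c \<ominus> d) \<in> kp (Suc (i + j))" using pw_mem_add[OF K assms(2,6)] by simp
  ultimately show ?thesis using idl_add[OF kp_idl] by simp
qed

lemma eqm_finsum:
  assumes "finite A" "\<And>i. i \<in> A \<Longrightarrow> f i \<in> \<A>" "\<And>i. i \<in> A \<Longrightarrow> g i \<in> \<A>" "\<And>i. i \<in> A \<Longrightarrow> eqm n (f i) (g i)"
  shows "eqm n (finsum R f A) (finsum R g A)"
  using assms
proof (induction A)
  case empty then show ?case using eqm_refl[OF zero_closed] by simp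
next
  case (insert x A)
  have "finsum R f (insert x A) = f x \<oplus> finsum R f A" by (rule finsum_insert) (use insert in auto)
  moreover have "finsum R g (insert x A) = g x \<oplus> finsum R g A" by (rule finsum_insert) (use insert in auto)
  moreover have "finsum R f A \<in> \<A>" "finsum R g A \<in> \<A>" using insert by (auto intro!: finsum_closed)
  ultimately show ?case using insert eqm_add by simp
qed

abbreviation reps :: "(nat \<Rightarrow> 'a) set" where "reps \<equiv> gr_reps R K"
abbreviation cls :: "(nat \<Rightarrow> 'a) \<Rightarrow> (nat \<Rightarrow> 'a) set" where "cls f \<equiv> gr_class R K f"

lemma repsD: "f \<in> reps \<Longrightarrow> f n \<in> kp n" unfolding gr_reps_def by blast
lemma repsE: "f \<in> reps \<Longrightarrow> \<exists>N. \<forall>n\<ge>N. f n \<in> kp (Suc n)" unfolding gr_reps_def by blast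
lemma reps_c: "f \<in> reps \<Longrightarrow> f n \<in> \<A>" using repsD kp_c by blast

lemma rel_equiv: "equiv reps (gr_rel R K)"
proof (rule equivI)
  show "gr_rel R K \<subseteq> reps \<times> reps" unfolding gr_rel_def by blast
  show "refl_on reps (gr_rel R K)" unfolding refl_on_def gr_rel_def using eqm_refl[OF reps_c] by auto
  show "sym (gr_rel R K)" unfolding sym_def gr_rel_def using eqm_sym[OF reps_c reps_c] by blast
  show "trans (gr_rel R K)" unfolding trans_def gr_rel_def using eqm_trans[OF reps_c reps_c reps_c] by blast
qed

lemma cls_eq: "f \<in> reps \<Longrightarrow> g \<in> reps \<Longrightarrow> cls f = cls g \<longleftrightarrow> (\<forall>n. eqm n (f n) (g n))"
  unfolding gr_class_def using eq_equiv_class_iff[OF rel_equiv] unfolding gr_rel_def by auto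

lemma carrier_G: "carrier G = cls ` reps"
  unfolding assoc_graded_def quotient_def gr_class_def by auto

lemma rep_cls: assumes "f \<in> reps" shows "gr_rep (cls f) \<in> reps" "eqm n (gr_rep (cls f) n) (f n)"
proof -
  have "f \<in> cls f" unfolding gr_class_def using equiv_class_self[OF rel_equiv assms] .
  then have "gr_rep (cls f) \<in> cls f" unfolding gr_rep_def by (rule someI[of "\<lambda>h. h \<in> cls f"])
  then have "(f, gr_rep (cls f)) \<in> gr_rel R K" unfolding gr_class_def by blast
  then have r: "gr_rep (cls f) \<in> reps" "eqm n (f n) (gr_rep (cls f) n)" unfolding gr_rel_def by auto
  show "gr_rep (cls f) \<in> reps" by fact
  show "eqm n (gr_rep (cls f) n) (f n)" by (rule eqm_sym[OF reps_c[OF assms] reps_c[OF r(1)] r(2)])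
qed

lemma rep_G: "U \<in> carrier G \<Longrightarrow> gr_rep U \<in> reps"
  unfolding carrier_G using rep_cls by blast

lemma cls_rep: "U \<in> carrier G \<Longrightarrow> cls (gr_rep U) = U"
  unfolding carrier_G using cls_eq[OF rep_cls(1)] rep_cls(2) by (auto)

abbreviation cnv :: "(nat \<Rightarrow> 'a) \<Rightarrow> (nat \<Rightarrow> 'a) \<Rightarrow> nat \<Rightarrow> 'a" where
  "cnv f g n \<equiv> finsum R (\<lambda>i. f i \<otimes> g (n - i)) {..n}"

lemma cnv_reps: assumes f: "f \<in> reps" and g: "g \<in> reps" shows "cnv f g \<in> reps"
proof -
  obtain N N' where N: "\<forall>n\<ge>N. f n \<in> kp (Suc n)" "\<forall>n\<ge>N'. g n \<in> kp (Suc n)" using repsE[OF f] repsE[OF g] by blast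
  have "cnv f g n \<in> kp n" for n
  proof (rule idl_finsum[OF kp_idl])
    fix i assume "i \<in> {..n}"
    then show "f i \<otimes> g (n - i) \<in> kp n" using pw_mem_add[OF K repsD[OF f, of i] repsD[OF g, of "n - i"]] by simp
  qed
  moreover have "cnv f g n \<in> kp (Suc n)" if n: "n \<ge> N + N'" for n
  proof (rule idl_finsum[OF kp_idl])
    fix i assume i: "i \<in> {..n}"
    show "f i \<otimes> g (n - i) \<in> kp (Suc n)"
    proof (cases "i \<ge> N")
      case True then show ?thesis using pw_mem_add[OF K _ repsD[OF g, of "n - i"], of "f i" "Suc i"] N i by simp
    next
      case False
      then have "n - i \<ge> N'" using n by simp
      then have "g (n - i) \<in> kp (Suc (n - i))" using N(2) by simp
      moreover have "i + Suc (n - i) = Suc n" using i by simp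
      ultimately show ?thesis using pw_mem_add[OF K repsD[OF f, of i]] by metis
    qed
  qed
  ultimately show ?thesis unfolding gr_reps_def by blast
qed

lemma add_reps: assumes f: "f \<in> reps" and g: "g \<in> reps" shows "(\<lambda>n. f n \<oplus> g n) \<in> reps"
proof -
  obtain N N' where N: "\<forall>n\<ge>N. f n \<in> kp (Suc n)" "\<forall>n\<ge>N'. g n \<in> kp (Suc n)" using repsE[OF f] repsE[OF g] by blast
  have "\<forall>n\<ge>max N N'. f n \<oplus> g n \<in> kp (Suc n)" using N idl_add[OF kp_idl] by simp
  then show ?thesis unfolding gr_reps_def using idl_add[OF kp_idl repsD[OF f] repsD[OF g]] by blast
qed

lemma cnv_cong:
  assumes "f \<in> reps" "f' \<in> reps" "g \<in> reps" "g' \<in> reps" "\<And>n. eqm n (f n) (f' n)" "\<And>n. eqm n (g n) (g' n)"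
  shows "eqm n (cnv f g n) (cnv f' g' n)"
proof (rule eqm_finsum)
  fix i assume i: "i \<in> {..n}"
  then show "eqm n (f i \<otimes> g (n - i)) (f' i \<otimes> g' (n - i))"
    using eqm_mult[of "f i" i "f' i" "g (n-i)" "n - i" "g' (n-i)"] assms repsD by simp
qed (use assms reps_c in auto)

lemma mult_cls: assumes "f \<in> reps" "g \<in> reps" shows "cls f \<otimes>\<^bsub>G\<^esub> cls g = cls (cnv f g)"
proof -
  have "cls f \<otimes>\<^bsub>G\<^esub> cls g = cls (cnv (gr_rep (cls f)) (gr_rep (cls g)))" unfolding assoc_graded_def by simp
  also have "\<dots> = cls (cnv f g)"
    using cls_eq[OF cnv_reps[OF rep_cls(1)[OF assms(1)] rep_cls(1)[OF assms(2)]] cnv_reps[OF assms]]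
      cnv_cong[OF rep_cls(1)[OF assms(1)] assms(1) rep_cls(1)[OF assms(2)] assms(2) rep_cls(2)[OF assms(1)] rep_cls(2)[OF assms(2)]]
    by simp
  finally show ?thesis .
qed

lemma add_cls: assumes "f \<in> reps" "g \<in> reps" shows "cls f \<oplus>\<^bsub>G\<^esub> cls g = cls (\<lambda>n. f n \<oplus> g n)"
proof -
  have "cls f \<oplus>\<^bsub>G\<^esub> cls g = cls (\<lambda>n. gr_rep (cls f) n \<oplus> gr_rep (cls g) n)" unfolding assoc_graded_def by simp
  also have "\<dots> = cls (\<lambda>n. f n \<oplus> g n)"
    using cls_eq[OF add_reps[OF rep_cls(1)[OF assms(1)] rep_cls(1)[OF assms(2)]] add_reps[OF assms]]
      eqm_add[OF reps_c[OF rep_cls(1)[OF assms(1)]] reps_c[OF assms(1)] reps_c[OF rep_cls(1)[OF assms(2)]] reps_c[OF assms(2)] rep_cls(2)[OF assms(1)] rep_cls(2)[OF assms(2)]]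
    by simp
  finally show ?thesis .
qed

text \<open>The Rees algebra inside the polynomial ring. The ring axioms of the graded ring are
  inherited from it through the homomorphism \<open>cls\<close>; checking them on chosen
  representatives would be laborious.\<close>

definition Rees :: "(nat \<Rightarrow> 'a) set" where "Rees = {p \<in> up R. \<forall>n. p n \<in> kp n}"

lemma Rees_reps: "p \<in> Rees \<Longrightarrow> p \<in> reps"
proof -
  assume p: "p \<in> Rees"
  then obtain N where "bound \<zero> N p" unfolding Rees_def up_def by auto
  then have "\<forall>n\<ge>Suc N. p n = \<zero>" unfolding bound_def by auto
  then have "\<forall>n\<ge>Suc N. p n \<in> kp (Suc n)" using idl_zero[OF kp_idl] by simp
  then show "p \<in> reps" unfolding gr_reps_def using p unfolding Rees_def by blast
qed

lemma zero_cls: "\<zero>\<^bsub>G\<^esub> = cls (\<lambda>n. \<zero>)" and one_cls: "\<one>\<^bsub>G\<^esub> = cls (\<lambda>n. if n = 0 then \<one> else \<zero>)"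
  unfolding assoc_graded_def by auto

lemma Rees_zero: "(\<lambda>n. \<zero>) \<in> Rees" and Rees_one: "(\<lambda>n. if n = 0 then \<one> else \<zero>) \<in> Rees"
  unfolding Rees_def up_def bound_def using idl_zero[OF kp_idl] by auto

lemma UP_carrier: "carrier (UP R) = up R" by (simp add: UP_def)
lemma UP_coeff: "q \<in> up R \<Longrightarrow> up_ring.coeff (UP R) q n = q n" by (simp add: UP_def)
lemma UP_mult_eq: "p \<in> up R \<Longrightarrow> q \<in> up R \<Longrightarrow> p \<otimes>\<^bsub>UP R\<^esub> q = cnv p q" by (simp add: UP_def)
lemma UP_add_eq: "p \<in> up R \<Longrightarrow> q \<in> up R \<Longrightarrow> p \<oplus>\<^bsub>UP R\<^esub> q = (\<lambda>n. p n \<oplus> q n)" by (simp add: UP_def)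
lemma UP_one_eq: "\<one>\<^bsub>UP R\<^esub> = (\<lambda>n. if n = 0 then \<one> else \<zero>)" and UP_zero_eq: "\<zero>\<^bsub>UP R\<^esub> = (\<lambda>n. \<zero>)" by (simp_all add: UP_def)

lemma Rees_cring: "cring (UP R\<lparr>carrier := Rees\<rparr>)"
proof -
  interpret U: UP_cring R "UP R" by unfold_locales (simp)
  have ucr: "cring (UP R)" by (rule U.UP_cring)
  have urr: "ring (UP R)" using ucr by (rule cring.axioms(1))
  note uag = ring.is_abelian_group[OF urr]
  have sub: "Rees \<subseteq> carrier (UP R)" unfolding UP_carrier Rees_def by auto
  have "subcring Rees (UP R)"
  proof (rule cring.subcringI'[OF ucr])
    show "subring Rees (UP R)"
    proof (rule ring.subringI[OF urr sub])
      show "\<one>\<^bsub>UP R\<^esub> \<in> Rees" using Rees_one unfolding UP_one_eq .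
    next
      fix p assume p: "p \<in> Rees"
      then have pc: "p \<in> carrier (UP R)" using sub by blast
      have "(\<ominus>\<^bsub>UP R\<^esub> p) n = \<ominus> p n" for n
      proof -
        have "(\<ominus>\<^bsub>UP R\<^esub> p) \<in> up R" using abelian_group.a_inv_closed[OF uag pc] unfolding UP_carrier .
        then have "(\<ominus>\<^bsub>UP R\<^esub> p) n = up_ring.coeff (UP R) (\<ominus>\<^bsub>UP R\<^esub> p) n" by (simp only: UP_coeff)
        also have "\<dots> = \<ominus> up_ring.coeff (UP R) p n" using pc by (rule U.coeff_a_inv)
        also have "\<dots> = \<ominus> p n" using pc unfolding UP_carrier by (simp only: UP_coeff)
        finally show ?thesis .
      qed
      moreover have "\<ominus>\<^bsub>UP R\<^esub> p \<in> up R" using abelian_group.a_inv_closed[OF uag pc] unfolding UP_carrier .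
      ultimately show "\<ominus>\<^bsub>UP R\<^esub> p \<in> Rees" using p idl_neg[OF kp_idl] unfolding Rees_def by simp
    next
      fix p q assume pq: "p \<in> Rees" "q \<in> Rees"
      then have c: "p \<in> up R" "q \<in> up R" unfolding Rees_def by auto
      have "p \<otimes>\<^bsub>UP R\<^esub> q = cnv p q" by (rule UP_mult_eq[OF c])
      moreover have "p \<otimes>\<^bsub>UP R\<^esub> q \<in> up R" using monoid.m_closed[OF ring.is_monoid[OF urr], of p q] c unfolding UP_carrier by blast
      ultimately show "p \<otimes>\<^bsub>UP R\<^esub> q \<in> Rees" unfolding Rees_def using repsD[OF cnv_reps[OF Rees_reps Rees_reps]] pq by simp
      have "p \<oplus>\<^bsub>UP R\<^esub> q = (\<lambda>n. p n \<oplus> q n)" by (rule UP_add_eq[OF c])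
      moreover have "p \<oplus>\<^bsub>UP R\<^esub> q \<in> up R" using abelian_monoid.a_closed[OF abelian_group.axioms(1)[OF uag], of p q] c unfolding UP_carrier by blast
      ultimately show "p \<oplus>\<^bsub>UP R\<^esub> q \<in> Rees" unfolding Rees_def using repsD[OF add_reps[OF Rees_reps Rees_reps]] pq by simp
    qed
  qed
  then show ?thesis using ring.subcring_iff[OF urr sub] by simp
qed

text \<open>A representative in \<open>gr_reps\<close> may have infinitely many nonzero entries, but
  almost all of them represent zero; truncation gives a polynomial, so \<open>cls\<close> is
  onto.\<close>

lemma trunc_Rees:
  assumes f: "f \<in> reps" shows "\<exists>p\<in>Rees. cls p = cls f"
proof -
  obtain N where N: "\<forall>n\<ge>N. f n \<in> kp (Suc n)" using repsE[OF f] by blast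
  define p where "p n = (if n < N then f n else \<zero>)" for n
  have "p \<in> up R" unfolding up_def p_def bound_def using reps_c[OF f] by (auto intro!: exI[of _ N])
  then have p: "p \<in> Rees" unfolding Rees_def using repsD[OF f] idl_zero[OF kp_idl] by (auto simp: p_def)
  have "eqm n (p n) (f n)" for n
  proof (cases "n < N")
    case True then show ?thesis unfolding p_def using eqm_refl reps_c[OF f] by simp
  next
    case False
    then show ?thesis unfolding p_def using idl_minus[OF kp_idl idl_zero[OF kp_idl], of "f n" "Suc n"] N by simp
  qed
  then show ?thesis using p cls_eq[OF Rees_reps[OF p] f] by blast
qed

lemma G_cring: "cring G"
proof -
  interpret Q: cring "UP R\<lparr>carrier := Rees\<rparr>" by (rule Rees_cring)
  have up: "p \<in> up R" if "p \<in> Rees" for p using that unfolding Rees_def by blast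
  have mu: "p \<otimes>\<^bsub>UP R\<^esub> q = cnv p q" and ad: "p \<oplus>\<^bsub>UP R\<^esub> q = (\<lambda>n. p n \<oplus> q n)" if "p \<in> Rees" "q \<in> Rees" for p q
    using UP_mult_eq[OF up[OF that(1)] up[OF that(2)]] UP_add_eq[OF up[OF that(1)] up[OF that(2)]] by auto
  have im: "cls ` Rees = carrier G"
  proof
    show "cls ` Rees \<subseteq> carrier G" using Rees_reps unfolding carrier_G by blast
    show "carrier G \<subseteq> cls ` Rees"
    proof
      fix U assume "U \<in> carrier G"
      then obtain f where "f \<in> reps" "U = cls f" unfolding carrier_G by blast
      then show "U \<in> cls ` Rees" using trunc_Rees[of f] by auto
    qed
  qed
  have hom: "cls \<in> ring_hom (UP R\<lparr>carrier := Rees\<rparr>) G"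
  proof (rule ring_hom_memI)
    fix p assume "p \<in> carrier (UP R\<lparr>carrier := Rees\<rparr>)"
    then show "cls p \<in> carrier G" using Rees_reps unfolding carrier_G by auto
  next
    fix p q assume "p \<in> carrier (UP R\<lparr>carrier := Rees\<rparr>)" "q \<in> carrier (UP R\<lparr>carrier := Rees\<rparr>)"
    then have pq: "p \<in> Rees" "q \<in> Rees" by auto
    show "cls (p \<otimes>\<^bsub>UP R\<lparr>carrier := Rees\<rparr>\<^esub> q) = cls p \<otimes>\<^bsub>G\<^esub> cls q"
      using mult_cls[OF Rees_reps[OF pq(1)] Rees_reps[OF pq(2)]] mu[OF pq] by simp
    show "cls (p \<oplus>\<^bsub>UP R\<lparr>carrier := Rees\<rparr>\<^esub> q) = cls p \<oplus>\<^bsub>G\<^esub> cls q"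
      using add_cls[OF Rees_reps[OF pq(1)] Rees_reps[OF pq(2)]] ad[OF pq] by simp
  next
    show "cls \<one>\<^bsub>UP R\<lparr>carrier := Rees\<rparr>\<^esub> = \<one>\<^bsub>G\<^esub>" unfolding one_cls by (simp add: UP_one_eq)
  qed
  have "cls \<zero>\<^bsub>UP R\<lparr>carrier := Rees\<rparr>\<^esub> = \<zero>\<^bsub>G\<^esub>" unfolding zero_cls by (simp add: UP_zero_eq)
  then have "ring (G\<lparr>carrier := carrier G, zero := \<zero>\<^bsub>G\<^esub>\<rparr>)"
    using Q.ring_hom_imp_img_ring[OF hom] im by simp
  then have rG: "ring G" by simp
  have "U \<otimes>\<^bsub>G\<^esub> V = V \<otimes>\<^bsub>G\<^esub> U" if UV: "U \<in> carrier G" "V \<in> carrier G" for U V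
  proof -
    have "U \<in> cls ` Rees" "V \<in> cls ` Rees" using UV unfolding im by auto
    then obtain p q where pq: "p \<in> Rees" "q \<in> Rees" "U = cls p" "V = cls q" by (elim imageE)
    have "p \<otimes>\<^bsub>UP R\<^esub> q = q \<otimes>\<^bsub>UP R\<^esub> p" using Q.m_comm[of p q] pq by simp
    then show ?thesis unfolding pq(3,4) mult_cls[OF Rees_reps[OF pq(1)] Rees_reps[OF pq(2)]]
        mult_cls[OF Rees_reps[OF pq(2)] Rees_reps[OF pq(1)]] using mu[OF pq(1,2)] mu[OF pq(2,1)] by simp
  qed
  then show ?thesis using rG by (intro cring.intro comm_monoid.intro comm_monoid_axioms.intro) (auto simp: ring_def)
qed

text \<open>The class of \<open>a\<close> in degree \<open>d\<close>. It is the initial form of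
  \<open>a\<close> when \<open>a\<close> has exact order \<open>d\<close>, and zero when
  \<open>a\<close> lies in \<open>K^(d+1)\<close>.\<close>

definition eta :: "nat \<Rightarrow> 'a \<Rightarrow> (nat \<Rightarrow> 'a) set" where
  "eta d a = cls (\<lambda>n. if n = d then a else \<zero>)"

definition cmp :: "nat \<Rightarrow> (nat \<Rightarrow> 'a) set \<Rightarrow> (nat \<Rightarrow> 'a) set" where
  "cmp n U = eta n (gr_rep U n)"

definition Hn :: "nat \<Rightarrow> (nat \<Rightarrow> 'a) set set" where "Hn d = eta d ` kp d"

lemma mono_reps: "a \<in> kp d \<Longrightarrow> (\<lambda>n. if n = d then a else \<zero>) \<in> reps"
  unfolding gr_reps_def using idl_zero[OF kp_idl] by (intro CollectI conjI allI exI[of _ "Suc d"]) auto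

lemma eta_c: "a \<in> kp d \<Longrightarrow> eta d a \<in> carrier G"
  unfolding eta_def carrier_G using mono_reps by blast

lemma eta_eq: assumes "a \<in> kp d" "b \<in> kp d" shows "eta d a = eta d b \<longleftrightarrow> eqm d a b"
proof -
  have "eqm n (if n = d then a else \<zero>) (if n = d then b else \<zero>) \<longleftrightarrow> (n = d \<longrightarrow> eqm d a b)" for n
    using eqm_refl[OF zero_closed] by auto
  then show ?thesis unfolding eta_def cls_eq[OF mono_reps[OF assms(1)] mono_reps[OF assms(2)]] by blast
qed

lemma eta_zero: "a \<in> kp d \<Longrightarrow> eta d a = \<zero>\<^bsub>G\<^esub> \<longleftrightarrow> a \<in> kp (Suc d)"
proof -
  assume a: "a \<in> kp d"
  have "(\<lambda>n. if n = d then \<zero> else \<zero>) = (\<lambda>n. \<zero>)" by auto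
  then have "eta d \<zero> = \<zero>\<^bsub>G\<^esub>" unfolding eta_def zero_cls by simp
  then have "eta d a = \<zero>\<^bsub>G\<^esub> \<longleftrightarrow> eqm d a \<zero>" using eta_eq[OF a idl_zero[OF kp_idl]] by simp
  also have "\<dots> \<longleftrightarrow> a \<in> kp (Suc d)" using kp_c[OF a] by (simp add: a_minus_def)
  finally show ?thesis .
qed

lemma eta_add: assumes "a \<in> kp d" "b \<in> kp d" shows "eta d a \<oplus>\<^bsub>G\<^esub> eta d b = eta d (a \<oplus> b)"
proof -
  have "(\<lambda>n. (if n = d then a else \<zero>) \<oplus> (if n = d then b else \<zero>)) = (\<lambda>n. if n = d then a \<oplus> b else \<zero>)"
    by auto
  then show ?thesis unfolding eta_def add_cls[OF mono_reps[OF assms(1)] mono_reps[OF assms(2)]] by simp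
qed

lemma cnv_mono:
  assumes "a \<in> \<A>" "\<And>n. f n \<in> \<A>"
  shows "cnv (\<lambda>n. if n = d then a else \<zero>) f n = (if d \<le> n then a \<otimes> f (n - d) else \<zero>)"
proof -
  have "cnv (\<lambda>n. if n = d then a else \<zero>) f n = finsum R (\<lambda>i. if i = d then a \<otimes> f (n - i) else \<zero>) {..n}"
    by (rule finsum_cong') (use assms in auto)
  also have "\<dots> = (if d \<le> n then a \<otimes> f (n - d) else \<zero>)"
  proof (cases "d \<le> n")
    case True
    have "finsum R (\<lambda>i. if i = d then a \<otimes> f (n - i) else \<zero>) {..n} = finsum R (\<lambda>i. if d = i then a \<otimes> f (n - i) else \<zero>) {..n}"
      by (rule finsum_cong') (use assms in auto)
    also have "\<dots> = a \<otimes> f (n - d)" by (rule finsum_singleton) (use True assms in auto)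
    finally show ?thesis using True by simp
  next
    case False
    have "finsum R (\<lambda>i. if i = d then a \<otimes> f (n - i) else \<zero>) {..n} = finsum R (\<lambda>i. \<zero>) {..n}"
      by (rule finsum_cong') (use assms False in auto)
    then show ?thesis using False by simp
  qed
  finally show ?thesis .
qed

lemma eta_mult: assumes "a \<in> kp d" "b \<in> kp e" shows "eta d a \<otimes>\<^bsub>G\<^esub> eta e b = eta (d + e) (a \<otimes> b)"
proof -
  have "cnv (\<lambda>n. if n = d then a else \<zero>) (\<lambda>n. if n = e then b else \<zero>) = (\<lambda>n. if n = d + e then a \<otimes> b else \<zero>)"
    using cnv_mono[of a "\<lambda>n. if n = e then b else \<zero>" d] kp_c[OF assms(1)] kp_c[OF assms(2)] by (auto simp: fun_eq_iff)
  then show ?thesis unfolding eta_def mult_cls[OF mono_reps[OF assms(1)] mono_reps[OF assms(2)]] by simp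
qed

lemma eta_one: "eta 0 \<one> = \<one>\<^bsub>G\<^esub>"
  unfolding eta_def one_cls by simp

lemma rep_mem: "U \<in> carrier G \<Longrightarrow> gr_rep U n \<in> kp n" using rep_G repsD by blast

lemma cmp_Hn: "U \<in> carrier G \<Longrightarrow> cmp n U \<in> Hn n"
  unfolding cmp_def Hn_def using rep_mem by blast

lemma cmp_cls: assumes "f \<in> reps" shows "cmp n (cls f) = eta n (f n)"
  unfolding cmp_def using eta_eq[OF repsD[OF rep_cls(1)[OF assms]] repsD[OF assms]] rep_cls(2)[OF assms] by blast

lemma cmp_inj: assumes "U \<in> carrier G" "V \<in> carrier G" "\<And>n. cmp n U = cmp n V" shows "U = V"
proof -
  have "cls (gr_rep U) = cls (gr_rep V)"
    using cls_eq[OF rep_G[OF assms(1)] rep_G[OF assms(2)]] assms(3) eta_eq[OF rep_mem[OF assms(1)] rep_mem[OF assms(2)]]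
    unfolding cmp_def by blast
  then show ?thesis using cls_rep assms by simp
qed

lemma cmp_add: assumes "U \<in> carrier G" "V \<in> carrier G" shows "cmp n (U \<oplus>\<^bsub>G\<^esub> V) = cmp n U \<oplus>\<^bsub>G\<^esub> cmp n V"
proof -
  obtain f g where fg: "f \<in> reps" "g \<in> reps" "U = cls f" "V = cls g" using assms unfolding carrier_G by blast
  then show ?thesis using cmp_cls[OF add_reps[OF fg(1,2)], of n] cmp_cls[OF fg(1)] cmp_cls[OF fg(2)]
      eta_add[OF repsD[OF fg(1)] repsD[OF fg(2)], of n] add_cls[OF fg(1,2)] by simp
qed

lemma cmp_eta: "a \<in> kp d \<Longrightarrow> cmp n (eta d a) = (if n = d then eta d a else \<zero>\<^bsub>G\<^esub>)"
  unfolding eta_def[of d a] using cmp_cls[OF mono_reps] eta_zero[OF idl_zero[OF kp_idl]] idl_zero[OF kp_idl]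
  by (auto simp: eta_def[symmetric])

lemma cmp_mult: assumes "a \<in> kp d" "U \<in> carrier G"
  shows "cmp n (eta d a \<otimes>\<^bsub>G\<^esub> U) = (if d \<le> n then eta d a \<otimes>\<^bsub>G\<^esub> cmp (n - d) U else \<zero>\<^bsub>G\<^esub>)"
proof -
  obtain f where f: "f \<in> reps" "U = cls f" using assms unfolding carrier_G by blast
  let ?a = "\<lambda>n. if n = d then a else \<zero>"
  have "eta d a \<otimes>\<^bsub>G\<^esub> U = cls (cnv ?a f)" unfolding eta_def f(2) mult_cls[OF mono_reps[OF assms(1)] f(1)] ..
  then have "cmp n (eta d a \<otimes>\<^bsub>G\<^esub> U) = eta n (cnv ?a f n)" using cmp_cls[OF cnv_reps[OF mono_reps[OF assms(1)] f(1)]] by simp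
  also have "\<dots> = (if d \<le> n then eta n (a \<otimes> f (n - d)) else eta n \<zero>)" using cnv_mono[of a f d n, OF kp_c[OF assms(1)] reps_c[OF f(1)]] by simp
  also have "\<dots> = (if d \<le> n then eta d a \<otimes>\<^bsub>G\<^esub> cmp (n - d) U else \<zero>\<^bsub>G\<^esub>)"
    using eta_mult[OF assms(1) repsD[OF f(1), of "n - d"]] cmp_cls[OF f(1), of "n - d"] f(2) eta_zero[OF idl_zero[OF kp_idl], of n] idl_zero[OF kp_idl, of "Suc n"] by simp
  finally show ?thesis .
qed

lemma cmp_fin: "U \<in> carrier G \<Longrightarrow> \<exists>N. \<forall>n\<ge>N. cmp n U = \<zero>\<^bsub>G\<^esub>"
proof -
  assume U: "U \<in> carrier G"
  then obtain N where "\<forall>n\<ge>N. gr_rep U n \<in> kp (Suc n)" using repsE[OF rep_G] by blast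
  then show ?thesis unfolding cmp_def using eta_zero[OF rep_mem[OF U]] by blast
qed

text \<open>Generation in degree 1, phrased as an induction rule: a set closed under addition that
  contains the products from degrees 1 and \<open>d\<close> contains all forms of degree
  \<open>d + 1\<close>.\<close>

lemma Hn_gen:
  assumes "\<And>a b. a \<in> Hn 1 \<Longrightarrow> b \<in> Hn d \<Longrightarrow> a \<otimes>\<^bsub>G\<^esub> b \<in> W" "\<And>a b. a \<in> W \<Longrightarrow> b \<in> W \<Longrightarrow> a \<oplus>\<^bsub>G\<^esub> b \<in> W"
  shows "Hn (Suc d) \<subseteq> W"
proof
  fix y assume "y \<in> Hn (Suc d)"
  then obtain a where a: "a \<in> K \<cdot> kp d" "y = eta (Suc d) a" unfolding Hn_def by (auto simp: ipow.simps(2))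
  have k1: "kp 1 = K" using pw_one[OF K] .
  have "eta (Suc d) a \<in> W" using a(1)
  proof (induction a rule: ideal_prod.induct)
    case (prod i j)
    then have "eta 1 i \<in> Hn 1" "eta d j \<in> Hn d" unfolding Hn_def k1 by auto
    then have "eta 1 i \<otimes>\<^bsub>G\<^esub> eta d j \<in> W" by (rule assms(1))
    then show ?case using eta_mult[of i 1 j d] prod k1 by simp
  next
    case (sum a b)
    then show ?case using assms(2)[of "eta (Suc d) a" "eta (Suc d) b"] eta_add[of a "Suc d" b] by (simp add: ipow.simps(2))
  qed
  then show "y \<in> W" using a by simp
qed

end

section \<open>Standard graded rings over a local degree 0 part with nil maximal ideal\<close>

locale gr0 = cr +
  fixes Hn :: "nat \<Rightarrow> 'a set" and cmp :: "nat \<Rightarrow> 'a \<Rightarrow> 'a" and nn :: "'a set"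
  assumes Hn_c: "\<And>y d. y \<in> Hn d \<Longrightarrow> y \<in> \<A>"
    and Hn_0: "\<And>d. \<zero> \<in> Hn d"
    and Hn_add: "\<And>d a b. a \<in> Hn d \<Longrightarrow> b \<in> Hn d \<Longrightarrow> a \<oplus> b \<in> Hn d"
    and Hn_neg: "\<And>d a. a \<in> Hn d \<Longrightarrow> \<ominus> a \<in> Hn d"
    and Hn_mult: "\<And>i j a b. a \<in> Hn i \<Longrightarrow> b \<in> Hn j \<Longrightarrow> a \<otimes> b \<in> Hn (i + j)"
    and Hn_one: "\<one> \<in> Hn 0"
    and cmp_H: "\<And>n a. a \<in> \<A> \<Longrightarrow> cmp n a \<in> Hn n"
    and cmp_add: "\<And>n a b. a \<in> \<A> \<Longrightarrow> b \<in> \<A> \<Longrightarrow> cmp n (a \<oplus> b) = cmp n a \<oplus> cmp n b"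
    and cmp_inj: "\<And>a b. a \<in> \<A> \<Longrightarrow> b \<in> \<A> \<Longrightarrow> (\<And>n. cmp n a = cmp n b) \<Longrightarrow> a = b"
    and cmp_eq: "\<And>n d y. y \<in> Hn d \<Longrightarrow> cmp n y = (if n = d then y else \<zero>)"
    and cmp_mult: "\<And>n d y a. y \<in> Hn d \<Longrightarrow> a \<in> \<A> \<Longrightarrow> cmp n (y \<otimes> a) = (if d \<le> n then y \<otimes> cmp (n - d) a else \<zero>)"
    and cmp_fin: "\<And>a. a \<in> \<A> \<Longrightarrow> \<exists>N. \<forall>n\<ge>N. cmp n a = \<zero>"
    and Hn_gen: "\<And>d W. (\<And>a b. a \<in> Hn 1 \<Longrightarrow> b \<in> Hn d \<Longrightarrow> a \<otimes> b \<in> W) \<Longrightarrow> (\<And>a b. a \<in> W \<Longrightarrow> b \<in> W \<Longrightarrow> a \<oplus> b \<in> W) \<Longrightarrow> Hn (Suc d) \<subseteq> W"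
    and H1_fg: "\<exists>S. finite S \<and> S \<subseteq> Hn 1 \<and> (\<forall>U. ideal U R \<longrightarrow> S \<subseteq> U \<longrightarrow> Hn 1 \<subseteq> U)"
    and nn_H: "nn \<subseteq> Hn 0" and nn_0: "\<zero> \<in> nn" and nn_1: "\<one> \<notin> nn"
    and nn_add: "\<And>a b. a \<in> nn \<Longrightarrow> b \<in> nn \<Longrightarrow> a \<oplus> b \<in> nn"
    and nn_mult: "\<And>x a. x \<in> Hn 0 \<Longrightarrow> a \<in> nn \<Longrightarrow> x \<otimes> a \<in> nn"
    and nn_unit: "\<And>y. y \<in> Hn 0 \<Longrightarrow> y \<notin> nn \<Longrightarrow> \<exists>z\<in>Hn 0. z \<otimes> y = \<one>"
    and nn_nil: "\<And>y. y \<in> nn \<Longrightarrow> \<exists>k::nat. y [^] k = \<zero>"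
begin

lemma cmp_c: "a \<in> \<A> \<Longrightarrow> cmp n a \<in> \<A>" using cmp_H Hn_c by blast

lemma cmp_0: "cmp n \<zero> = \<zero>" using cmp_eq[OF Hn_0, of n "Suc n"] by simp

lemma cmp_neg: assumes "a \<in> \<A>" shows "cmp n (\<ominus> a) = \<ominus> cmp n a"
proof -
  have "cmp n a \<oplus> cmp n (\<ominus> a) = \<zero>" using cmp_add[of a "\<ominus> a" n] assms cmp_0 by (simp add: r_neg)
  then show ?thesis using cmp_c assms minus_equality[of "cmp n (\<ominus> a)" "cmp n a"] a_comm[of "cmp n a" "cmp n (\<ominus> a)"] by simp
qed

lemma cmp_minus: "a \<in> \<A> \<Longrightarrow> b \<in> \<A> \<Longrightarrow> cmp n (a \<ominus> b) = cmp n a \<ominus> cmp n b"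
  unfolding a_minus_def by (simp add: cmp_add cmp_neg)

text \<open>Elements of degree strictly below \<open>d\<close>. The strict bound makes
  \<open>FL 0\<close> trivial; a form of degree \<open>d\<close> lies in
  \<open>FL (d + 1)\<close>.\<close>

definition FL :: "nat \<Rightarrow> 'a set" where "FL d = {a \<in> \<A>. \<forall>n\<ge>d. cmp n a = \<zero>}"

lemma FL_c: "a \<in> FL d \<Longrightarrow> a \<in> \<A>" unfolding FL_def by blast
lemma FL_cmp: "a \<in> FL d \<Longrightarrow> d \<le> n \<Longrightarrow> cmp n a = \<zero>" unfolding FL_def by blast
lemma FL_mono: "d \<le> e \<Longrightarrow> FL d \<subseteq> FL e" unfolding FL_def by auto
lemma FL_0: "FL 0 = {\<zero>}"
proof -
  have "a = \<zero>" if "a \<in> FL 0" for a using cmp_inj[OF FL_c[OF that] zero_closed] FL_cmp[OF that] cmp_0 by simp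
  moreover have "\<zero> \<in> FL 0" unfolding FL_def using cmp_0 by simp
  ultimately show ?thesis by blast
qed
lemma FL_ex: "a \<in> \<A> \<Longrightarrow> \<exists>d. a \<in> FL d" unfolding FL_def using cmp_fin by blast
lemma FL_add: "a \<in> FL d \<Longrightarrow> b \<in> FL d \<Longrightarrow> a \<oplus> b \<in> FL d" unfolding FL_def by (auto simp: cmp_add)
lemma FL_zero: "\<zero> \<in> FL d" unfolding FL_def by (simp add: cmp_0)
lemma FL_neg: "a \<in> FL d \<Longrightarrow> \<ominus> a \<in> FL d" unfolding FL_def by (auto simp: cmp_neg)
lemma FL_minus: "a \<in> FL d \<Longrightarrow> b \<in> FL d \<Longrightarrow> a \<ominus> b \<in> FL d" unfolding a_minus_def by (simp add: FL_add FL_neg)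
lemma Hn_FL: "y \<in> Hn d \<Longrightarrow> y \<in> FL (Suc d)" unfolding FL_def using cmp_eq Hn_c by auto

lemma top_FL: assumes "a \<in> FL (Suc d)" shows "a \<ominus> cmp d a \<in> FL d"
proof -
  have a: "a \<in> \<A>" using FL_c[OF assms] .
  have "cmp n (a \<ominus> cmp d a) = \<zero>" if "n \<ge> d" for n
    using cmp_minus[OF a cmp_c[OF a]] cmp_eq[OF cmp_H[OF a]] FL_cmp[OF assms, of n] cmp_c[OF a, of n] that
    by (cases "n = d") (auto simp: a_minus_def r_neg)
  then show ?thesis unfolding FL_def using a cmp_c by simp
qed

lemma graded_induct:
  assumes a: "a \<in> \<A>" and 0: "\<zero> \<in> W" and add: "\<And>x y. x \<in> W \<Longrightarrow> y \<in> W \<Longrightarrow> x \<oplus> y \<in> W" and c: "\<And>n. cmp n a \<in> W"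
  shows "a \<in> W"
proof -
  have "\<And>a. a \<in> FL N \<Longrightarrow> (\<And>n. cmp n a \<in> W) \<Longrightarrow> a \<in> W" for N
  proof (induction N)
    case 0 then show ?case using FL_0 \<open>\<zero> \<in> W\<close> by simp
  next
    case (Suc N)
    have ac: "a \<in> \<A>" using FL_c Suc by blast
    have "cmp n (a \<ominus> cmp N a) \<in> W" for n
      using cmp_minus[OF ac cmp_c[OF ac]] cmp_eq[OF cmp_H[OF ac]] Suc.prems(2)[of n] cmp_c[OF ac] 0
      by (cases "n = N") (auto simp: a_minus_def r_neg)
    then have "a \<ominus> cmp N a \<in> W" using Suc.IH[OF top_FL[OF Suc.prems(1)]] by blast
    then have "(a \<ominus> cmp N a) \<oplus> cmp N a \<in> W" using add Suc.prems(2) by blast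
    moreover have "(a \<ominus> cmp N a) \<oplus> cmp N a = a" using ac cmp_c[OF ac] by algebra
    ultimately show ?case by simp
  qed
  then show ?thesis using FL_ex[OF a] c by blast
qed

lemma FL_mult_H: assumes "y \<in> Hn e" "b \<in> FL d" shows "y \<otimes> b \<in> FL (d + e)"
proof -
  have "cmp n (y \<otimes> b) = \<zero>" if "n \<ge> d + e" for n
    using cmp_mult[OF assms(1) FL_c[OF assms(2)]] FL_cmp[OF assms(2), of "n - e"] that Hn_c[OF assms(1)] by simp
  then show ?thesis unfolding FL_def using Hn_c[OF assms(1)] FL_c[OF assms(2)] by simp
qed

lemma FL_mult: assumes "a \<in> FL (Suc e)" "b \<in> FL d" shows "a \<otimes> b \<in> FL (d + e)"
proof -
  have bc: "b \<in> \<A>" using FL_c[OF assms(2)] .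
  have "a \<in> {a \<in> \<A>. a \<otimes> b \<in> FL (d + e)}"
  proof (rule graded_induct[OF FL_c[OF assms(1)]])
    show "\<zero> \<in> {a \<in> \<A>. a \<otimes> b \<in> FL (d + e)}" using FL_zero bc by simp
    show "x \<oplus> y \<in> {a \<in> \<A>. a \<otimes> b \<in> FL (d + e)}" if "x \<in> {a \<in> \<A>. a \<otimes> b \<in> FL (d + e)}" "y \<in> {a \<in> \<A>. a \<otimes> b \<in> FL (d + e)}" for x y
      using that bc FL_add by (simp add: l_distr)
    show "cmp n a \<in> {a \<in> \<A>. a \<otimes> b \<in> FL (d + e)}" for n
    proof (cases "n \<le> e")
      case True
      then show ?thesis using FL_mult_H[OF cmp_H[OF FL_c[OF assms(1)], of n] assms(2)] FL_mono[of "d + n" "d + e"] cmp_c[OF FL_c[OF assms(1)]] by auto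
    next
      case False then show ?thesis using FL_cmp[OF assms(1), of n] FL_zero bc by simp
    qed
  qed
  then show ?thesis by blast
qed

lemma cmp_top_mult: assumes "a \<in> FL (Suc e)" "b \<in> FL (Suc d)" shows "cmp (d + e) (a \<otimes> b) = cmp e a \<otimes> cmp d b"
proof -
  have ac: "a \<in> \<A>" and bc: "b \<in> \<A>" using assms FL_c by auto
  have ec: "cmp e a \<in> \<A>" using cmp_c[OF ac] .
  have "(a \<ominus> cmp e a) \<otimes> b \<in> FL (d + e)"
  proof (cases e)
    case 0 then show ?thesis using top_FL[OF assms(1)] FL_0 FL_zero bc by simp
  next
    case (Suc e') then show ?thesis using FL_mult[of "a \<ominus> cmp e a" e' b "Suc d"] top_FL[OF assms(1)] assms(2) by simp
  qed
  then have z: "cmp (d + e) ((a \<ominus> cmp e a) \<otimes> b) = \<zero>" using FL_cmp by blast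
  have "a \<otimes> b = (a \<ominus> cmp e a) \<otimes> b \<oplus> cmp e a \<otimes> b" using ac bc ec by algebra
  then have "cmp (d + e) (a \<otimes> b) = cmp (d + e) ((a \<ominus> cmp e a) \<otimes> b) \<oplus> cmp (d + e) (cmp e a \<otimes> b)"
    using cmp_add[of "(a \<ominus> cmp e a) \<otimes> b" "cmp e a \<otimes> b" "d + e"] ac bc ec by simp
  also have "cmp (d + e) (cmp e a \<otimes> b) = cmp e a \<otimes> cmp d b" using cmp_mult[OF cmp_H[OF ac] bc] by simp
  finally show ?thesis using z cmp_c[OF bc] ec by simp
qed

lemma cmp0_mult: assumes "a \<in> \<A>" "b \<in> \<A>" shows "cmp 0 (a \<otimes> b) = cmp 0 a \<otimes> cmp 0 b"
proof -
  have bc: "cmp 0 b \<in> \<A>" using cmp_c assms by blast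
  have "a \<in> {a \<in> \<A>. cmp 0 (a \<otimes> b) = cmp 0 a \<otimes> cmp 0 b}"
  proof (rule graded_induct[OF assms(1)])
    show "\<zero> \<in> {a \<in> \<A>. cmp 0 (a \<otimes> b) = cmp 0 a \<otimes> cmp 0 b}" using assms bc cmp_0 by simp
    show "x \<oplus> y \<in> {a \<in> \<A>. cmp 0 (a \<otimes> b) = cmp 0 a \<otimes> cmp 0 b}"
      if "x \<in> {a \<in> \<A>. cmp 0 (a \<otimes> b) = cmp 0 a \<otimes> cmp 0 b}" "y \<in> {a \<in> \<A>. cmp 0 (a \<otimes> b) = cmp 0 a \<otimes> cmp 0 b}" for x y
      using that assms bc cmp_c by (simp add: l_distr cmp_add)
    show "cmp n a \<in> {a \<in> \<A>. cmp 0 (a \<otimes> b) = cmp 0 a \<otimes> cmp 0 b}" for n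
      using cmp_mult[OF cmp_H[OF assms(1), of n] assms(2), of 0] cmp_eq[OF cmp_H[OF assms(1), of n], of 0] bc cmp_c[OF assms(1)] by auto
  qed
  then show ?thesis by blast
qed

text \<open>The homogeneous maximal ideal. A prime containing \<open>Hn 1\<close> contains it, since
  the elements of \<open>nn\<close> are nilpotent.\<close>

definition MM :: "'a set" where "MM = {a \<in> \<A>. cmp 0 a \<in> nn}"

lemma MM_idl: "idl MM"
  by (rule idlI) (auto simp: MM_def cmp_0 nn_0 cmp_add nn_add cmp0_mult nn_mult cmp_H)

lemma MM_maximal: "maximalideal MM R"
proof (rule maximalidealI[OF MM_idl])
  have "\<one> \<notin> MM" unfolding MM_def using cmp_eq[OF Hn_one, of 0] nn_1 by simp
  then show "\<A> \<noteq> MM" by blast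
next
  fix J assume J: "ideal J R" "MM \<subseteq> J" "J \<subseteq> \<A>"
  show "J = MM \<or> J = \<A>"
  proof (cases "J = MM")
    case False
    then obtain a where a: "a \<in> J" "a \<notin> MM" using J by blast
    have ac: "a \<in> \<A>" using a J by blast
    then have "cmp 0 a \<notin> nn" using a unfolding MM_def by blast
    then obtain z where z: "z \<in> Hn 0" "z \<otimes> cmp 0 a = \<one>" using nn_unit[OF cmp_H[OF ac]] by blast
    have zc: "z \<in> \<A>" using Hn_c z by blast
    have "cmp 0 (\<one> \<ominus> z \<otimes> a) = \<one> \<ominus> \<one>" using cmp_minus[OF one_closed, of "z \<otimes> a" 0] zc ac cmp_eq[OF Hn_one, of 0] cmp_mult[OF z(1) ac, of 0] z by simp
    also have "\<dots> = \<zero>" by (simp add: a_minus_def r_neg)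
    finally have "\<one> \<ominus> z \<otimes> a \<in> MM" unfolding MM_def using nn_0 zc ac by simp
    then have "\<one> \<ominus> z \<otimes> a \<in> J" using J by blast
    then have "\<one> \<in> J" using idl_cancel_minus[OF J(1) _ idl_l[OF J(1) a(1) zc] one_closed] by blast
    then show ?thesis using idl_one[OF J(1)] by blast
  qed simp
qed

lemma MM_prime: "primeideal MM R" using maximalideal_prime[OF MM_maximal] .

lemma Hn_sub_W:
  assumes "idl U" "Hn 1 \<subseteq> U" "d \<ge> 1" shows "Hn d \<subseteq> U"
proof -
  obtain e where e: "d = Suc e" using assms(3) by (cases d) auto
  show ?thesis unfolding e by (rule Hn_gen) (use assms(1,2) idl_r[OF assms(1)] Hn_c idl_add[OF assms(1)] in auto)
qed

lemma nn_prime: assumes "primeideal P R" shows "nn \<subseteq> P"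
proof
  fix y assume y: "y \<in> nn"
  then obtain k :: nat where "y [^] k = \<zero>" using nn_nil by blast
  then show "y \<in> P" using prime_pow[OF assms, of y k] idl_zero[OF primeideal.axioms(1)[OF assms]] nn_H Hn_c y by auto
qed

lemma prime_MM: assumes "primeideal P R" "Hn 1 \<subseteq> P" shows "MM \<subseteq> P"
proof
  fix a assume a: "a \<in> MM"
  have iP: "idl P" using primeideal.axioms(1)[OF assms(1)] .
  show "a \<in> P"
  proof (rule graded_induct)
    show "a \<in> \<A>" using a unfolding MM_def by blast
    show "cmp n a \<in> P" for n
    proof (cases "n = 0")
      case True then show ?thesis using a nn_prime[OF assms(1)] unfolding MM_def by blast
    next
      case False then show ?thesis using Hn_sub_W[OF iP assms(2), of n] cmp_H a unfolding MM_def by auto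
    qed
  qed (use idl_zero[OF iP] idl_add[OF iP] in auto)
qed

lemma Hn_MM: "d \<ge> 1 \<Longrightarrow> Hn d \<subseteq> MM"
  unfolding MM_def using Hn_c cmp_eq nn_0 by auto

definition homid :: "'a set \<Rightarrow> bool" where "homid U \<longleftrightarrow> idl U \<and> (\<forall>a\<in>U. \<forall>n. cmp n a \<in> U)"

lemma homid_zero: "homid {\<zero>}" unfolding homid_def using zeroideal cmp_0 by simp

lemma homid_sum: assumes U: "homid U" and y: "y \<in> Hn d" shows "homid (U \<boxplus> PIdl y)"
proof -
  have i: "idl U" and yc: "y \<in> \<A>" using U Hn_c[OF y] unfolding homid_def by auto
  have "cmp n a \<in> U \<boxplus> PIdl y" if a: "a \<in> U \<boxplus> PIdl y" for a n
  proof -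
    obtain u r where ur: "u \<in> U" "r \<in> \<A>" "a = u \<oplus> y \<otimes> r" using a yc by (rule sumPIE)
    have uc: "u \<in> \<A>" using idl_carr[OF i ur(1)] .
    have "cmp n a = cmp n u \<oplus> cmp n (y \<otimes> r)" unfolding ur(3) using cmp_add uc yc ur(2) by simp
    also have "cmp n (y \<otimes> r) = y \<otimes> (if d \<le> n then cmp (n - d) r else \<zero>)" using cmp_mult[OF y ur(2)] yc by simp
    finally show ?thesis using sumPI_mem[of "cmp n u" U "if d \<le> n then cmp (n - d) r else \<zero>" y] U ur cmp_c yc unfolding homid_def by auto
  qed
  then show ?thesis unfolding homid_def using sum_PI_idl[OF i yc] by blast
qed

lemma hom_nzd:
  assumes U: "homid U" and y: "y \<in> Hn d" and h: "\<And>n a. a \<in> Hn n \<Longrightarrow> y \<otimes> a \<in> U \<Longrightarrow> a \<in> U"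
  shows "nzd U y"
  unfolding nzd_def
proof (intro ballI impI)
  fix b assume b: "b \<in> \<A>" "y \<otimes> b \<in> U"
  have i: "idl U" using U unfolding homid_def by blast
  have "cmp n b \<in> U" for n
  proof -
    have "cmp (d + n) (y \<otimes> b) \<in> U" using U b(2) unfolding homid_def by blast
    then show ?thesis using cmp_mult[OF y b(1), of "d + n"] h[OF cmp_H[OF b(1)], of n] by simp
  qed
  then show "b \<in> U" using graded_induct[OF b(1), of U] idl_zero[OF i] idl_add[OF i] by blast
qed

end

locale gr = gr0 + assumes noeth: "noetherian_ring R"

sublocale gr \<subseteq> N: avs R MM Hn
proof (intro avs.intro ncr.intro avs_axioms.intro ncr_axioms.intro)
  show "cr R" by (rule cr_axioms)
  show "noetherian_ring R" by (rule noeth)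
  show "idl MM" by (rule MM_idl)
  show "\<And>d. 1 \<le> d \<Longrightarrow> Hn d \<subseteq> MM" by (rule Hn_MM)
  show "\<And>d. \<zero> \<in> Hn d" by (rule Hn_0)
  show "\<And>d a b. a \<in> Hn d \<Longrightarrow> b \<in> Hn d \<Longrightarrow> a \<oplus> b \<in> Hn d" by (rule Hn_add)
  show "\<And>i j a b. a \<in> Hn i \<Longrightarrow> b \<in> Hn j \<Longrightarrow> a \<otimes> b \<in> Hn (i + j)" by (rule Hn_mult)
  show "\<And>P. primeideal P R \<Longrightarrow> Hn 1 \<subseteq> P \<Longrightarrow> MM \<subseteq> P" by (rule prime_MM)
qed

context gr
begin

text \<open>Saturation with respect to the irrelevant ideal. It is the unit ideal exactly when
  \<open>U\<close> contains all forms of large degree, which is \<open>complete\<close>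
  below.\<close>

definition sat :: "'a set \<Rightarrow> 'a set" where
  "sat U = {r \<in> \<A>. \<exists>N. \<forall>d\<ge>N. \<forall>y\<in>Hn d. y \<otimes> r \<in> U}"

lemma sat_idl: assumes U: "idl U" shows "idl (sat U)"
proof (rule idlI)
  show "sat U \<subseteq> \<A>" unfolding sat_def by blast
  show "\<zero> \<in> sat U" unfolding sat_def using idl_zero[OF U] Hn_c by auto
next
  fix a b assume ab: "a \<in> sat U" "b \<in> sat U"
  then obtain N N' where N: "\<forall>d\<ge>N. \<forall>y\<in>Hn d. y \<otimes> a \<in> U" "\<forall>d\<ge>N'. \<forall>y\<in>Hn d. y \<otimes> b \<in> U" unfolding sat_def by blast
  have c: "a \<in> \<A>" "b \<in> \<A>" using ab unfolding sat_def by auto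
  have "y \<otimes> (a \<oplus> b) \<in> U" if "d \<ge> max N N'" "y \<in> Hn d" for d y
  proof -
    have "y \<otimes> a \<in> U" "y \<otimes> b \<in> U" using N that by auto
    then show ?thesis using c Hn_c[OF that(2)] idl_add[OF U] by (simp add: r_distr)
  qed
  then show "a \<oplus> b \<in> sat U" unfolding sat_def using c by blast
next
  fix a x assume a: "a \<in> sat U" and x: "x \<in> \<A>"
  then obtain N where N: "\<forall>d\<ge>N. \<forall>y\<in>Hn d. y \<otimes> a \<in> U" unfolding sat_def by blast
  have c: "a \<in> \<A>" using a unfolding sat_def by auto
  have "y \<otimes> (x \<otimes> a) \<in> U" if "d \<ge> N" "y \<in> Hn d" for d y
    using m_lcomm[OF Hn_c[OF that(2)] x c] idl_l[OF U _ x] N that by simp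
  then show "x \<otimes> a \<in> sat U" unfolding sat_def using c x by blast
qed

lemma sat_sup: "idl U \<Longrightarrow> U \<subseteq> sat U"
  unfolding sat_def using idl_l idl_carr Hn_c by blast

lemma sat_homid: assumes U: "homid U" shows "homid (sat U)"
proof -
  have i: "idl U" using U unfolding homid_def by blast
  have "cmp n a \<in> sat U" if a: "a \<in> sat U" for a n
  proof -
    obtain N where N: "\<forall>d\<ge>N. \<forall>y\<in>Hn d. y \<otimes> a \<in> U" using a unfolding sat_def by blast
    have c: "a \<in> \<A>" using a unfolding sat_def by auto
    have "y \<otimes> cmp n a \<in> U" if d: "d \<ge> N" "y \<in> Hn d" for d y
    proof -
      have "cmp (d + n) (y \<otimes> a) \<in> U" using N d U unfolding homid_def by blast
      then show ?thesis using cmp_mult[OF d(2) c, of "d + n"] by simp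
    qed
    then show ?thesis unfolding sat_def using cmp_c[OF c] by blast
  qed
  then show ?thesis unfolding homid_def using sat_idl[OF i] by blast
qed

text \<open>If \<open>M\<close> carries \<open>u\<close> into the saturation, then finitely many
  generators of \<open>Hn 1\<close> share one exponent \<open>N0\<close>, and a form of degree
  \<open>d + 1\<close> is a sum of products of forms of degrees 1 and \<open>d\<close>. So all forms
  of degree above \<open>N0\<close> carry \<open>u\<close> into \<open>U\<close>.\<close>

lemma sat_nsoc: assumes U: "idl U" shows "N.nsoc (sat U)"
  unfolding N.nsoc_def
proof (intro ballI impI)
  fix u assume u: "u \<in> \<A>" "\<forall>y\<in>MM. y \<otimes> u \<in> sat U"
  obtain S where S: "finite S" "S \<subseteq> Hn 1" "\<And>V. idl V \<Longrightarrow> S \<subseteq> V \<Longrightarrow> Hn 1 \<subseteq> V" using H1_fg by blast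
  have "\<forall>s\<in>S. \<exists>N. \<forall>d\<ge>N. \<forall>y\<in>Hn d. y \<otimes> (s \<otimes> u) \<in> U" using u(2) S(2) Hn_MM[of 1] unfolding sat_def by blast
  then obtain N where N: "\<And>s d y. s \<in> S \<Longrightarrow> d \<ge> N s \<Longrightarrow> y \<in> Hn d \<Longrightarrow> y \<otimes> (s \<otimes> u) \<in> U" by metis
  define N0 where "N0 = Max (insert 0 (N ` S))"
  have N0: "N s \<le> N0" if "s \<in> S" for s unfolding N0_def using S(1) that by simp
  have step: "z \<otimes> u \<in> U" if d: "d \<ge> N0" and z: "z \<in> Hn (Suc d)" for d z
  proof -
    have zW: "Hn (Suc d) \<subseteq> {z \<in> \<A>. z \<otimes> u \<in> U}"
    proof (rule Hn_gen)
      fix a b assume a: "a \<in> Hn 1" and b: "b \<in> Hn d"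
      have bc: "b \<in> \<A>" using Hn_c[OF b] .
      have "S \<subseteq> colon U (b \<otimes> u)"
      proof
        fix s assume s: "s \<in> S"
        then have sc: "s \<in> \<A>" using S Hn_c by blast
        have "b \<otimes> u \<otimes> s = b \<otimes> (s \<otimes> u)" using bc sc u(1) m_comm[of u s] m_assoc by simp
        then show "s \<in> colon U (b \<otimes> u)" unfolding colon_def using N[OF s _ b] N0[OF s] d sc by simp
      qed
      then have "a \<in> colon U (b \<otimes> u)" using S(3)[OF colon_idl[OF U, of "b \<otimes> u"]] a bc u by auto
      then have "b \<otimes> u \<otimes> a \<in> U" "a \<in> \<A>" unfolding colon_def by auto
      moreover have "b \<otimes> u \<otimes> a = a \<otimes> b \<otimes> u" using bc u(1) calculation(2) by algebra
      ultimately show "a \<otimes> b \<in> {z \<in> \<A>. z \<otimes> u \<in> U}" using bc by simp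
    next
      fix a b assume "a \<in> {z \<in> \<A>. z \<otimes> u \<in> U}" "b \<in> {z \<in> \<A>. z \<otimes> u \<in> U}"
      then show "a \<oplus> b \<in> {z \<in> \<A>. z \<otimes> u \<in> U}" using u(1) idl_add[OF U] by (simp add: l_distr)
    qed
    then show ?thesis using z by blast
  qed
  have "z \<otimes> u \<in> U" if "d \<ge> Suc N0" "z \<in> Hn d" for d z using step[of "d - 1" z] that by (cases d) auto
  then show "u \<in> sat U" unfolding sat_def using u(1) by blast
qed

lemma sat_uniform: assumes U: "idl U" shows "\<exists>N. \<forall>d\<ge>N. \<forall>y\<in>Hn d. \<forall>r\<in>sat U. y \<otimes> r \<in> U"
proof -
  obtain S where S: "S \<subseteq> \<A>" "finite S" "sat U = Idl S" using N.fg[OF sat_idl[OF U]] by blast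
  have Ss: "S \<subseteq> sat U" using S genideal_self by blast
  have "\<forall>s\<in>S. \<exists>N. \<forall>d\<ge>N. \<forall>y\<in>Hn d. y \<otimes> s \<in> U" using Ss unfolding sat_def by blast
  then obtain N where N: "\<And>s d y. s \<in> S \<Longrightarrow> d \<ge> N s \<Longrightarrow> y \<in> Hn d \<Longrightarrow> y \<otimes> s \<in> U" by metis
  define N0 where "N0 = Max (insert 0 (N ` S))"
  have N0: "N s \<le> N0" if "s \<in> S" for s unfolding N0_def using S(2) that by simp
  have "y \<otimes> r \<in> U" if "d \<ge> N0" "y \<in> Hn d" "r \<in> sat U" for d y r
  proof -
    have "S \<subseteq> colon U y"
    proof
      fix s assume s: "s \<in> S"
      then have "y \<otimes> s \<in> U" using N[OF s _ that(2)] N0[OF s] that(1) by simp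
      then show "s \<in> colon U y" unfolding colon_def using s S(1) by blast
    qed
    then have "sat U \<subseteq> colon U y" unfolding S(3) by (rule genideal_minimal[OF colon_idl[OF U Hn_c[OF that(2)]]])
    then show ?thesis using that unfolding colon_def by blast
  qed
  then show ?thesis by blast
qed

definition complete :: "'a set \<Rightarrow> bool" where "complete U \<longleftrightarrow> (\<exists>N. \<forall>d\<ge>N. Hn d \<subseteq> U)"

lemma sat_one: "\<one> \<in> sat U \<longleftrightarrow> complete U"
proof -
  have "(\<forall>y\<in>Hn d. y \<otimes> \<one> \<in> U) \<longleftrightarrow> Hn d \<subseteq> U" for d using Hn_c by auto
  then show ?thesis unfolding sat_def complete_def by simp
qed

lemma sat_MM: assumes U: "homid U" and nc: "\<not> complete U" shows "sat U \<subseteq> MM"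
proof
  fix r assume r: "r \<in> sat U"
  have i: "idl U" using U unfolding homid_def by blast
  obtain N where N: "\<forall>d\<ge>N. \<forall>y\<in>Hn d. y \<otimes> r \<in> U" using r unfolding sat_def by blast
  have c: "r \<in> \<A>" using r unfolding sat_def by auto
  show "r \<in> MM"
  proof (rule ccontr)
    assume "r \<notin> MM"
    then have "cmp 0 r \<notin> nn" using c unfolding MM_def by blast
    then obtain z where z: "z \<in> Hn 0" "z \<otimes> cmp 0 r = \<one>" using nn_unit[OF cmp_H[OF c]] by blast
    have "y \<in> U" if d: "d \<ge> N" "y \<in> Hn d" for d y
    proof -
      have yc: "y \<in> \<A>" "z \<in> \<A>" "cmp 0 r \<in> \<A>" using Hn_c d z cmp_c c by auto
      have "cmp d (y \<otimes> r) \<in> U" using N d U unfolding homid_def by blast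
      then have "y \<otimes> cmp 0 r \<in> U" using cmp_mult[OF d(2) c, of d] by simp
      then have "z \<otimes> (y \<otimes> cmp 0 r) \<in> U" using idl_l[OF i] yc by blast
      moreover have "z \<otimes> (y \<otimes> cmp 0 r) = y \<otimes> (z \<otimes> cmp 0 r)" using yc by (intro m_lcomm) auto
      ultimately show ?thesis using z yc by simp
    qed
    then show False using nc unfolding complete_def by blast
  qed
qed

text \<open>An associated prime of the saturation lying in \<open>MM\<close> differs from
  \<open>MM\<close>, because the saturation has no socle. This stands in for the positive dimension
  of the quotient.\<close>

lemma prime_below_MM:
  assumes U: "homid U" and nc: "\<not> complete U"
  shows "\<exists>P. primeideal P R \<and> U \<subseteq> P \<and> P \<subset> MM"
proof -
  have i: "idl U" using U unfolding homid_def by blast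
  obtain w where w: "w \<in> \<A>" "w \<notin> sat U" "primeideal (colon (sat U) w) R" "colon (sat U) w \<subseteq> MM"
    using N.assoc_prime_below[OF sat_idl[OF i] MM_prime sat_MM[OF U nc]] by blast
  have "colon (sat U) w \<noteq> MM"
  proof
    assume h: "colon (sat U) w = MM"
    have "y \<otimes> w \<in> sat U" if "y \<in> MM" for y
    proof -
      have "y \<in> colon (sat U) w" using that h by simp
      then have "y \<in> \<A>" "w \<otimes> y \<in> sat U" unfolding colon_def by auto
      then show ?thesis using m_comm[OF w(1), of y] by simp
    qed
    then have "\<forall>y\<in>MM. y \<otimes> w \<in> sat U" by blast
    then show False using sat_nsoc[OF i] w unfolding N.nsoc_def by blast
  qed
  moreover have "U \<subseteq> colon (sat U) w" using sat_sup[OF i] colon_sup[OF sat_idl[OF i] w(1)] by blast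
  ultimately show ?thesis using w by blast
qed

lemma rsq_homid:
  assumes "homid U" "\<And>x. x \<in> set xs \<Longrightarrow> \<exists>d. x \<in> Hn d" shows "homid (N.gi U xs)"
  using assms
proof (induction xs arbitrary: U)
  case (Cons x xs)
  then obtain d where "x \<in> Hn d" by auto
  then show ?case using Cons homid_sum by auto
qed simp

text \<open>The point where Cohen-Macaulayness of the graded ring is used. The sequence
  \<open>xs\<close> yields a prime chain of its length ending strictly below \<open>MM\<close>, so
  \<open>MM\<close> has a chain longer by one, hence a regular sequence longer by one. By exchange
  \<open>xs\<close> can be prolonged by a regular element, which excludes a socle.\<close>

lemma nsoc_of_cm:
  assumes cm: "cohen_macaulay R" and xs: "N.rsq {\<zero>} xs" "\<And>x. x \<in> set xs \<Longrightarrow> \<exists>d. x \<in> Hn d"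
    and nc: "\<not> complete (N.gi {\<zero>} xs)"
  shows "N.nsoc (N.gi {\<zero>} xs)"
proof -
  have hom: "homid (N.gi {\<zero>} xs)" using rsq_homid[OF homid_zero xs(2)] .
  obtain P where P: "primeideal P R" "N.gi {\<zero>} xs \<subseteq> P" "P \<subset> MM" using prime_below_MM[OF hom nc] by blast
  obtain C where C: "prime_chain R C (length xs)" "C (length xs) = P"
    using N.rsq_prime_chain[OF zeroideal xs(1) P(1,2)] by blast
  define C' where "C' i = (if i \<le> length xs then C i else MM)" for i
  have "prime_chain R C' (Suc (length xs))" unfolding prime_chain_def C'_def
    using C P MM_prime unfolding prime_chain_def by (auto simp: le_Suc_eq less_Suc_eq)
  moreover have "C' (Suc (length xs)) = MM" unfolding C'_def by simp
  ultimately obtain ys where ys: "length ys = Suc (length xs)" "set ys \<subseteq> MM" "regular_seq R ys"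
    using cm MM_maximal unfolding cohen_macaulay_def by blast
  have "N.dep (length xs + 1) {\<zero>}" using N.regular_seq_dep[OF ys(3,2)] ys(1) by simp
  then have "N.dep 1 (N.gi {\<zero>} xs)" using N.exchange_list[OF zeroideal _ xs(1)] by blast
  then show ?thesis using N.dep_nsoc[of 0] by simp
qed

end

section \<open>The associated graded ring of an \<open>m\<close>-primary ideal\<close>

locale lgrd = lcr + fixes K :: "'a set" assumes mp: "m_primary R m K"

sublocale lgrd \<subseteq> D: grd R K
  using m_primary_pow(1)[OF mp] by (intro grd.intro grd_axioms.intro cr_axioms)

context lgrd
begin

lemma Km: "K \<subseteq> m" using m_primary_pow(2)[OF mp] .

definition nnK :: "(nat \<Rightarrow> 'a) set set" where "nnK = D.eta 0 ` m"

lemma kp0: "D.kp 0 = \<A>" by simp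
lemma kp1: "D.kp 1 = K" using pw_one[OF D.K] .
lemma kpS0: "D.kp (Suc 0) = K" using kp1 by simp

text \<open>Connects the encoding by classes of sequences with the abstract graded setting. The
  degree 0 part is \<open>A/K\<close>, local with maximal ideal \<open>m/K\<close>, which is nil
  because \<open>K\<close> is \<open>m\<close>-primary.\<close>

lemma gr0G: "gr0 D.G D.Hn D.cmp nnK"
proof -
  interpret G: cr D.G by (intro cr.intro D.G_cring)
  have pw0: "D.eta 0 a [^]\<^bsub>D.G\<^esub> (k::nat) = D.eta 0 (a [^] k)" if "a \<in> \<A>" for a k
  proof (induction k)
    case 0 then show ?case using D.eta_one by simp
  next
    case (Suc k) then show ?case using D.eta_mult[of "a [^] k" 0 a 0] that by simp
  qed
  show ?thesis
  proof (intro gr0.intro gr0_axioms.intro)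
    show "cr D.G" by (rule G.cr_axioms)
    show "y \<in> carrier D.G" if "y \<in> D.Hn d" for y d using that D.eta_c unfolding D.Hn_def by blast
    show z: "\<zero>\<^bsub>D.G\<^esub> \<in> D.Hn d" for d
      using D.eta_zero[of \<zero> d] idl_zero[OF D.kp_idl, of d] idl_zero[OF D.kp_idl, of "Suc d"] unfolding D.Hn_def by (metis imageI)
    show add: "a \<oplus>\<^bsub>D.G\<^esub> b \<in> D.Hn d" if "a \<in> D.Hn d" "b \<in> D.Hn d" for a b d
      using that D.eta_add idl_add[OF D.kp_idl] unfolding D.Hn_def by fastforce
    show "\<ominus>\<^bsub>D.G\<^esub> a \<in> D.Hn d" if ad: "a \<in> D.Hn d" for a d
    proof -
      obtain b where b: "b \<in> D.kp d" "a = D.eta d b" using ad unfolding D.Hn_def by blast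
      have nb: "\<ominus> b \<in> D.kp d" using idl_neg[OF D.kp_idl b(1)] .
      have "a \<oplus>\<^bsub>D.G\<^esub> D.eta d (\<ominus> b) = D.eta d \<zero>" unfolding b(2) using D.eta_add[OF b(1) nb] D.kp_c[OF b(1)] by (simp add: r_neg)
      also have "\<dots> = \<zero>\<^bsub>D.G\<^esub>" using D.eta_zero[OF idl_zero[OF D.kp_idl], of d] idl_zero[OF D.kp_idl] by simp
      finally have "\<ominus>\<^bsub>D.G\<^esub> a = D.eta d (\<ominus> b)"
        using G.minus_equality[of "D.eta d (\<ominus> b)" a] G.a_comm[of a "D.eta d (\<ominus> b)"] D.eta_c[OF nb] D.eta_c[OF b(1)] b(2) by simp
      then show ?thesis unfolding D.Hn_def using nb by blast
    qed
    show "a \<otimes>\<^bsub>D.G\<^esub> b \<in> D.Hn (i + j)" if "a \<in> D.Hn i" "b \<in> D.Hn j" for a b i j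
      using that D.eta_mult pw_mem_add[OF D.K] unfolding D.Hn_def by fastforce
    show "\<one>\<^bsub>D.G\<^esub> \<in> D.Hn 0" using D.eta_one unfolding D.Hn_def by (metis imageI kp0 one_closed)
    show "D.cmp n a \<in> D.Hn n" if "a \<in> carrier D.G" for n a using D.cmp_Hn[OF that] .
    show "D.cmp n (a \<oplus>\<^bsub>D.G\<^esub> b) = D.cmp n a \<oplus>\<^bsub>D.G\<^esub> D.cmp n b" if "a \<in> carrier D.G" "b \<in> carrier D.G" for n a b using D.cmp_add[OF that] .
    show "a = b" if "a \<in> carrier D.G" "b \<in> carrier D.G" "\<And>n. D.cmp n a = D.cmp n b" for a b using D.cmp_inj[OF that] .
    show "D.cmp n y = (if n = d then y else \<zero>\<^bsub>D.G\<^esub>)" if "y \<in> D.Hn d" for n d y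
      using that D.cmp_eta unfolding D.Hn_def by auto
    show "D.cmp n (y \<otimes>\<^bsub>D.G\<^esub> a) = (if d \<le> n then y \<otimes>\<^bsub>D.G\<^esub> D.cmp (n - d) a else \<zero>\<^bsub>D.G\<^esub>)" if "y \<in> D.Hn d" "a \<in> carrier D.G" for n d y a
      using that D.cmp_mult unfolding D.Hn_def by auto
    show "\<exists>N. \<forall>n\<ge>N. D.cmp n a = \<zero>\<^bsub>D.G\<^esub>" if "a \<in> carrier D.G" for a using D.cmp_fin[OF that] .
    show "D.Hn (Suc d) \<subseteq> W" if "\<And>a b. a \<in> D.Hn 1 \<Longrightarrow> b \<in> D.Hn d \<Longrightarrow> a \<otimes>\<^bsub>D.G\<^esub> b \<in> W" "\<And>a b. a \<in> W \<Longrightarrow> b \<in> W \<Longrightarrow> a \<oplus>\<^bsub>D.G\<^esub> b \<in> W" for d W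
      using D.Hn_gen[OF that] by blast
    show "\<exists>S. finite S \<and> S \<subseteq> D.Hn 1 \<and> (\<forall>U. ideal U D.G \<longrightarrow> S \<subseteq> U \<longrightarrow> D.Hn 1 \<subseteq> U)"
    proof -
      obtain T where T: "T \<subseteq> \<A>" "finite T" "K = Idl T" using fg[OF D.K] by blast
      have TK: "T \<subseteq> K" using T genideal_self by blast
      have "D.Hn 1 \<subseteq> U" if U: "ideal U D.G" "D.eta 1 ` T \<subseteq> U" for U
      proof -
        have "idl {a \<in> K. D.eta 1 a \<in> U}"
        proof (rule idlI)
          show "{a \<in> K. D.eta 1 a \<in> U} \<subseteq> \<A>" using idl_carr[OF D.K] by blast
          show "\<zero> \<in> {a \<in> K. D.eta 1 a \<in> U}" using idl_zero[OF D.K] D.eta_zero[of \<zero> 1] G.idl_zero[OF U(1)] idl_zero[OF D.kp_idl] kp1 by auto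
        next
          fix a b assume "a \<in> {a \<in> K. D.eta 1 a \<in> U}" "b \<in> {a \<in> K. D.eta 1 a \<in> U}"
          then have ab: "a \<in> K" "b \<in> K" "D.eta 1 a \<in> U" "D.eta 1 b \<in> U" by auto
          have "D.eta 1 (a \<oplus> b) = D.eta 1 a \<oplus>\<^bsub>D.G\<^esub> D.eta 1 b" using D.eta_add[of a 1 b] ab(1,2) kp1 by simp
          then show "a \<oplus> b \<in> {a \<in> K. D.eta 1 a \<in> U}" using G.idl_add[OF U(1) ab(3,4)] idl_add[OF D.K ab(1,2)] by simp
        next
          fix a x assume a: "a \<in> {a \<in> K. D.eta 1 a \<in> U}" and x: "x \<in> \<A>"
          have "D.eta 0 x \<otimes>\<^bsub>D.G\<^esub> D.eta 1 a = D.eta 1 (x \<otimes> a)" using D.eta_mult[of x 0 a 1] a x kp1 by simp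
          then show "x \<otimes> a \<in> {a \<in> K. D.eta 1 a \<in> U}" using a x idl_l[OF D.K] G.idl_l[OF U(1), of "D.eta 1 a" "D.eta 0 x"] D.eta_c[of x 0] by simp
        qed
        moreover have "T \<subseteq> {a \<in> K. D.eta 1 a \<in> U}" using U TK by blast
        ultimately have "K \<subseteq> {a \<in> K. D.eta 1 a \<in> U}" unfolding T(3) by (rule genideal_minimal)
        then show ?thesis unfolding D.Hn_def kp1 by blast
      qed
      moreover have "D.eta 1 ` T \<subseteq> D.Hn 1" unfolding D.Hn_def kp1 using TK by blast
      ultimately show ?thesis using T(2) by blast
    qed
    show "nnK \<subseteq> D.Hn 0" unfolding nnK_def D.Hn_def using m_c by auto
    show "\<zero>\<^bsub>D.G\<^esub> \<in> nnK" unfolding nnK_def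
      using D.eta_zero[of \<zero> 0] idl_zero[OF D.kp_idl, of "Suc 0"] idl_zero[OF m_idl] by (metis imageI kp0 zero_closed)
    show "\<one>\<^bsub>D.G\<^esub> \<notin> nnK"
    proof
      assume "\<one>\<^bsub>D.G\<^esub> \<in> nnK"
      then obtain a where a: "a \<in> m" "D.eta 0 \<one> = D.eta 0 a" unfolding nnK_def using D.eta_one by auto
      then have "\<one> \<ominus> a \<in> D.kp (Suc 0)" using D.eta_eq[of \<one> 0 a] m_c by simp
      then have "\<one> \<ominus> a \<in> m" using kpS0 Km by blast
      then show False using idl_cancel_minus[OF m_idl _ a(1) one_closed] one_notin_m by blast
    qed
    show "a \<oplus>\<^bsub>D.G\<^esub> b \<in> nnK" if ab: "a \<in> nnK" "b \<in> nnK" for a b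
    proof -
      obtain a' b' where h: "a' \<in> m" "b' \<in> m" "a = D.eta 0 a'" "b = D.eta 0 b'" using ab unfolding nnK_def by blast
      then show ?thesis using D.eta_add[of a' 0 b'] m_c idl_add[OF m_idl h(1,2)] unfolding nnK_def by auto
    qed
    show "x \<otimes>\<^bsub>D.G\<^esub> a \<in> nnK" if xa: "x \<in> D.Hn 0" "a \<in> nnK" for x a
    proof -
      obtain x' a' where h: "x' \<in> \<A>" "a' \<in> m" "x = D.eta 0 x'" "a = D.eta 0 a'" using xa unfolding nnK_def D.Hn_def by auto
      then show ?thesis using D.eta_mult[of x' 0 a' 0] m_c idl_l[OF m_idl h(2,1)] unfolding nnK_def by auto
    qed
    show "\<exists>z\<in>D.Hn 0. z \<otimes>\<^bsub>D.G\<^esub> y = \<one>\<^bsub>D.G\<^esub>" if y: "y \<in> D.Hn 0" "y \<notin> nnK" for y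
    proof -
      obtain a where a: "a \<in> \<A>" "y = D.eta 0 a" using y unfolding D.Hn_def by auto
      then have "a \<notin> m" using y unfolding nnK_def by blast
      then obtain b where b: "b \<in> \<A>" "b \<otimes> a = \<one>" using unit_not_m a by blast
      have "D.eta 0 b \<otimes>\<^bsub>D.G\<^esub> y = \<one>\<^bsub>D.G\<^esub>" using D.eta_mult[of b 0 a 0] a b D.eta_one by simp
      then show ?thesis using b unfolding D.Hn_def by auto
    qed
    show "\<exists>k::nat. y [^]\<^bsub>D.G\<^esub> k = \<zero>\<^bsub>D.G\<^esub>" if yy: "y \<in> nnK" for y
    proof -
      obtain a where a: "a \<in> m" "y = D.eta 0 a" using yy unfolding nnK_def by blast
      obtain k where k: "a [^] (k::nat) \<in> K" using mp a unfolding m_primary_def by blast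
      have "y [^]\<^bsub>D.G\<^esub> k = D.eta 0 (a [^] k)" unfolding a(2) using pw0 m_c a by simp
      also have "\<dots> = \<zero>\<^bsub>D.G\<^esub>" using D.eta_zero[of "a [^] k" 0] k kpS0 m_c[OF a(1)] by simp
      finally show ?thesis by blast
    qed
  qed
qed

text \<open>\<open>inn B d\<close> collects the coefficients in \<open>K^d\<close> of the components
  of degree \<open>d\<close> of elements of \<open>B\<close> of degree at most \<open>d\<close>.
  These ideals form a family over \<open>K\<close>, so Artin-Rees bounds the degrees of generators;
  finitely many lifts then generate \<open>B\<close> by descending induction on the top
  degree.\<close>

lemma G_noeth: "noetherian_ring D.G"
proof -
  interpret Q: gr0 D.G D.Hn D.cmp nnK by (rule gr0G)
  define inn where "inn B d = {a \<in> D.kp d. \<exists>U\<in>B. U \<in> Q.FL (Suc d) \<and> D.cmp d U = D.eta d a}" for B d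
  have famB: "fam K (inn B)" if B: "ideal B D.G" for B
    unfolding fam_def
  proof (intro allI conjI)
    fix d
    show i: "idl (inn B d)" for d
    proof (rule idlI)
      show "inn B d \<subseteq> \<A>" unfolding inn_def using D.kp_c by blast
      have "D.cmp d \<zero>\<^bsub>D.G\<^esub> = D.eta d \<zero>" using Q.cmp_0 D.eta_zero[OF idl_zero[OF D.kp_idl], of d] idl_zero[OF D.kp_idl] by simp
      then show "\<zero> \<in> inn B d" unfolding inn_def using idl_zero[OF D.kp_idl] Q.idl_zero[OF B] Q.FL_zero by blast
    next
      fix a b assume "a \<in> inn B d" "b \<in> inn B d"
      then obtain U V where h: "a \<in> D.kp d" "b \<in> D.kp d" "U \<in> B" "V \<in> B" "U \<in> Q.FL (Suc d)" "V \<in> Q.FL (Suc d)"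
        "D.cmp d U = D.eta d a" "D.cmp d V = D.eta d b" unfolding inn_def by blast
      have "D.cmp d (U \<oplus>\<^bsub>D.G\<^esub> V) = D.eta d (a \<oplus> b)" using D.cmp_add[OF Q.FL_c[OF h(5)] Q.FL_c[OF h(6)], of d] h(7,8) D.eta_add[OF h(1,2)] by simp
      then show "a \<oplus> b \<in> inn B d" unfolding inn_def using idl_add[OF D.kp_idl h(1,2)] Q.idl_add[OF B h(3,4)] Q.FL_add[OF h(5,6)] by blast
    next
      fix a x assume "a \<in> inn B d" and x: "x \<in> \<A>"
      then obtain U where h: "a \<in> D.kp d" "U \<in> B" "U \<in> Q.FL (Suc d)" "D.cmp d U = D.eta d a" unfolding inn_def by blast
      have x0: "x \<in> D.kp 0" using x by simp
      have "D.cmp d (D.eta 0 x \<otimes>\<^bsub>D.G\<^esub> U) = D.eta d (x \<otimes> a)" using D.cmp_mult[OF x0 Q.FL_c[OF h(3)], of d] h(4) D.eta_mult[OF x0 h(1)] by simp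
      moreover have "D.eta 0 x \<otimes>\<^bsub>D.G\<^esub> U \<in> Q.FL (Suc d)" using Q.FL_mult_H[of "D.eta 0 x" 0 U "Suc d"] h(3) x0 unfolding D.Hn_def by simp
      ultimately show "x \<otimes> a \<in> inn B d" unfolding inn_def using idl_l[OF D.kp_idl h(1) x] Q.idl_l[OF B h(2) D.eta_c[OF x0]] by blast
    qed
    show "inn B d \<subseteq> D.kp d" unfolding inn_def by blast
    show "K \<cdot> inn B d \<subseteq> inn B (Suc d)"
    proof (rule prod_least[OF i])
      fix x a assume x: "x \<in> K" and "a \<in> inn B d"
      then obtain U where h: "a \<in> D.kp d" "U \<in> B" "U \<in> Q.FL (Suc d)" "D.cmp d U = D.eta d a" unfolding inn_def by blast
      have x1: "x \<in> D.kp 1" using x kp1 by simp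
      have "D.cmp (Suc d) (D.eta 1 x \<otimes>\<^bsub>D.G\<^esub> U) = D.eta (Suc d) (x \<otimes> a)" using D.cmp_mult[OF x1 Q.FL_c[OF h(3)], of "Suc d"] h(4) D.eta_mult[OF x1 h(1)] by simp
      moreover have "D.eta 1 x \<otimes>\<^bsub>D.G\<^esub> U \<in> Q.FL (Suc (Suc d))" using Q.FL_mult_H[of "D.eta 1 x" 1 U "Suc d"] h(3) x1 unfolding D.Hn_def by simp
      moreover have "x \<otimes> a \<in> D.kp (Suc d)" using pw_mem_add[OF D.K x1 h(1)] by simp
      ultimately show "x \<otimes> a \<in> inn B (Suc d)" unfolding inn_def using Q.idl_l[OF B h(2) D.eta_c[OF x1]] by blast
    qed
  qed
  show ?thesis
  proof (rule Q.noetherian_ringI)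
    fix B assume B: "ideal B D.G"
    obtain N where N: "\<forall>i\<ge>N. inn B (Suc i) \<subseteq> K \<cdot> inn B i" using AR_all[OF D.K] famB[OF B] unfolding AR_def by blast
    have "\<forall>d. \<exists>S. S \<subseteq> \<A> \<and> finite S \<and> inn B d = Idl S" using fg famB[OF B] unfolding fam_def by blast
    then obtain S where S: "\<And>d. S d \<subseteq> \<A>" "\<And>d. finite (S d)" "\<And>d. inn B d = Idl (S d)" by metis
    have SB: "S d \<subseteq> inn B d" for d using S genideal_self by blast
    have "\<forall>d a. \<exists>U. a \<in> S d \<longrightarrow> U \<in> B \<and> U \<in> Q.FL (Suc d) \<and> D.cmp d U = D.eta d a" using SB unfolding inn_def by blast
    then obtain L where L: "\<And>d a. a \<in> S d \<Longrightarrow> L d a \<in> B \<and> L d a \<in> Q.FL (Suc d) \<and> D.cmp d (L d a) = D.eta d a" by metis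
    define T where "T = (\<Union>d\<in>{..N}. L d ` S d)"
    have Tf: "finite T" unfolding T_def using S(2) by blast
    have TB: "T \<subseteq> B" unfolding T_def using L by blast
    have Tc: "T \<subseteq> carrier D.G" using TB Q.idl_carr[OF B] by blast
    define Cc where "Cc = Idl\<^bsub>D.G\<^esub> T"
    have iC: "ideal Cc D.G" unfolding Cc_def using Q.genideal_ideal[OF Tc] .
    have CB: "Cc \<subseteq> B" unfolding Cc_def using Q.genideal_minimal[OF B TB] .
    have TC: "T \<subseteq> Cc" unfolding Cc_def using Q.genideal_self[OF Tc] .
    have iiC: "idl (inn Cc d)" for d using famB[OF iC] unfolding fam_def by blast
    have small: "inn B d \<subseteq> inn Cc d" if d: "d \<le> N" for d
    proof -
      have "S d \<subseteq> inn Cc d"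
      proof
        fix a assume a: "a \<in> S d"
        then have "L d a \<in> Cc" using TC d unfolding T_def by blast
        then show "a \<in> inn Cc d" using L[OF a] SB a unfolding inn_def by blast
      qed
      then show ?thesis unfolding S(3) by (rule genideal_minimal[OF iiC])
    qed
    have all: "inn B d \<subseteq> inn Cc d" for d
    proof (cases "d \<le> N")
      case False
      then have "N \<le> d" by simp
      then show ?thesis
      proof (induction d rule: dec_induct)
        case base then show ?case using small by simp
      next
        case (step d)
        have "inn B (Suc d) \<subseteq> K \<cdot> inn B d" using N step by simp
        also have "\<dots> \<subseteq> K \<cdot> inn Cc d" using prod_mono[OF order_refl step.IH] .
        also have "\<dots> \<subseteq> inn Cc (Suc d)" using famB[OF iC] unfolding fam_def by blast
        finally show ?case .
      qed
    qed (rule small)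
    have "B \<inter> Q.FL d \<subseteq> Cc" for d
    proof (induction d)
      case 0 then show ?case using Q.FL_0 Q.idl_zero[OF iC] by auto
    next
      case (Suc d)
      show ?case
      proof
        fix U assume U: "U \<in> B \<inter> Q.FL (Suc d)"
        have Uc: "U \<in> carrier D.G" using U Q.FL_c by blast
        have "gr_rep U d \<in> inn B d" unfolding inn_def using U D.rep_mem[OF Uc] unfolding D.cmp_def by blast
        then obtain V where V: "V \<in> Cc" "V \<in> Q.FL (Suc d)" "D.cmp d V = D.cmp d U" using all unfolding inn_def D.cmp_def by blast
        have Vc: "V \<in> carrier D.G" using V Q.FL_c by blast
        have "U \<ominus>\<^bsub>D.G\<^esub> V \<in> Q.FL d"
        proof -
          have "D.cmp n (U \<ominus>\<^bsub>D.G\<^esub> V) = \<zero>\<^bsub>D.G\<^esub>" if "n \<ge> d" for n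
          proof (cases "n = d")
            case True then show ?thesis using Q.cmp_minus[OF Uc Vc, of n] V(3) Q.cmp_c[OF Uc] by (simp add: a_minus_def Q.r_neg)
          next
            case False
            then have "Suc d \<le> n" using that by simp
            then show ?thesis using Q.cmp_minus[OF Uc Vc, of n] Q.FL_cmp[of U "Suc d" n] Q.FL_cmp[OF V(2), of n] U by (simp add: a_minus_def)
          qed
          then show ?thesis unfolding Q.FL_def using Uc Vc by simp
        qed
        moreover have "U \<ominus>\<^bsub>D.G\<^esub> V \<in> B" using Q.idl_minus[OF B] U V(1) CB by blast
        ultimately have "U \<ominus>\<^bsub>D.G\<^esub> V \<in> Cc" using Suc by blast
        then show "U \<in> Cc" using Q.idl_cancel_minus[OF iC _ V(1) Uc] by blast
      qed
    qed
    then have "B \<subseteq> Cc" using Q.FL_ex Q.idl_carr[OF B] by blast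
    then show "\<exists>A\<subseteq>carrier D.G. finite A \<and> B = Idl\<^bsub>D.G\<^esub> A"
      using CB Tc Tf Cc_def by (intro exI[of _ T]) auto
  qed
qed

end

sublocale lgrd \<subseteq> Q: gr D.G D.Hn D.cmp nnK
  using gr0G G_noeth by (intro gr.intro gr_axioms.intro)

sublocale lcr \<subseteq> LA: avs R m "\<lambda>_. m"
proof (intro avs.intro avs_axioms.intro ncr_axioms)
  show "idl m" by (rule m_idl)
  show "a \<otimes> b \<in> m" if "a \<in> m" "b \<in> m" for a b using idl_l[OF m_idl that(2) m_c[OF that(1)]] .
qed (auto simp: idl_zero[OF m_idl] idl_add[OF m_idl])

section \<open>The Valabrega-Valla criterion\<close>

context lgrd
begin

text \<open>In these lists of pairs (degree, element) the head is the last member of the sequence,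
  opposite to \<open>rsq\<close> and \<open>gi\<close>; hence the \<open>rev\<close> in later
  statements. By truncated subtraction an element of degree above \<open>i\<close> contributes its
  whole principal ideal.\<close>

primrec Fm :: "(nat \<times> 'a) list \<Rightarrow> nat \<Rightarrow> 'a set" where
  "Fm [] i = {\<zero>}"
| "Fm (p # xs) i = Fm xs i \<boxplus> smul (snd p) (D.kp (i - fst p))"

primrec Ai :: "(nat \<times> 'a) list \<Rightarrow> 'a set" where
  "Ai [] = {\<zero>}"
| "Ai (p # xs) = Ai xs \<boxplus> PIdl (snd p)"

primrec GI :: "(nat \<times> 'a) list \<Rightarrow> (nat \<Rightarrow> 'a) set set" where
  "GI [] = {\<zero>\<^bsub>D.G\<^esub>}"
| "GI (p # xs) = Q.sumI (GI xs) (cgenideal D.G (D.eta (fst p) (snd p)))"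

primrec dg :: "(nat \<times> 'a) list \<Rightarrow> bool" where
  "dg [] \<longleftrightarrow> True"
| "dg (p # xs) \<longleftrightarrow> fst p \<ge> 1 \<and> snd p \<in> D.kp (fst p) \<and> dg xs"

primrec goodl :: "(nat \<times> 'a) list \<Rightarrow> bool" where
  "goodl [] \<longleftrightarrow> True"
| "goodl (p # xs) \<longleftrightarrow> fst p \<ge> 1 \<and> snd p \<in> D.kp (fst p) \<and> Q.nzd (GI xs) (D.eta (fst p) (snd p)) \<and> goodl xs"

lemma goodl_dg: "goodl xs \<Longrightarrow> dg xs" by (induction xs) auto

lemma kp_m: "d \<ge> 1 \<Longrightarrow> D.kp d \<subseteq> m"
  using pw_antimono[OF D.K, of 1 d] kp1 Km by blast

lemma Fm_idl: "dg xs \<Longrightarrow> idl (Fm xs i)"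
  by (induction xs) (auto simp: zeroideal sum_idl smul_idl D.kp_idl D.kp_c)

lemma Ai_idl: "dg xs \<Longrightarrow> idl (Ai xs)"
  by (induction xs) (auto simp: zeroideal sum_PI_idl D.kp_c)

lemma Ai_m: "dg xs \<Longrightarrow> Ai xs \<subseteq> m"
proof (induction xs)
  case (Cons p xs)
  then have "snd p \<in> m" using kp_m by auto
  then show ?case using Cons sum_least[OF m_idl] PI_least[OF m_idl] by simp
qed (simp add: idl_zero[OF m_idl])

lemma Fm_Ai: "dg xs \<Longrightarrow> Fm xs i \<subseteq> Ai xs"
proof (induction xs)
  case (Cons p xs)
  have "smul (snd p) (D.kp (i - fst p)) \<subseteq> PIdl (snd p)"
    using smul_sub_PI[OF D.kp_c idl_sub[OF D.kp_idl], of "snd p" "fst p"] Cons.prems by simp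
  then show ?case using Cons sum_mono by simp
qed simp

lemma Fm_kp: "dg xs \<Longrightarrow> Fm xs i \<subseteq> D.kp i"
proof (induction xs)
  case (Cons p xs)
  then show ?case using pw_smul_sub[OF D.K] sum_least[OF D.kp_idl] by simp
qed (simp add: idl_zero[OF D.kp_idl])

lemma GI_gi: "GI xs = Q.N.gi {\<zero>\<^bsub>D.G\<^esub>} (rev (map (\<lambda>p. D.eta (fst p) (snd p)) xs))"
  by (induction xs) (auto simp: Q.N.gi_snoc)

lemma goodl_rsq: "goodl xs \<Longrightarrow> Q.N.rsq {\<zero>\<^bsub>D.G\<^esub>} (rev (map (\<lambda>p. D.eta (fst p) (snd p)) xs))"
proof (induction xs)
  case (Cons p xs)
  have "D.eta (fst p) (snd p) \<in> D.Hn (fst p)" using Cons.prems unfolding D.Hn_def by auto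
  then have "D.eta (fst p) (snd p) \<in> Q.MM" using Q.Hn_MM[of "fst p"] Cons.prems by auto
  then show ?case using Cons GI_gi[of xs] by (simp add: Q.N.rsq_snoc)
qed simp

lemma GI_homid: "dg xs \<Longrightarrow> Q.homid (GI xs)"
proof (induction xs)
  case Nil then show ?case using Q.homid_zero by simp
next
  case (Cons p xs)
  have "D.eta (fst p) (snd p) \<in> D.Hn (fst p)" using Cons.prems unfolding D.Hn_def by auto
  then show ?case using Q.homid_sum Cons by simp
qed

text \<open>Dictionary between the graded ring and the base ring: ideals generated by forms become
  sums \<open>Fm xs i\<close> modulo \<open>K^(i+1)\<close>, so that regularity of forms can be
  handled by elements of \<open>A\<close>.\<close>

lemma mem_GI: "dg xs \<Longrightarrow> a \<in> D.kp i \<Longrightarrow> D.eta i a \<in> GI xs \<longleftrightarrow> a \<in> Fm xs i \<boxplus> D.kp (Suc i)"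
proof (induction xs arbitrary: i a)
  case Nil
  then show ?case using D.eta_zero[of a i] zero_sum[OF D.kp_idl] by simp
next
  case (Cons p xs)
  define d x where "d = fst p" and "x = snd p"
  have dx: "d \<ge> 1" "x \<in> D.kp d" and dgx: "dg xs" using Cons.prems unfolding d_def x_def by auto
  have xc: "x \<in> \<A>" using D.kp_c[OF dx(2)] .
  have ec: "D.eta d x \<in> carrier D.G" using D.eta_c[OF dx(2)] .
  have ac: "a \<in> \<A>" using D.kp_c[OF Cons.prems(2)] .
  have iF: "idl (Fm xs i)" using Fm_idl[OF dgx] .
  have iS: "idl (smul x (D.kp (i - d)))" using smul_idl[OF xc D.kp_idl] .
  have iFS: "idl (Fm xs i \<boxplus> smul x (D.kp (i - d)))" using sum_idl[OF iF iS] .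
  have iT: "idl (Fm xs i \<boxplus> smul x (D.kp (i - d)) \<boxplus> D.kp (Suc i))" using sum_idl[OF iFS D.kp_idl] .
  note subs = sum_l[OF iF iS] sum_r[OF iF iS] sum_l[OF iFS D.kp_idl, of "Suc i"] sum_r[OF iFS D.kp_idl, of "Suc i"]
  have FT: "Fm xs i \<boxplus> D.kp (Suc i) \<subseteq> Fm xs i \<boxplus> smul x (D.kp (i - d)) \<boxplus> D.kp (Suc i)"
    using subs by (intro sum_least[OF iT]) auto
  have hom: "Q.homid (GI xs)" "Q.idl (GI xs)" using GI_homid[OF dgx] unfolding Q.homid_def by auto
  show ?case
  proof
    assume "D.eta i a \<in> GI (p # xs)"
    then have "D.eta i a \<in> Q.sumI (GI xs) (cgenideal D.G (D.eta d x))" unfolding d_def x_def by simp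
    then obtain U r where U: "U \<in> GI xs" "r \<in> carrier D.G" "D.eta i a = U \<oplus>\<^bsub>D.G\<^esub> D.eta d x \<otimes>\<^bsub>D.G\<^esub> r"
      using ec by (rule Q.sumPIE)
    have Uc: "U \<in> carrier D.G" using Q.idl_carr[OF hom(2) U(1)] .
    define b where "b = gr_rep U i"
    have b: "b \<in> D.kp i" "D.cmp i U = D.eta i b" unfolding b_def D.cmp_def using D.rep_mem[OF Uc] by auto
    have "D.eta i b \<in> GI xs" using hom U(1) b(2) unfolding Q.homid_def by metis
    then have bF: "b \<in> Fm xs i \<boxplus> D.kp (Suc i)" using Cons.IH[OF dgx b(1)] by simp
    have bc: "b \<in> \<A>" using D.kp_c b by blast
    have "D.cmp i (D.eta i a) = D.cmp i U \<oplus>\<^bsub>D.G\<^esub> D.cmp i (D.eta d x \<otimes>\<^bsub>D.G\<^esub> r)"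
      using D.cmp_add[OF Uc, of "D.eta d x \<otimes>\<^bsub>D.G\<^esub> r" i] U ec by simp
    then have e: "D.eta i a = D.eta i b \<oplus>\<^bsub>D.G\<^esub> D.cmp i (D.eta d x \<otimes>\<^bsub>D.G\<^esub> r)" using D.cmp_eta[OF Cons.prems(2), of i] b(2) by simp
    show "a \<in> Fm (p # xs) i \<boxplus> D.kp (Suc i)"
    proof (cases "d \<le> i")
      case True
      define c where "c = gr_rep r (i - d)"
      have c: "c \<in> D.kp (i - d)" "D.cmp (i - d) r = D.eta (i - d) c" unfolding c_def D.cmp_def using D.rep_mem[OF U(2)] by auto
      have xck: "x \<otimes> c \<in> D.kp i" using pw_mem_sub[OF D.K dx(2) c(1)] .
      have "D.cmp i (D.eta d x \<otimes>\<^bsub>D.G\<^esub> r) = D.eta i (x \<otimes> c)" using D.cmp_mult[OF dx(2) U(2), of i] True c(2) D.eta_mult[OF dx(2) c(1)] by simp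
      then have "D.eta i a = D.eta i (b \<oplus> x \<otimes> c)" using e D.eta_add[OF b(1) xck] by simp
      then have "a \<ominus> (b \<oplus> x \<otimes> c) \<in> D.kp (Suc i)" using D.eta_eq[OF Cons.prems(2) idl_add[OF D.kp_idl b(1) xck]] by simp
      then have 1: "a \<ominus> (b \<oplus> x \<otimes> c) \<in> Fm xs i \<boxplus> smul x (D.kp (i - d)) \<boxplus> D.kp (Suc i)" using subs by blast
      have "b \<oplus> x \<otimes> c \<in> Fm xs i \<boxplus> smul x (D.kp (i - d)) \<boxplus> D.kp (Suc i)"
        using idl_add[OF iT] bF FT smul_mem[OF c(1), of x] subs by blast
      then show ?thesis using idl_cancel_minus[OF iT 1 _ ac] unfolding d_def x_def by simp
    next
      case False
      then have "D.eta i a = D.eta i b" using e D.cmp_mult[OF dx(2) U(2), of i] D.eta_c[OF b(1)] by simp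
      then have "a \<ominus> b \<in> D.kp (Suc i)" using D.eta_eq[OF Cons.prems(2) b(1)] by simp
      then have "a \<ominus> b \<in> Fm xs i \<boxplus> smul x (D.kp (i - d)) \<boxplus> D.kp (Suc i)" using subs by blast
      then show ?thesis using idl_cancel_minus[OF iT _ _ ac, of b] bF FT unfolding d_def x_def by auto
    qed
  next
    assume "a \<in> Fm (p # xs) i \<boxplus> D.kp (Suc i)"
    then have "a \<in> Fm xs i \<boxplus> smul x (D.kp (i - d)) \<boxplus> D.kp (Suc i)" unfolding d_def x_def by simp
    then obtain v k where v: "v \<in> Fm xs i \<boxplus> smul x (D.kp (i - d))" "k \<in> D.kp (Suc i)" "a = v \<oplus> k" by (rule sumE)
    obtain b c where bc: "b \<in> Fm xs i" "c \<in> D.kp (i - d)" "v = b \<oplus> x \<otimes> c" using v(1) by (rule sum_smulE)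
    have bk: "b \<in> D.kp i" using Fm_kp[OF dgx] bc by blast
    have xck: "x \<otimes> c \<in> D.kp i" using pw_mem_sub[OF D.K dx(2) bc(2)] .
    have vk: "v \<in> D.kp i" unfolding bc(3) using idl_add[OF D.kp_idl bk xck] .
    have cc: "b \<in> \<A>" "x \<otimes> c \<in> \<A>" "k \<in> \<A>" "v \<in> \<A>" using bk xck v(2) vk D.kp_c by auto
    have "a \<ominus> v = k" unfolding v(3) using cc by algebra
    then have ea: "D.eta i a = D.eta i v" using D.eta_eq[OF Cons.prems(2) vk] v(2) by simp
    have bG: "D.eta i b \<in> GI xs" using Cons.IH[OF dgx bk] sum_l[OF iF D.kp_idl, of "Suc i"] bc(1) by blast
    have iG: "Q.idl (cgenideal D.G (D.eta d x))" using Q.PI_idl[OF ec] .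
    have "D.eta i v \<in> Q.sumI (GI xs) (cgenideal D.G (D.eta d x))"
    proof (cases "d \<le> i")
      case True
      have "D.eta i v = D.eta i b \<oplus>\<^bsub>D.G\<^esub> D.eta d x \<otimes>\<^bsub>D.G\<^esub> D.eta (i - d) c"
        using D.eta_add[OF bk xck] D.eta_mult[OF dx(2) bc(2)] True bc(3) by simp
      then show ?thesis using Q.sumPI_mem[OF bG D.eta_c[OF bc(2)] ec] by simp
    next
      case False
      \<comment> \<open>For \<open>d > i\<close> the summand \<open>x A\<close> of \<open>Fm\<close>
        lies in \<open>K^d\<close>, hence in \<open>K^(i+1)\<close>, and contributes nothing in
        degree \<open>i\<close>.\<close>
      have "x \<otimes> c \<in> D.kp d" using idl_r[OF D.kp_idl dx(2) D.kp_c[OF bc(2)]] .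
      then have "x \<otimes> c \<in> D.kp (Suc i)" using pw_antimono[OF D.K, of "Suc i" d] False by auto
      moreover have "v \<ominus> b = x \<otimes> c" unfolding bc(3) using cc by algebra
      ultimately have "D.eta i v = D.eta i b" using D.eta_eq[OF vk bk] by simp
      then show ?thesis using bG Q.sum_l[OF hom(2) iG] by auto
    qed
    then show "D.eta i a \<in> GI (p # xs)" unfolding ea d_def x_def by simp
  qed
qed

text \<open>Induction along the sequence. If \<open>x a\<close> lies in \<open>Ai xs\<close>,
  regularity of the form of \<open>x\<close> pushes \<open>a\<close> into \<open>Ai xs + K^n\<close>
  for every \<open>n\<close>, and Krull's intersection theorem gives \<open>a\<close> in
  \<open>Ai xs\<close>. In the same way, in a representation \<open>a = f + x b\<close> of an
  element of \<open>K^i\<close>, the cofactor \<open>b\<close> is moved step by step into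
  \<open>K^(i-d)\<close>.\<close>

lemma valabrega_valla:
  "goodl xs \<Longrightarrow> (\<forall>i. D.kp i \<inter> Ai xs \<subseteq> Fm xs i) \<and> LA.rsq {\<zero>} (rev (map snd xs)) \<and> LA.gi {\<zero>} (rev (map snd xs)) = Ai xs"
proof (induction xs)
  case Nil then show ?case by simp
next
  case (Cons p xs)
  define d x where "d = fst p" and "x = snd p"
  have dx: "d \<ge> 1" "x \<in> D.kp d" "Q.nzd (GI xs) (D.eta d x)" "goodl xs" using Cons.prems unfolding d_def x_def by auto
  have dgx: "dg xs" using goodl_dg[OF dx(4)] .
  have xc: "x \<in> \<A>" using D.kp_c[OF dx(2)] .
  have VV: "D.kp i \<inter> Ai xs \<subseteq> Fm xs i" for i using Cons.IH[OF dx(4)] by blast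
  have iF: "idl (Fm xs i)" for i using Fm_idl[OF dgx] .
  have iA: "idl (Ai xs)" using Ai_idl[OF dgx] .
  have greg: "a \<in> Fm xs i \<boxplus> D.kp (Suc i)" if a: "a \<in> D.kp i" "x \<otimes> a \<in> Fm xs (d + i) \<boxplus> D.kp (Suc (d + i))" for a i
  proof -
    have "x \<otimes> a \<in> D.kp (d + i)" using pw_mem_add[OF D.K dx(2) a(1)] .
    then have "D.eta d x \<otimes>\<^bsub>D.G\<^esub> D.eta i a \<in> GI xs" using mem_GI[OF dgx, of "x \<otimes> a" "d + i"] a D.eta_mult[OF dx(2) a(1)] by simp
    then have "D.eta i a \<in> GI xs" using Q.nzdD[OF dx(3)] D.eta_c[OF a(1)] by blast
    then show ?thesis using mem_GI[OF dgx a(1)] by simp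
  qed
  have nz: "nzd (Ai xs) x" unfolding nzd_def
  proof (intro ballI impI)
    fix a assume a: "a \<in> \<A>" "x \<otimes> a \<in> Ai xs"
    have "a \<in> Ai xs \<boxplus> D.kp n" for n
    proof (induction n)
      case 0 then show ?case using sum_r[OF iA D.kp_idl, of 0] a by auto
    next
      case (Suc n)
      obtain f b where fb: "f \<in> Ai xs" "b \<in> D.kp n" "a = f \<oplus> b" using Suc by (rule sumE)
      have cc: "f \<in> \<A>" "b \<in> \<A>" using idl_carr[OF iA fb(1)] D.kp_c[OF fb(2)] by auto
      have "x \<otimes> b = x \<otimes> a \<ominus> x \<otimes> f" unfolding fb(3) using xc cc by algebra
      then have "x \<otimes> b \<in> Ai xs" using idl_minus[OF iA a(2) idl_l[OF iA fb(1) xc]] by simp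
      then have "x \<otimes> b \<in> Fm xs (d + n)" using VV pw_mem_add[OF D.K dx(2) fb(2)] by blast
      then have "b \<in> Fm xs n \<boxplus> D.kp (Suc n)" using greg[OF fb(2)] sum_l[OF iF D.kp_idl] by blast
      then obtain b1 b2 where b: "b1 \<in> Fm xs n" "b2 \<in> D.kp (Suc n)" "b = b1 \<oplus> b2" by (rule sumE)
      have "b1 \<in> \<A>" "b2 \<in> \<A>" using b idl_carr[OF iF] D.kp_c by auto
      then have "a = (f \<oplus> b1) \<oplus> b2" unfolding fb(3) b(3) using cc a_assoc by simp
      moreover have "f \<oplus> b1 \<in> Ai xs" using idl_add[OF iA fb(1)] b(1) Fm_Ai[OF dgx] by blast
      ultimately show ?case using sum_mem b(2) by simp
    qed
    then show "a \<in> Ai xs" by (rule krull_intersection[OF iA Km])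
  qed
  have V2: "D.kp i \<inter> Ai (p # xs) \<subseteq> Fm (p # xs) i" for i
  proof
    fix a assume "a \<in> D.kp i \<inter> Ai (p # xs)"
    then have a: "a \<in> D.kp i" "a \<in> Ai xs \<boxplus> PIdl x" unfolding x_def by auto
    have ac: "a \<in> \<A>" using D.kp_c[OF a(1)] .
    have "\<exists>f b. f \<in> Ai xs \<and> b \<in> D.kp j \<and> a = f \<oplus> x \<otimes> b" if "j \<le> i - d" for j
      using that
    proof (induction j)
      case 0
      obtain f r where "f \<in> Ai xs" "r \<in> \<A>" "a = f \<oplus> x \<otimes> r" using a(2) xc by (rule sumPIE)
      then show ?case by auto
    next
      case (Suc j)
      then obtain f b where fb: "f \<in> Ai xs" "b \<in> D.kp j" "a = f \<oplus> x \<otimes> b" by auto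
      have cc: "f \<in> \<A>" "b \<in> \<A>" using idl_carr[OF iA fb(1)] D.kp_c[OF fb(2)] by auto
      have ji: "Suc (d + j) \<le> i" using Suc.prems by simp
      have ak: "a \<in> D.kp (Suc (d + j))" using a(1) pw_antimono[OF D.K ji] by blast
      have xb: "x \<otimes> b \<in> D.kp (d + j)" using pw_mem_add[OF D.K dx(2) fb(2)] .
      have "f = a \<ominus> x \<otimes> b" unfolding fb(3) using cc xc by algebra
      moreover have "a \<ominus> x \<otimes> b \<in> D.kp (d + j)" using idl_minus[OF D.kp_idl _ xb] ak D.kp_Suc by blast
      ultimately have fF: "f \<in> Fm xs (d + j)" using VV fb(1) by auto
      have "x \<otimes> b = \<ominus> f \<oplus> a" unfolding fb(3) using cc xc by algebra
      then have "x \<otimes> b \<in> Fm xs (d + j) \<boxplus> D.kp (Suc (d + j))" using sum_mem[OF idl_neg[OF iF fF] ak] by simp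
      then have "b \<in> Fm xs j \<boxplus> D.kp (Suc j)" using greg[OF fb(2)] by blast
      then obtain b1 b2 where b: "b1 \<in> Fm xs j" "b2 \<in> D.kp (Suc j)" "b = b1 \<oplus> b2" by (rule sumE)
      have bc: "b1 \<in> \<A>" "b2 \<in> \<A>" using b idl_carr[OF iF] D.kp_c by auto
      have "a = (f \<oplus> x \<otimes> b1) \<oplus> x \<otimes> b2" unfolding fb(3) b(3) using cc bc xc by algebra
      moreover have "f \<oplus> x \<otimes> b1 \<in> Ai xs" using idl_add[OF iA fb(1)] idl_l[OF iA _ xc] b(1) Fm_Ai[OF dgx] by blast
      ultimately show ?case using b(2) by blast
    qed
    from this[of "i - d"] obtain f b where fb: "f \<in> Ai xs" "b \<in> D.kp (i - d)" "a = f \<oplus> x \<otimes> b" by auto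
    have cc: "f \<in> \<A>" "b \<in> \<A>" using idl_carr[OF iA fb(1)] D.kp_c[OF fb(2)] by auto
    have "f = a \<ominus> x \<otimes> b" unfolding fb(3) using cc xc by algebra
    then have "f \<in> D.kp i" using idl_minus[OF D.kp_idl a(1) pw_mem_sub[OF D.K dx(2) fb(2)]] by simp
    then have "f \<in> Fm xs i" using VV fb(1) by blast
    then show "a \<in> Fm (p # xs) i" unfolding fb(3) Fm.simps d_def[symmetric] x_def[symmetric] by (rule sum_smul_mem[OF _ fb(2)])
  qed
  have "x \<in> m" using kp_m[OF dx(1)] dx(2) by blast
  then show ?case using V2 Cons.IH[OF dx(4)] nz unfolding x_def by (simp add: LA.rsq_snoc LA.gi_snoc)
qed

text \<open>Generation by forms gives \<open>K^i <= Fm xs i + K^(i+1)\<close>; Nakayama's lemma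
  removes the error term.\<close>

lemma complete_T:
  assumes dgx: "dg xs" and c: "Q.complete (GI xs)" shows "\<exists>t. \<forall>i\<ge>t. D.kp i \<subseteq> Fm xs i"
proof -
  obtain t where t: "\<forall>d\<ge>t. D.Hn d \<subseteq> GI xs" using c unfolding Q.complete_def by blast
  have "D.kp i \<subseteq> Fm xs i" if i: "i \<ge> t" for i
  proof (rule nakayama[OF Fm_idl[OF dgx] D.kp_idl])
    show "D.kp i \<subseteq> Fm xs i \<boxplus> m \<cdot> D.kp i"
    proof
      fix a assume a: "a \<in> D.kp i"
      then have "D.eta i a \<in> GI xs" using t i unfolding D.Hn_def by blast
      then have "a \<in> Fm xs i \<boxplus> D.kp (Suc i)" using mem_GI[OF dgx a] by blast
      moreover have "D.kp (Suc i) \<subseteq> m \<cdot> D.kp i" unfolding ipow.simps(2) by (rule prod_mono[OF Km order_refl])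
      ultimately show "a \<in> Fm xs i \<boxplus> m \<cdot> D.kp i" using sum_mono[OF order_refl] by blast
    qed
  qed
  then show ?thesis by blast
qed

end

section \<open>Regular sequences of forms in the Cohen-Macaulay graded ring\<close>

locale hyp = lgrd +
  assumes cmA: "cohen_macaulay R" and dim3: "krull_dim_is R 3" and cmG: "cohen_macaulay D.G"
begin

lemma dep3: "LA.dep 3 {\<zero>}"
proof -
  obtain C where C: "prime_chain R C 3" and no: "\<not> (\<exists>C. prime_chain R C (Suc 3))" using dim3 unfolding krull_dim_is_def by blast
  have p3: "primeideal (C 3) R" using C unfolding prime_chain_def by blast
  have "C 3 \<subseteq> m" using proper_sub_m[OF primeideal.axioms(1)[OF p3]] primeideal.I_notcarr[OF p3] by blast
  have "C 3 = m"
  proof (rule ccontr)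
    assume "C 3 \<noteq> m"
    then have st: "C 3 \<subset> m" using \<open>C 3 \<subseteq> m\<close> by blast
    have "prime_chain R (\<lambda>i. if i \<le> 3 then C i else m) (Suc 3)" unfolding prime_chain_def
    proof (intro conjI allI impI)
      show "primeideal (if i \<le> 3 then C i else m) R" if "i \<le> Suc 3" for i using C m_prime unfolding prime_chain_def by auto
      show "(if i \<le> 3 then C i else m) \<subset> (if Suc i \<le> 3 then C (Suc i) else m)" if i: "i < Suc 3" for i
      proof (cases "i = 3")
        case True then show ?thesis using st by simp
      next
        case False then show ?thesis using C i unfolding prime_chain_def by auto
      qed
    qed
    then show False using no by blast
  qed
  then obtain ys where "length ys = 3" "set ys \<subseteq> m" "regular_seq R ys"
    using cmA m_max C unfolding cohen_macaulay_def by blast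
  then show ?thesis using LA.regular_seq_dep by metis
qed

text \<open>\<open>A\<close> has depth 3, so modulo at most two lifted elements some
  \<open>g\<close> in \<open>m\<close> is still regular. Completeness would put a power of
  \<open>K\<close>, hence a power of \<open>g\<close>, into the ideal \<open>Ai xs\<close>, and
  cancelling \<open>g\<close> would put 1 there.\<close>

lemma not_complete: assumes g: "goodl xs" and l: "length xs \<le> 2" shows "\<not> Q.complete (GI xs)"
proof
  assume "Q.complete (GI xs)"
  then obtain t where t: "\<forall>i\<ge>t. D.kp i \<subseteq> Fm xs i" using complete_T[OF goodl_dg[OF g]] by blast
  then have tA: "D.kp t \<subseteq> Ai xs" using Fm_Ai[OF goodl_dg[OF g]] by blast
  have rs: "LA.rsq {\<zero>} (rev (map snd xs))" "LA.gi {\<zero>} (rev (map snd xs)) = Ai xs" using valabrega_valla[OF g] by auto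
  have e3: "3 = length (rev (map snd xs)) + Suc (2 - length xs)" using l by simp
  have "LA.dep (length (rev (map snd xs)) + Suc (2 - length xs)) {\<zero>}" using dep3 unfolding e3[symmetric] .
  then have "LA.dep (Suc (2 - length xs)) (LA.gi {\<zero>} (rev (map snd xs)))" by (rule LA.exchange_list[OF zeroideal _ rs(1)])
  then obtain g where g': "g \<in> m" "nzd (Ai xs) g" using rs(2) by auto
  have gc: "g \<in> \<A>" using m_c g' by blast
  obtain k where k: "pw m k \<subseteq> K" using m_primary_pow(3)[OF mp] by blast
  have iA: "idl (Ai xs)" using Ai_idl[OF goodl_dg[OF g]] .
  have "g [^] (k * t) \<in> pw m (1 * (k * t))" using pw_nat_pow[OF m_idl, of g 1] g' pw_one[OF m_idl] by auto
  moreover have "pw m (k * t) \<subseteq> D.kp t" using pw_mono[OF k, of t] pw_pw[OF m_idl] by simp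
  ultimately have gA: "g [^] (k * t) \<in> Ai xs" using tA by auto
  have "g [^] j \<in> Ai xs \<Longrightarrow> \<one> \<in> Ai xs" for j :: nat
  proof (induction j)
    case (Suc j)
    have "g \<otimes> g [^] j \<in> Ai xs" using Suc.prems gc m_comm[of g "g [^] j"] by simp
    then show ?case using Suc.IH nzdD[OF g'(2)] gc by simp
  qed simp
  then show False using gA Ai_m[OF goodl_dg[OF g]] one_notin_m by blast
qed

lemma nsoc_GI: assumes "goodl xs" "\<not> Q.complete (GI xs)" shows "Q.N.nsoc (GI xs)"
proof -
  have "\<exists>d. y \<in> D.Hn d" if "y \<in> set (rev (map (\<lambda>p. D.eta (fst p) (snd p)) xs))" for y
    using that goodl_dg[OF assms(1)]
  proof (induction xs)
    case (Cons p xs)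
    then show ?case unfolding D.Hn_def by auto
  qed simp
  then show ?thesis using Q.nsoc_of_cm[OF cmG goodl_rsq[OF assms(1)]] assms(2) unfolding GI_gi by blast
qed

lemma select:
  assumes "finite XX" "\<And>xs. xs \<in> XX \<Longrightarrow> goodl xs \<and> \<not> Q.complete (GI xs)"
  shows "\<exists>d0. \<forall>d\<ge>d0. \<exists>x. \<forall>xs\<in>XX. goodl ((d, x) # xs)"
proof -
  have "\<exists>d0. \<forall>d\<ge>d0. \<exists>f\<in>D.Hn d. \<forall>U\<in>GI ` XX. Q.nzd U f"
  proof (rule Q.N.avoid_all)
    show "finite (GI ` XX)" using assms by simp
    show "Q.idl U \<and> Q.N.nsoc U" if "U \<in> GI ` XX" for U
      using that nsoc_GI assms(2) GI_homid goodl_dg unfolding Q.homid_def by blast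
  qed
  then obtain d0 where d0: "\<forall>d\<ge>d0. \<exists>f\<in>D.Hn d. \<forall>U\<in>GI ` XX. Q.nzd U f" by blast
  have "\<exists>x. \<forall>xs\<in>XX. goodl ((d, x) # xs)" if d: "d \<ge> max 1 d0" for d
  proof -
    obtain f where f: "f \<in> D.Hn d" "\<forall>U\<in>GI ` XX. Q.nzd U f" using d0 d by (meson max.boundedE)
    obtain x where x: "x \<in> D.kp d" "f = D.eta d x" using f(1) unfolding D.Hn_def by blast
    have "\<forall>xs\<in>XX. goodl ((d, x) # xs)" using x f(2) d assms(2) by auto
    then show ?thesis by blast
  qed
  then show ?thesis by blast
qed

text \<open>Otherwise a fourth regular form exists; the lifts to \<open>A\<close> form a regular
  sequence of length 4 in \<open>m\<close> and thus a prime chain longer than the dimension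
  allows.\<close>

lemma complete3: assumes g: "goodl xs" and l: "length xs = 3" shows "Q.complete (GI xs)"
proof (rule ccontr)
  assume nc: "\<not> Q.complete (GI xs)"
  obtain d0 where "\<forall>d\<ge>d0. \<exists>x. \<forall>ys\<in>{xs}. goodl ((d, x) # ys)" using select[of "{xs}"] g nc by blast
  then obtain d x where gd: "goodl ((d, x) # xs)" by blast
  then have "LA.rsq {\<zero>} (rev (map snd ((d, x) # xs)))" "LA.gi {\<zero>} (rev (map snd ((d, x) # xs))) = Ai ((d, x) # xs)" "Ai ((d, x) # xs) \<subseteq> m"
    using valabrega_valla[OF gd] Ai_m[OF goodl_dg[OF gd]] by blast+
  then obtain C where "prime_chain R C (length (rev (map snd ((d, x) # xs))))"
    using LA.rsq_prime_chain[OF zeroideal _ m_prime] by metis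
  moreover have "length (rev (map snd ((d, x) # xs))) = Suc 3" using l by simp
  ultimately show False using dim3 unfolding krull_dim_is_def by metis
qed

end

section \<open>Products of parameters, and parameters in every large degree\<close>

context lcr
begin

text \<open>\<open>V3\<close> is the Valabrega--Valla criterion for the initial forms of \<open>x, y, z\<close> in degrees \<open>d, e, f\<close> to be a
  regular sequence of \<open>Gr\<^sub>K\<close>, and \<open>T3\<close> says that they generate everything in large degree.
  The shape of the bound in \<open>T3\<close> makes it stable under products in each of the three slots.\<close>

definition S3 where
  "S3 K d x e y f z i = smul x (pw K (i - d)) \<boxplus> smul y (pw K (i - e)) \<boxplus> smul z (pw K (i - f))"

definition V3 where
  "V3 K d x e y f z \<longleftrightarrow> x \<in> pw K d \<and> y \<in> pw K e \<and> z \<in> pw K f \<and> reg3 x y z \<and>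
     (\<forall>i. pw K i \<inter> (PI3 x y z) \<subseteq> S3 K d x e y f z i)"

definition T3 where
  "T3 K t d x e y f z \<longleftrightarrow> (\<forall>i\<ge>t + d + e + f. pw K i \<subseteq> S3 K d x e y f z i)"

lemma reg3_c: "reg3 x y z \<Longrightarrow> x \<in> \<A> \<and> y \<in> \<A> \<and> z \<in> \<A>"
  unfolding reg3_def using m_c by blast

lemma PI3_idl: "x \<in> \<A> \<Longrightarrow> y \<in> \<A> \<Longrightarrow> z \<in> \<A> \<Longrightarrow> idl (PI3 x y z)"
  using sum_PI_idl PI_idl by simp

lemma sum3_swap12: "U \<subseteq> \<A> \<Longrightarrow> V \<subseteq> \<A> \<Longrightarrow> U \<boxplus> V \<boxplus> W = V \<boxplus> U \<boxplus> W"
  using sum_comm[of U V] by simp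

lemma sum3_swap23: assumes "U \<subseteq> \<A>" "V \<subseteq> \<A>" "W \<subseteq> \<A>" shows "U \<boxplus> V \<boxplus> W = U \<boxplus> W \<boxplus> V"
  using sum_assoc[OF assms] sum_assoc[OF assms(1,3,2)] sum_comm[OF assms(2,3)] by simp

lemma S3_mem: "a \<in> S3 K d x e y f z i \<longleftrightarrow> (\<exists>u\<in>pw K (i - d). \<exists>v\<in>pw K (i - e). \<exists>w\<in>pw K (i - f). a = x \<otimes> u \<oplus> y \<otimes> v \<oplus> z \<otimes> w)"
  unfolding S3_def smul_def by (auto elim!: sumE intro!: sum_mem)

lemma V3_swap12: assumes K: "idl K" and V: "V3 K d x e y f z" shows "V3 K e y d x f z"
proof -
  have c: "x \<in> \<A>" "y \<in> \<A>" "z \<in> \<A>" using V reg3_c unfolding V3_def by auto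
  have "S3 K d x e y f z i = S3 K e y d x f z i" for i unfolding S3_def
    using c smul_idl[OF _ pw_idl[OF K]] idl_sub by (intro sum3_swap12) auto
  moreover have "PI3 x y z = PIdl y \<boxplus> PIdl x \<boxplus> PIdl z" using c PI_idl idl_sub by (intro sum3_swap12) auto
  ultimately show ?thesis using V reg3_swap12 unfolding V3_def by simp
qed

lemma V3_swap23: assumes K: "idl K" and V: "V3 K d x e y f z" shows "V3 K d x f z e y"
proof -
  have c: "x \<in> \<A>" "y \<in> \<A>" "z \<in> \<A>" using V reg3_c unfolding V3_def by auto
  have "S3 K d x e y f z i = S3 K d x f z e y i" for i unfolding S3_def
    using c smul_idl[OF _ pw_idl[OF K]] idl_sub by (intro sum3_swap23) auto
  moreover have "PI3 x y z = PIdl x \<boxplus> PIdl z \<boxplus> PIdl y" using c PI_idl idl_sub by (intro sum3_swap23) auto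
  ultimately show ?thesis using V reg3_swap23 unfolding V3_def by simp
qed

lemma T3_swap12: assumes K: "idl K" "x \<in> \<A>" "y \<in> \<A>" "z \<in> \<A>" and V: "T3 K t d x e y f z" shows "T3 K t e y d x f z"
proof -
  have "S3 K d x e y f z i = S3 K e y d x f z i" for i unfolding S3_def
    using K smul_idl[OF _ pw_idl[OF K(1)]] idl_sub by (intro sum3_swap12) auto
  then show ?thesis using V unfolding T3_def by (simp add: add.assoc add.left_commute)
qed

lemma T3_swap23: assumes K: "idl K" "x \<in> \<A>" "y \<in> \<A>" "z \<in> \<A>" and V: "T3 K t d x e y f z" shows "T3 K t d x f z e y"
proof -
  have "S3 K d x e y f z i = S3 K d x f z e y i" for i unfolding S3_def
    using K smul_idl[OF _ pw_idl[OF K(1)]] idl_sub by (intro sum3_swap23) auto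
  then show ?thesis using V unfolding T3_def by (simp add: add.commute add.left_commute)
qed

lemma S3_prod:
  assumes K: "idl K" and x1: "x1 \<in> pw K d1" and x2: "x2 \<in> pw K d2" and yz: "y \<in> \<A>" "z \<in> \<A>"
    and u: "u \<in> S3 K d2 x2 e y f z (i - d1)" and vw: "v \<in> pw K (i - e)" "w \<in> pw K (i - f)"
  shows "x1 \<otimes> u \<oplus> y \<otimes> v \<oplus> z \<otimes> w \<in> S3 K (d1 + d2) (x1 \<otimes> x2) e y f z i"
proof -
  obtain u' v' w' where h: "u' \<in> pw K (i - d1 - d2)" "v' \<in> pw K (i - d1 - e)" "w' \<in> pw K (i - d1 - f)" "u = x2 \<otimes> u' \<oplus> y \<otimes> v' \<oplus> z \<otimes> w'"
    using u unfolding S3_mem by blast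
  have c: "x1 \<in> \<A>" "x2 \<in> \<A>" "u' \<in> \<A>" "v' \<in> \<A>" "w' \<in> \<A>" "v \<in> \<A>" "w \<in> \<A>"
    using x1 x2 h vw pw_carr[OF K] by auto
  have "i - d1 - e = i - e - d1" "i - d1 - f = i - f - d1" by auto
  then have "v \<oplus> x1 \<otimes> v' \<in> pw K (i - e)" "w \<oplus> x1 \<otimes> w' \<in> pw K (i - f)"
    using vw h(2,3) pw_mem_sub[OF K x1] idl_add[OF pw_idl[OF K]] by auto
  moreover have "u' \<in> pw K (i - (d1 + d2))" using h(1) by simp
  moreover have "x1 \<otimes> u \<oplus> y \<otimes> v \<oplus> z \<otimes> w = x1 \<otimes> x2 \<otimes> u' \<oplus> y \<otimes> (v \<oplus> x1 \<otimes> v') \<oplus> z \<otimes> (w \<oplus> x1 \<otimes> w')"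
    unfolding h(4) using c yz by algebra
  ultimately show ?thesis unfolding S3_mem by blast
qed

text \<open>First use the condition for \<open>x1\<close> to write
  \<open>a = x1 u + y v + z w\<close> with \<open>u\<close> in \<open>K^(i-d1)\<close>. Since
  \<open>x1\<close> is regular modulo \<open>(y, z)\<close>, the cofactor \<open>u\<close> lies in
  \<open>(x2, y, z)\<close>, and the condition for \<open>x2\<close> applies to
  \<open>u\<close>.\<close>

lemma V3_prod:
  assumes K: "idl K" and V1: "V3 K d1 x1 e y f z" and V2: "V3 K d2 x2 e y f z"
  shows "V3 K (d1 + d2) (x1 \<otimes> x2) e y f z"
proof -
  have k: "x1 \<in> pw K d1" "x2 \<in> pw K d2" "y \<in> pw K e" "z \<in> pw K f" "reg3 x1 y z" "reg3 x2 y z" using V1 V2 unfolding V3_def by auto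
  have c: "x1 \<in> \<A>" "x2 \<in> \<A>" "y \<in> \<A>" "z \<in> \<A>" using k pw_carr[OF K] by auto
  have r1: "reg3 y z x1" "reg3 y z x2" using reg3_swap23[OF reg3_swap12] k(5,6) by auto
  have nz: "nzd (PIdl y \<boxplus> PIdl z) x1" "nzd (PIdl y \<boxplus> PIdl z) x2" using r1 unfolding reg3_def by auto
  have "reg3 y z (x1 \<otimes> x2)" using r1 nzd_mult[OF nz c(1,2)] idl_l[OF m_idl _ c(1), of x2] unfolding reg3_def by auto
  then have reg: "reg3 (x1 \<otimes> x2) y z" using reg3_swap12[OF reg3_swap23] by blast
  have iyz: "idl (PIdl y \<boxplus> PIdl z)" using sum_PI_idl[OF PI_idl[OF c(3)] c(4)] .
  have as: "PI3 x y z = PIdl x \<boxplus> (PIdl y \<boxplus> PIdl z)" if "x \<in> \<A>" for x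
    using sum_assoc that c idl_sub[OF PI_idl] by simp
  have "a \<in> S3 K (d1 + d2) (x1 \<otimes> x2) e y f z i" if a: "a \<in> pw K i" "a \<in> PIdl (x1 \<otimes> x2) \<boxplus> PIdl y \<boxplus> PIdl z" for a i
  proof -
    obtain s q where sq: "s \<in> PIdl (x1 \<otimes> x2)" "q \<in> PIdl y \<boxplus> PIdl z" "a = s \<oplus> q" by (rule sumE[OF a(2)[unfolded as[OF m_closed[OF c(1,2)]]]])
    then obtain r where r: "r \<in> \<A>" "s = x1 \<otimes> x2 \<otimes> r" using PI_iff c by auto
    have qc: "q \<in> \<A>" using idl_carr[OF iyz sq(2)] .
    have "s = x1 \<otimes> (x2 \<otimes> r)" using r c m_assoc by simp
    then have "s \<in> PIdl x1" using PI_iff[OF c(1)] c r by blast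
    then have "a \<in> PIdl x1 \<boxplus> PIdl y \<boxplus> PIdl z" unfolding sq(3) as[OF c(1)] using sq(2) by (rule sum_mem)
    then have "a \<in> S3 K d1 x1 e y f z i" using V1 a(1) unfolding V3_def by blast
    then obtain u v w where h: "u \<in> pw K (i - d1)" "v \<in> pw K (i - e)" "w \<in> pw K (i - f)" "a = x1 \<otimes> u \<oplus> y \<otimes> v \<oplus> z \<otimes> w"
      unfolding S3_mem by blast
    have hc: "u \<in> \<A>" "v \<in> \<A>" "w \<in> \<A>" using h pw_carr[OF K] by auto
    have yv: "y \<otimes> v \<oplus> z \<otimes> w \<in> PIdl y \<boxplus> PIdl z" using sumPI_mem[OF _ hc(3) c(4)] PI_iff[OF c(3)] hc by blast
    have "x1 \<otimes> (u \<ominus> x2 \<otimes> r) = (x1 \<otimes> u \<oplus> y \<otimes> v \<oplus> z \<otimes> w) \<ominus> (y \<otimes> v \<oplus> z \<otimes> w) \<ominus> x1 \<otimes> x2 \<otimes> r" using c hc r(1) by algebra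
    also have "\<dots> = (x1 \<otimes> x2 \<otimes> r \<oplus> q) \<ominus> (y \<otimes> v \<oplus> z \<otimes> w) \<ominus> x1 \<otimes> x2 \<otimes> r" using h(4) sq(3) r(2) by simp
    also have "\<dots> = q \<ominus> (y \<otimes> v \<oplus> z \<otimes> w)" using c hc r(1) qc by algebra
    also have "\<dots> \<in> PIdl y \<boxplus> PIdl z" using idl_minus[OF iyz sq(2) yv] .
    finally have 1: "u \<ominus> x2 \<otimes> r \<in> PIdl y \<boxplus> PIdl z" using nzdD[OF nz(1)] hc c r by simp
    have "x2 \<otimes> r \<oplus> (u \<ominus> x2 \<otimes> r) \<in> PIdl x2 \<boxplus> (PIdl y \<boxplus> PIdl z)" using sum_mem[OF _ 1] PI_iff[OF c(2)] r(1) by blast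
    moreover have "x2 \<otimes> r \<oplus> (u \<ominus> x2 \<otimes> r) = u" using hc c r(1) by algebra
    ultimately have "u \<in> S3 K d2 x2 e y f z (i - d1)" using V2 h(1) as[OF c(2)] unfolding V3_def by auto
    then show ?thesis unfolding h(4) by (rule S3_prod[OF K k(1,2) c(3,4) _ h(2,3)])
  qed
  then show ?thesis unfolding V3_def using pw_mem_add[OF K k(1,2)] k reg by blast
qed

lemma T3_prod:
  assumes K: "idl K" and k: "x1 \<in> pw K d1" "x2 \<in> pw K d2" "y \<in> \<A>" "z \<in> \<A>"
    and T1: "T3 K t d1 x1 e y f z" and T2: "T3 K t d2 x2 e y f z"
  shows "T3 K t (d1 + d2) (x1 \<otimes> x2) e y f z"
  unfolding T3_def
proof (intro allI impI subsetI)
  fix i a assume i: "i \<ge> t + (d1 + d2) + e + f" and a: "a \<in> pw K i"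
  have "a \<in> S3 K d1 x1 e y f z i" using T1[unfolded T3_def, rule_format, of i] i a by auto
  then obtain u v w where h: "u \<in> pw K (i - d1)" "v \<in> pw K (i - e)" "w \<in> pw K (i - f)" "a = x1 \<otimes> u \<oplus> y \<otimes> v \<oplus> z \<otimes> w"
    unfolding S3_mem by blast
  have "t + d2 + e + f \<le> i - d1" using i by linarith
  then have "u \<in> S3 K d2 x2 e y f z (i - d1)" using subsetD[OF T2[unfolded T3_def, rule_format, of "i - d1"]] h(1) by blast
  then show "a \<in> S3 K (d1 + d2) (x1 \<otimes> x2) e y f z i" unfolding h(4) by (rule S3_prod[OF K k _ h(2,3)])
qed

definition VT where
  "VT K t d x e y f z \<longleftrightarrow> V3 K d x e y f z \<and> T3 K t d x e y f z"

lemma VT_prod1: "idl K \<Longrightarrow> VT K t d1 x1 e y f z \<Longrightarrow> VT K t d2 x2 e y f z \<Longrightarrow> VT K t (d1 + d2) (x1 \<otimes> x2) e y f z"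
  unfolding VT_def using V3_prod[of K d1 x1 e y f z d2 x2] T3_prod[of K x1 d1 x2 d2 y z t e f] pw_carr[of K] unfolding V3_def by blast

lemma VT_swap12: "idl K \<Longrightarrow> VT K t d x e y f z \<Longrightarrow> VT K t e y d x f z"
  unfolding VT_def using V3_swap12[of K d x e y f z] T3_swap12[of K x y z t d e f] reg3_c[of x y z] unfolding V3_def by blast

lemma VT_swap23: "idl K \<Longrightarrow> VT K t d x e y f z \<Longrightarrow> VT K t d x f z e y"
  unfolding VT_def using V3_swap23[of K d x e y f z] T3_swap23[of K x y z t d e f] reg3_c[of x y z] unfolding V3_def by blast

lemma VT_prod2: "idl K \<Longrightarrow> VT K t d x e1 y1 f z \<Longrightarrow> VT K t d x e2 y2 f z \<Longrightarrow> VT K t d x (e1 + e2) (y1 \<otimes> y2) f z"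
  using VT_swap12[of K t d x e1 y1 f z] VT_swap12[of K t d x e2 y2 f z] VT_prod1[of K t e1 y1 d x f z e2 y2] VT_swap12[of K t "e1 + e2" "y1 \<otimes> y2" d x f z] by simp

lemma VT_prod3: "idl K \<Longrightarrow> VT K t d x e y f1 z1 \<Longrightarrow> VT K t d x e y f2 z2 \<Longrightarrow> VT K t d x e y (f1 + f2) (z1 \<otimes> z2)"
  using VT_swap23[of K t d x e y f1 z1] VT_swap23[of K t d x e y f2 z2] VT_prod2[of K t d x f1 z1 e y f2 z2] VT_swap23[of K t d x "f1 + f2" "z1 \<otimes> z2" e y] by simp

text \<open>The semigroup generated by \<open>d\<close> and \<open>d + 1\<close> contains every
  \<open>n >= d * d\<close>: with \<open>j = n mod d\<close> one has
  \<open>n = i d + j (d + 1)\<close> for \<open>i = n div d - j\<close>, and \<open>i >= 1\<close>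
  because \<open>n div d >= d > j\<close>.\<close>

lemma degree_closure:
  fixes Pr :: "nat \<Rightarrow> 'a \<Rightarrow> bool"
  assumes cl: "\<And>d x e y. Pr d x \<Longrightarrow> Pr e y \<Longrightarrow> Pr (d + e) (x \<otimes> y)" and b: "Pr d x" "Pr (Suc d) x'" and d: "d \<ge> 1"
    and n: "n \<ge> d * d"
  shows "\<exists>z. Pr n z"
proof -
  have pow: "\<exists>z. Pr (i * e) z" if "Pr e y" "i \<ge> 1" for i e y
    using that(2)
  proof (induction i rule: dec_induct)
    case base then show ?case using that by auto
  next
    case (step i) then show ?case using cl[OF that(1)] by auto
  qed
  define j where "j = n mod d"
  define i where "i = n div d - j"
  have jd: "j < d" unfolding j_def using d by simp
  have "d \<le> n div d" using n d by (metis div_le_mono nonzero_mult_div_cancel_left not_one_le_zero)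
  then have i: "i \<ge> 1" "n div d = i + j" unfolding i_def using jd by auto
  have eq: "n = i * d + j * Suc d"
  proof -
    have "n = n div d * d + n mod d" by simp
    also have "\<dots> = (i + j) * d + j" using i(2) j_def by simp
    finally show ?thesis by (simp add: algebra_simps)
  qed
  obtain z1 where z1: "Pr (i * d) z1" using pow[OF b(1) i(1)] by blast
  show ?thesis
  proof (cases "j = 0")
    case True then show ?thesis using z1 eq by auto
  next
    case False
    then obtain z2 where "Pr (j * Suc d) z2" using pow[OF b(2), of j] by auto
    then show ?thesis using cl[OF z1] eq by auto
  qed
qed

end

context hyp
begin

lemma goodl_VT:
  assumes g: "goodl [(f, z), (e, y), (d, x)]"
  shows "\<exists>t. VT K t d x e y f z"
proof -
  let ?l = "[(f, z), (e, y), (d, x)]"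
  have c: "x \<in> D.kp d" "y \<in> D.kp e" "z \<in> D.kp f" using g by auto
  then have cc: "x \<in> \<A>" "y \<in> \<A>" "z \<in> \<A>" using D.kp_c by auto
  have zF: "Fm ?l i = S3 K d x e y f z i" for i unfolding S3_def using zero_sum[OF smul_idl[OF cc(1) D.kp_idl]] by simp
  have zA: "Ai ?l = PI3 x y z" using zero_sum[OF PI_idl[OF cc(1)]] by simp
  note vv = valabrega_valla[OF g]
  have reg: "reg3 x y z" using vv zero_sum[OF PI_idl[OF cc(1)]] unfolding reg3_def by auto
  have V: "V3 K d x e y f z" unfolding V3_def using vv zF zA reg c by auto
  obtain t where "\<forall>i\<ge>t. D.kp i \<subseteq> Fm ?l i" using complete_T[OF goodl_dg[OF g] complete3[OF g]] by auto
  then have "T3 K t d x e y f z" unfolding T3_def zF by auto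
  then show ?thesis using V unfolding VT_def by blast
qed

lemma VT_mono: "VT K t d x e y f z \<Longrightarrow> t \<le> t' \<Longrightarrow> VT K t' d x e y f z"
  unfolding VT_def T3_def by auto

lemma base_select:
  assumes "finite XX" "\<And>xs. xs \<in> XX \<Longrightarrow> goodl xs \<and> length xs \<le> 2"
  shows "\<exists>d x x'. d \<ge> 1 \<and> (\<forall>xs\<in>XX. goodl ((d, x) # xs) \<and> goodl ((Suc d, x') # xs))"
proof -
  obtain d0 where d0: "\<forall>d\<ge>d0. \<exists>x. \<forall>xs\<in>XX. goodl ((d, x) # xs)" using select[OF assms(1)] assms(2) not_complete by blast
  define d where "d = Suc d0"
  obtain x where x: "\<forall>xs\<in>XX. goodl ((d, x) # xs)" using d0[rule_format, of d] unfolding d_def by auto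
  obtain x' where "\<forall>xs\<in>XX. goodl ((Suc d, x') # xs)" using d0[rule_format, of "Suc d"] unfolding d_def by auto
  then have "d \<ge> 1 \<and> (\<forall>xs\<in>XX. goodl ((d, x) # xs) \<and> goodl ((Suc d, x') # xs))" using x unfolding d_def by simp
  then show ?thesis by blast
qed

text \<open>Each slot receives elements in two consecutive degrees, every new element being regular
  for all earlier choices at once. The eight triples have a common bound \<open>t\<close>, and
  multiplication within one slot preserves it; by \<open>degree_closure\<close> the slots reach
  degree \<open>n\<close> one after the other with \<open>t\<close> independent of
  \<open>n\<close>.\<close>

lemma parameters:
  "\<exists>n0 t. \<forall>n\<ge>n0. \<exists>x y z. VT K t n x n y n z"
proof -
  obtain d x x' where d: "d \<ge> 1" and gx: "goodl [(d, x)]" "goodl [(Suc d, x')]" using base_select[of "{[]}"] by auto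
  define S1 where "S1 = {(d, x), (Suc d, x')}"
  have g1: "goodl [p]" if "p \<in> S1" for p using that gx unfolding S1_def by auto
  obtain e y y' where e: "e \<ge> 1" and gy: "\<forall>xs\<in>(\<lambda>p. [p]) ` S1. goodl ((e, y) # xs) \<and> goodl ((Suc e, y') # xs)"
  proof -
    have "goodl xs \<and> length xs \<le> 2" if "xs \<in> (\<lambda>p. [p]) ` S1" for xs using that g1 by fastforce
    moreover have "finite ((\<lambda>p. [p]) ` S1)" unfolding S1_def by simp
    ultimately show thesis using base_select[of "(\<lambda>p. [p]) ` S1"] that by blast
  qed
  define S2 where "S2 = {(e, y), (Suc e, y')}"
  have g2: "goodl [q, p]" if "p \<in> S1" "q \<in> S2" for p q using that gy unfolding S2_def by auto
  define XX where "XX = (\<lambda>(p, q). [q, p]) ` (S1 \<times> S2)"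
  have "finite XX" unfolding XX_def S1_def S2_def by simp
  moreover have "goodl xs \<and> length xs \<le> 2" if "xs \<in> XX" for xs using that g2 unfolding XX_def by auto
  ultimately obtain f z z' where f: "f \<ge> 1" and gz: "\<forall>xs\<in>XX. goodl ((f, z) # xs) \<and> goodl ((Suc f, z') # xs)"
    using base_select[of XX] by blast
  define S3' where "S3' = {(f, z), (Suc f, z')}"
  have g3: "goodl [r, q, p]" if "p \<in> S1" "q \<in> S2" "r \<in> S3'" for p q r
  proof -
    have "[q, p] \<in> XX" unfolding XX_def using that by force
    then show ?thesis using gz that(3) unfolding S3'_def by auto
  qed
  have "\<forall>p\<in>S1. \<forall>q\<in>S2. \<forall>r\<in>S3'. \<exists>t. VT K t (fst p) (snd p) (fst q) (snd q) (fst r) (snd r)"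
    using g3 goodl_VT by (metis prod.collapse)
  then obtain tt where tt: "\<And>p q r. p \<in> S1 \<Longrightarrow> q \<in> S2 \<Longrightarrow> r \<in> S3' \<Longrightarrow> VT K (tt p q r) (fst p) (snd p) (fst q) (snd q) (fst r) (snd r)" by metis
  define t where "t = Max ((\<lambda>(p, q, r). tt p q r) ` (S1 \<times> S2 \<times> S3'))"
  have all: "VT K t (fst p) (snd p) (fst q) (snd q) (fst r) (snd r)" if h: "p \<in> S1" "q \<in> S2" "r \<in> S3'" for p q r
  proof (rule VT_mono[OF tt[OF h]])
    have "finite ((\<lambda>(p, q, r). tt p q r) ` (S1 \<times> S2 \<times> S3'))" unfolding S1_def S2_def S3'_def by simp
    then show "tt p q r \<le> t" unfolding t_def using h by (intro Max_ge) force+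
  qed
  have "\<exists>x y z. VT K t n x n y n z" if n: "n \<ge> d * d + e * e + f * f" for n
  proof -
    have "\<exists>u. \<forall>q\<in>S2. \<forall>r\<in>S3'. VT K t n u (fst q) (snd q) (fst r) (snd r)"
      by (rule degree_closure[where Pr = "\<lambda>n u. \<forall>q\<in>S2. \<forall>r\<in>S3'. VT K t n u (fst q) (snd q) (fst r) (snd r)", of d x x'])
        (use VT_prod1[OF D.K] all d n in \<open>auto simp: S1_def\<close>)
    then obtain u where u: "\<forall>q\<in>S2. \<forall>r\<in>S3'. VT K t n u (fst q) (snd q) (fst r) (snd r)" by blast
    have "\<exists>v. \<forall>r\<in>S3'. VT K t n u n v (fst r) (snd r)"
      by (rule degree_closure[where Pr = "\<lambda>n' v. \<forall>r\<in>S3'. VT K t n u n' v (fst r) (snd r)", of e y y'])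
        (use VT_prod2[OF D.K] u e n in \<open>auto simp: S2_def\<close>)
    then obtain v where v: "\<forall>r\<in>S3'. VT K t n u n v (fst r) (snd r)" by blast
    have "\<exists>w. VT K t n u n v n w"
      by (rule degree_closure[where Pr = "\<lambda>n' w. VT K t n u n v n' w", of f z z'])
        (use VT_prod3[OF D.K] v f n in \<open>auto simp: S3'_def\<close>)
    then show ?thesis by blast
  qed
  then show ?thesis by blast
qed

end

section \<open>Itoh's theorem\<close>

context cr
begin

text \<open>A power of a sum is contained in an ideal as soon as all mixed products are. The
  induction applies to the residual ideals of \<open>W\<close> by \<open>U\<close> and by
  \<open>V\<close>, so no sum over \<open>j\<close> has to be written.\<close>

lemma pw_sum_expand:
  assumes U: "idl U" and V: "idl V"
  shows "idl W \<Longrightarrow> (\<And>j. j \<le> n \<Longrightarrow> pw U (n - j) \<cdot> pw V j \<subseteq> W) \<Longrightarrow> pw (U \<boxplus> V) n \<subseteq> W"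
proof (induction n arbitrary: W)
  case 0
  have "pw U 0 \<cdot> pw V 0 = \<A>" using ideal_prod_one[OF oneideal] by simp
  then show ?case using 0(2)[of 0] by simp
next
  case (Suc n)
  have UV: "idl (U \<boxplus> V)" using sum_idl[OF U V] .
  let ?X = "\<lambda>B. {x \<in> \<A>. \<forall>b\<in>B. b \<otimes> x \<in> W}"
  have res: "idl (?X B)" if "idl B" for B
  proof (rule idlI)
    show "\<zero> \<in> ?X B" using idl_zero[OF Suc.prems(1)] idl_carr[OF that] by simp
  next
    fix a b assume "a \<in> ?X B" "b \<in> ?X B"
    then show "a \<oplus> b \<in> ?X B" using idl_add[OF Suc.prems(1)] idl_carr[OF that] by (simp add: r_distr)
  next
    fix a x assume a: "a \<in> ?X B" "x \<in> \<A>"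
    have "b \<otimes> (x \<otimes> a) = x \<otimes> (b \<otimes> a)" if "b \<in> B" for b
      using that a idl_carr[OF \<open>idl B\<close>] by (intro m_lcomm) auto
    then show "x \<otimes> a \<in> ?X B" using a idl_l[OF Suc.prems(1)] by simp
  qed auto
  have 1: "pw (U \<boxplus> V) n \<subseteq> ?X U"
  proof (rule Suc.IH[OF res[OF U]])
    fix j assume j: "j \<le> n"
    have "U \<cdot> (pw U (n - j) \<cdot> pw V j) = pw U (Suc n - j) \<cdot> pw V j"
      using ideal_prod_assoc[OF U pw_idl[OF U] pw_idl[OF V], of "n - j" j] j by (simp add: Suc_diff_le ipow.simps(2))
    then have "U \<cdot> (pw U (n - j) \<cdot> pw V j) \<subseteq> W" using Suc.prems(2)[of j] j by simp
    then show "pw U (n - j) \<cdot> pw V j \<subseteq> ?X U"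
      using prod_mem idl_carr[OF prod_idl[OF pw_idl[OF U] pw_idl[OF V]]] by blast
  qed
  have 2: "pw (U \<boxplus> V) n \<subseteq> ?X V"
  proof (rule Suc.IH[OF res[OF V]])
    fix j assume j: "j \<le> n"
    have "V \<cdot> (pw U (n - j) \<cdot> pw V j) = pw U (n - j) \<cdot> pw V (Suc j)"
      using ideal_prod_assoc[OF V pw_idl[OF U] pw_idl[OF V], of "n - j" j] ideal_prod_assoc[OF pw_idl[OF U] V pw_idl[OF V], of "n - j" j]
        ideal_prod_commute[OF V pw_idl[OF U], of "n - j"] by (simp add: ipow.simps(2))
    then have "V \<cdot> (pw U (n - j) \<cdot> pw V j) \<subseteq> W" using Suc.prems(2)[of "Suc j"] j by simp
    then show "pw U (n - j) \<cdot> pw V j \<subseteq> ?X V"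
      using prod_mem idl_carr[OF prod_idl[OF pw_idl[OF U] pw_idl[OF V]]] by blast
  qed
  have "U \<cdot> pw (U \<boxplus> V) n \<subseteq> W" "V \<cdot> pw (U \<boxplus> V) n \<subseteq> W"
    using 1 2 by (auto intro!: prod_least[OF Suc.prems(1)])
  then show ?case using prod_sum_l[OF U V pw_idl[OF UV], of n] sum_least[OF Suc.prems(1)] by (simp add: ipow.simps(2))
qed

lemma pw_prod: "idl U \<Longrightarrow> idl V \<Longrightarrow> pw (U \<cdot> V) n = pw U n \<cdot> pw V n"
proof (induction n)
  case 0 then show ?case using ideal_prod_one[OF oneideal] by simp
next
  case (Suc n)
  note U = Suc.prems(1) and V = Suc.prems(2)
  have "(U \<cdot> V) \<cdot> (pw U n \<cdot> pw V n) = U \<cdot> (V \<cdot> (pw U n \<cdot> pw V n))" by (rule ideal_prod_assoc[OF U V prod_idl[OF pw_idl[OF U] pw_idl[OF V]]])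
  also have "V \<cdot> (pw U n \<cdot> pw V n) = (V \<cdot> pw U n) \<cdot> pw V n" by (rule ideal_prod_assoc[OF V pw_idl[OF U] pw_idl[OF V], symmetric])
  also have "V \<cdot> pw U n = pw U n \<cdot> V" by (rule ideal_prod_commute[OF V pw_idl[OF U]])
  also have "(pw U n \<cdot> V) \<cdot> pw V n = pw U n \<cdot> (V \<cdot> pw V n)" by (rule ideal_prod_assoc[OF pw_idl[OF U] V pw_idl[OF V]])
  also have "U \<cdot> (pw U n \<cdot> (V \<cdot> pw V n)) = (U \<cdot> pw U n) \<cdot> (V \<cdot> pw V n)" by (rule ideal_prod_assoc[OF U pw_idl[OF U] prod_idl[OF V pw_idl[OF V]], symmetric])
  finally show ?case using Suc by (simp add: ipow.simps(2))
qed

lemma nzd_pow: "nzd U x \<Longrightarrow> x \<in> \<A> \<Longrightarrow> nzd U (x [^] (n::nat))"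
proof (induction n)
  case 0 then show ?case unfolding nzd_def by simp
next
  case (Suc n) then show ?case using nzd_mult[of U "x [^] n" x] by simp
qed

text \<open>Induction along the filtration by powers of \<open>y\<close>: since \<open>z\<close> is
  regular modulo \<open>y\<close>, the element \<open>a\<close> is a multiple of \<open>y\<close>
  modulo \<open>U\<close>, and cancelling one factor \<open>y\<close> leads back to the exponent
  \<open>n\<close>.\<close>

lemma nzd_mod_pow:
  assumes U: "idl U" and c: "y \<in> \<A>" "z \<in> \<A>" and y: "nzd U y" and z: "nzd (U \<boxplus> PIdl y) z"
  shows "nzd (U \<boxplus> PIdl (y [^] (n::nat))) z"
proof (induction n)
  case 0
  have "PIdl \<one> = \<A>" using idl_one[OF PI_idl PI_self] by simp
  then have "U \<boxplus> PIdl (y [^] (0::nat)) = \<A>" using sum_r[OF U PI_idl[OF one_closed]] idl_sub[OF sum_PI_idl[OF U one_closed]] by auto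
  then show ?case unfolding nzd_def by simp
next
  case (Suc n)
  have yn: "y [^] n \<in> \<A>" "y [^] Suc n \<in> \<A>" using c by auto
  show ?case unfolding nzd_def
  proof (intro ballI impI)
    fix a assume a: "a \<in> \<A>" "z \<otimes> a \<in> U \<boxplus> PIdl (y [^] Suc n)"
    obtain u r where ur: "u \<in> U" "r \<in> \<A>" "z \<otimes> a = u \<oplus> y [^] Suc n \<otimes> r" by (rule sumPIE[OF a(2) yn(2)])
    have uc: "u \<in> \<A>" using idl_carr[OF U ur(1)] .
    have e1: "y [^] Suc n \<otimes> r = y \<otimes> (y [^] n \<otimes> r)" using yn c ur(2) m_comm[of "y [^] n" y] m_assoc by simp
    have "z \<otimes> a \<in> U \<boxplus> PIdl y" unfolding ur(3) e1 using sumPI_mem[OF ur(1) _ c(1)] yn ur(2) by simp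
    then have "a \<in> U \<boxplus> PIdl y" using nzdD[OF z] a by blast
    then obtain v b where vb: "v \<in> U" "b \<in> \<A>" "a = v \<oplus> y \<otimes> b" using c(1) by (rule sumPIE)
    have vc: "v \<in> \<A>" using idl_carr[OF U vb(1)] .
    define q where "q = y [^] n"
    have qc: "q \<in> \<A>" unfolding q_def using yn by simp
    have "y \<otimes> (z \<otimes> b \<ominus> q \<otimes> r) = (z \<otimes> (v \<oplus> y \<otimes> b) \<ominus> y \<otimes> (q \<otimes> r)) \<ominus> z \<otimes> v" using c vb(2) qc ur(2) vc by algebra
    also have "\<dots> = (u \<oplus> y \<otimes> (q \<otimes> r) \<ominus> y \<otimes> (q \<otimes> r)) \<ominus> z \<otimes> v" using ur(3) e1 vb(3) unfolding q_def by simp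
    also have "\<dots> = u \<ominus> z \<otimes> v" using c qc ur(2) vc uc by algebra
    also have "\<dots> \<in> U" using idl_minus[OF U ur(1) idl_l[OF U vb(1) c(2)]] .
    finally have 1: "z \<otimes> b \<ominus> q \<otimes> r \<in> U" using nzdD[OF y] c vb(2) qc ur(2) by simp
    have "z \<otimes> b = (z \<otimes> b \<ominus> q \<otimes> r) \<oplus> q \<otimes> r" using c vb(2) qc ur(2) by algebra
    then have "z \<otimes> b \<in> U \<boxplus> PIdl q" using sumPI_mem[OF 1 ur(2) qc] by simp
    then have "b \<in> U \<boxplus> PIdl q" using Suc nzdD vb(2) unfolding q_def by blast
    then obtain v' b' where b: "v' \<in> U" "b' \<in> \<A>" "b = v' \<oplus> q \<otimes> b'" using qc by (rule sumPIE)
    have v'c: "v' \<in> \<A>" using idl_carr[OF U b(1)] .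
    have "a = (v \<oplus> y \<otimes> v') \<oplus> q \<otimes> y \<otimes> b'" unfolding vb(3) b(3) using c qc vc v'c b(2) by algebra
    then show "a \<in> U \<boxplus> PIdl (y [^] Suc n)" using sumPI_mem[OF idl_add[OF U vb(1) idl_l[OF U b(1) c(1)]] b(2) yn(2)] unfolding q_def by simp
  qed
qed

end

context lcr
begin

text \<open>Reflects that the graded ring of \<open>P = (x, y)\<close> is a polynomial ring over
  \<open>A/P\<close>. Two facts suffice: \<open>P^(T+1) <= x P^T + (y^(T+1))\<close>, and
  \<open>x w\<close> in \<open>P^(T+1)\<close> forces \<open>w\<close> in \<open>P^T\<close>. Since
  \<open>z\<close> is regular modulo \<open>(x, y^(T+1))\<close>, an element \<open>u\<close> with
  \<open>z u\<close> in \<open>P^(T+1)\<close> has the form \<open>x w + y^(T+1) v\<close>, and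
  \<open>w\<close> is handled by induction.\<close>

lemma nzd_pw:
  assumes r: "reg3 x y z" shows "nzd (pw (PIdl x \<boxplus> PIdl y) n) z"
proof -
  have c: "x \<in> \<A>" "y \<in> \<A>" "z \<in> \<A>" using reg3_c[OF r] by auto
  have nx: "nzd {\<zero>} x" and ny: "nzd (PIdl x) y" and nz: "nzd (PIdl x \<boxplus> PIdl y) z" using r unfolding reg3_def by auto
  define P where "P = PIdl x \<boxplus> PIdl y"
  have ix: "idl (PIdl x)" and iy: "idl (PIdl y)" using PI_idl c by auto
  have iP: "idl P" unfolding P_def using sum_idl[OF ix iy] .
  have xP: "x \<in> P" "y \<in> P" unfolding P_def using sum_l[OF ix iy] sum_r[OF ix iy] PI_self c by auto
  have yT: "y [^] T \<in> pw P T" for T :: nat using pw_nat_pow[OF iP, of y 1 T] xP pw_one[OF iP] by simp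
  have exp: "pw P (Suc T) \<subseteq> smul x (pw P T) \<boxplus> PIdl (y [^] Suc T)" for T
  proof -
    have yc: "y [^] Suc T \<in> \<A>" using c by (rule_tac nat_pow_closed)
    have iW: "idl (smul x (pw P T) \<boxplus> PIdl (y [^] Suc T))" using sum_PI_idl[OF smul_idl[OF c(1) pw_idl[OF iP]] yc] .
    show ?thesis unfolding P_def
    proof (rule pw_sum_expand[OF ix iy iW[unfolded P_def]])
      fix j assume j: "j \<le> Suc T"
      show "pw (PIdl x) (Suc T - j) \<cdot> pw (PIdl y) j \<subseteq> smul x (pw (PIdl x \<boxplus> PIdl y) T) \<boxplus> PIdl (y [^] Suc T)"
      proof (cases "j = Suc T")
        case True
        have "pw (PIdl x) 0 \<cdot> pw (PIdl y) (Suc T) \<subseteq> pw (PIdl y) (Suc T)" using ideal_prod_inter[OF pw_idl[OF ix] pw_idl[OF iy], of 0 "Suc T"] by blast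
        then show ?thesis using sum_r[OF smul_idl[OF c(1) pw_idl[OF iP]] PI_idl[OF yc], of T] pw_PI[OF c(2), of "Suc T"] True unfolding P_def by auto
      next
        case False
        then obtain i where i: "Suc T - j = Suc i" "T = i + j" using j by (metis Suc_diff_le add_diff_cancel_right' diff_add_inverse2 le_Suc_eq le_add_diff_inverse2)
        have "pw (PIdl x) (Suc i) \<cdot> pw (PIdl y) j = (PIdl x) \<cdot> (pw (PIdl x) i \<cdot> pw (PIdl y) j)"
          using ideal_prod_assoc[OF ix pw_idl[OF ix] pw_idl[OF iy], of i j] by (simp add: ipow.simps(2))
        also have "\<dots> = smul x (pw (PIdl x) i \<cdot> pw (PIdl y) j)" by (rule prod_PI[OF c(1) prod_idl[OF pw_idl[OF ix] pw_idl[OF iy]]])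
        also have "\<dots> \<subseteq> smul x (pw P T)" unfolding i(2) pw_add[OF iP] unfolding P_def
          using sum_l[OF ix iy] sum_r[OF ix iy] by (intro smul_mono prod_mono pw_mono) auto
        finally show ?thesis using sum_l[OF smul_idl[OF c(1) pw_idl[OF iP]] PI_idl[OF yc], of T] i(1) unfolding P_def by auto
      qed
    qed
  qed
  have colx: "w \<in> pw P T" if w: "w \<in> \<A>" "x \<otimes> w \<in> pw P (Suc T)" for w T
  proof -
    have yc: "y [^] Suc T \<in> \<A>" using c by (rule_tac nat_pow_closed)
    obtain s q where sq: "s \<in> smul x (pw P T)" "q \<in> \<A>" "x \<otimes> w = s \<oplus> y [^] Suc T \<otimes> q"
      using subsetD[OF exp w(2)] yc by (rule sumPIE)
    obtain p where p: "p \<in> pw P T" "s = x \<otimes> p" using sq(1) unfolding smul_def by blast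
    have pc: "p \<in> \<A>" using pw_carr[OF iP p(1)] .
    define Yt where "Yt = y [^] Suc T"
    have Yc: "Yt \<in> \<A>" unfolding Yt_def using yc .
    have "Yt \<otimes> q = x \<otimes> w \<ominus> x \<otimes> p" unfolding sq(3) p(2) Yt_def[symmetric] using Yc sq(2) c pc by algebra
    also have "\<dots> = x \<otimes> (w \<ominus> p)" using w(1) c pc by algebra
    finally have "Yt \<otimes> q \<in> PIdl x" using PI_iff[OF c(1)] w(1) pc by (metis minus_closed)
    then have "q \<in> PIdl x" using nzdD[OF nzd_pow[OF ny c(2)]] sq(2) unfolding Yt_def by blast
    then obtain q' where q': "q' \<in> \<A>" "q = x \<otimes> q'" using PI_iff[OF c(1)] by blast
    have "x \<otimes> (w \<ominus> (p \<oplus> Yt \<otimes> q')) = x \<otimes> w \<ominus> (x \<otimes> p \<oplus> Yt \<otimes> (x \<otimes> q'))" using w(1) c pc Yc q'(1) by algebra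
    also have "\<dots> = \<zero>" unfolding sq(3) p(2) Yt_def[symmetric] q'(2) using c pc Yc q'(1) by (simp add: a_minus_def r_neg)
    finally have "w \<ominus> (p \<oplus> Yt \<otimes> q') \<in> {\<zero>}" using nzdD[OF nx] w(1) pc Yc q'(1) by simp
    then have "w = p \<oplus> Yt \<otimes> q'" using w(1) pc Yc q'(1) by simp
    moreover have "Yt \<in> pw P T" unfolding Yt_def using yT[of "Suc T"] pw_antimono[OF iP, of T "Suc T"] by auto
    ultimately show ?thesis using idl_add[OF pw_idl[OF iP] p(1)] idl_r[OF pw_idl[OF iP] _ q'(1)] by simp
  qed
  have "nzd (pw P n) z" for n
  proof (induction n)
    case 0 then show ?case unfolding nzd_def by simp
  next
    case (Suc T)
    show ?case unfolding nzd_def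
    proof (intro ballI impI)
      fix u assume u: "u \<in> \<A>" "z \<otimes> u \<in> pw P (Suc T)"
      have yc: "y [^] Suc T \<in> \<A>" using c by (rule_tac nat_pow_closed)
      have "smul x (pw P T) \<boxplus> PIdl (y [^] Suc T) \<subseteq> PIdl x \<boxplus> PIdl (y [^] Suc T)"
        using smul_sub_PI[OF c(1) idl_sub[OF pw_idl[OF iP]]] by (intro sum_mono) auto
      then have "z \<otimes> u \<in> PIdl x \<boxplus> PIdl (y [^] Suc T)" using u(2) exp by blast
      then have "u \<in> PIdl x \<boxplus> PIdl (y [^] Suc T)" using nzdD[OF nzd_mod_pow[OF ix c(2,3) ny nz]] u(1) by blast
      then obtain s v where sv: "s \<in> PIdl x" "v \<in> \<A>" "u = s \<oplus> y [^] Suc T \<otimes> v" using yc by (rule sumPIE)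
      obtain w where w: "w \<in> \<A>" "s = x \<otimes> w" using sv(1) PI_iff[OF c(1)] by blast
      define Yt where "Yt = y [^] Suc T"
      have Yc: "Yt \<in> \<A>" unfolding Yt_def using yc .
      have YP: "Yt \<in> pw P (Suc T)" unfolding Yt_def using yT .
      have "x \<otimes> (z \<otimes> w) = z \<otimes> u \<ominus> Yt \<otimes> (z \<otimes> v)" unfolding sv(3) w(2) Yt_def[symmetric] using c w(1) Yc sv(2) by algebra
      also have "\<dots> \<in> pw P (Suc T)" using idl_minus[OF pw_idl[OF iP] u(2) idl_r[OF pw_idl[OF iP] YP]] c sv(2) by simp
      finally have "z \<otimes> w \<in> pw P T" using colx c w by simp
      then have "w \<in> pw P T" using nzdD[OF Suc] w by blast
      then have "x \<otimes> w \<in> pw P (Suc T)" using prod_mem[OF xP(1)] by (simp add: ipow.simps(2))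
      then show "u \<in> pw P (Suc T)" unfolding sv(3) w(2) Yt_def[symmetric] using idl_add[OF pw_idl[OF iP]] idl_r[OF pw_idl[OF iP] YP sv(2)] by blast
    qed
  qed
  then show ?thesis unfolding P_def .
qed

end

context lcr
begin

lemma PI2_mem: "x \<in> \<A> \<Longrightarrow> y \<in> \<A> \<Longrightarrow> x \<in> PIdl x \<boxplus> PIdl y \<and> y \<in> PIdl x \<boxplus> PIdl y"
  using subsetD[OF sum_l[OF PI_idl PI_idl] PI_self] subsetD[OF sum_r[OF PI_idl PI_idl] PI_self] by auto

text \<open>Read the hypotheses as orders: \<open>b\<close> and \<open>c\<close> have asymptotic
  \<open>K\<close>-order at least \<open>k/(k+1)\<close>, and then \<open>d\<close> has order at
  least \<open>(k+1)/(k+2)\<close>. With \<open>a'\<close> in \<open>K^2\<close>,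
  \<open>P = (x, y)\<close> and \<open>B = (b, c)\<close> one has \<open>z d\<close> in
  \<open>(a') + P B\<close>. In the expansion of \<open>(z d)^N\<close> every term either lies in a
  high power of \<open>P\<close> or has high order in \<open>K\<close>; working modulo that power of
  \<open>P\<close> and cancelling \<open>z^N\<close> bounds the order of \<open>d^N\<close>.\<close>

lemma itoh_step:
  assumes K: "idl K" and XYZ: "x \<in> K" "y \<in> K" "z \<in> K" and reg: "reg3 x y z"
    and e: "\<And>i. pw K (i + e) \<subseteq> pw (PI3 x y z) i"
    and ic: "integrally_closed_ideal R (pw K (Suc k))"
    and bcd: "b \<in> \<A>" "c \<in> \<A>" "d \<in> \<A>" and a: "x \<otimes> b \<oplus> y \<otimes> c \<oplus> z \<otimes> d \<in> pw K 2"
    and Sb: "b [^] Suc k \<in> pw K k" and Sc: "c [^] Suc k \<in> pw K k"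
  shows "d [^] Suc (Suc k) \<in> pw K (Suc k)"
proof -
  have cc: "x \<in> \<A>" "y \<in> \<A>" "z \<in> \<A>" using idl_carr[OF K] XYZ by auto
  define P where "P = PIdl x \<boxplus> PIdl y"
  define Q where "Q = P \<boxplus> PIdl z"
  define B where "B = PIdl b \<boxplus> PIdl c"
  define a' where "a' = x \<otimes> b \<oplus> y \<otimes> c \<oplus> z \<otimes> d"
  have iP: "idl P" unfolding P_def using sum_PI_idl PI_idl cc by blast
  have iQ: "idl Q" unfolding Q_def using sum_PI_idl iP cc by blast
  have iB: "idl B" unfolding B_def using sum_PI_idl PI_idl bcd by blast
  have PK: "P \<subseteq> K" unfolding P_def using PI_least[OF K] XYZ by (intro sum_least[OF K]) auto
  have QK: "Q \<subseteq> K" unfolding Q_def using PI_least[OF K] XYZ PK by (intro sum_least[OF K]) auto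
  have PQ: "P \<subseteq> Q" unfolding Q_def using sum_l[OF iP PI_idl] cc by auto
  have XP: "x \<in> P" "y \<in> P" unfolding P_def using PI2_mem cc by auto
  have ZQ: "z \<in> Q" unfolding Q_def using subsetD[OF sum_r[OF iP PI_idl] PI_self] cc by auto
  have bB: "b \<in> B" "c \<in> B" unfolding B_def using PI2_mem bcd by auto
  have powS: "u [^] n \<in> pw K (k * (n div Suc k))" if u: "u \<in> \<A>" "u [^] Suc k \<in> pw K k" for u and n :: nat
  proof -
    have "(u [^] Suc k) [^] (n div Suc k) \<otimes> u [^] (n mod Suc k) \<in> pw K (k * (n div Suc k))"
      by (rule idl_r[OF pw_idl[OF K] pw_nat_pow[OF K u(2)]]) (use u in simp)
    then show ?thesis unfolding nat_pow_pow[OF u(1)] nat_pow_mult[OF u(1)] mult_div_mod_eq .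
  qed
  \<comment> \<open>A mixed product \<open>b^(j-i) c^i\<close> loses one unit, because the two
    integer quotients add up to at least \<open>j div (k+1) - 1\<close>.\<close>
  have BK: "pw B j \<subseteq> pw K (k * (j div Suc k - 1))" for j
    unfolding B_def
  proof (rule pw_sum_expand[OF PI_idl[OF bcd(1)] PI_idl[OF bcd(2)] pw_idl[OF K]])
    fix i assume i: "i \<le> j"
    have "pw (PIdl b) (j - i) \<subseteq> pw K (k * ((j - i) div Suc k))" unfolding pw_PI[OF bcd(1)]
      by (rule PI_least[OF pw_idl[OF K] powS[OF bcd(1) Sb]])
    moreover have "pw (PIdl c) i \<subseteq> pw K (k * (i div Suc k))" unfolding pw_PI[OF bcd(2)]
      by (rule PI_least[OF pw_idl[OF K] powS[OF bcd(2) Sc]])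
    ultimately have 1: "pw (PIdl b) (j - i) \<cdot> pw (PIdl c) i \<subseteq> pw K (k * ((j - i) div Suc k) + k * (i div Suc k))"
      unfolding pw_add[OF K] by (rule prod_mono)
    have "j div Suc k \<le> (j - i) div Suc k + i div Suc k + 1"
    proof -
      have "j div Suc k = ((j - i) + i) div Suc k" using i by simp
      also have "\<dots> = (j - i) div Suc k + i div Suc k + ((j - i) mod Suc k + i mod Suc k) div Suc k" by (rule div_add1_eq)
      also have "((j - i) mod Suc k + i mod Suc k) div Suc k \<le> 1"
      proof -
        have "(j - i) mod Suc k + i mod Suc k < 2 * Suc k" unfolding mult_2 by (intro add_strict_mono mod_less_divisor zero_less_Suc)
        then have "((j - i) mod Suc k + i mod Suc k) div Suc k < 2" by (rule less_mult_imp_div_less)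
        then show ?thesis by linarith
      qed
      finally show ?thesis by simp
    qed
    then have "k * (j div Suc k - 1) \<le> k * ((j - i) div Suc k + i div Suc k)" by (intro mult_left_mono) auto
    then show "pw (PIdl b) (j - i) \<cdot> pw (PIdl c) i \<subseteq> pw K (k * (j div Suc k - 1))"
      using 1 pw_antimono[OF K] by (metis distrib_left subset_trans)
  qed
  have iPB: "idl (P \<cdot> B)" using prod_idl[OF iP iB] .
  have a'K: "a' \<in> pw K 2" unfolding a'_def by (rule a)
  have a'c: "a' \<in> \<A>" using pw_carr[OF K a'K] .
  have "\<ominus> (x \<otimes> b \<oplus> y \<otimes> c) \<in> P \<cdot> B" using idl_neg[OF iPB idl_add[OF iPB prod_mem[OF XP(1) bB(1)] prod_mem[OF XP(2) bB(2)]]] .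
  then have "\<ominus> (x \<otimes> b \<oplus> y \<otimes> c) \<oplus> a' \<otimes> \<one> \<in> P \<cdot> B \<boxplus> PIdl a'" using a'c by (intro sumPI_mem) auto
  moreover have "\<ominus> (x \<otimes> b \<oplus> y \<otimes> c) \<oplus> a' \<otimes> \<one> = z \<otimes> d" unfolding a'_def using cc bcd by algebra
  ultimately have Zd: "z \<otimes> d \<in> PIdl a' \<boxplus> P \<cdot> B" using sum_comm[OF idl_sub[OF iPB] idl_sub[OF PI_idl[OF a'c]]] by simp
  \<comment> \<open>One \<open>k\<close> pays for the rounding in \<open>BK\<close>, the other for
    the remainder of \<open>j\<close> modulo \<open>k + 1\<close>, and \<open>e\<close> for the
    passage from powers of \<open>K\<close> to powers of \<open>Q\<close>. The constant does not
    depend on \<open>M\<close>, so it is negligible asymptotically.\<close>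
  define c0 where "c0 = 2 * k + e"
  have key: "d [^] ((k + 2) * M + c0) \<in> pw K (Suc k * M)" for M
  proof -
    define T where "T = Suc k * M"
    define N where "N = (k + 2) * M + c0"
    \<comment> \<open>Terms of the expansion with \<open>j >= T\<close> lie in \<open>P^T\<close>.
      For \<open>j < T\<close> their order in \<open>K\<close> is at least \<open>N + T + e\<close>,
      which puts them into \<open>Q^(N+T)\<close>.\<close>
    define W where "W = pw P T \<boxplus> pw Q (N + T)"
    have iW: "idl W" unfolding W_def using sum_idl pw_idl iP iQ by blast
    have 1: "pw (PIdl a' \<boxplus> P \<cdot> B) N \<subseteq> W"
    proof (rule pw_sum_expand[OF PI_idl[OF a'c] iPB iW])
      fix j assume j: "j \<le> N"
      have VP: "pw (P \<cdot> B) j \<subseteq> pw P j" unfolding pw_prod[OF iP iB] using ideal_prod_inter[OF pw_idl[OF iP] pw_idl[OF iB], of j j] by blast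
      show "pw (PIdl a') (N - j) \<cdot> pw (P \<cdot> B) j \<subseteq> W"
      proof (cases "T \<le> j")
        case True
        have "pw (PIdl a') (N - j) \<cdot> pw (P \<cdot> B) j \<subseteq> pw (P \<cdot> B) j" using ideal_prod_inter[OF pw_idl[OF PI_idl[OF a'c]] pw_idl[OF iPB], of "N - j" j] by blast
        also have "\<dots> \<subseteq> pw P T" using VP pw_antimono[OF iP True] by (rule subset_trans)
        also have "\<dots> \<subseteq> W" unfolding W_def by (rule sum_l[OF pw_idl[OF iP] pw_idl[OF iQ]])
        finally show ?thesis .
      next
        case False
        have "pw (PIdl a') (N - j) \<subseteq> pw K (2 * (N - j))" unfolding pw_PI[OF a'c]
          by (rule PI_least[OF pw_idl[OF K] pw_nat_pow[OF K a'K]])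
        moreover have "pw (P \<cdot> B) j \<subseteq> pw K j \<cdot> pw K (k * (j div Suc k - 1))" unfolding pw_prod[OF iP iB]
          by (rule prod_mono[OF pw_mono[OF PK] BK])
        ultimately have "pw (PIdl a') (N - j) \<cdot> pw (P \<cdot> B) j \<subseteq> pw K (2 * (N - j) + (j + k * (j div Suc k - 1)))"
          unfolding pw_add[OF K] by (rule prod_mono)
        also have "\<dots> \<subseteq> pw K (N + T + e)"
        proof (rule pw_antimono[OF K])
          define q where "q = j div Suc k"
          define r where "r = j mod Suc k"
          have jq: "j = k * q + q + r" unfolding q_def r_def using div_mult_mod_eq[of j "Suc k"] by (simp add: algebra_simps)
          have rk: "r \<le> k" unfolding r_def using mod_less_divisor[of "Suc k" j] by simp
          have "q < M" using False unfolding q_def T_def by (simp add: less_mult_imp_div_less mult.commute not_le)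
          moreover have "k * q \<le> k * (q - 1) + k" by (cases q) auto
          ultimately have "N + T + e + 2 * j \<le> 2 * N + (j + k * (q - 1))"
            using jq rk unfolding N_def T_def c0_def by (simp add: algebra_simps)
          then show "N + T + e \<le> 2 * (N - j) + (j + k * (j div Suc k - 1))" unfolding q_def using j by linarith
        qed
        also have "\<dots> \<subseteq> pw Q (N + T)" using e unfolding Q_def P_def .
        also have "\<dots> \<subseteq> W" unfolding W_def by (rule sum_r[OF pw_idl[OF iP] pw_idl[OF iQ]])
        finally show ?thesis .
      qed
    qed
    have Zc: "z [^] j \<in> \<A>" for j :: nat using cc by simp
    \<comment> \<open>Expanding \<open>Q = P + (z)\<close>: a product with at most \<open>N\<close>
      factors \<open>z\<close> has at least \<open>T\<close> factors from \<open>P\<close>; any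
      other is divisible by \<open>z^N\<close> with cofactor in \<open>Q^T\<close>. So
      \<open>z^N (d^N - q)\<close> lies in \<open>P^T\<close> for some \<open>q\<close> in
      \<open>Q^T\<close>, and \<open>nzd_pw\<close> cancels \<open>z^N\<close>.\<close>
    define W' where "W' = pw P T \<boxplus> smul (z [^] N) (pw Q T)"
    have iW': "idl W'" unfolding W'_def using sum_idl pw_idl iP iQ smul_idl[OF Zc] by blast
    have 2: "pw Q (N + T) \<subseteq> W'" unfolding Q_def
    proof (rule pw_sum_expand[OF iP PI_idl[OF cc(3)] iW'])
      fix j assume j: "j \<le> N + T"
      show "pw P (N + T - j) \<cdot> pw (PIdl z) j \<subseteq> W'"
      proof (cases "j \<le> N")
        case True
        have "pw P (N + T - j) \<cdot> pw (PIdl z) j \<subseteq> pw P (N + T - j)" using ideal_prod_inter[OF pw_idl[OF iP] pw_idl[OF PI_idl[OF cc(3)]], of "N + T - j" j] by blast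
        also have "\<dots> \<subseteq> pw P T" using True by (intro pw_antimono[OF iP]) auto
        also have "\<dots> \<subseteq> W'" unfolding W'_def by (rule sum_l[OF pw_idl[OF iP] smul_idl[OF Zc pw_idl[OF iQ]]])
        finally show ?thesis .
      next
        case False
        define i where "i = N + T - j"
        have jj: "j = N + (j - N)" using False by simp
        have iT: "(j - N) + i = T" unfolding i_def using False j by simp
        have "pw P i \<cdot> pw (PIdl z) j = smul (z [^] j) (pw P i)"
          unfolding pw_PI[OF cc(3)] using ideal_prod_commute[OF pw_idl[OF iP] PI_idl[OF Zc], of i j] prod_PI[OF Zc pw_idl[OF iP], of j i] by simp
        also have "z [^] j = z [^] N \<otimes> z [^] (j - N)" using jj nat_pow_mult[OF cc(3), of N "j - N"] by simp
        also have "smul (z [^] N \<otimes> z [^] (j - N)) (pw P i) = smul (z [^] N) (smul (z [^] (j - N)) (pw P i))"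
          by (rule smul_smul[OF Zc Zc idl_sub[OF pw_idl[OF iP]], symmetric])
        also have "\<dots> \<subseteq> smul (z [^] N) (pw Q T)"
        proof (rule smul_mono)
          have "z [^] (j - N) \<in> pw Q (j - N)" using pw_nat_pow[OF iQ, of z 1 "j - N"] ZQ pw_one[OF iQ] by simp
          then show "smul (z [^] (j - N)) (pw P i) \<subseteq> pw Q T" unfolding smul_def iT[symmetric]
            using pw_mem_add[OF iQ] pw_mono[OF PQ, of i] by blast
        qed
        also have "\<dots> \<subseteq> W'" unfolding W'_def by (rule sum_r[OF pw_idl[OF iP] smul_idl[OF Zc pw_idl[OF iQ]]])
        finally show ?thesis unfolding i_def .
      qed
    qed
    have "W \<subseteq> W'" unfolding W_def using 2 sum_l[OF pw_idl[OF iP] smul_idl[OF Zc pw_idl[OF iQ]]] unfolding W'_def[symmetric]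
      by (intro sum_least[OF iW']) (auto simp: W'_def)
    moreover have "(z \<otimes> d) [^] N \<in> pw (PIdl a' \<boxplus> P \<cdot> B) N"
      using pw_nat_pow[OF sum_idl[OF PI_idl[OF a'c] iPB], of "z \<otimes> d" 1 N] Zd pw_one[OF sum_idl[OF PI_idl[OF a'c] iPB]] by simp
    ultimately have "z [^] N \<otimes> d [^] N \<in> W'" using 1 nat_pow_distrib[OF cc(3) bcd(3), of N] by auto
    then obtain p q where pq: "p \<in> pw P T" "q \<in> pw Q T" "z [^] N \<otimes> d [^] N = p \<oplus> z [^] N \<otimes> q" unfolding W'_def by (rule sum_smulE)
    define ZN where "ZN = z [^] N"
    define dN where "dN = d [^] N"
    have ec: "ZN \<in> \<A>" "dN \<in> \<A>" "p \<in> \<A>" "q \<in> \<A>" unfolding ZN_def dN_def using cc bcd pq pw_carr iP iQ by auto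
    have "ZN \<otimes> (dN \<ominus> q) = (ZN \<otimes> dN) \<ominus> ZN \<otimes> q" using ec by algebra
    also have "\<dots> = p \<oplus> ZN \<otimes> q \<ominus> ZN \<otimes> q" using pq(3) unfolding ZN_def dN_def by simp
    also have "\<dots> = p" using ec by algebra
    finally have "ZN \<otimes> (dN \<ominus> q) \<in> pw P T" using pq(1) by simp
    moreover have "nzd (pw P T) ZN" unfolding ZN_def P_def by (rule nzd_pow[OF nzd_pw[OF reg] cc(3)])
    ultimately have "dN \<ominus> q \<in> pw P T" using nzdD ec by (metis minus_closed)
    then have "dN \<ominus> q \<in> pw Q T" using pw_mono[OF PQ] by blast
    then have "(dN \<ominus> q) \<oplus> q \<in> pw Q T" using idl_add[OF pw_idl[OF iQ]] pq(2) by blast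
    moreover have "(dN \<ominus> q) \<oplus> q = dN" using ec by algebra
    ultimately show ?thesis using pw_mono[OF QK, of T] unfolding dN_def N_def T_def by auto
  qed
  define w where "w = d [^] Suc (Suc k)"
  have wc: "w \<in> \<A>" unfolding w_def using bcd by blast
  \<comment> \<open>The multiplier for \<open>integral_criterion\<close>: its order
    \<open>(k+1) c0\<close> makes up for the constant defect. For \<open>i < c0\<close> it suffices
    alone; for \<open>i = c0 + M\<close> the remaining order comes from \<open>key\<close> at
    \<open>M\<close>.\<close>
  define cx where "cx = x [^] (Suc k * c0)"
  have XK: "x [^] n \<in> pw K n" for n :: nat using pw_nat_pow[OF K, of x 1 n] XYZ pw_one[OF K] by simp
  have "cx \<otimes> w [^] i \<in> pw (pw K (Suc k)) i" for i
  proof (cases "c0 \<le> i")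
    case False
    have "Suc k * i \<le> Suc k * c0" using False by (intro mult_le_mono2) simp
    then have "cx \<in> pw K (Suc k * i)" unfolding cx_def using subsetD[OF pw_antimono[OF K] XK] by blast
    then show ?thesis unfolding pw_pw[OF K] using idl_r[OF pw_idl[OF K]] wc by simp
  next
    case True
    then obtain M where M: "i = c0 + M" using le_Suc_ex by blast
    have "(k + 2) * M + c0 + (Suc k * c0) = Suc (Suc k) * i" unfolding M by (simp add: algebra_simps)
    then have "w [^] i = d [^] ((k + 2) * M + c0) \<otimes> d [^] (Suc k * c0)" unfolding w_def using nat_pow_pow[OF bcd(3)] nat_pow_mult[OF bcd(3)] by metis
    then have "w [^] i \<in> pw K (Suc k * M)" using idl_r[OF pw_idl[OF K] key[of M]] bcd by simp
    then have "cx \<otimes> w [^] i \<in> pw K (Suc k * c0 + Suc k * M)" unfolding cx_def by (intro pw_mem_add[OF K] XK)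
    moreover have "Suc k * c0 + Suc k * M = Suc k * i" unfolding M by (rule distrib_left[symmetric])
    ultimately show ?thesis unfolding pw_pw[OF K] by simp
  qed
  moreover have "cx \<in> \<A>" unfolding cx_def using cc by simp
  moreover have "nzd {\<zero>} cx" unfolding cx_def using nzd_pow cc reg unfolding reg3_def by blast
  ultimately have "w \<in> ideal_int_closure R (pw K (Suc k))" using integral_criterion[OF pw_idl[OF K]] wc by blast
  then show ?thesis using ic unfolding integrally_closed_ideal_def w_def by blast
qed

text \<open>The starting case \<open>k = 0\<close> is void, since \<open>K^0\<close> is the whole
  ring. Applying \<open>itoh_step\<close> with each of \<open>x, y, z\<close> in the last position
  improves all three orders together. As \<open>k\<close> grows the orders tend to 1:
  \<open>u^(k+1)\<close> in \<open>K^k\<close> for all \<open>k\<close> gives \<open>x u^i\<close>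
  in \<open>K^i\<close> for all \<open>i\<close>, so \<open>u\<close> is integral over
  \<open>K\<close>.\<close>

lemma itoh:
  assumes K: "idl K" and XYZ: "x \<in> K" "y \<in> K" "z \<in> K" and reg: "reg3 x y z"
    and e: "\<And>i. pw K (i + e) \<subseteq> pw (PI3 x y z) i"
    and ic: "\<And>i. i \<ge> 1 \<Longrightarrow> integrally_closed_ideal R (pw K i)"
    and bcd: "b \<in> \<A>" "c \<in> \<A>" "d \<in> \<A>" and a: "x \<otimes> b \<oplus> y \<otimes> c \<oplus> z \<otimes> d \<in> pw K 2"
  shows "b \<in> K" "c \<in> K" "d \<in> K"
proof -
  have cc: "x \<in> \<A>" "y \<in> \<A>" "z \<in> \<A>" using idl_carr[OF K] XYZ by auto
  have s: "PIdl x \<subseteq> \<A>" "PIdl y \<subseteq> \<A>" "PIdl z \<subseteq> \<A>" using PI_idl idl_sub cc by auto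
  have q1: "PI3 x y z = PIdl x \<boxplus> PIdl z \<boxplus> PIdl y" using sum3_swap23 s by blast
  have q2: "PIdl x \<boxplus> PIdl z \<boxplus> PIdl y = PIdl z \<boxplus> PIdl x \<boxplus> PIdl y" using sum3_swap12 s by blast
  have q3: "PIdl z \<boxplus> PIdl x \<boxplus> PIdl y = PIdl z \<boxplus> PIdl y \<boxplus> PIdl x" using sum3_swap23 s by blast
  have r1: "reg3 x z y" using reg3_swap23[OF reg] .
  have r2: "reg3 z y x" using reg3_swap23[OF reg3_swap12[OF r1]] .
  have a1: "x \<otimes> b \<oplus> z \<otimes> d \<oplus> y \<otimes> c \<in> pw K 2"
  proof -
    have "x \<otimes> b \<oplus> z \<otimes> d \<oplus> y \<otimes> c = x \<otimes> b \<oplus> y \<otimes> c \<oplus> z \<otimes> d" using cc bcd by algebra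
    then show ?thesis using a by simp
  qed
  have a2: "z \<otimes> d \<oplus> y \<otimes> c \<oplus> x \<otimes> b \<in> pw K 2"
  proof -
    have "z \<otimes> d \<oplus> y \<otimes> c \<oplus> x \<otimes> b = x \<otimes> b \<oplus> y \<otimes> c \<oplus> z \<otimes> d" using cc bcd by algebra
    then show ?thesis using a by simp
  qed
  have S: "b [^] Suc k \<in> pw K k \<and> c [^] Suc k \<in> pw K k \<and> d [^] Suc k \<in> pw K k" for k
  proof (induction k)
    case 0 then show ?case using bcd by simp
  next
    case (Suc k)
    have i: "integrally_closed_ideal R (pw K (Suc k))" using ic by simp
    have "d [^] Suc (Suc k) \<in> pw K (Suc k)" using itoh_step[OF K XYZ reg e i bcd a] Suc by blast
    moreover have "c [^] Suc (Suc k) \<in> pw K (Suc k)"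
      using itoh_step[OF K XYZ(1,3,2) r1 e[unfolded q1] i bcd(1,3,2) a1] Suc by blast
    moreover have "b [^] Suc (Suc k) \<in> pw K (Suc k)"
      using itoh_step[OF K XYZ(3,2,1) r2 e[unfolded q1 q2 q3] i bcd(3,2,1) a2] Suc by blast
    ultimately show ?case by blast
  qed
  have fin: "u \<in> K" if u: "u \<in> \<A>" "\<And>k. u [^] Suc k \<in> pw K k" for u
  proof -
    have "x \<otimes> u [^] i \<in> pw K i" for i :: nat
    proof (cases i)
      case 0 then show ?thesis using u cc by simp
    next
      case (Suc k)
      then show ?thesis using prod_mem[OF XYZ(1) u(2)[of k]] by (simp add: ipow.simps(2))
    qed
    moreover have "nzd {\<zero>} x" using reg unfolding reg3_def by blast
    ultimately have "u \<in> ideal_int_closure R K" using integral_criterion[OF K cc(1) _ u(1)] by blast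
    then show ?thesis using ic[of 1] pw_one[OF K] unfolding integrally_closed_ideal_def by auto
  qed
  show "b \<in> K" "c \<in> K" "d \<in> K" using fin S bcd by blast+
qed

text \<open>The initial forms of \<open>x, y, z\<close> in degree 1 behave like a regular sequence up to degree 1.\<close>

definition kz2 :: "'a set \<Rightarrow> 'a \<Rightarrow> 'a \<Rightarrow> 'a \<Rightarrow> bool" where
  "kz2 K x y z \<longleftrightarrow> (\<forall>b\<in>\<A>. \<forall>c\<in>\<A>. \<forall>d\<in>\<A>. x \<otimes> b \<oplus> y \<otimes> c \<oplus> z \<otimes> d \<in> pw K 2 \<longrightarrow> b \<in> K \<and> c \<in> K \<and> d \<in> K)"

text \<open>Exactness of the Koszul complex: every syzygy of a regular sequence is a combination of
  the trivial ones, with coefficients \<open>p, q, s\<close>.\<close>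

lemma reg3_syz:
  assumes reg: "reg3 x y z" and w: "u \<in> \<A>" "v \<in> \<A>" "w \<in> \<A>" and z: "x \<otimes> u \<oplus> y \<otimes> v \<oplus> z \<otimes> w = \<zero>"
  shows "\<exists>p\<in>\<A>. \<exists>q\<in>\<A>. \<exists>s\<in>\<A>. u = y \<otimes> p \<oplus> z \<otimes> q \<and> v = z \<otimes> s \<ominus> x \<otimes> p \<and> w = \<ominus> (x \<otimes> q \<oplus> y \<otimes> s)"
proof -
  have c: "x \<in> \<A>" "y \<in> \<A>" "z \<in> \<A>" using reg3_c[OF reg] by auto
  have r2: "reg3 y z x" using reg3_swap23[OF reg3_swap12[OF reg]] .
  have "x \<otimes> u = \<zero> \<ominus> (y \<otimes> v \<oplus> z \<otimes> w)" unfolding z[symmetric] using c w by algebra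
  also have "\<dots> = y \<otimes> (\<ominus> v) \<oplus> z \<otimes> (\<ominus> w)" using c w by algebra
  also have "\<dots> \<in> PIdl y \<boxplus> PIdl z" using c w PI_iff[OF c(2)] by (intro sumPI_mem) auto
  finally have "u \<in> PIdl y \<boxplus> PIdl z" using r2 nzdD w unfolding reg3_def by blast
  then obtain u' q where q: "u' \<in> PIdl y" "q \<in> \<A>" "u = u' \<oplus> z \<otimes> q" using c(3) by (rule sumPIE)
  obtain p where p: "p \<in> \<A>" "u' = y \<otimes> p" using q(1) PI_iff[OF c(2)] by blast
  have "y \<otimes> (x \<otimes> p \<oplus> v) \<oplus> z \<otimes> (x \<otimes> q \<oplus> w) = x \<otimes> (y \<otimes> p \<oplus> z \<otimes> q) \<oplus> y \<otimes> v \<oplus> z \<otimes> w" using c w p(1) q(2) by algebra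
  also have "\<dots> = \<zero>" using z p(2) q(3) by simp
  finally have e: "y \<otimes> (x \<otimes> p \<oplus> v) \<oplus> z \<otimes> (x \<otimes> q \<oplus> w) = \<zero>" .
  have "z \<otimes> (x \<otimes> q \<oplus> w) = (y \<otimes> (x \<otimes> p \<oplus> v) \<oplus> z \<otimes> (x \<otimes> q \<oplus> w)) \<oplus> y \<otimes> (\<ominus> (x \<otimes> p \<oplus> v))" using c w p(1) q(2) by algebra
  also have "\<dots> = y \<otimes> (\<ominus> (x \<otimes> p \<oplus> v))" unfolding e using c w p(1) by simp
  finally have "z \<otimes> (x \<otimes> q \<oplus> w) \<in> PIdl y" using PI_iff[OF c(2)] c w p(1) by blast
  moreover have "nzd (PIdl y) z" using r2 unfolding reg3_def by blast
  ultimately have "x \<otimes> q \<oplus> w \<in> PIdl y" using nzdD c w q(2) by blast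
  then obtain s' where s': "s' \<in> \<A>" "x \<otimes> q \<oplus> w = y \<otimes> s'" using PI_iff[OF c(2)] by blast
  define s where "s = \<ominus> s'"
  have s: "s \<in> \<A>" "x \<otimes> q \<oplus> w = \<ominus> (y \<otimes> s)" unfolding s_def using s' c r_minus by simp_all
  have w': "w = \<ominus> (x \<otimes> q \<oplus> y \<otimes> s)"
  proof -
    have "w = (x \<otimes> q \<oplus> w) \<ominus> x \<otimes> q" using c w q(2) by algebra
    also have "\<dots> = \<ominus> (y \<otimes> s) \<ominus> x \<otimes> q" unfolding s(2) ..
    also have "\<dots> = \<ominus> (x \<otimes> q \<oplus> y \<otimes> s)" using c q(2) s(1) by algebra
    finally show ?thesis .
  qed
  have "y \<otimes> (x \<otimes> p \<oplus> v \<ominus> z \<otimes> s) = y \<otimes> (x \<otimes> p \<oplus> v) \<oplus> z \<otimes> (\<ominus> (y \<otimes> s))" using c w p(1) s(1) by algebra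
  also have "\<dots> = \<zero>" unfolding s(2)[symmetric] by (rule e)
  finally have "x \<otimes> p \<oplus> v \<ominus> z \<otimes> s \<in> {\<zero>}" using r2 nzdD[of "{\<zero>}" y "x \<otimes> p \<oplus> v \<ominus> z \<otimes> s"] c w p(1) s(1) unfolding reg3_def by simp
  then have e2: "x \<otimes> p \<oplus> v \<ominus> z \<otimes> s = \<zero>" by simp
  have "v = (x \<otimes> p \<oplus> v \<ominus> z \<otimes> s) \<oplus> (z \<otimes> s \<ominus> x \<otimes> p)" using c w p(1) s(1) by algebra
  also have "\<dots> = z \<otimes> s \<ominus> x \<otimes> p" unfolding e2 using c p(1) s(1) by simp
  finally show ?thesis using p q w' s by blast
qed

text \<open>The condition in degree 2 offers a second representation of the same element with
  coefficients in \<open>K\<close>. The two differ by a Koszul syzygy, whose entries lie in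
  \<open>K\<close> because \<open>x, y, z\<close> do.\<close>

lemma kz2_V3:
  assumes K: "idl K" and V: "V3 K 1 x 1 y 1 z"
  shows "kz2 K x y z"
  unfolding kz2_def
proof (intro ballI impI)
  fix b c d assume h: "b \<in> \<A>" "c \<in> \<A>" "d \<in> \<A>" "x \<otimes> b \<oplus> y \<otimes> c \<oplus> z \<otimes> d \<in> pw K 2"
  have XK: "x \<in> K" "y \<in> K" "z \<in> K" and reg: "reg3 x y z" using V pw_one[OF K] unfolding V3_def by auto
  have cc: "x \<in> \<A>" "y \<in> \<A>" "z \<in> \<A>" using reg3_c[OF reg] by auto
  have "x \<otimes> b \<oplus> y \<otimes> c \<oplus> z \<otimes> d \<in> PI3 x y z" using h cc PI_iff by (intro sumPI_mem) auto
  then have "x \<otimes> b \<oplus> y \<otimes> c \<oplus> z \<otimes> d \<in> S3 K 1 x 1 y 1 z 2" using V h(4) unfolding V3_def by blast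
  then obtain u v w where u: "u \<in> pw K (2 - 1)" "v \<in> pw K (2 - 1)" "w \<in> pw K (2 - 1)" "x \<otimes> b \<oplus> y \<otimes> c \<oplus> z \<otimes> d = x \<otimes> u \<oplus> y \<otimes> v \<oplus> z \<otimes> w"
    unfolding S3_mem by blast
  have uK: "u \<in> K" "v \<in> K" "w \<in> K" using u pw_one[OF K] by auto
  have uc: "u \<in> \<A>" "v \<in> \<A>" "w \<in> \<A>" using uK idl_carr[OF K] by auto
  have "x \<otimes> (b \<ominus> u) \<oplus> y \<otimes> (c \<ominus> v) \<oplus> z \<otimes> (d \<ominus> w) = (x \<otimes> b \<oplus> y \<otimes> c \<oplus> z \<otimes> d) \<ominus> (x \<otimes> u \<oplus> y \<otimes> v \<oplus> z \<otimes> w)"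
    using cc h uc by algebra
  also have "\<dots> = \<zero>" unfolding u(4) using cc uc by (simp add: a_minus_def r_neg)
  finally have e: "x \<otimes> (b \<ominus> u) \<oplus> y \<otimes> (c \<ominus> v) \<oplus> z \<otimes> (d \<ominus> w) = \<zero>" .
  obtain p q s where s: "p \<in> \<A>" "q \<in> \<A>" "s \<in> \<A>" "b \<ominus> u = y \<otimes> p \<oplus> z \<otimes> q" "c \<ominus> v = z \<otimes> s \<ominus> x \<otimes> p" "d \<ominus> w = \<ominus> (x \<otimes> q \<oplus> y \<otimes> s)"
    using reg3_syz[OF reg _ _ _ e] h uc by auto
  have "b \<ominus> u \<in> K" "c \<ominus> v \<in> K" "d \<ominus> w \<in> K" unfolding s(4-6) using s(1-3) XK idl_r[OF K] idl_add[OF K] idl_minus[OF K] idl_neg[OF K] by auto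
  then have "(b \<ominus> u) \<oplus> u \<in> K" "(c \<ominus> v) \<oplus> v \<in> K" "(d \<ominus> w) \<oplus> w \<in> K" using uK idl_add[OF K] by auto
  moreover have "(b \<ominus> u) \<oplus> u = b" "(c \<ominus> v) \<oplus> v = c" "(d \<ominus> w) \<oplus> w = d" using h uc by algebra+
  ultimately show "b \<in> K \<and> c \<in> K \<and> d \<in> K" by simp
qed

end

section \<open>Length formulas for parameter ideals\<close>

context lcr
begin

text \<open>Here \<open>W = Q K^2\<close>. Adding \<open>x\<close>, \<open>y\<close>,
  \<open>z\<close> to \<open>W\<close> in turn, the colon ideals are \<open>K^2\<close>,
  \<open>K^2 + (x)\<close> and \<open>K^2 + (x, y)\<close>. Adding \<open>x\<close> and
  \<open>y\<close> to \<open>K^2\<close>, the colon ideal is \<open>K\<close> both times. So the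
  three colengths are those of \<open>K^2\<close> diminished by 0, 1 and 2 copies of that of
  \<open>K\<close>.\<close>

lemma col_QK2:
  assumes K: "idl K" and xyz: "x \<in> K" "y \<in> K" "z \<in> K" and reg: "reg3 x y z" and kz: "kz2 K x y z"
    and W: "W = smul x (pw K 2) \<boxplus> smul y (pw K 2) \<boxplus> smul z (pw K 2)" and fW: "fin W" and f2: "fin (pw K 2)"
  shows "col W + 3 * col K = col (PI3 x y z) + 3 * col (pw K 2)"
proof -
  have c: "x \<in> \<A>" "y \<in> \<A>" "z \<in> \<A>" using reg3_c[OF reg] by auto
  define k where "k = pw K 2"
  have ik: "idl k" unfolding k_def using pw_idl[OF K] .
  have kc: "u \<in> \<A>" if "u \<in> k" for u using idl_carr[OF ik that] .
  have kk: "u \<otimes> v \<in> k" if "u \<in> K" "v \<in> K" for u v using pw_mem_add[OF K, of u 1 v 1] that pw_one[OF K] unfolding k_def by (simp add: numeral_2_eq_2)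
  have kz': "b \<in> K \<and> c \<in> K \<and> d \<in> K" if "x \<otimes> b \<oplus> y \<otimes> c \<oplus> z \<otimes> d = u" "u \<in> k" "b \<in> \<A>" "c \<in> \<A>" "d \<in> \<A>" for b c d u
    using kz that unfolding kz2_def k_def by blast
  have iW: "idl W" using fin_idl[OF fW] .
  have WE: "\<exists>b\<in>k. \<exists>c\<in>k. \<exists>d\<in>k. a = x \<otimes> b \<oplus> y \<otimes> c \<oplus> z \<otimes> d" if "a \<in> W" for a
    using that unfolding W k_def[symmetric] smul_def by (auto elim!: sumE)
  have WI: "x \<otimes> b \<oplus> y \<otimes> c \<oplus> z \<otimes> d \<in> W" if "b \<in> k" "c \<in> k" "d \<in> k" for b c d
    unfolding W k_def[symmetric] using that by (intro sum_mem smul_mem)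
  have Wxyz: "x \<otimes> b \<in> W" "y \<otimes> b \<in> W" "z \<otimes> b \<in> W" if "b \<in> k" for b
    using WI[OF that idl_zero[OF ik] idl_zero[OF ik]] WI[OF idl_zero[OF ik] that idl_zero[OF ik]] WI[OF idl_zero[OF ik] idl_zero[OF ik] that] kc[OF that] c by simp_all
  define U1 where "U1 = W \<boxplus> PIdl x"
  define U2 where "U2 = U1 \<boxplus> PIdl y"
  define k1 where "k1 = k \<boxplus> PIdl x"
  define k2 where "k2 = k1 \<boxplus> PIdl y"
  have iU1: "idl U1" unfolding U1_def using sum_PI_idl[OF iW c(1)] .
  have iU2: "idl U2" unfolding U2_def using sum_PI_idl[OF iU1 c(2)] .
  have ik1: "idl k1" unfolding k1_def using sum_PI_idl[OF ik c(1)] .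
  have ik2: "idl k2" unfolding k2_def using sum_PI_idl[OF ik1 c(2)] .
  have WU1: "W \<subseteq> U1" "x \<in> U1" unfolding U1_def using sum_l[OF iW PI_idl[OF c(1)]] sum_r[OF iW PI_idl[OF c(1)]] PI_self[OF c(1)] by auto
  have U12: "U1 \<subseteq> U2" "y \<in> U2" unfolding U2_def using sum_l[OF iU1 PI_idl[OF c(2)]] sum_r[OF iU1 PI_idl[OF c(2)]] PI_self[OF c(2)] by auto
  have kk1: "k \<subseteq> k1" "x \<in> k1" unfolding k1_def using sum_l[OF ik PI_idl[OF c(1)]] sum_r[OF ik PI_idl[OF c(1)]] PI_self[OF c(1)] by auto
  have k12: "k1 \<subseteq> k2" "y \<in> k2" unfolding k2_def using sum_l[OF ik1 PI_idl[OF c(2)]] sum_r[OF ik1 PI_idl[OF c(2)]] PI_self[OF c(2)] by auto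
  \<comment> \<open>A representation of \<open>x w\<close> in \<open>W\<close> is a syzygy of
    \<open>x, y, z\<close>, hence Koszul. Its second and third entries lie in \<open>K^2\<close>, so
    by \<open>kz2\<close> the coefficients \<open>p\<close> and \<open>q\<close> lie in
    \<open>K\<close>, and \<open>w\<close> agrees with \<open>b\<close> modulo
    \<open>K^2\<close>.\<close>
  have A: "colon W x = k"
  proof (intro subset_antisym subsetI)
    fix w assume "w \<in> k" then show "w \<in> colon W x" unfolding colon_def using Wxyz kc by simp
  next
    fix w assume "w \<in> colon W x"
    then have w: "w \<in> \<A>" "x \<otimes> w \<in> W" unfolding colon_def by auto
    obtain b b' d where h: "b \<in> k" "b' \<in> k" "d \<in> k" "x \<otimes> w = x \<otimes> b \<oplus> y \<otimes> b' \<oplus> z \<otimes> d" using WE[OF w(2)] by blast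
    note hc = kc[OF h(1)] kc[OF h(2)] kc[OF h(3)]
    have "x \<otimes> (b \<ominus> w) \<oplus> y \<otimes> b' \<oplus> z \<otimes> d = (x \<otimes> b \<oplus> y \<otimes> b' \<oplus> z \<otimes> d) \<ominus> x \<otimes> w" using c hc w(1) by algebra
    also have "\<dots> = \<zero>" unfolding h(4) using c hc by (simp add: a_minus_def r_neg)
    finally obtain p q s where s: "p \<in> \<A>" "q \<in> \<A>" "s \<in> \<A>" "b \<ominus> w = y \<otimes> p \<oplus> z \<otimes> q" "b' = z \<otimes> s \<ominus> x \<otimes> p" "d = \<ominus> (x \<otimes> q \<oplus> y \<otimes> s)"
      using reg3_syz[OF reg _ hc(2,3)] hc w(1) by (metis minus_closed)
    have "x \<otimes> (\<ominus> p) \<oplus> y \<otimes> \<zero> \<oplus> z \<otimes> s = b'" unfolding s(5) using c s(1-3) by algebra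
    then have p: "\<ominus> p \<in> K" using kz' h(2) s(1,3) by blast
    have "x \<otimes> (\<ominus> q) \<oplus> y \<otimes> (\<ominus> s) \<oplus> z \<otimes> \<zero> = d" unfolding s(6) using c s(1-3) by algebra
    then have q: "\<ominus> q \<in> K" using kz' h(3) s(2,3) by blast
    have "w = b \<oplus> \<ominus> (b \<ominus> w)" using hc w(1) by algebra
    also have "\<dots> = b \<oplus> (y \<otimes> (\<ominus> p) \<oplus> z \<otimes> (\<ominus> q))" unfolding s(4) using c hc s(1-3) by algebra
    also have "\<dots> \<in> k" using idl_add[OF ik] kk xyz p q h(1) by simp
    finally show "w \<in> k" .
  qed
  have B: "colon U1 y = k1"
  proof (intro subset_antisym subsetI)
    fix w assume "w \<in> k1"
    moreover have "k1 \<subseteq> colon U1 y" unfolding k1_def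
    proof (rule sum_least[OF colon_idl[OF iU1 c(2)]])
      show "k \<subseteq> colon U1 y" unfolding colon_def using Wxyz WU1 kc by auto
      show "PIdl x \<subseteq> colon U1 y" using PI_least[OF colon_idl[OF iU1 c(2)]] idl_l[OF iU1 WU1(2) c(2)] c unfolding colon_def by simp
    qed
    ultimately show "w \<in> colon U1 y" by blast
  next
    fix w assume "w \<in> colon U1 y"
    then have w: "w \<in> \<A>" "y \<otimes> w \<in> U1" unfolding colon_def by auto
    obtain a r where ar: "a \<in> W" "r \<in> \<A>" "y \<otimes> w = a \<oplus> x \<otimes> r" using w(2) c(1) unfolding U1_def by (rule sumPIE)
    obtain b b' d where h: "b \<in> k" "b' \<in> k" "d \<in> k" "a = x \<otimes> b \<oplus> y \<otimes> b' \<oplus> z \<otimes> d" using WE[OF ar(1)] by blast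
    note hc = kc[OF h(1)] kc[OF h(2)] kc[OF h(3)]
    have "x \<otimes> (b \<oplus> r) \<oplus> y \<otimes> (b' \<ominus> w) \<oplus> z \<otimes> d = (x \<otimes> b \<oplus> y \<otimes> b' \<oplus> z \<otimes> d) \<oplus> x \<otimes> r \<ominus> y \<otimes> w" using c hc w(1) ar(2) by algebra
    also have "\<dots> = \<zero>" unfolding ar(3) h(4) using c hc ar(2) by (simp add: a_minus_def r_neg)
    finally obtain p q s where s: "p \<in> \<A>" "q \<in> \<A>" "s \<in> \<A>" "b' \<ominus> w = z \<otimes> s \<ominus> x \<otimes> p" "d = \<ominus> (x \<otimes> q \<oplus> y \<otimes> s)"
      using reg3_syz[OF reg _ _ hc(3)] hc w(1) ar(2) by (metis minus_closed a_closed)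
    have "x \<otimes> (\<ominus> q) \<oplus> y \<otimes> (\<ominus> s) \<oplus> z \<otimes> \<zero> = d" unfolding s(5) using c s(1-3) by algebra
    then have q: "\<ominus> s \<in> K" using kz' h(3) s(2,3) by blast
    have "w = b' \<oplus> \<ominus> (b' \<ominus> w)" using hc w(1) by algebra
    also have "\<dots> = (b' \<oplus> z \<otimes> (\<ominus> s)) \<oplus> x \<otimes> p" unfolding s(4) using c hc s(1-3) by algebra
    also have "\<dots> \<in> k1" unfolding k1_def using sumPI_mem[OF idl_add[OF ik h(2) kk[OF xyz(3) q]] s(1) c(1)] .
    finally show "w \<in> k1" .
  qed
  have C: "colon U2 z = k2"
  proof (intro subset_antisym subsetI)
    fix w assume "w \<in> k2"
    moreover have "k2 \<subseteq> colon U2 z" unfolding k2_def k1_def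
    proof (rule sum_least[OF colon_idl[OF iU2 c(3)] sum_least[OF colon_idl[OF iU2 c(3)]]])
      show "k \<subseteq> colon U2 z" unfolding colon_def using Wxyz subset_trans[OF WU1(1) U12(1)] kc by auto
      show "PIdl x \<subseteq> colon U2 z" using PI_least[OF colon_idl[OF iU2 c(3)]] idl_l[OF iU2 subsetD[OF U12(1) WU1(2)] c(3)] c unfolding colon_def by simp
      show "PIdl y \<subseteq> colon U2 z" using PI_least[OF colon_idl[OF iU2 c(3)]] idl_l[OF iU2 U12(2) c(3)] c unfolding colon_def by simp
    qed
    ultimately show "w \<in> colon U2 z" by blast
  next
    fix w assume "w \<in> colon U2 z"
    then have w: "w \<in> \<A>" "z \<otimes> w \<in> U2" unfolding colon_def by auto
    obtain a' r' where ar': "a' \<in> U1" "r' \<in> \<A>" "z \<otimes> w = a' \<oplus> y \<otimes> r'" using w(2) c(2) unfolding U2_def by (rule sumPIE)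
    obtain a r where ar: "a \<in> W" "r \<in> \<A>" "a' = a \<oplus> x \<otimes> r" using ar'(1) c(1) unfolding U1_def by (rule sumPIE)
    obtain b b' d where h: "b \<in> k" "b' \<in> k" "d \<in> k" "a = x \<otimes> b \<oplus> y \<otimes> b' \<oplus> z \<otimes> d" using WE[OF ar(1)] by blast
    note hc = kc[OF h(1)] kc[OF h(2)] kc[OF h(3)]
    have "z \<otimes> (w \<ominus> d) = z \<otimes> w \<ominus> z \<otimes> d" using c w(1) hc by algebra
    also have "\<dots> = x \<otimes> (b \<oplus> r) \<oplus> y \<otimes> (b' \<oplus> r')" unfolding ar'(3) ar(3) h(4) using c hc ar(2) ar'(2) by algebra
    also have "\<dots> \<in> PIdl x \<boxplus> PIdl y" using c hc ar(2) ar'(2) PI_iff[OF c(1)] by (intro sumPI_mem) auto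
    finally have "w \<ominus> d \<in> PIdl x \<boxplus> PIdl y" using nzdD[of _ z "w \<ominus> d"] reg w(1) hc unfolding reg3_def by blast
    then obtain p' q where q: "p' \<in> PIdl x" "q \<in> \<A>" "w \<ominus> d = p' \<oplus> y \<otimes> q" using c(2) by (rule sumPIE)
    obtain p where p: "p \<in> \<A>" "p' = x \<otimes> p" using q(1) PI_iff[OF c(1)] by blast
    have "w = d \<oplus> (w \<ominus> d)" using w(1) hc by algebra
    also have "\<dots> = (d \<oplus> x \<otimes> p) \<oplus> y \<otimes> q" unfolding q(3) p(2) using c hc p(1) q(2) by algebra
    also have "\<dots> \<in> k2" unfolding k2_def k1_def using sumPI_mem[OF sumPI_mem[OF h(3) p(1) c(1)] q(2) c(2)] .
    finally show "w \<in> k2" .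
  qed
  have D: "colon k x = K"
  proof (intro subset_antisym subsetI)
    fix w assume "w \<in> K" then show "w \<in> colon k x" unfolding colon_def using kk xyz idl_carr[OF K] by simp
  next
    fix w assume "w \<in> colon k x"
    then have w: "w \<in> \<A>" "x \<otimes> w \<in> k" unfolding colon_def by auto
    have "x \<otimes> w \<oplus> y \<otimes> \<zero> \<oplus> z \<otimes> \<zero> = x \<otimes> w" using c w(1) by simp
    then show "w \<in> K" using kz' w by blast
  qed
  have E: "colon k1 y = K"
  proof (intro subset_antisym subsetI)
    fix w assume "w \<in> K" then show "w \<in> colon k1 y" unfolding colon_def using kk kk1 xyz idl_carr[OF K] by auto
  next
    fix w assume "w \<in> colon k1 y"
    then have w: "w \<in> \<A>" "y \<otimes> w \<in> k1" unfolding colon_def by auto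
    obtain a r where ar: "a \<in> k" "r \<in> \<A>" "y \<otimes> w = a \<oplus> x \<otimes> r" using w(2) c(1) unfolding k1_def by (rule sumPIE)
    have "x \<otimes> (\<ominus> r) \<oplus> y \<otimes> w \<oplus> z \<otimes> \<zero> = a" unfolding ar(3) using c kc[OF ar(1)] ar(2) by algebra
    then show "w \<in> K" using kz' ar w(1) by blast
  qed
  have F: "U2 \<boxplus> PIdl z = PI3 x y z"
  proof (rule subset_antisym)
    have iQ: "idl (PI3 x y z)" using PI3_idl[OF c] .
    have Qx: "PIdl x \<subseteq> PI3 x y z"
      using sum_l[OF PI_idl PI_idl, OF c(1,2)] sum_l[OF sum_PI_idl[OF PI_idl[OF c(1)] c(2)] PI_idl[OF c(3)]] by (rule subset_trans)
    have Qy: "PIdl y \<subseteq> PI3 x y z"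
      using sum_r[OF PI_idl PI_idl, OF c(1,2)] sum_l[OF sum_PI_idl[OF PI_idl[OF c(1)] c(2)] PI_idl[OF c(3)]] by (rule subset_trans)
    have Qz: "PIdl z \<subseteq> PI3 x y z" using sum_r[OF sum_PI_idl[OF PI_idl[OF c(1)] c(2)] PI_idl[OF c(3)]] .
    have "W \<subseteq> PI3 x y z" unfolding W using smul_sub_PI[OF _ idl_sub[OF ik]] c unfolding k_def by (intro sum_mono) auto
    then show "U2 \<boxplus> PIdl z \<subseteq> PI3 x y z" unfolding U2_def U1_def using Qx Qy Qz sum_least[OF iQ] by simp
    have "PIdl x \<subseteq> U1" unfolding U1_def by (rule sum_r[OF iW PI_idl[OF c(1)]])
    then show "PI3 x y z \<subseteq> U2 \<boxplus> PIdl z" unfolding U2_def by (intro sum_mono) auto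
  qed
  have fU1: "fin U1" using fin_sup[OF fW iU1 WU1(1)] .
  have fU2: "fin U2" using fin_sup[OF fU1 iU2 U12(1)] .
  have fk: "fin k" using f2 unfolding k_def .
  have fk1: "fin k1" using fin_sup[OF fk ik1 kk1(1)] .
  have "col W = col U1 + col k" using col_colon(2)[OF fW c(1)] A U1_def by simp
  moreover have "col U1 = col U2 + col k1" using col_colon(2)[OF fU1 c(2)] B U2_def by simp
  moreover have "col U2 = col (PI3 x y z) + col k2" using col_colon(2)[OF fU2 c(3)] C F by simp
  moreover have "col k = col k1 + col K" using col_colon(2)[OF fk c(1)] D k1_def by simp
  moreover have "col k1 = col k2 + col K" using col_colon(2)[OF fk1 c(2)] E k2_def by simp
  ultimately show ?thesis unfolding k_def by simp
qed

lemma col_pow_le: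
  assumes U: "idl U" and x: "x \<in> \<A>" and f: "fin (U \<boxplus> PIdl x)"
  shows "fin (U \<boxplus> PIdl (x [^] (a::nat))) \<and> col (U \<boxplus> PIdl (x [^] a)) \<le> a * col (U \<boxplus> PIdl x)"
proof (induction a)
  case 0
  have "PIdl \<one> = \<A>" using idl_one[OF PI_idl PI_self] by simp
  then have "U \<boxplus> PIdl (x [^] (0::nat)) = \<A>" using sum_r[OF U PI_idl[OF one_closed]] idl_sub[OF sum_PI_idl[OF U one_closed]] by auto
  then show ?case using fin_carrier by simp
next
  case (Suc a)
  have xa: "x [^] a \<in> \<A>" "x [^] Suc a \<in> \<A>" using x by auto
  define W where "W = U \<boxplus> PIdl (x [^] Suc a)"
  have iW: "idl W" unfolding W_def using sum_PI_idl[OF U xa(2)] .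
  have ix: "idl (U \<boxplus> PIdl x)" using sum_PI_idl[OF U x] .
  have xs: "x [^] Suc a = x \<otimes> x [^] a" using x xa m_comm by simp
  have UW: "U \<subseteq> W" "x [^] Suc a \<in> W" unfolding W_def using sum_l[OF U PI_idl[OF xa(2)]] sum_r[OF U PI_idl[OF xa(2)]] PI_self[OF xa(2)] by auto
  have Wx: "W \<boxplus> PIdl x = U \<boxplus> PIdl x"
  proof (rule subset_antisym)
    have "PIdl (x [^] Suc a) \<subseteq> PIdl x" using PI_least[OF PI_idl[OF x]] PI_iff[OF x] xs xa by blast
    then show "W \<boxplus> PIdl x \<subseteq> U \<boxplus> PIdl x" unfolding W_def using sum_l[OF U PI_idl[OF x]] sum_r[OF U PI_idl[OF x]] by (intro sum_least[OF ix]) auto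
    show "U \<boxplus> PIdl x \<subseteq> W \<boxplus> PIdl x" using UW by (intro sum_mono) auto
  qed
  have sub: "U \<boxplus> PIdl (x [^] a) \<subseteq> colon W x"
  proof (rule sum_least[OF colon_idl[OF iW x]])
    show "U \<subseteq> colon W x" using UW colon_sup[OF iW x] by blast
    show "PIdl (x [^] a) \<subseteq> colon W x" using PI_least[OF colon_idl[OF iW x]] UW(2) xa xs unfolding colon_def by simp
  qed
  have fc: "fin (colon W x)" using fin_sup[OF _ colon_idl[OF iW x] sub] Suc by blast
  have "I.flen W (W \<boxplus> PIdl x)" unfolding PI_smul[OF x]
    using I.mulmap(2)[of W "\<A>" x] iW x fc oneideal unfolding I_sm colon_def fin_def by blast
  then have fW: "fin W" using I.len_add(1)[of W "W \<boxplus> PIdl x" "\<A>"] f unfolding fin_def Wx by simp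
  have "col W = col (U \<boxplus> PIdl x) + col (colon W x)" using col_colon(2)[OF fW x] Wx by simp
  moreover have "col (colon W x) \<le> col (U \<boxplus> PIdl (x [^] a))" using col_mono[OF _ colon_idl[OF iW x] sub] Suc by blast
  ultimately show ?case using fW Suc unfolding W_def[symmetric] by simp
qed

text \<open>\<open>K^N\<close> contains the powers \<open>x^s, y^s, z^s\<close> for
  \<open>s = N + 1\<close>, because \<open>N <= n s\<close>; each of the three exponents multiplies
  the colength by at most \<open>s\<close>. The crude exponent suffices, as only the degree of
  growth matters.\<close>

lemma col_cubic:
  assumes K: "idl K" and xyz: "x \<in> pw K n" "y \<in> pw K n" "z \<in> pw K n" and n: "n \<ge> 1"
    and f: "fin (PI3 x y z)"
  shows "col (pw K N) \<le> col (PI3 x y z) * (N + 1) ^ 3"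
proof -
  have c: "x \<in> \<A>" "y \<in> \<A>" "z \<in> \<A>" using xyz pw_carr[OF K] by auto
  define s where "s = N + 1"
  define x' y' z' where "x' = x [^] s" "y' = y [^] s" "z' = z [^] s"
  have c': "x' \<in> \<A>" "y' \<in> \<A>" "z' \<in> \<A>" unfolding x'_y'_z'_def using c by auto
  have i: "PIdl x \<subseteq> \<A>" "PIdl y \<subseteq> \<A>" "PIdl z' \<subseteq> \<A>" "PIdl y' \<subseteq> \<A>" using c c' PI_idl idl_sub by auto
  have j: "idl (PIdl a \<boxplus> PIdl b)" if "a \<in> \<A>" "b \<in> \<A>" for a b using sum_PI_idl PI_idl that by blast
  define q where "q = col (PI3 x y z)"
  have 1: "fin (PIdl x \<boxplus> PIdl y \<boxplus> PIdl z')" "col (PIdl x \<boxplus> PIdl y \<boxplus> PIdl z') \<le> s * q"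
    using col_pow_le[OF j[OF c(1,2)] c(3) f, of s] unfolding x'_y'_z'_def q_def by auto
  have e1: "PIdl x \<boxplus> PIdl y \<boxplus> PIdl z' = PIdl x \<boxplus> PIdl z' \<boxplus> PIdl y" using sum3_swap23 i by blast
  have 2: "fin (PIdl x \<boxplus> PIdl z' \<boxplus> PIdl y')" "col (PIdl x \<boxplus> PIdl z' \<boxplus> PIdl y') \<le> s * (s * q)"
    using col_pow_le[OF j[OF c(1) c'(3)] c(2) 1(1)[unfolded e1], of s] le_trans[OF _ mult_le_mono2[OF 1(2)[unfolded e1], of s]] unfolding x'_y'_z'_def(2)[symmetric] by blast+
  have e2: "PIdl x \<boxplus> PIdl z' \<boxplus> PIdl y' = PIdl z' \<boxplus> PIdl y' \<boxplus> PIdl x"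
    using sum3_swap12[of "PIdl x" "PIdl z'" "PIdl y'"] sum3_swap23[of "PIdl z'" "PIdl x" "PIdl y'"] i by simp
  have 3: "fin (PIdl z' \<boxplus> PIdl y' \<boxplus> PIdl x')" "col (PIdl z' \<boxplus> PIdl y' \<boxplus> PIdl x') \<le> s * (s * (s * q))"
    using col_pow_le[OF j[OF c'(3,2)] c(1) 2(1)[unfolded e2], of s] le_trans[OF _ mult_le_mono2[OF 2(2)[unfolded e2], of s]] unfolding x'_y'_z'_def(1)[symmetric] by blast+
  have mem: "PIdl (u [^] s) \<subseteq> pw K N" if "u \<in> pw K n" for u
  proof (rule PI_least[OF pw_idl[OF K]])
    have "N \<le> n * s" unfolding s_def using n by (cases n) auto
    then show "u [^] s \<in> pw K N" using pw_nat_pow[OF K that, of s] pw_antimono[OF K, of N "n * s"] by blast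
  qed
  have "PIdl z' \<boxplus> PIdl y' \<boxplus> PIdl x' \<subseteq> pw K N" unfolding x'_y'_z'_def using mem xyz by (intro sum_least[OF pw_idl[OF K]]) auto
  then have "col (pw K N) \<le> s * (s * (s * q))" using col_mono[OF 3(1) pw_idl[OF K]] 3(2) le_trans by blast
  also have "\<dots> = q * (N + 1) ^ 3" unfolding s_def by (simp add: power3_eq_cube algebra_simps)
  finally show ?thesis unfolding q_def .
qed

end

lemma cubic_lead_nonneg:
  fixes a b c d :: int
  assumes "\<And>n. n \<ge> n0 \<Longrightarrow> 0 \<le> a * int n ^ 3 + b * int n ^ 2 + c * int n + d"
  shows "0 \<le> a"
proof (rule ccontr)
  assume a: "\<not> 0 \<le> a"
  define s where "s = \<bar>b\<bar> + \<bar>c\<bar> + \<bar>d\<bar>"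
  define n where "n = n0 + nat s + 1"
  define t where "t = int n"
  have t: "t \<ge> 1" "t > s" unfolding t_def n_def s_def by auto
  have t2: "1 \<le> t ^ 2" "t \<le> t ^ 2" using t(1) by (auto simp: power2_eq_square mult_le_cancel_left1 one_le_power[of t 2, unfolded power2_eq_square])
  have "b * t ^ 2 \<le> \<bar>b\<bar> * t ^ 2" by (intro mult_right_mono) auto
  moreover have "c * t \<le> \<bar>c\<bar> * t ^ 2" using t t2 by (intro mult_mono) auto
  moreover have "d * 1 \<le> \<bar>d\<bar> * t ^ 2" using t2 by (intro mult_mono) auto
  moreover have "a * t ^ 3 \<le> (- 1) * t ^ 3" using a t by (intro mult_right_mono) auto
  ultimately have "a * t ^ 3 + b * t ^ 2 + c * t + d \<le> (s - t) * t ^ 2"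
    unfolding s_def by (simp add: algebra_simps power3_eq_cube power2_eq_square)
  also have "\<dots> < 0" using t t2 by (intro mult_neg_pos) auto
  finally show False using assms[of n] unfolding t_def n_def by simp
qed

section \<open>Transfer from the reduction to the larger ideal\<close>

context hyp
begin

text \<open>The locale ideal \<open>K\<close> is the reduction, with Cohen-Macaulay graded ring;
  \<open>J\<close> is the larger ideal. The conclusion also records cubic growth of colengths, from
  which dimension bounds for the graded ring of \<open>J^n\<close> will follow.\<close>

lemma reduction_V3:
  assumes mpJ: "m_primary R m J" and red: "is_reduction R K J" and an: "asymptotically_normal R J"
    and e3: "hilbert_coeffs R J 3 = hilbert_coeffs R K 3"
  shows "\<exists>N. \<forall>n\<ge>N. \<exists>x y z. V3 (pw J n) 1 x 1 y 1 z \<and> (\<exists>C. \<forall>d. col (pw (pw J n) d) \<le> C * (d + 1) ^ 3)"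
proof -
  have K: "idl K" and J: "idl J" using m_primary_pow(1) mp mpJ by auto
  have KJ: "K \<subseteq> J" using red unfolding is_reduction_def by blast
  have fK: "fin (pw K i)" and fJ: "fin (pw J i)" for i using fin_pw mp mpJ by auto
  obtain r where r: "\<And>i. i \<ge> r \<Longrightarrow> K \<cdot> pw J i = pw J (Suc i)" using red unfolding is_reduction_def by blast
  have JK: "pw J (i + r) = pw K i \<cdot> pw J r" for i
  proof (induction i)
    case 0 then show ?case using pw_add[OF J, of 0 r] by simp
  next
    case (Suc i)
    then show ?case using r[of "i + r"] ideal_prod_assoc[OF K pw_idl[OF K] pw_idl[OF J], of i r] by (simp add: ipow.simps(2))
  qed
  have KJp: "pw K i \<subseteq> pw J i" for i using pw_mono[OF KJ] .
  have JKp: "pw J (i + r) \<subseteq> pw K i" for i unfolding JK using ideal_prod_inter[OF pw_idl[OF K] pw_idl[OF J], of i r] by blast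
  obtain n0 t where par: "\<And>n. n \<ge> n0 \<Longrightarrow> \<exists>x y z. VT K t n x n y n z" using parameters by blast
  have S3Q: "S3 L d x e y f z i \<subseteq> PI3 x y z" if "idl L" "x \<in> \<A>" "y \<in> \<A>" "z \<in> \<A>" for L d x e y f z i
    unfolding S3_def using that smul_sub_PI[OF _ idl_sub[OF pw_idl[OF that(1)]]] by (intro sum_mono) auto
  have finQ: "fin (PI3 x y z)" if v: "VT K t n x n y n z" for n x y z
  proof -
    have c: "x \<in> \<A>" "y \<in> \<A>" "z \<in> \<A>" using v reg3_c unfolding VT_def V3_def by auto
    have "pw K (t + n + n + n) \<subseteq> PI3 x y z" using v S3Q[OF K c] unfolding VT_def T3_def by blast
    then show ?thesis using fin_sup[OF fK] PI3_idl[OF c] by blast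
  qed
  obtain x1 y1 z1 where v1: "VT K t (Suc n0) x1 (Suc n0) y1 (Suc n0) z1" using par[of "Suc n0"] by auto
  define C where "C = col (PIdl x1 \<boxplus> PIdl y1 \<boxplus> PIdl z1)"
  have cubK: "col (pw K N) \<le> C * (N + 1) ^ 3" for N unfolding C_def
    using col_cubic[OF K _ _ _ _ finQ[OF v1], of "Suc n0" N] v1 unfolding VT_def V3_def by auto
  have cubJ: "col (pw J N) \<le> C * (N + 1) ^ 3" for N using col_mono[OF fK pw_idl[OF J] KJp, of N] cubK[of N] by linarith
  have hp: "\<exists>e0 e1 e2 N. \<forall>n\<ge>N. 6 * int (col (pw L n)) =
     e0 * (int n * (int n + 1) * (int n + 2)) - 3 * e1 * (int n * (int n + 1)) + 6 * e2 * int n - 6 * hilbert_coeffs R L 3"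
    if L: "m_primary R m L" and b: "\<And>N. col (pw L N) \<le> C * (N + 1) ^ 3" for L
  proof -
    have "\<bar>int (col (pw L N))\<bar> \<le> int C * (int N + 1) ^ 3" for N
    proof -
      have "int (col (pw L N)) \<le> int (C * (N + 1) ^ 3)" using b[of N] by (rule of_nat_mono)
      then show ?thesis by (simp add: algebra_simps)
    qed
    then obtain N where "\<forall>n\<ge>N. (dif ^^ Suc 3) (\<lambda>n. int (col (pw L n))) n = 0" using evpoly_growth[OF evpoly_col[OF L]] by blast
    then have "\<forall>n\<ge>N. (dif ^^ 4) (\<lambda>n. int (col (pw L n))) n = 0" by (simp add: numeral_eq_Suc del: funpow.simps)
    then show ?thesis by (rule hilbert_coeffs_props)
  qed
  define e where "e = hilbert_coeffs R K 3"
  obtain a0 a1 a2 Na where a: "\<And>n. n \<ge> Na \<Longrightarrow> 6 * int (col (pw K n)) =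
     a0 * (int n * (int n + 1) * (int n + 2)) - 3 * a1 * (int n * (int n + 1)) + 6 * a2 * int n - 6 * e" using hp[OF mp cubK] unfolding e_def by blast
  obtain b0 b1 b2 Nb where b: "\<And>n. n \<ge> Nb \<Longrightarrow> 6 * int (col (pw J n)) =
     b0 * (int n * (int n + 1) * (int n + 2)) - 3 * b1 * (int n * (int n + 1)) + 6 * b2 * int n - 6 * e" using hp[OF mpJ cubJ] unfolding e_def e3 by blast
  \<comment> \<open>The leading coefficients agree because the powers are sandwiched:
    \<open>K^n <= J^n\<close> and \<open>J^(n+r) <= K^n\<close>. The displayed cubics are six times
    the resulting differences of colengths, expanded in \<open>n\<close>.\<close>
  have ab1: "0 \<le> a0 - b0"
  proof (rule cubic_lead_nonneg)
    fix n assume n: "n \<ge> Na + Nb"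
    have "6 * int (col (pw J n)) \<le> 6 * int (col (pw K n))" using col_mono[OF fK pw_idl[OF J] KJp, of n] by simp
    then show "0 \<le> (a0 - b0) * int n ^ 3 + (3 * (a0 - b0) - 3 * (a1 - b1)) * int n ^ 2 + (2 * (a0 - b0) - 3 * (a1 - b1) + 6 * (a2 - b2)) * int n + 0"
      using a[of n] b[of n] n by (simp add: algebra_simps power2_eq_square power3_eq_cube)
  qed
  have ab2: "0 \<le> b0 - a0"
  proof (rule cubic_lead_nonneg)
    fix n assume n: "n \<ge> Na + Nb"
    have "6 * int (col (pw K n)) \<le> 6 * int (col (pw J (n + r)))" using col_mono[OF fJ pw_idl[OF K] JKp, of n] by simp
    then show "0 \<le> (b0 - a0) * int n ^ 3 + (3 * b0 * (int r + 1) - 3 * a0 - 3 * b1 + 3 * a1) * int n ^ 2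
      + (b0 * (3 * int r * int r + 6 * int r + 2) - 2 * a0 - 3 * b1 * (2 * int r + 1) + 3 * a1 + 6 * b2 - 6 * a2) * int n
      + (b0 * (int r * (int r + 1) * (int r + 2)) - 3 * b1 * (int r * (int r + 1)) + 6 * b2 * int r)"
      using a[of n] b[of "n + r"] n by (simp add: algebra_simps power2_eq_square power3_eq_cube)
  qed
  have ab: "a0 = b0" using ab1 ab2 by simp
  obtain Nc where an': "\<And>n. n \<ge> Nc \<Longrightarrow> integrally_closed_ideal R (pw J n)" using an unfolding asymptotically_normal_def by blast
  \<comment> \<open>The threshold collects: existence of parameters (\<open>n0\<close>), validity of
    both Hilbert polynomials at \<open>n, 2n, 3n\<close> (\<open>Na\<close>, \<open>Nb\<close>),
    closedness of \<open>J^n\<close> and beyond (\<open>Nc\<close>), and \<open>n >= t + r\<close>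
    for the inclusion \<open>TJ\<close>.\<close>
  have "\<exists>x y z. V3 (pw J n) 1 x 1 y 1 z \<and> (\<exists>C. \<forall>d. col (pw (pw J n) d) \<le> C * (d + 1) ^ 3)"
    if n: "n \<ge> n0 + Na + Nb + Nc + t + r + 1" for n
  proof -
    obtain x y z where v: "VT K t n x n y n z" using par[of n] n by auto
    have V: "V3 K n x n y n z" and T: "T3 K t n x n y n z" using v unfolding VT_def by auto
    have reg: "reg3 x y z" and xK: "x \<in> pw K n" "y \<in> pw K n" "z \<in> pw K n" using V unfolding V3_def by auto
    have c: "x \<in> \<A>" "y \<in> \<A>" "z \<in> \<A>" using reg3_c[OF reg] by auto
    define Q where "Q = PI3 x y z"
    have iQ: "idl Q" unfolding Q_def using PI3_idl[OF c] .
    have fQ: "fin Q" unfolding Q_def using finQ[OF v] .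
    define Kn where "Kn = pw K n"
    define Jn where "Jn = pw J n"
    have iK: "idl Kn" and iJ: "idl Jn" unfolding Kn_def Jn_def using pw_idl K J by auto
    have pK: "pw Kn i = pw K (n * i)" and pJ: "pw Jn i = pw J (n * i)" for i unfolding Kn_def Jn_def using pw_pw K J by auto
    have xJ: "x \<in> Jn" "y \<in> Jn" "z \<in> Jn" unfolding Jn_def using xK KJp by auto
    have SK: "S3 Kn 1 x 1 y 1 z i = S3 K n x n y n z (n * i)" for i unfolding S3_def pK by (simp add: diff_mult_distrib2)
    have VK: "V3 Kn 1 x 1 y 1 z" unfolding V3_def SK pw_one[OF iK] using V xK reg pK unfolding V3_def Kn_def by simp
    have Santi: "S3 L 1 x 1 y 1 z j \<subseteq> S3 L 1 x 1 y 1 z i" if "idl L" "i \<le> j" for L i j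
      unfolding S3_def using that by (intro sum_mono smul_mono pw_antimono) auto
    have SL: "S3 L 1 x 1 y 1 z i \<subseteq> pw L i" if L: "idl L" "x \<in> L" "y \<in> L" "z \<in> L" for L i
      unfolding S3_def using L pw_one[OF L(1)] by (intro sum_least[OF pw_idl[OF L(1)]] pw_smul_sub[OF L(1)]) auto
    have iS: "idl (S3 L 1 x 1 y 1 z i)" if L: "idl L" for L i unfolding S3_def
      using smul_idl[OF _ pw_idl[OF L]] c by (intro sum_idl) auto
    \<comment> \<open>For \<open>i >= 4\<close> one has \<open>n i - r >= t + 3 n\<close>, so the
      factor \<open>K^(n i - r)\<close> of \<open>J^(n i)\<close> is already generated through
      \<open>x, y, z\<close>. This is \<open>J^(n i) = Q J^(n (i-1))\<close>.\<close>
    have TJ: "pw Jn i \<subseteq> S3 Jn 1 x 1 y 1 z i" if i: "i \<ge> 4" for i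
    proof -
      define k where "k = n * i - r"
      have "n * 4 \<le> n * i" using i by (rule mult_le_mono2)
      then have k: "n * i = k + r" "k \<ge> t + n + n + n" using n unfolding k_def by linarith+
      have "pw Jn i = pw K k \<cdot> pw J r" unfolding pJ k(1) JK ..
      also have "\<dots> \<subseteq> S3 Jn 1 x 1 y 1 z i"
      proof (rule prod_least[OF iS[OF iJ]])
        fix a b assume ab: "a \<in> pw K k" "b \<in> pw J r"
        then have "a \<in> S3 K n x n y n z k" using T k(2) unfolding T3_def by blast
        then obtain u v w where h: "u \<in> pw K (k - n)" "v \<in> pw K (k - n)" "w \<in> pw K (k - n)" "a = x \<otimes> u \<oplus> y \<otimes> v \<oplus> z \<otimes> w" unfolding S3_mem by blast
        have kn: "k - n + r = n * (i - 1)" using k by (simp add: diff_mult_distrib2)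
        have m: "q \<otimes> b \<in> pw Jn (i - 1)" if "q \<in> pw K (k - n)" for q
          unfolding pJ kn[symmetric] JK using that ab(2) by (rule prod_mem)
        have hc: "u \<in> \<A>" "v \<in> \<A>" "w \<in> \<A>" "b \<in> \<A>" using h ab pw_carr K J by auto
        have "a \<otimes> b = x \<otimes> (u \<otimes> b) \<oplus> y \<otimes> (v \<otimes> b) \<oplus> z \<otimes> (w \<otimes> b)" unfolding h(4) using c hc by algebra
        then show "a \<otimes> b \<in> S3 Jn 1 x 1 y 1 z i" unfolding S3_mem using m h by blast
      qed
      finally show ?thesis .
    qed
    have SJQ: "S3 Jn 1 x 1 y 1 z (Suc i) \<subseteq> Q \<cdot> pw Jn i" for i
    proof -
      have xQ: "x \<in> Q" "y \<in> Q" "z \<in> Q" unfolding Q_def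
        using PI2_mem[OF c(1,2)] subsetD[OF sum_l[OF sum_PI_idl[OF PI_idl[OF c(1)] c(2)] PI_idl[OF c(3)]]]
          subsetD[OF sum_r[OF sum_PI_idl[OF PI_idl[OF c(1)] c(2)] PI_idl[OF c(3)]] PI_self[OF c(3)]] by auto
      have "smul u (pw Jn i) \<subseteq> Q \<cdot> pw Jn i" if "u \<in> Q" for u unfolding smul_def using prod_mem[OF that] by auto
      then show ?thesis unfolding S3_def using xQ by (intro sum_least[OF prod_idl[OF iQ pw_idl[OF iJ]]]) auto
    qed
    \<comment> \<open>The shift 3 matches \<open>TJ\<close> starting at exponent 4; it is the
      constant \<open>e\<close> of \<open>itoh\<close>.\<close>
    have eJ: "pw Jn (i + 3) \<subseteq> pw Q i" for i
    proof (induction i)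
      case 0 then show ?case using idl_sub[OF pw_idl[OF iJ]] by simp
    next
      case (Suc i)
      have "pw Jn (Suc i + 3) \<subseteq> Q \<cdot> pw Jn (i + 3)" using TJ[of "Suc i + 3"] SJQ[of "i + 3"] by simp
      also have "\<dots> \<subseteq> Q \<cdot> pw Q i" using Suc by (intro prod_mono) auto
      finally show ?case by (simp add: ipow.simps(2))
    qed
    have ic: "integrally_closed_ideal R (pw Jn i)" if "i \<ge> 1" for i
    proof -
      have "Nc \<le> n * i" using n that by (cases i) auto
      then show ?thesis unfolding pJ by (rule an')
    qed
    have kzJ: "kz2 Jn x y z" unfolding kz2_def
    proof (intro ballI impI)
      fix b c d assume h: "b \<in> \<A>" "c \<in> \<A>" "d \<in> \<A>" "x \<otimes> b \<oplus> y \<otimes> c \<oplus> z \<otimes> d \<in> pw Jn 2"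
      show "b \<in> Jn \<and> c \<in> Jn \<and> d \<in> Jn"
        by (intro conjI itoh[OF iJ xJ reg eJ[unfolded Q_def] ic h]) assumption+
    qed
    define WK where "WK = S3 Kn 1 x 1 y 1 z 3"
    define WJ where "WJ = S3 Jn 1 x 1 y 1 z 3"
    have fWK: "fin WK"
    proof -
      have "t + n + n + n \<le> n * (t + 3)" using n by (cases n) (auto simp: algebra_simps)
      then have "pw K (n * (t + 3)) \<subseteq> S3 Kn 1 x 1 y 1 z (t + 3)" unfolding SK using T unfolding T3_def by blast
      also have "\<dots> \<subseteq> WK" unfolding WK_def by (rule Santi[OF iK]) simp
      finally show ?thesis using fin_sup[OF fK] iS[OF iK] unfolding WK_def by blast
    qed
    have fWJ: "fin WJ"
    proof -
      have "pw J (n * 4) \<subseteq> S3 Jn 1 x 1 y 1 z 4" using TJ[of 4] unfolding pJ by simp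
      also have "\<dots> \<subseteq> WJ" unfolding WJ_def by (rule Santi[OF iJ]) simp
      finally show ?thesis using fin_sup[OF fJ] iS[OF iJ] unfolding WJ_def by blast
    qed
    have xKn: "x \<in> Kn" "y \<in> Kn" "z \<in> Kn" unfolding Kn_def using xK by auto
    have q1: "col WK + 3 * col (pw K n) = col Q + 3 * col (pw K (n * 2))"
      using col_QK2[OF iK xKn reg kz2_V3[OF iK VK] _ fWK] fK unfolding WK_def S3_def Q_def pK by (simp add: Kn_def)
    have q2: "col WJ + 3 * col (pw J n) = col Q + 3 * col (pw J (n * 2))"
      using col_QK2[OF iJ xJ reg kzJ _ fWJ] fJ unfolding WJ_def S3_def Q_def pJ by (simp add: Jn_def)
    have n3: "n \<ge> Na" "n * 2 \<ge> Na" "n * 3 \<ge> Na" "n \<ge> Nb" "n * 2 \<ge> Nb" "n * 3 \<ge> Nb" using n by auto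
    \<comment> \<open>For a cubic \<open>p\<close> with step \<open>n\<close>, the third difference
      \<open>p(3n) - 3 p(2n) + 3 p(n) - p(0)\<close> is \<open>n^3\<close> times the normalised
      leading coefficient, and \<open>p(0) = -e_3\<close>.\<close>
    have h1: "int (col (pw K (n * 3))) - 3 * int (col (pw K (n * 2))) + 3 * int (col (pw K n)) = a0 * int n ^ 3 - e"
      using a[OF n3(1)] a[OF n3(2)] a[OF n3(3)] by (simp add: algebra_simps power3_eq_cube)
    have h2: "int (col (pw J (n * 3))) - 3 * int (col (pw J (n * 2))) + 3 * int (col (pw J n)) = b0 * int n ^ 3 - e"
      using b[OF n3(4)] b[OF n3(5)] b[OF n3(6)] by (simp add: algebra_simps power3_eq_cube)
    have key: "col (pw K (n * 3)) + col WJ = col (pw J (n * 3)) + col WK" using q1 q2 h1 h2 ab by simp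
    have WKQ: "pw K (n * 3) \<inter> Q = WK"
    proof
      show "pw K (n * 3) \<inter> Q \<subseteq> WK" using VK unfolding V3_def WK_def Q_def pK by blast
      show "WK \<subseteq> pw K (n * 3) \<inter> Q" using SL[OF iK xKn, of 3] S3Q[OF iK c] unfolding WK_def Q_def pK by blast
    qed
    have "col (pw K (n * 3)) + col Q = col (pw K (n * 3) \<boxplus> Q) + col WK" using col_diamond(2)[OF fK fQ, of "n * 3"] unfolding WKQ .
    moreover have "col (pw J (n * 3)) + col Q = col (pw J (n * 3) \<boxplus> Q) + col (pw J (n * 3) \<inter> Q)" using col_diamond(2)[OF fJ fQ] .
    \<comment> \<open>The slack goes the right way: \<open>J^(3n) + Q\<close> contains
      \<open>K^(3n) + Q\<close>. Together with \<open>key\<close> and the two formulas for sum and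
      intersection, the colength of \<open>WJ\<close> is at most that of the intersection of
      \<open>J^(3n)\<close> with \<open>Q\<close>, an ideal that contains \<open>WJ\<close>; so the
      two are equal.\<close>
    moreover have "col (pw J (n * 3) \<boxplus> Q) \<le> col (pw K (n * 3) \<boxplus> Q)"
    proof (rule col_mono)
      show "fin (pw K (n * 3) \<boxplus> Q)" using fin_sup[OF fK sum_idl[OF pw_idl[OF K] iQ] sum_l[OF pw_idl[OF K] iQ]] .
      show "idl (pw J (n * 3) \<boxplus> Q)" using sum_idl[OF pw_idl[OF J] iQ] .
      show "pw K (n * 3) \<boxplus> Q \<subseteq> pw J (n * 3) \<boxplus> Q" using KJp by (intro sum_mono) auto
    qed
    ultimately have le: "col WJ \<le> col (pw J (n * 3) \<inter> Q)" using key by linarith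
    have "WJ \<subseteq> pw J (n * 3) \<inter> Q" using SL[OF iJ xJ, of 3] S3Q[OF iJ c] unfolding WJ_def Q_def pJ by blast
    then have WJQ: "WJ = pw J (n * 3) \<inter> Q" using col_inj[OF fWJ fin_idl[OF col_diamond(1)[OF fJ fQ]] _ le] by blast
    have VJ: "V3 Jn 1 x 1 y 1 z" unfolding V3_def
    proof (intro conjI allI)
      show "x \<in> pw Jn 1" "y \<in> pw Jn 1" "z \<in> pw Jn 1" using xJ pw_one[OF iJ] by auto
      show "reg3 x y z" by (rule reg)
      fix i :: nat
      \<comment> \<open>Exponents up to 1 hold since \<open>K^(i-1)\<close> is then the whole ring,
        2 is Itoh's theorem, 3 is the comparison of lengths, and from 4 on \<open>TJ\<close>
        applies.\<close>
      consider "i \<le> 1" | "i = 2" | "i = 3" | "i \<ge> 4" by linarith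
      then show "pw Jn i \<inter> (PI3 x y z) \<subseteq> S3 Jn 1 x 1 y 1 z i"
      proof cases
        case 1
        then have "i - 1 = 0" by simp
        then show ?thesis unfolding S3_def using PI_smul c by simp
      next
        case 2
        show ?thesis
        proof
          fix a assume a: "a \<in> pw Jn i \<inter> (PI3 x y z)"
          then obtain b' d where h: "b' \<in> PIdl x \<boxplus> PIdl y" "d \<in> \<A>" "a = b' \<oplus> z \<otimes> d" using sumPIE[of a "PIdl x \<boxplus> PIdl y" z] c by blast
          obtain b'' c' where h': "b'' \<in> PIdl x" "c' \<in> \<A>" "b' = b'' \<oplus> y \<otimes> c'" using h(1) c(2) by (rule sumPIE)
          obtain b where h'': "b \<in> \<A>" "b'' = x \<otimes> b" using h'(1) PI_iff[OF c(1)] by blast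
          have e: "a = x \<otimes> b \<oplus> y \<otimes> c' \<oplus> z \<otimes> d" using h h' h'' by simp
          then have "b \<in> Jn \<and> c' \<in> Jn \<and> d \<in> Jn" using a 2 kzJ h(2) h'(2) h''(1) unfolding kz2_def by simp
          then show "a \<in> S3 Jn 1 x 1 y 1 z i" unfolding S3_mem e 2 using pw_one[OF iJ] by auto
        qed
      next
        case 3 then show ?thesis using WJQ unfolding WJ_def Q_def pJ by simp
      next
        case 4 then show ?thesis using TJ by blast
      qed
    qed
    have "col (pw Jn d) \<le> (C * (n + 1) ^ 3) * (d + 1) ^ 3" for d
    proof -
      have "n * d + 1 \<le> (n + 1) * (d + 1)" by (simp add: algebra_simps)
      then have "C * (n * d + 1) ^ 3 \<le> C * ((n + 1) * (d + 1)) ^ 3" by (intro mult_le_mono2 power_mono) auto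
      then show ?thesis using le_trans[OF cubJ[of "n * d"]] unfolding pJ power_mult_distrib mult.assoc by blast
    qed
    then show ?thesis using VJ unfolding Jn_def by blast
  qed
  then show ?thesis by blast
qed

end

section \<open>Prime chains bounded by growth of lengths\<close>

sublocale gr \<subseteq> L: lenr R "Hn 0"
  using Hn_c Hn_neg[OF Hn_one] by (intro lenr.intro lenr_axioms.intro cr_axioms) auto

locale grg = gr + fixes c0 :: nat
  assumes FLf: "\<And>d. L.flen {\<zero>} (FL d)" and FLl: "\<And>d. L.len {\<zero>} (FL d) \<le> c0 * (d + 1) ^ 3"
begin

lemma FL_sm: "L.sm (FL d)" using L.flenD(2)[OF FLf] .

lemma idl_sm: assumes U: "idl U" shows "L.sm U"
  unfolding L.sm_def using idl_sub[OF U] idl_zero[OF U] idl_add[OF U] idl_l[OF U] Hn_c[of _ 0] by simp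

text \<open>Cumulative Hilbert function of the quotient by \<open>U\<close>, measured over the
  degree 0 part with the filtration by degree. It makes sense for inhomogeneous
  \<open>U\<close>.\<close>

definition hh :: "'a set \<Rightarrow> nat \<Rightarrow> nat" where "hh U d = L.len (U \<inter> FL d) (FL d)"

lemma cap_sm: "idl U \<Longrightarrow> L.sm (U \<inter> FL d)" using L.sm_int[OF idl_sm FL_sm] .

lemma cap_fl:
  assumes U: "idl U" shows "L.flen {\<zero>} (U \<inter> FL d)" "L.flen (U \<inter> FL d) (FL d)"
  using L.flen_sub[OF FLf cap_sm[OF U], of d] idl_zero[OF U] FL_zero[of d] by auto

text \<open>Multiplication by \<open>g\<close> maps \<open>FL d\<close> modulo \<open>P\<close>
  injectively into \<open>P'\<close> modulo \<open>P\<close> in degrees below \<open>d + e\<close>,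
  because \<open>P\<close> is prime and \<open>g\<close> lies in \<open>P'\<close> but not in
  \<open>P\<close>.\<close>

lemma hh_step:
  assumes P: "primeideal P R" and P': "idl P'" "P \<subseteq> P'" and g: "g \<in> P'" "g \<notin> P" "g \<in> FL (Suc e)"
  shows "hh P' (d + e) + hh P d \<le> hh P (d + e)"
proof -
  have iP: "idl P" using primeideal.axioms(1)[OF P] .
  have gc: "g \<in> \<A>" using FL_c[OF g(3)] .
  define F where "F = FL (d + e)"
  have W: "{a \<in> FL d. g \<otimes> a \<in> P \<inter> F} = P \<inter> FL d"
  proof (intro subset_antisym subsetI)
    fix a assume "a \<in> {a \<in> FL d. g \<otimes> a \<in> P \<inter> F}"
    then show "a \<in> P \<inter> FL d" using primeideal.I_prime[OF P gc, of a] g(2) FL_c[of a d] by blast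
  next
    fix a assume a: "a \<in> P \<inter> FL d"
    then show "a \<in> {a \<in> FL d. g \<otimes> a \<in> P \<inter> F}" unfolding F_def using FL_mult[OF g(3), of a d] idl_l[OF iP _ gc] by blast
  qed
  define T where "T = (P \<inter> F) \<boxplus> smul g (FL d)"
  have sF: "L.sm (P \<inter> F)" "L.sm (P' \<inter> F)" unfolding F_def using cap_sm iP P' by auto
  have T: "L.sm T" "P \<inter> F \<subseteq> T" "T \<subseteq> P' \<inter> F" unfolding T_def
  proof -
    show "L.sm ((P \<inter> F) \<boxplus> smul g (FL d))" using L.sm_sum[OF sF(1) L.sm_smul[OF FL_sm gc]] .
    show "P \<inter> F \<subseteq> (P \<inter> F) \<boxplus> smul g (FL d)" using L.sm_l[OF sF(1) L.sm_smul[OF FL_sm gc]] .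
    have "smul g (FL d) \<subseteq> P' \<inter> F" unfolding smul_def F_def using FL_mult[OF g(3), of _ d] idl_r[OF P'(1) g(1)] FL_c by blast
    then show "(P \<inter> F) \<boxplus> smul g (FL d) \<subseteq> P' \<inter> F" using P'(2) by (intro L.sm_least[OF sF(2)]) auto
  qed
  have PF: "L.flen (P \<inter> F) F" "L.flen (P' \<inter> F) F" unfolding F_def using cap_fl iP P' by auto
  have f1: "L.flen (P \<inter> F) (P' \<inter> F)" using L.flen_sub(1)[OF PF(1) sF(2)] P'(2) by blast
  note f2 = L.flen_sub[OF f1 T]
  have "L.len (P \<inter> F) T = hh P d" using L.mulmap(3)[OF sF(1) FL_sm gc, of d] f2(1) unfolding W T_def hh_def by blast
  then have "hh P d \<le> L.len (P \<inter> F) (P' \<inter> F)" using L.len_add(2)[OF f2] by simp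
  then show ?thesis using L.len_add(2)[OF f1 PF(2)] unfolding hh_def F_def by simp
qed

lemma hh_mono: assumes P: "idl P" shows "hh P d \<le> hh P (d + k)"
proof -
  have s: "L.sm (P \<inter> FL (d + k))" using cap_sm[OF P] .
  have W: "{a \<in> FL d. \<one> \<otimes> a \<in> P \<inter> FL (d + k)} = P \<inter> FL d" using FL_mono[of d "d + k"] FL_c by auto
  define T where "T = (P \<inter> FL (d + k)) \<boxplus> smul \<one> (FL d)"
  have sT: "L.sm T" "P \<inter> FL (d + k) \<subseteq> T" "T \<subseteq> FL (d + k)" unfolding T_def
  proof -
    show "L.sm ((P \<inter> FL (d + k)) \<boxplus> smul \<one> (FL d))" using L.sm_sum[OF s L.sm_smul[OF FL_sm one_closed]] .
    show "P \<inter> FL (d + k) \<subseteq> (P \<inter> FL (d + k)) \<boxplus> smul \<one> (FL d)" using L.sm_l[OF s L.sm_smul[OF FL_sm one_closed]] .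
    have "smul \<one> (FL d) \<subseteq> FL (d + k)" unfolding smul_def using FL_c FL_mono[of d "d + k"] by auto
    then show "(P \<inter> FL (d + k)) \<boxplus> smul \<one> (FL d) \<subseteq> FL (d + k)" by (intro L.sm_least[OF FL_sm]) auto
  qed
  note f2 = L.flen_sub[OF cap_fl(2)[OF P] sT]
  have "L.len (P \<inter> FL (d + k)) T = hh P d" using L.mulmap(3)[OF s FL_sm one_closed, of d] f2(1) unfolding W T_def hh_def by blast
  then show ?thesis using L.len_add(2)[OF f2] unfolding hh_def by simp
qed

lemma hh_mult:
  assumes P: "primeideal P R" and P': "idl P'" "P \<subseteq> P'" and g: "g \<in> P'" "g \<notin> P" "g \<in> FL (Suc e)"
  shows "j * hh P' d \<le> hh P (d + j * e)"
proof (induction j)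
  case (Suc j)
  have "hh P' (d + j * e + e) + hh P (d + j * e) \<le> hh P (d + j * e + e)" by (rule hh_step[OF assms])
  moreover have "hh P' d \<le> hh P' (d + j * e + e)" using hh_mono[OF P'(1), of d "j * e + e"] by (simp add: add.assoc)
  ultimately show ?case using Suc by (simp add: algebra_simps)
qed simp

text \<open>Each strict inclusion of primes lowers the degree of growth of \<open>hh\<close> by one.
  After three steps \<open>hh\<close> is bounded, after four it vanishes in degree 0, and then 1
  lies in the fourth prime.\<close>

lemma prime_chain_le3:
  assumes C: "prime_chain R C n" shows "n \<le> 3"
proof (rule ccontr)
  assume n: "\<not> n \<le> 3"
  have Cp: "primeideal (C i) R" if "i \<le> n" for i using C that unfolding prime_chain_def by blast
  have Ci: "idl (C i)" if "i \<le> n" for i using primeideal.axioms(1)[OF Cp[OF that]] .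
  have Cs: "C i \<subset> C (Suc i)" if "i < n" for i using C that unfolding prime_chain_def by blast
  have st: "\<exists>e. \<forall>j d. j * hh (C (Suc i)) d \<le> hh (C i) (d + j * e)" if i: "i < n" for i
  proof -
    obtain g where g: "g \<in> C (Suc i)" "g \<notin> C i" using Cs[OF i] by blast
    obtain e where "g \<in> FL e" using FL_ex idl_carr[OF Ci g(1)] i by auto
    then have "g \<in> FL (Suc e)" using FL_mono[of e "Suc e"] by auto
    then have "j * hh (C (Suc i)) d \<le> hh (C i) (d + j * e)" for j d using hh_mult[OF Cp Ci _ g, of e] Cs[OF i] i by simp
    then show ?thesis by blast
  qed
  have bd: "\<exists>c. \<forall>d. hh (C i) d \<le> c * (d + 1) ^ (3 - i)" if "i \<le> 3" for i
    using that
  proof (induction i)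
    case 0
    have "hh (C 0) d \<le> c0 * (d + 1) ^ (3 - 0)" for d
      using L.len_add(2)[OF cap_fl[OF Ci[of 0]], of d] FLl[of d] unfolding hh_def by simp
    then show ?case by blast
  next
    case (Suc i)
    obtain c where c: "\<And>d. hh (C i) d \<le> c * (d + 1) ^ (3 - i)" using Suc by auto
    obtain e where e: "\<And>j d. j * hh (C (Suc i)) d \<le> hh (C i) (d + j * e)" using st[of i] Suc.prems n by auto
    define k where "k = 3 - Suc i"
    have k: "3 - i = Suc k" unfolding k_def using Suc.prems by simp
    have "hh (C (Suc i)) d \<le> c * (e + 1) ^ Suc k * (d + 1) ^ k" for d
    proof -
      \<comment> \<open>Iterating \<open>j = d + 1\<close> times gains the factor
        \<open>d + 1\<close>, while the argument grows only to \<open>(e + 1)(d + 1) - 1\<close>; so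
        one power of \<open>d + 1\<close> cancels.\<close>
      have "(d + 1) * hh (C (Suc i)) d \<le> c * (d + (d + 1) * e + 1) ^ Suc k" using e[of "d + 1" d] c[of "d + (d + 1) * e"] unfolding k by (rule le_trans)
      also have "d + (d + 1) * e + 1 = (e + 1) * (d + 1)" by (simp add: algebra_simps)
      also have "c * ((e + 1) * (d + 1)) ^ Suc k = (d + 1) * (c * (e + 1) ^ Suc k * (d + 1) ^ k)" unfolding power_mult_distrib power_Suc by (simp only: mult.assoc mult.commute mult.left_commute)
      finally show ?thesis by (metis add_gr_0 mult_le_cancel1 zero_less_one)
    qed
    then show ?case unfolding k_def by blast
  qed
  obtain c where c: "\<And>d. hh (C 3) d \<le> c" using bd[of 3] by auto
  obtain e where e: "\<And>j d. j * hh (C 4) d \<le> hh (C 3) (d + j * e)" using st[of 3] n by (auto simp: eval_nat_numeral)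
  have "hh (C 4) 1 = 0"
  proof (rule ccontr)
    assume "hh (C 4) 1 \<noteq> 0"
    then have "Suc c \<le> Suc c * hh (C 4) 1" by (cases "hh (C 4) 1") auto
    then show False using e[of "Suc c" 1] c[of "1 + Suc c * e"] by linarith
  qed
  then have "C 4 \<inter> FL 1 = FL 1" unfolding hh_def using L.len_zero[OF cap_fl(2)[OF Ci]] n by auto
  moreover have "\<one> \<in> FL 1" using Hn_FL[OF Hn_one] by simp
  ultimately have "\<one> \<in> C 4" by blast
  then show False using idl_one[OF Ci[of 4]] primeideal.I_notcarr[OF Cp[of 4]] n by auto
qed

end

section \<open>Leading forms and inhomogeneous maximal ideals\<close>

context gr
begin

text \<open>The ideal generated by the top degree forms of the elements of \<open>U\<close>.\<close>

definition lf :: "'a set \<Rightarrow> 'a set" where "lf U = {r \<in> \<A>. \<forall>i. cmp i r \<in> U \<boxplus> FL i}"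

lemma UFL_add: assumes U: "idl U" and a: "a \<in> U \<boxplus> FL i" "b \<in> U \<boxplus> FL i" shows "a \<oplus> b \<in> U \<boxplus> FL i"
proof -
  obtain u v where u: "u \<in> U" "v \<in> FL i" "a = u \<oplus> v" by (rule sumE[OF a(1)])
  obtain u' v' where u': "u' \<in> U" "v' \<in> FL i" "b = u' \<oplus> v'" by (rule sumE[OF a(2)])
  have c: "u \<in> \<A>" "u' \<in> \<A>" "v \<in> \<A>" "v' \<in> \<A>" using u u' idl_carr[OF U] FL_c by auto
  have "a \<oplus> b = (u \<oplus> u') \<oplus> (v \<oplus> v')" unfolding u(3) u'(3) using c by algebra
  then show ?thesis using sum_mem[OF idl_add[OF U u(1) u'(1)] FL_add[OF u(2) u'(2)]] by simp
qed

lemma UFL_U: assumes U: "idl U" and u: "u \<in> U" shows "u \<in> U \<boxplus> FL i"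
  using sum_mem[OF u FL_zero[of i]] idl_carr[OF U u] by simp

lemma UFL_FL: assumes U: "idl U" and v: "v \<in> FL i" shows "v \<in> U \<boxplus> FL i"
  using sum_mem[OF idl_zero[OF U] v] FL_c[OF v] by simp

lemma UFL_mult: assumes U: "idl U" and a: "a \<in> U \<boxplus> FL i" and y: "y \<in> Hn j" shows "y \<otimes> a \<in> U \<boxplus> FL (i + j)"
proof -
  obtain u v where u: "u \<in> U" "v \<in> FL i" "a = u \<oplus> v" by (rule sumE[OF a])
  have "y \<otimes> a = y \<otimes> u \<oplus> y \<otimes> v" unfolding u(3) using r_distr idl_carr[OF U u(1)] FL_c[OF u(2)] Hn_c[OF y] by simp
  then show ?thesis using sum_mem[OF idl_l[OF U u(1) Hn_c[OF y]] FL_mult_H[OF y u(2)]] by simp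
qed

lemma lf_hom: assumes U: "idl U" shows "homid (lf U)"
proof -
  have idl: "idl (lf U)"
  proof (rule idlI)
    show "lf U \<subseteq> \<A>" unfolding lf_def by blast
    show "\<zero> \<in> lf U" unfolding lf_def using cmp_0 UFL_U[OF U idl_zero[OF U]] by simp
  next
    fix a b assume "a \<in> lf U" "b \<in> lf U"
    then show "a \<oplus> b \<in> lf U" unfolding lf_def using cmp_add UFL_add[OF U] by simp
  next
    fix a r assume a: "a \<in> lf U" and r: "r \<in> \<A>"
    then have ac: "a \<in> \<A>" unfolding lf_def by blast
    have hom: "y \<otimes> a \<in> lf U" if y: "y \<in> Hn j" for y j
    proof -
      have "cmp i (y \<otimes> a) \<in> U \<boxplus> FL i" for i
      proof (cases "j \<le> i")
        case True
        have "y \<otimes> cmp (i - j) a \<in> U \<boxplus> FL (i - j + j)" using UFL_mult[OF U _ y] a unfolding lf_def by blast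
        then show ?thesis using cmp_mult[OF y ac, of i] True by simp
      next
        case False then show ?thesis using cmp_mult[OF y ac, of i] UFL_U[OF U idl_zero[OF U]] by simp
      qed
      then show ?thesis unfolding lf_def using Hn_c[OF y] ac by simp
    qed
    let ?W = "{r \<in> \<A>. r \<otimes> a \<in> lf U}"
    have "r \<in> ?W"
    proof (rule graded_induct[OF r])
      show "\<zero> \<in> ?W" using hom[OF Hn_0] by simp
      show "cmp n r \<in> ?W" for n using hom[OF cmp_H[OF r]] cmp_c[OF r] by simp
      fix x y assume "x \<in> ?W" "y \<in> ?W"
      then show "x \<oplus> y \<in> ?W" unfolding lf_def using ac cmp_add UFL_add[OF U] by (simp add: l_distr)
    qed
    then show "r \<otimes> a \<in> lf U" by blast
  qed
  moreover have "cmp n a \<in> lf U" if a: "a \<in> lf U" for a n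
  proof -
    have ac: "a \<in> \<A>" using a unfolding lf_def by blast
    have "cmp i (cmp n a) \<in> U \<boxplus> FL i" for i using cmp_eq[OF cmp_H[OF ac], of i n] a UFL_U[OF U idl_zero[OF U]] unfolding lf_def by simp
    then show ?thesis unfolding lf_def using cmp_c[OF ac] by simp
  qed
  ultimately show ?thesis unfolding homid_def by blast
qed

lemma lf_Hn: assumes U: "idl U" and y: "y \<in> Hn d" shows "y \<in> lf U \<longleftrightarrow> y \<in> U \<boxplus> FL d"
proof
  assume "y \<in> lf U" then have "cmp d y \<in> U \<boxplus> FL d" unfolding lf_def by blast
  then show "y \<in> U \<boxplus> FL d" using cmp_eq[OF y, of d] by simp
next
  assume "y \<in> U \<boxplus> FL d"
  then show "y \<in> lf U" unfolding lf_def using cmp_eq[OF y] Hn_c[OF y] UFL_U[OF U idl_zero[OF U]] by simp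
qed

lemma lf_top: assumes U: "idl U" and u: "u \<in> U" "u \<in> FL (Suc d)" shows "cmp d u \<in> lf U"
proof -
  have uc: "u \<in> \<A>" using FL_c[OF u(2)] .
  have "u \<oplus> (\<ominus> (u \<ominus> cmp d u)) \<in> U \<boxplus> FL d" by (rule sum_mem[OF u(1) FL_neg[OF top_FL[OF u(2)]]])
  moreover have "u \<oplus> (\<ominus> (u \<ominus> cmp d u)) = cmp d u" using uc cmp_c[OF uc, of d] by algebra
  ultimately show ?thesis using lf_Hn[OF U cmp_H[OF uc], of d] by simp
qed

lemma lf_zero: "lf {\<zero>} = {\<zero>}"
proof
  show "{\<zero>} \<subseteq> lf {\<zero>}" using lf_hom[OF zeroideal] idl_zero unfolding homid_def by blast
  show "lf {\<zero>} \<subseteq> {\<zero>}"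
  proof
    fix r assume r: "r \<in> lf {\<zero>}"
    then have rc: "r \<in> \<A>" unfolding lf_def by blast
    have "cmp i r = cmp i \<zero>" for i
    proof -
      obtain u v where "u \<in> {\<zero>}" "v \<in> FL i" "cmp i r = u \<oplus> v" using r unfolding lf_def by (blast elim: sumE)
      then have "cmp i r \<in> FL i" using FL_c[of v i] by simp
      then have "cmp i (cmp i r) = \<zero>" using FL_cmp by blast
      then show ?thesis using cmp_eq[OF cmp_H[OF rc], of i i] cmp_0 by simp
    qed
    then show "r \<in> {\<zero>}" using cmp_inj[OF rc zero_closed] by blast
  qed
qed

lemma lf_mono: "U \<subseteq> V \<Longrightarrow> lf U \<subseteq> lf V"
  unfolding lf_def using sum_mono[of U V] by blast

text \<open>If \<open>f g\<close> lies in \<open>U\<close>, then \<open>y\<close> times the top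
  component of \<open>g\<close> lies in \<open>lf U\<close>; so that component is congruent modulo
  \<open>U\<close> to something of lower degree, and induction on the degree of \<open>g\<close>
  applies.\<close>

lemma lift_nzd:
  assumes U: "idl U" and nz: "nzd (lf U) y" and f: "f \<in> FL (Suc e)" "cmp e f = y"
  shows "nzd U f"
proof -
  have fc: "f \<in> \<A>" using FL_c[OF f(1)] .
  have "g \<in> U" if "g \<in> U \<boxplus> FL d" "f \<otimes> g \<in> U" for g d
    using that
  proof (induction d arbitrary: g)
    case 0
    obtain u v where u: "u \<in> U" "v \<in> FL 0" "g = u \<oplus> v" by (rule sumE[OF 0(1)])
    then show ?case using FL_0 idl_carr[OF U] by simp
  next
    case (Suc d)
    obtain u g' where u: "u \<in> U" "g' \<in> FL (Suc d)" "g = u \<oplus> g'" by (rule sumE[OF Suc.prems(1)])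
    have c: "u \<in> \<A>" "g' \<in> \<A>" using idl_carr[OF U u(1)] FL_c[OF u(2)] by auto
    have "f \<otimes> g' = f \<otimes> g \<ominus> f \<otimes> u" unfolding u(3) using c fc by algebra
    then have fg: "f \<otimes> g' \<in> U" using idl_minus[OF U Suc.prems(2) idl_l[OF U u(1) fc]] by simp
    have "cmp (d + e) (f \<otimes> g') \<in> lf U" using lf_top[OF U fg] FL_mult[OF f(1) u(2)] by simp
    then have "y \<otimes> cmp d g' \<in> lf U" using cmp_top_mult[OF f(1) u(2)] f(2) by simp
    then have "cmp d g' \<in> lf U" using nzdD[OF nz _ cmp_c[OF c(2)]] by blast
    then have 1: "cmp d g' \<in> U \<boxplus> FL d" using lf_Hn[OF U cmp_H[OF c(2)]] by blast
    have "cmp d g' \<oplus> (g' \<ominus> cmp d g') \<in> U \<boxplus> FL d" using UFL_add[OF U 1 UFL_FL[OF U top_FL[OF u(2)]]] .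
    moreover have "cmp d g' \<oplus> (g' \<ominus> cmp d g') = g'" using c cmp_c[OF c(2), of d] by algebra
    ultimately have "g' \<in> U" using Suc.IH fg by simp
    then show ?case unfolding u(3) using idl_add[OF U u(1)] by blast
  qed
  moreover have "\<exists>d. g \<in> U \<boxplus> FL d" if "g \<in> \<A>" for g using FL_ex[OF that] UFL_FL[OF U] by blast
  ultimately show ?thesis unfolding nzd_def by blast
qed

text \<open>As for Groebner bases: a form of lower degree can arise from \<open>u + f g\<close> only
  by cancellation at the top, and regularity of \<open>y\<close> shows that such cancellation can be
  undone modulo \<open>U\<close>.\<close>

lemma lf_sum:
  assumes U: "idl U" and nz: "nzd (lf U) y" and f: "f \<in> FL (Suc e)" "cmp e f = y"
  shows "lf (U \<boxplus> PIdl f) = lf U \<boxplus> PIdl y"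
proof
  have fc: "f \<in> \<A>" using FL_c[OF f(1)] .
  have yH: "y \<in> Hn e" using cmp_H[OF fc] f(2) by blast
  have yc: "y \<in> \<A>" using Hn_c[OF yH] .
  have Uf: "idl (U \<boxplus> PIdl f)" using sum_PI_idl[OF U fc] .
  have iL: "idl (lf U)" and iLf: "idl (lf (U \<boxplus> PIdl f))" using lf_hom U Uf unfolding homid_def by auto
  have iR: "idl (lf U \<boxplus> PIdl y)" using sum_PI_idl[OF iL yc] .
  have "f \<in> U \<boxplus> PIdl f" using subsetD[OF sum_r[OF U PI_idl[OF fc]] PI_self[OF fc]] .
  then have "y \<in> lf (U \<boxplus> PIdl f)" using lf_top[OF Uf _ f(1)] f(2) by simp
  then show "lf U \<boxplus> PIdl y \<subseteq> lf (U \<boxplus> PIdl f)"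
    using PI_least[OF iLf] lf_mono[OF sum_l[OF U PI_idl[OF fc]]] by (intro sum_least[OF iLf]) auto
  \<comment> \<open>Induction on the degree of \<open>g\<close>. If the top degree
    \<open>d + e\<close> of \<open>f g\<close> is at most \<open>i\<close>, the components of degree
    \<open>i\<close> can be compared directly. Otherwise the top of \<open>f g\<close> cancels
    against \<open>u\<close>, so \<open>cmp d g\<close> lies in \<open>lf U\<close>, and
    \<open>g\<close> can be lowered by moving a multiple of \<open>f\<close> into
    \<open>u\<close>.\<close>
  have key: "r \<in> lf U \<boxplus> PIdl y" if "r \<in> Hn i" "u \<in> U" "g \<in> FL d" "w \<in> FL i" "r = u \<oplus> f \<otimes> g \<oplus> w" for r i u g w d
    using that
  proof (induction d arbitrary: u g)
    case 0
    then have "r = u \<oplus> w" using FL_0 fc idl_carr[OF U] FL_c by simp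
    then have "r \<in> lf U" using lf_Hn[OF U 0(1)] sum_mem[OF 0(2,4)] by simp
    then show ?case using sum_l[OF iL PI_idl[OF yc]] by blast
  next
    case (Suc d)
    note r = Suc.prems(1) and u = Suc.prems(2) and g = Suc.prems(3) and w = Suc.prems(4) and e = Suc.prems(5)
    have c: "u \<in> \<A>" "g \<in> \<A>" "w \<in> \<A>" "r \<in> \<A>" using idl_carr[OF U u] FL_c[OF g] FL_c[OF w] Hn_c[OF r] by auto
    have fg: "f \<otimes> g \<in> FL (Suc d + e)" using FL_mult[OF f(1) g] .
    have ue: "u = r \<ominus> f \<otimes> g \<ominus> w" unfolding e using c(1-3) fc by algebra
    have gtop: "cmp (d + e) (f \<otimes> g) = y \<otimes> cmp d g" using cmp_top_mult[OF f(1) g] f(2) by simp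
    show ?case
    proof (cases "d + e \<le> i")
      case True
      have "f \<otimes> g \<in> FL (Suc i)" using fg FL_mono[of "Suc d + e" "Suc i"] True by auto
      then have "u \<in> FL (Suc i)" unfolding ue using FL_minus Hn_FL[OF r] w FL_mono[of i "Suc i"] by auto
      then have 1: "cmp i u \<in> lf U" using lf_top[OF U u] by blast
      have 2: "cmp i (f \<otimes> g) \<in> PIdl y"
      proof (cases "d + e = i")
        case True then show ?thesis using gtop PI_iff[OF yc] cmp_c[OF c(2)] by auto
      next
        case False
        then have "cmp i (f \<otimes> g) = \<zero>" using FL_cmp[OF fg] \<open>d + e \<le> i\<close> by simp
        then show ?thesis using idl_zero[OF PI_idl[OF yc]] by simp
      qed
      have "r = cmp i r" using cmp_eq[OF r, of i] by simp
      also have "\<dots> = cmp i u \<oplus> cmp i (f \<otimes> g) \<oplus> cmp i w" unfolding e using c fc cmp_add by simp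
      also have "\<dots> = cmp i u \<oplus> cmp i (f \<otimes> g)" using FL_cmp[OF w] c fc cmp_c by simp
      finally show ?thesis using sum_mem[OF 1 2] by simp
    next
      case False
      have "r \<in> FL (Suc (d + e))" "w \<in> FL (Suc (d + e))" using False Hn_FL[OF r] w FL_mono[of "Suc i" "Suc (d + e)"] FL_mono[of i "Suc (d + e)"] by auto
      then have uF: "u \<in> FL (Suc (d + e))" unfolding ue using FL_minus fg by simp
      have "cmp (d + e) r = \<zero>" using cmp_eq[OF r, of "d + e"] False by simp
      then have "cmp (d + e) u = \<ominus> (y \<otimes> cmp d g)" unfolding ue using c fc cmp_minus gtop FL_cmp[OF w, of "d + e"] False yc cmp_c by (simp add: a_minus_def)
      then have "\<ominus> (\<ominus> (y \<otimes> cmp d g)) \<in> lf U" using idl_neg[OF iL lf_top[OF U u uF]] by simp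
      then have "y \<otimes> cmp d g \<in> lf U" using yc cmp_c[OF c(2)] by simp
      then have "cmp d g \<in> lf U" using nzdD[OF nz _ cmp_c[OF c(2)]] by blast
      then have "cmp d g \<in> U \<boxplus> FL d" using lf_Hn[OF U cmp_H[OF c(2)]] by blast
      then obtain u' w' where h: "u' \<in> U" "w' \<in> FL d" "cmp d g = u' \<oplus> w'" by (rule sumE)
      define g' where "g' = w' \<oplus> (g \<ominus> cmp d g)"
      have g': "g' \<in> FL d" unfolding g'_def using FL_add[OF h(2) top_FL[OF g]] .
      have hc: "u' \<in> \<A>" "w' \<in> \<A>" using idl_carr[OF U h(1)] FL_c[OF h(2)] by auto
      have ge: "g = u' \<oplus> g'" unfolding g'_def h(3) using hc c(2) by algebra
      have "r = (u \<oplus> f \<otimes> u') \<oplus> f \<otimes> g' \<oplus> w" unfolding e ge using c hc fc FL_c[OF g'] by algebra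
      then show ?thesis using Suc.IH[OF r idl_add[OF U u idl_l[OF U h(1) fc]] g' w] by blast
    qed
  qed
  show "lf (U \<boxplus> PIdl f) \<subseteq> lf U \<boxplus> PIdl y"
  proof
    fix r assume r: "r \<in> lf (U \<boxplus> PIdl f)"
    then have rc: "r \<in> \<A>" unfolding lf_def by blast
    show "r \<in> lf U \<boxplus> PIdl y"
    proof (rule graded_induct[OF rc idl_zero[OF iR] idl_add[OF iR]])
      fix i
      have "cmp i r \<in> (U \<boxplus> PIdl f) \<boxplus> FL i" using r unfolding lf_def by blast
      then obtain v w where v: "v \<in> U \<boxplus> PIdl f" "w \<in> FL i" "cmp i r = v \<oplus> w" by (rule sumE)
      obtain u g where u: "u \<in> U" "g \<in> \<A>" "v = u \<oplus> f \<otimes> g" by (rule sumPIE[OF v(1) fc])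
      obtain d where "g \<in> FL d" using FL_ex[OF u(2)] by blast
      then show "cmp i r \<in> lf U \<boxplus> PIdl y" using key[OF cmp_H[OF rc] u(1) _ v(2)] v(3) u(3) by blast
    qed assumption+
  qed
qed

text \<open>The saturation has finitely many generators, of degree below some \<open>d\<close>, and
  forms of degree at least \<open>N\<close> carry it into \<open>U\<close>. A form of degree at
  least \<open>N + d\<close> in the saturation involves only coefficients of degree at least
  \<open>N\<close>.\<close>

lemma sat_bounded:
  assumes U: "homid U" shows "\<exists>d1. \<forall>i\<ge>d1. sat U \<inter> Hn i \<subseteq> U"
proof -
  have iU: "idl U" using U unfolding homid_def by blast
  have sh: "homid (sat U)" using sat_homid[OF U] .
  obtain N where N: "\<And>d y r. d \<ge> N \<Longrightarrow> y \<in> Hn d \<Longrightarrow> r \<in> sat U \<Longrightarrow> y \<otimes> r \<in> U" using sat_uniform[OF iU] by blast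
  obtain S where S: "S \<subseteq> \<A>" "finite S" "sat U = Idl S" using N.fg[OF sat_idl[OF iU]] by blast
  have "\<exists>d. S \<subseteq> FL d" using S(2,1)
  proof (induction S rule: finite_induct)
    case (insert s S)
    then obtain d where d: "S \<subseteq> FL d" by auto
    obtain e where e: "s \<in> FL e" using FL_ex insert.prems by auto
    have "insert s S \<subseteq> FL (d + e)" using d e FL_mono[of d "d + e"] FL_mono[of e "d + e"] by auto
    then show ?case by blast
  qed simp
  then obtain d where d: "S \<subseteq> FL d" by blast
  \<comment> \<open>Quantifying over all multiples \<open>r a\<close> makes \<open>V\<close> an
    ideal, so it is enough to place the generators in it.\<close>
  define V where "V = {a \<in> \<A>. \<forall>r\<in>\<A>. \<forall>i\<ge>N + d. cmp i (r \<otimes> a) \<in> U}"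
  have iV: "idl V"
  proof (rule idlI)
    show "V \<subseteq> \<A>" unfolding V_def by blast
    show "\<zero> \<in> V" unfolding V_def using cmp_0 idl_zero[OF iU] by simp
  next
    fix a b assume "a \<in> V" "b \<in> V"
    then show "a \<oplus> b \<in> V" unfolding V_def using cmp_add idl_add[OF iU] by (simp add: r_distr)
  next
    fix a x assume a: "a \<in> V" and x: "x \<in> \<A>"
    have "r \<otimes> (x \<otimes> a) = (r \<otimes> x) \<otimes> a" if "r \<in> \<A>" for r using a x that m_assoc unfolding V_def by simp
    then show "x \<otimes> a \<in> V" using a x unfolding V_def by simp
  qed
  have "S \<subseteq> V"
  proof
    fix s assume s: "s \<in> S"
    have sc: "s \<in> \<A>" and ss: "s \<in> sat U" using s S genideal_self by auto
    have sF: "s \<in> FL d" using s d by blast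
    have "cmp i (r \<otimes> s) \<in> U" if r: "r \<in> \<A>" and i: "i \<ge> N + d" for r i
    proof -
      let ?W = "{r \<in> \<A>. cmp i (r \<otimes> s) \<in> U}"
      have "r \<in> ?W"
      proof (rule graded_induct[OF r])
        show "\<zero> \<in> ?W" using sc cmp_0 idl_zero[OF iU] by simp
        fix x y assume "x \<in> ?W" "y \<in> ?W"
        then show "x \<oplus> y \<in> ?W" using sc cmp_add idl_add[OF iU] by (simp add: l_distr)
      next
        fix n
        have rn: "cmp n r \<in> Hn n" using cmp_H[OF r] .
        have "cmp i (cmp n r \<otimes> s) \<in> U"
        proof (cases "n \<le> i \<and> i - n < d")
          case True
          then have "cmp n r \<otimes> cmp (i - n) s \<in> U" using N[OF _ rn, of "cmp (i - n) s"] i sh ss unfolding homid_def by auto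
          then show ?thesis using cmp_mult[OF rn sc, of i] True by simp
        next
          case False
          then have "cmp i (cmp n r \<otimes> s) = \<zero>" using cmp_mult[OF rn sc, of i] FL_cmp[OF sF, of "i - n"] Hn_c[OF rn] by auto
          then show ?thesis using idl_zero[OF iU] by simp
        qed
        then show "cmp n r \<in> {r \<in> \<A>. cmp i (r \<otimes> s) \<in> U}" using Hn_c[OF rn] by simp
      qed
      then show ?thesis by blast
    qed
    then show "s \<in> V" unfolding V_def using sc by blast
  qed
  then have "sat U \<subseteq> V" unfolding S(3) by (rule genideal_minimal[OF iV])
  then have "sat U \<inter> Hn i \<subseteq> U" if i: "i \<ge> N + d" for i
  proof (intro subsetI)
    fix a assume a: "a \<in> sat U \<inter> Hn i"
    then have "cmp i (\<one> \<otimes> a) \<in> U" using \<open>sat U \<subseteq> V\<close> i unfolding V_def by blast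
    then show "a \<in> U" using a cmp_eq[of a i i] Hn_c[of a i] by simp
  qed
  then show ?thesis by blast
qed

end

context grg
begin

text \<open>Descending chain condition in the finite length module \<open>FL d\<close>. An index
  \<open>k >= 1\<close> is wanted because the inverses in \<open>maximal_leading_forms\<close> are
  taken of positive powers.\<close>

lemma descending_stable:
  assumes M: "\<And>k. L.sm (M k)" "\<And>k. M k \<subseteq> FL d" "\<And>k. M (Suc k) \<subseteq> M k"
  shows "\<exists>k\<ge>1. M k = M (Suc k)"
proof (rule ccontr)
  assume no: "\<not> (\<exists>k\<ge>1. M k = M (Suc k))"
  define n where "n = Suc (L.len {\<zero>} (FL d))"
  define E where "E i = M (Suc n - i)" for i
  have anti: "M j \<subseteq> M i" if "i \<le> j" for i j using lift_Suc_antimono_le[of M, OF M(3) that] .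
  have fl: "L.flen {\<zero>} (M 1)" "L.flen (M 1) (FL d)" "L.flen (M (Suc n)) (M 1)"
  proof -
    have z: "{\<zero>} \<subseteq> M k" for k using L.sm_0[OF M(1)] by blast
    show "L.flen {\<zero>} (M 1)" "L.flen (M 1) (FL d)" using L.flen_sub[OF FLf M(1) z M(2)] by auto
    then show "L.flen (M (Suc n)) (M 1)" using L.flen_sub(2)[OF _ M(1) z anti[of 1 "Suc n"]] by auto
  qed
  have st: "E i \<noteq> E (Suc i) \<and> E i \<subseteq> E (Suc i)" if i: "i < n" for i
  proof -
    have "Suc n - i = Suc (Suc n - Suc i)" "Suc n - Suc i \<ge> 1" using i by auto
    then show ?thesis unfolding E_def using no M(3) by metis
  qed
  have "card {i. i < n \<and> E i \<noteq> E (Suc i)} \<le> L.len (M (Suc n)) (M 1)"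
    by (rule L.weak_le[OF fl(3)]) (use M(1) st in \<open>auto simp: E_def\<close>)
  moreover have "{i. i < n \<and> E i \<noteq> E (Suc i)} = {..<n}" using st by auto
  ultimately have "n \<le> L.len (M (Suc n)) (M 1)" by simp
  moreover have "L.len (M (Suc n)) (M 1) \<le> L.len {\<zero>} (M 1)"
    using L.len_add(2)[OF L.flen_sub(1)[OF fl(1) M(1)[of "Suc n"]] fl(3)] L.sm_0[OF M(1)] anti[of 1 "Suc n"] by simp
  moreover have "L.len {\<zero>} (M 1) \<le> L.len {\<zero>} (FL d)" using L.len_add(2)[OF fl(1,2)] by simp
  ultimately show False unfolding n_def by linarith
qed

text \<open>A form of Zariski's lemma: some power of the irrelevant ideal consists of leading forms of elements of \<open>P\<close>.
  Otherwise a form \<open>T\<close> that is regular modulo the saturation of \<open>lf P\<close> has inverses of all its powers modulo \<open>P\<close>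
  in one fixed \<open>FL d\<close>, and the finite length of \<open>FL d\<close> makes a power of \<open>T\<close> congruent to an element of lower degree.\<close>

lemma maximal_leading_forms:
  assumes P: "maximalideal P R" shows "\<exists>e\<ge>1. Hn e \<subseteq> P \<boxplus> FL e"
proof (rule ccontr)
  assume no: "\<not> ?thesis"
  have pP: "primeideal P R" using maximalideal_prime[OF P] .
  have iP: "idl P" using primeideal.axioms(1)[OF pP] .
  have hom: "homid (lf P)" using lf_hom[OF iP] .
  then have iL: "idl (lf P)" unfolding homid_def by blast
  have nc: "\<not> complete (lf P)"
  proof
    assume "complete (lf P)"
    then obtain N where "\<forall>d\<ge>N. Hn d \<subseteq> lf P" unfolding complete_def by blast
    then have "Hn (Suc N) \<subseteq> lf P" by simp
    then have "Hn (Suc N) \<subseteq> P \<boxplus> FL (Suc N)" using lf_Hn[OF iP] by blast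
    then show False using no by auto
  qed
  define S where "S = sat (lf P)"
  have iS: "idl S" unfolding S_def using sat_idl[OF iL] .
  have LS: "lf P \<subseteq> S" unfolding S_def using sat_sup[OF iL] .
  have S1: "\<one> \<notin> S" unfolding S_def using sat_one nc by blast
  obtain d0 where d0: "\<And>d. d \<ge> d0 \<Longrightarrow> \<exists>f\<in>Hn d. nzd S f" using N.avoid_all[of "{S}"] iS sat_nsoc[OF iL] unfolding S_def by auto
  define e where "e = Suc d0"
  obtain T where T: "T \<in> Hn e" "nzd S T" using d0[of e] unfolding e_def by auto
  have Tc: "T \<in> \<A>" using Hn_c[OF T(1)] .
  have Tp: "T [^] k \<in> Hn (k * e)" for k :: nat
  proof (induction k)
    case (Suc k) then show ?case using Hn_mult[OF Suc T(1)] by (simp add: add.commute)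
  qed (use Hn_one in simp)
  have Tn: "nzd S (T [^] k)" for k :: nat using nzd_pow[OF T(2) Tc] .
  have TL: "T [^] k \<notin> lf P" for k :: nat
  proof
    assume "T [^] k \<in> lf P"
    then have "T [^] k \<otimes> \<one> \<in> S" using LS Tc by auto
    then show False using nzdD[OF Tn] S1 by blast
  qed
  obtain d1 where d1: "\<And>i. i \<ge> d1 \<Longrightarrow> S \<inter> Hn i \<subseteq> lf P" using sat_bounded[OF hom] unfolding S_def by blast
  \<comment> \<open>An inverse \<open>s\<close> of \<open>T^j\<close> modulo \<open>P\<close> can be
    taken of degree below \<open>d1\<close>, whatever \<open>j\<close> is. Since \<open>T^j\<close>
    has positive degree, the top form of a higher \<open>s\<close> is carried into
    \<open>lf P\<close> by \<open>T^j\<close>; so it lies in the saturation, hence in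
    \<open>lf P\<close>, and may be replaced modulo \<open>P\<close> by something of lower
    degree.\<close>
  have inv: "\<exists>s\<in>FL d1. T [^] j \<otimes> s \<ominus> \<one> \<in> P" if j: "j \<ge> 1" for j :: nat
  proof -
    have Tj: "T [^] j \<in> \<A>" using Tc by simp
    have "T [^] j \<notin> P"
    proof
      assume "T [^] j \<in> P"
      then show False using UFL_U[OF iP] lf_Hn[OF iP Tp] TL by blast
    qed
    have iPT: "idl (P \<boxplus> PIdl (T [^] j))" using sum_PI_idl[OF iP Tj] .
    have "P \<boxplus> PIdl (T [^] j) = \<A>"
    proof (rule ccontr)
      assume "P \<boxplus> PIdl (T [^] j) \<noteq> \<A>"
      then have "P \<boxplus> PIdl (T [^] j) = P" using maximalideal.I_maximal[OF P iPT sum_l[OF iP PI_idl[OF Tj]] idl_sub[OF iPT]] by blast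
      then show False using subsetD[OF sum_r[OF iP PI_idl[OF Tj]] PI_self[OF Tj]] \<open>T [^] j \<notin> P\<close> by blast
    qed
    then have "\<one> \<in> P \<boxplus> PIdl (T [^] j)" by simp
    then obtain p s0 where p: "p \<in> P" "s0 \<in> \<A>" "\<one> = p \<oplus> T [^] j \<otimes> s0" using Tj by (rule sumPIE)
    define q where "q = T [^] j"
    have qc: "q \<in> \<A>" unfolding q_def by (rule Tj)
    have "q \<otimes> s0 \<ominus> \<one> = q \<otimes> s0 \<ominus> (p \<oplus> q \<otimes> s0)" using p(3) unfolding q_def by simp
    also have "\<dots> = \<ominus> p" using qc p(2) idl_carr[OF iP p(1)] by algebra
    finally have s0: "T [^] j \<otimes> s0 \<ominus> \<one> \<in> P" using idl_neg[OF iP p(1)] unfolding q_def by simp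
    have "\<exists>s\<in>FL d1. T [^] j \<otimes> s \<ominus> \<one> \<in> P" if "s \<in> FL (d1 + k)" "T [^] j \<otimes> s \<ominus> \<one> \<in> P" for s k
      using that
    proof (induction k arbitrary: s)
      case 0 then show ?case by auto
    next
      case (Suc k)
      define n where "n = d1 + k"
      have sF: "s \<in> FL (Suc n)" using Suc.prems(1) unfolding n_def by simp
      have sc: "s \<in> \<A>" using FL_c[OF sF] .
      have je: "j * e \<ge> 1" using j unfolding e_def by simp
      have "T [^] j \<in> FL (Suc (j * e))" using Hn_FL[OF Tp] .
      then have Ts: "T [^] j \<otimes> s \<in> FL (Suc (n + j * e))" using FL_mult[OF _ sF] by fastforce
      have o: "\<one> \<in> FL 1" using Hn_FL[OF Hn_one] by simp
      then have "\<one> \<in> FL (Suc (n + j * e))" using FL_mono[of 1 "Suc (n + j * e)"] by auto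
      then have "cmp (n + j * e) (T [^] j \<otimes> s \<ominus> \<one>) \<in> lf P" using lf_top[OF iP Suc.prems(2) FL_minus[OF Ts]] by blast
      moreover have "cmp (n + j * e) (T [^] j \<otimes> s \<ominus> \<one>) = cmp (n + j * e) (T [^] j \<otimes> s) \<ominus> cmp (n + j * e) \<one>" using cmp_minus Tj sc by simp
      moreover have "cmp (n + j * e) \<one> = \<zero>" using FL_cmp[OF o trans_le_add2[OF je]] .
      moreover have "cmp (n + j * e) (T [^] j \<otimes> s) = T [^] j \<otimes> cmp n s" using cmp_mult[OF Tp sc, of "n + j * e" j] by simp
      ultimately have "T [^] j \<otimes> cmp n s \<in> lf P" using Tj cmp_c[OF sc] by (simp add: a_minus_def)
      then have "cmp n s \<in> S" using nzdD[OF Tn _ cmp_c[OF sc]] LS by blast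
      then have "cmp n s \<in> lf P" using d1[of n] cmp_H[OF sc] unfolding n_def by auto
      then have "cmp n s \<in> P \<boxplus> FL n" using lf_Hn[OF iP cmp_H[OF sc]] by blast
      then obtain u w where u: "u \<in> P" "w \<in> FL n" "cmp n s = u \<oplus> w" by (rule sumE)
      define s' where "s' = w \<oplus> (s \<ominus> cmp n s)"
      have s'F: "s' \<in> FL n" unfolding s'_def using FL_add[OF u(2) top_FL[OF sF]] .
      have c: "u \<in> \<A>" "w \<in> \<A>" "s' \<in> \<A>" using idl_carr[OF iP u(1)] FL_c[OF u(2)] FL_c[OF s'F] by auto
      have se: "s = u \<oplus> s'" unfolding s'_def u(3) using c sc by algebra
      have "q \<otimes> s' \<ominus> \<one> = (q \<otimes> s \<ominus> \<one>) \<ominus> q \<otimes> u" unfolding se using qc c by algebra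
      then have "T [^] j \<otimes> s' \<ominus> \<one> \<in> P" using idl_minus[OF iP Suc.prems(2) idl_l[OF iP u(1) qc]] unfolding q_def by simp
      then show ?case using Suc.IH s'F unfolding n_def by blast
    qed
    moreover obtain d where "s0 \<in> FL d" using FL_ex[OF p(2)] by blast
    then have "s0 \<in> FL (d1 + d)" using FL_mono[of d "d1 + d"] by auto
    ultimately show ?thesis using s0 by blast
  qed
  \<comment> \<open>The elements of \<open>FL d1\<close> that behave like \<open>T^(-k)\<close>:
    modulo \<open>P\<close>, some \<open>T^l v\<close> has degree at most \<open>(l - k) e\<close>.
    The \<open>+ 1\<close> reflects the strict bound in \<open>FL\<close>. The inverse of
    \<open>T^k\<close> belongs to \<open>M k\<close>; if \<open>M k = M (k+1)\<close>, then for some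
    \<open>l\<close> the power \<open>T^(l-k)\<close> is congruent to something of lower degree and
    so lies in \<open>lf P\<close>.\<close>
  define M where "M k = {v \<in> FL d1. \<exists>l\<ge>k. T [^] l \<otimes> v \<in> P \<boxplus> FL ((l - k) * e + 1)}" for k :: nat
  have up: "T [^] (l + i) \<otimes> v \<in> P \<boxplus> FL ((l + i - k) * e + 1)"
    if h: "l \<ge> k" "v \<in> \<A>" "T [^] l \<otimes> v \<in> P \<boxplus> FL ((l - k) * e + 1)" for l i k :: nat and v
  proof -
    have "T [^] i \<otimes> (T [^] l \<otimes> v) \<in> P \<boxplus> FL (((l - k) * e + 1) + i * e)" using UFL_mult[OF iP h(3) Tp] .
    moreover have "T [^] i \<otimes> (T [^] l \<otimes> v) = T [^] (l + i) \<otimes> v" using nat_pow_mult[OF Tc, of i l] m_assoc[of "T [^] i" "T [^] l" v] Tc h(2) by (simp add: add.commute)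
    moreover have "((l - k) * e + 1) + i * e = (l + i - k) * e + 1" using h(1) by (simp add: add_mult_distrib[symmetric])
    ultimately show ?thesis by simp
  qed
  have "\<exists>k\<ge>1. M k = M (Suc k)"
  proof (rule descending_stable)
    show "M k \<subseteq> FL d1" for k unfolding M_def by blast
    show "M (Suc k) \<subseteq> M k" for k
    proof
      fix v assume "v \<in> M (Suc k)"
      then obtain l where l: "v \<in> FL d1" "l \<ge> Suc k" "T [^] l \<otimes> v \<in> P \<boxplus> FL ((l - Suc k) * e + 1)" unfolding M_def by blast
      have "FL ((l - Suc k) * e + 1) \<subseteq> FL ((l - k) * e + 1)" by (intro FL_mono add_right_mono mult_le_mono1 diff_le_mono2) simp
      then have "T [^] l \<otimes> v \<in> P \<boxplus> FL ((l - k) * e + 1)" using l(3) sum_mono[OF order_refl] by blast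
      moreover have "k \<le> l" using l(2) by simp
      ultimately show "v \<in> M k" unfolding M_def using l(1) by blast
    qed
    show "L.sm (M k)" for k unfolding L.sm_def
    proof (intro conjI ballI)
      show "M k \<subseteq> \<A>" unfolding M_def using FL_c by blast
      have "T [^] k \<otimes> \<zero> \<in> P \<boxplus> FL ((k - k) * e + 1)" using UFL_U[OF iP idl_zero[OF iP]] Tc by simp
      then show "\<zero> \<in> M k" unfolding M_def using FL_zero by blast
    next
      fix a b assume "a \<in> M k" "b \<in> M k"
      then obtain l l' where l: "a \<in> FL d1" "l \<ge> k" "T [^] l \<otimes> a \<in> P \<boxplus> FL ((l - k) * e + 1)"
        "b \<in> FL d1" "l' \<ge> k" "T [^] l' \<otimes> b \<in> P \<boxplus> FL ((l' - k) * e + 1)" unfolding M_def by blast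
      have c: "a \<in> \<A>" "b \<in> \<A>" using l FL_c by auto
      have "T [^] (l + l') \<otimes> a \<oplus> T [^] (l + l') \<otimes> b \<in> P \<boxplus> FL ((l + l' - k) * e + 1)"
        using UFL_add[OF iP up[OF l(2) c(1) l(3), of l'] up[OF l(5) c(2) l(6), of l, unfolded add.commute[of l' l]]] .
      then have "T [^] (l + l') \<otimes> (a \<oplus> b) \<in> P \<boxplus> FL ((l + l' - k) * e + 1)" using r_distr Tc c by simp
      moreover have "l + l' \<ge> k" using l(2) by simp
      ultimately show "a \<oplus> b \<in> M k" unfolding M_def using FL_add[OF l(1,4)] by blast
    next
      fix x a assume x: "x \<in> Hn 0" and "a \<in> M k"
      then obtain l where l: "a \<in> FL d1" "l \<ge> k" "T [^] l \<otimes> a \<in> P \<boxplus> FL ((l - k) * e + 1)" unfolding M_def by blast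
      have c: "a \<in> \<A>" "x \<in> \<A>" using l FL_c Hn_c[OF x] by auto
      have "x \<otimes> (T [^] l \<otimes> a) \<in> P \<boxplus> FL ((l - k) * e + 1)" using UFL_mult[OF iP l(3) x] by simp
      moreover have "x \<otimes> (T [^] l \<otimes> a) = T [^] l \<otimes> (x \<otimes> a)" using m_lcomm[of x "T [^] l" a] c Tc by simp
      ultimately show "x \<otimes> a \<in> M k" unfolding M_def using l FL_mult_H[OF x l(1)] by auto
    qed
  qed
  then obtain k where k: "k \<ge> 1" "M k = M (Suc k)" by blast
  obtain s where s: "s \<in> FL d1" "T [^] k \<otimes> s \<ominus> \<one> \<in> P" using inv[OF k(1)] by blast
  have sc: "s \<in> \<A>" using FL_c[OF s(1)] .
  have ts: "T [^] k \<otimes> s \<in> \<A>" using Tc sc by simp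
  have o: "\<one> \<in> FL 1" using Hn_FL[OF Hn_one] by simp
  have "(T [^] k \<otimes> s \<ominus> \<one>) \<oplus> \<one> \<in> P \<boxplus> FL 1" using sum_mem[OF s(2) o] .
  moreover have "(T [^] k \<otimes> s \<ominus> \<one>) \<oplus> \<one> = T [^] k \<otimes> s" using ts by algebra
  ultimately have "s \<in> M k" unfolding M_def using s(1) by auto
  then have "s \<in> M (Suc k)" using k(2) by simp
  then obtain l where l: "l \<ge> Suc k" "T [^] l \<otimes> s \<in> P \<boxplus> FL ((l - Suc k) * e + 1)" unfolding M_def by blast
  define j where "j = l - k"
  have lj: "j + k = l" unfolding j_def using l by simp
  have Tj: "T [^] j \<in> \<A>" using Tc by simp
  have "(l - Suc k) * e + 1 \<le> j * e"
  proof -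
    have "j = Suc (l - Suc k)" "e \<ge> 1" unfolding j_def e_def using l(1) by auto
    then show ?thesis by simp
  qed
  then have 1: "T [^] l \<otimes> s \<in> P \<boxplus> FL (j * e)" using l(2) sum_mono[OF order_refl FL_mono] by blast
  have "\<ominus> (T [^] j \<otimes> (T [^] k \<otimes> s \<ominus> \<one>)) \<in> P" using idl_neg[OF iP idl_l[OF iP s(2) Tj]] .
  then have "T [^] l \<otimes> s \<oplus> \<ominus> (T [^] j \<otimes> (T [^] k \<otimes> s \<ominus> \<one>)) \<in> P \<boxplus> FL (j * e)" using UFL_add[OF iP 1] UFL_U[OF iP] by blast
  moreover have "T [^] l \<otimes> s \<oplus> \<ominus> (T [^] j \<otimes> (T [^] k \<otimes> s \<ominus> \<one>)) = T [^] j"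
  proof -
    have "T [^] l \<otimes> s = T [^] j \<otimes> (T [^] k \<otimes> s)" using nat_pow_mult[OF Tc, of j k] lj m_assoc[OF Tj _ sc, of "T [^] k"] Tc by simp
    then show ?thesis using Tj ts by algebra
  qed
  ultimately have "T [^] j \<in> lf P" using lf_Hn[OF iP Tp] by simp
  then show False using TL by blast
qed

end

section \<open>From the Valabrega-Valla condition back to the graded ring\<close>

context lcr
begin

lemma V3_pow1:
  assumes K: "idl K" and V: "V3 K d x e y f z" and n: "n \<ge> 1"
  shows "V3 K (n * d) (x [^] n) e y f z"
  using n
proof (induction n rule: dec_induct)
  case base
  have "x \<in> \<A>" using V reg3_c unfolding V3_def by blast
  then show ?case using V by simp
next
  case (step n)
  then show ?case using V3_prod[OF K step.IH V] by (simp add: add.commute)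
qed

lemma V3_pow:
  assumes K: "idl K" and V: "V3 K 1 x 1 y 1 z" and n: "n \<ge> 1"
  shows "V3 K n (x [^] n) n (y [^] n) n (z [^] n)"
proof -
  have "V3 K n (x [^] n) 1 y 1 z" using V3_pow1[OF K V n] by simp
  then have "V3 K 1 y n (x [^] n) 1 z" by (rule V3_swap12[OF K])
  then have "V3 K n (y [^] n) n (x [^] n) 1 z" using V3_pow1[OF K _ n] by fastforce
  then have "V3 K 1 z n (y [^] n) n (x [^] n)" using V3_swap12[OF K] V3_swap23[OF K] by blast
  then have "V3 K n (z [^] n) n (y [^] n) n (x [^] n)" using V3_pow1[OF K _ n] by fastforce
  then show ?thesis using V3_swap12[OF K] V3_swap23[OF K] by blast
qed

end

context lgrd
begin

lemma Fm_zero: "dg xs \<Longrightarrow> Fm xs 0 = Ai xs"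
  by (induction xs) (auto simp: PI_smul D.kp_c)

lemma Fm_mult:
  assumes "dg xs" "z \<in> D.kp f" "w \<in> Fm xs (i - f)" shows "z \<otimes> w \<in> Fm xs i"
  using assms
proof (induction xs arbitrary: w)
  case Nil then show ?case using D.kp_c by simp
next
  case (Cons p xs)
  have "w \<in> Fm xs (i - f) \<boxplus> smul (snd p) (D.kp (i - f - fst p))" using Cons.prems(3) by simp
  then obtain w1 u where w: "w1 \<in> Fm xs (i - f)" "u \<in> D.kp (i - f - fst p)" "w = w1 \<oplus> snd p \<otimes> u" by (rule sum_smulE)
  have dx: "dg xs" "snd p \<in> D.kp (fst p)" using Cons.prems(1) by auto
  have c: "z \<in> \<A>" "snd p \<in> \<A>" "w1 \<in> \<A>" "u \<in> \<A>"
    using Cons.prems(2) dx w D.kp_c idl_carr[OF Fm_idl[OF dx(1)]] by auto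
  have "i - f - fst p = i - fst p - f" by simp
  then have zu: "z \<otimes> u \<in> D.kp (i - fst p)" using pw_mem_sub[OF D.K Cons.prems(2)] w(2) by simp
  have "z \<otimes> w = z \<otimes> w1 \<oplus> snd p \<otimes> (z \<otimes> u)" unfolding w(3) using c by algebra
  then show ?case using sum_smul_mem[OF Cons.IH[OF dx(1) Cons.prems(2) w(1)] zu] by simp
qed

text \<open>The condition descends to shorter sequences: for \<open>a = b + z w\<close> in
  \<open>Ai xs\<close> the cofactor \<open>w\<close> lies in \<open>Ai xs\<close> too, with smaller
  exponent because the degree of \<open>z\<close> is positive.\<close>

lemma vv_drop:
  assumes dg: "dg (p # xs)" and nz: "nzd (Ai xs) (snd p)" and vv: "\<And>i. D.kp i \<inter> Ai (p # xs) \<subseteq> Fm (p # xs) i"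
  shows "D.kp i \<inter> Ai xs \<subseteq> Fm xs i"
proof (induction i rule: less_induct)
  case (less i)
  define f z where "f = fst p" and "z = snd p"
  have dx: "dg xs" "f \<ge> 1" "z \<in> D.kp f" using dg unfolding f_def z_def by auto
  have zc: "z \<in> \<A>" using D.kp_c[OF dx(3)] .
  have iA: "idl (Ai xs)" using Ai_idl[OF dx(1)] .
  show ?case
  proof (cases "i = 0")
    case True then show ?thesis using Fm_zero[OF dx(1)] by auto
  next
    case False
    show ?thesis
    proof
      fix a assume a: "a \<in> D.kp i \<inter> Ai xs"
      then have "a \<in> Ai (p # xs)" using sum_l[OF iA PI_idl[OF zc]] unfolding z_def by auto
      then have "a \<in> Fm xs i \<boxplus> smul z (D.kp (i - f))" using vv[of i] a unfolding f_def z_def by auto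
      then obtain b w where w: "b \<in> Fm xs i" "w \<in> D.kp (i - f)" "a = b \<oplus> z \<otimes> w" by (rule sum_smulE)
      have bA: "b \<in> Ai xs" using Fm_Ai[OF dx(1)] w(1) by blast
      have c: "b \<in> \<A>" "w \<in> \<A>" using idl_carr[OF iA bA] D.kp_c[OF w(2)] by auto
      have "z \<otimes> w = a \<ominus> b" unfolding w(3) using c zc by algebra
      then have "z \<otimes> w \<in> Ai xs" using idl_minus[OF iA _ bA] a by simp
      then have "w \<in> Ai xs" using nzdD[OF nz[folded z_def]] c by blast
      then have "w \<in> Fm xs (i - f)" using less[of "i - f"] w(2) dx(2) False by auto
      then show "a \<in> Fm xs i" unfolding w(3) using idl_add[OF Fm_idl[OF dx(1)] w(1) Fm_mult[OF dx(1,3)]] by blast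
    qed
  qed
qed

text \<open>Together with \<open>vv_drop\<close> the converse of \<open>valabrega_valla\<close>. If
  \<open>z w\<close> is in \<open>Fm\<close> up to an error \<open>k\<close> of higher order, the
  condition rewrites \<open>k\<close> as \<open>b2 + z w'\<close> with \<open>w'\<close> in
  \<open>K^(n+1)\<close>. Then \<open>w - w'\<close> lies in \<open>Ai xs\<close> and
  \<open>K^n\<close>, so \<open>w\<close> vanishes modulo the forms.\<close>

lemma vv_nzd:
  assumes dg: "dg (p # xs)" and nz: "nzd (Ai xs) (snd p)" and vv: "\<And>i. D.kp i \<inter> Ai (p # xs) \<subseteq> Fm (p # xs) i"
  shows "Q.nzd (GI xs) (D.eta (fst p) (snd p))"
proof -
  define f z where "f = fst p" and "z = snd p"
  have dx: "dg xs" "f \<ge> 1" "z \<in> D.kp f" using dg unfolding f_def z_def by auto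
  have zc: "z \<in> \<A>" using D.kp_c[OF dx(3)] .
  have iA: "idl (Ai xs)" using Ai_idl[OF dx(1)] .
  have Ap: "Ai (p # xs) = Ai xs \<boxplus> PIdl z" unfolding z_def by simp
  have "Q.nzd (GI xs) (D.eta f z)"
  proof (rule Q.hom_nzd[OF GI_homid[OF dx(1)]])
    show "D.eta f z \<in> D.Hn f" unfolding D.Hn_def using dx(3) by blast
    fix n b assume "b \<in> D.Hn n" and zb: "D.eta f z \<otimes>\<^bsub>D.G\<^esub> b \<in> GI xs"
    then obtain w where w: "w \<in> D.kp n" "b = D.eta n w" unfolding D.Hn_def by blast
    have wc: "w \<in> \<A>" using D.kp_c[OF w(1)] .
    have zw: "z \<otimes> w \<in> D.kp (f + n)" using pw_mem_add[OF D.K dx(3) w(1)] .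
    have "D.eta (f + n) (z \<otimes> w) \<in> GI xs" using zb D.eta_mult[OF dx(3) w(1)] w(2) by simp
    then have "z \<otimes> w \<in> Fm xs (f + n) \<boxplus> D.kp (Suc (f + n))" using mem_GI[OF dx(1) zw] by blast
    then obtain b1 k where k: "b1 \<in> Fm xs (f + n)" "k \<in> D.kp (Suc (f + n))" "z \<otimes> w = b1 \<oplus> k" by (rule sumE)
    have b1: "b1 \<in> Ai xs" using Fm_Ai[OF dx(1)] k(1) by blast
    have c: "b1 \<in> \<A>" "k \<in> \<A>" using idl_carr[OF iA b1] D.kp_c[OF k(2)] by auto
    have "\<ominus> b1 \<oplus> z \<otimes> w \<in> Ai (p # xs)" unfolding Ap using sumPI_mem[OF idl_neg[OF iA b1] wc zc] .
    moreover have "\<ominus> b1 \<oplus> z \<otimes> w = k" unfolding k(3) using c by algebra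
    ultimately have "k \<in> Fm (p # xs) (Suc (f + n))" using vv[of "Suc (f + n)"] k(2) by auto
    then have "k \<in> Fm xs (Suc (f + n)) \<boxplus> smul z (D.kp (Suc (f + n) - f))" unfolding f_def z_def by simp
    then obtain b2 w' where w': "b2 \<in> Fm xs (Suc (f + n))" "w' \<in> D.kp (Suc (f + n) - f)" "k = b2 \<oplus> z \<otimes> w'" by (rule sum_smulE)
    have "Suc (f + n) - f = Suc n" by simp
    then have w'n: "w' \<in> D.kp (Suc n)" using w'(2) by metis
    have b2: "b2 \<in> Ai xs" using Fm_Ai[OF dx(1)] w'(1) by blast
    have c': "b2 \<in> \<A>" "w' \<in> \<A>" using idl_carr[OF iA b2] D.kp_c[OF w'n] by auto
    have "z \<otimes> (w \<ominus> w') = (z \<otimes> w) \<ominus> z \<otimes> w'" using zc wc c' by algebra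
    also have "\<dots> = b1 \<oplus> b2" unfolding k(3) w'(3) using zc c c' by algebra
    finally have "z \<otimes> (w \<ominus> w') \<in> Ai xs" using idl_add[OF iA b1 b2] by simp
    then have "w \<ominus> w' \<in> Ai xs" using nzdD[OF nz[folded z_def]] wc c' by simp
    moreover have "w \<ominus> w' \<in> D.kp n" using idl_minus[OF D.kp_idl w(1)] w'n D.kp_Suc by blast
    ultimately have "w \<ominus> w' \<in> Fm xs n" using vv_drop[OF dg nz vv] by blast
    then have "(w \<ominus> w') \<oplus> w' \<in> Fm xs n \<boxplus> D.kp (Suc n)" by (rule sum_mem[OF _ w'n])
    moreover have "(w \<ominus> w') \<oplus> w' = w" using wc c' by algebra
    ultimately show "b \<in> GI xs" using mem_GI[OF dx(1) w(1)] w(2) by simp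
  qed
  then show ?thesis unfolding f_def z_def .
qed

lemma V3_goodl:
  assumes V: "V3 K d x e y f z" and d: "d \<ge> 1" "e \<ge> 1" "f \<ge> 1"
  shows "goodl [(f, z), (e, y), (d, x)]"
proof -
  have h: "x \<in> D.kp d" "y \<in> D.kp e" "z \<in> D.kp f" "reg3 x y z" using V unfolding V3_def by auto
  have c: "x \<in> \<A>" "y \<in> \<A>" "z \<in> \<A>" using reg3_c[OF h(4)] by auto
  have zx: "{\<zero>} \<boxplus> PIdl x = PIdl x" using zero_sum[OF PI_idl[OF c(1)]] .
  have dg3: "dg [(f, z), (e, y), (d, x)]" and dg2: "dg [(e, y), (d, x)]" and dg1: "dg [(d, x)]" using h d by auto
  have n3: "nzd (Ai [(e, y), (d, x)]) (snd (f, z))" and n2: "nzd (Ai [(d, x)]) (snd (e, y))" and n1: "nzd (Ai []) (snd (d, x))"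
    using h(4) zx unfolding reg3_def by auto
  have v3: "D.kp i \<inter> Ai [(f, z), (e, y), (d, x)] \<subseteq> Fm [(f, z), (e, y), (d, x)] i" for i
    using V zx zero_sum[OF smul_idl[OF c(1) D.kp_idl]] unfolding V3_def S3_def by simp
  note v2 = vv_drop[OF dg3 n3 v3]
  note v1 = vv_drop[OF dg2 n2 v2]
  have "Q.nzd (GI [(e, y), (d, x)]) (D.eta f z)" using vv_nzd[OF dg3 n3 v3] by simp
  moreover have "Q.nzd (GI [(d, x)]) (D.eta e y)" using vv_nzd[OF dg2 n2 v2] by simp
  moreover have "Q.nzd (GI []) (D.eta d x)" using vv_nzd[OF dg1 n1 v1] by simp
  ultimately show ?thesis using h d by simp
qed

text \<open>Modulo \<open>FL d\<close> an element of \<open>FL (d + 1)\<close> is determined by its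
  degree \<open>d\<close> component, so chains between the two pull back to strict chains of ideals
  between \<open>K^(d+1)\<close> and \<open>K^d\<close>.\<close>

lemma FL_step:
  "Q.L.flen (Q.FL d) (Q.FL (Suc d)) \<and> Q.L.len (Q.FL d) (Q.FL (Suc d)) \<le> col (D.kp (Suc d)) - col (D.kp d)"
proof -
  have sm: "Q.L.sm (Q.FL d)" for d unfolding Q.L.sm_def
    using Q.FL_c Q.FL_zero Q.FL_add Q.FL_mult_H[of _ 0] by auto
  have b: "n \<le> col (D.kp (Suc d)) - col (D.kp d)" if C: "Q.L.chn C n (Q.FL d) (Q.FL (Suc d))" for n C
  proof -
    define U where "U i = {a \<in> D.kp d. D.eta d a \<in> C i}" for i
    have Cs: "Q.L.sm (C i)" if "i \<le> n" for i using C that unfolding Q.L.chn_def by blast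
    have C0: "C 0 = Q.FL d" "C n = Q.FL (Suc d)" using C unfolding Q.L.chn_def by auto
    have Cm: "Q.FL d \<subseteq> C i" "C i \<subseteq> Q.FL (Suc d)" if "i \<le> n" for i
      using Q.L.chn_mono[OF C, of 0 i] Q.L.chn_mono[OF C, of i n] that C0 by auto
    have iU: "idl (U i)" if i: "i \<le> n" for i
    proof (rule idlI)
      show "U i \<subseteq> \<A>" unfolding U_def using D.kp_c by blast
      show "\<zero> \<in> U i" unfolding U_def using D.eta_zero[OF idl_zero[OF D.kp_idl], of d] idl_zero[OF D.kp_idl] Q.L.sm_0[OF Cs[OF i]] by simp
    next
      fix a b assume "a \<in> U i" "b \<in> U i"
      then show "a \<oplus> b \<in> U i" unfolding U_def using D.eta_add[of a d b] Q.L.sm_add[OF Cs[OF i], of "D.eta d a" "D.eta d b"] idl_add[OF D.kp_idl] by simp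
    next
      fix a r assume a: "a \<in> U i" and r: "r \<in> \<A>"
      have "D.eta 0 r \<in> D.Hn 0" unfolding D.Hn_def using r by simp
      then have "D.eta 0 r \<otimes>\<^bsub>D.G\<^esub> D.eta d a \<in> C i" using Q.L.sm_sc[OF Cs[OF i]] a unfolding U_def by blast
      then show "r \<otimes> a \<in> U i" using D.eta_mult[of r 0 a d] a r idl_l[OF D.kp_idl] unfolding U_def by simp
    qed
    have lt: "U i \<subset> U (Suc i)" if i: "i < n" for i
    proof -
      have ci: "C i \<subset> C (Suc i)" using C i unfolding Q.L.chn_def by blast
      then obtain w where w: "w \<in> C (Suc i)" "w \<notin> C i" by blast
      have wF: "w \<in> Q.FL (Suc d)" using Cm(2)[of "Suc i"] i w(1) by auto
      have wc: "w \<in> carrier D.G" using Q.FL_c[OF wF] .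
      have cw: "D.cmp d w \<in> carrier D.G" using Q.cmp_c[OF wc] .
      obtain a where a: "a \<in> D.kp d" "D.cmp d w = D.eta d a" using D.cmp_Hn[OF wc, of d] unfolding D.Hn_def by blast
      define l where "l = w \<ominus>\<^bsub>D.G\<^esub> D.cmp d w"
      have l: "l \<in> Q.FL d" unfolding l_def using Q.top_FL[OF wF] .
      have lC: "l \<in> C i" "l \<in> C (Suc i)" using subsetD[OF Cm(1)[of i] l] subsetD[OF Cm(1)[of "Suc i"] l] i by simp_all
      have lc: "l \<in> carrier D.G" using Q.FL_c[OF l] .
      have 1: "D.cmp d w \<in> C (Suc i)"
      proof -
        have "w \<ominus>\<^bsub>D.G\<^esub> l \<in> C (Suc i)" using Q.L.sm_minus[OF Cs w(1) lC(2)] i by simp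
        moreover have "w \<ominus>\<^bsub>D.G\<^esub> l = D.cmp d w" unfolding l_def using wc cw by (simp add: a_minus_def Q.minus_add Q.minus_minus Q.r_neg2)
        ultimately show ?thesis by simp
      qed
      have 2: "D.cmp d w \<notin> C i"
      proof
        assume "D.cmp d w \<in> C i"
        then have "l \<oplus>\<^bsub>D.G\<^esub> D.cmp d w \<in> C i" using Q.L.sm_add[OF Cs lC(1)] i by simp
        moreover have "l \<oplus>\<^bsub>D.G\<^esub> D.cmp d w = w" unfolding l_def using wc cw by (simp add: a_minus_def Q.a_assoc Q.l_neg)
        ultimately show False using w(2) by simp
      qed
      have "a \<in> U (Suc i)" "a \<notin> U i" using 1 2 a unfolding U_def by auto
      moreover have "U i \<subseteq> U (Suc i)" using ci unfolding U_def by blast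
      ultimately show ?thesis by blast
    qed
    have k0: "D.kp (Suc d) \<subseteq> U 0"
    proof
      fix a assume a: "a \<in> D.kp (Suc d)"
      then have ad: "a \<in> D.kp d" using D.kp_Suc by blast
      then have "D.eta d a = \<zero>\<^bsub>D.G\<^esub>" using D.eta_zero a by blast
      then show "a \<in> U 0" unfolding U_def using ad Q.L.sm_0[OF Cs[of 0]] by simp
    qed
    have kn: "U n \<subseteq> D.kp d" unfolding U_def by blast
    have fk: "fin (D.kp i)" for i using fin_pw[OF mp] .
    have f0: "fin (U 0)" using fin_sup[OF fk iU k0] by simp
    have chU: "I.chn U n (U 0) (U n)" unfolding I.chn_def I_sm using iU lt by auto
    have "U 0 \<subseteq> U n" using I.chn_mono[OF chU, of 0 n] by simp
    then have fl: "I.flen (U 0) (U n)" "col (U 0) = col (U n) + I.len (U 0) (U n)" using fin_flen[OF f0 iU] col_len[OF f0 iU] by auto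
    have "n \<le> I.len (U 0) (U n)" using I.len_ge[OF fl(1) chU] .
    moreover have "col (U 0) \<le> col (D.kp (Suc d))" using col_mono[OF fk iU k0] by simp
    moreover have "col (D.kp d) \<le> col (U n)" using col_mono[OF fin_sup[OF f0 iU \<open>U 0 \<subseteq> U n\<close>] D.kp_idl kn] by simp
    ultimately show ?thesis using fl(2) by linarith
  qed
  have s: "Q.FL d \<subseteq> Q.FL (Suc d)" by (rule Q.FL_mono) simp
  show ?thesis by (intro conjI Q.L.len_bound[OF sm sm s]) (rule b, assumption)+
qed

lemma FL_len: "Q.L.flen {\<zero>\<^bsub>D.G\<^esub>} (Q.FL d) \<and> Q.L.len {\<zero>\<^bsub>D.G\<^esub>} (Q.FL d) \<le> col (D.kp d)"
proof (induction d)
  case 0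
  have "Q.L.sm {\<zero>\<^bsub>D.G\<^esub>}" unfolding Q.L.sm_def using Q.Hn_c by auto
  then show ?case unfolding Q.FL_0 using Q.L.len_self by simp
next
  case (Suc d)
  have "col (D.kp d) \<le> col (D.kp (Suc d))" using col_mono[OF fin_pw[OF mp] D.kp_idl D.kp_Suc] .
  moreover have "Q.L.len {\<zero>\<^bsub>D.G\<^esub>} (Q.FL (Suc d)) = Q.L.len {\<zero>\<^bsub>D.G\<^esub>} (Q.FL d) + Q.L.len (Q.FL d) (Q.FL (Suc d))"
    by (rule Q.L.len_add(2)[OF conjunct1[OF Suc] conjunct1[OF FL_step]])
  ultimately have "Q.L.len {\<zero>\<^bsub>D.G\<^esub>} (Q.FL (Suc d)) \<le> col (D.kp (Suc d))"
    using conjunct2[OF Suc] conjunct2[OF FL_step[of d]] by linarith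
  then show ?case using Q.L.len_add(1)[OF conjunct1[OF Suc] conjunct1[OF FL_step]] by simp
qed

end

context gr
begin

lemma lift_form:
  assumes P: "idl P" and h: "Hn e \<subseteq> P \<boxplus> FL e" and y: "y \<in> Hn e"
  shows "\<exists>f\<in>P. f \<in> FL (Suc e) \<and> cmp e f = y"
proof -
  have "y \<in> P \<boxplus> FL e" using h y by blast
  then obtain p w where p: "p \<in> P" "w \<in> FL e" "y = p \<oplus> w" by (rule sumE)
  have c: "p \<in> \<A>" "w \<in> \<A>" "y \<in> \<A>" using idl_carr[OF P p(1)] FL_c[OF p(2)] Hn_c[OF y] by auto
  have pe: "p = y \<ominus> w" unfolding p(3) using c(1,2) by algebra
  have "w \<in> FL (Suc e)" using p(2) FL_mono[of e "Suc e"] by auto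
  then have "p \<in> FL (Suc e)" unfolding pe using FL_minus[OF Hn_FL[OF y]] by blast
  moreover have "cmp e p = y" unfolding pe using cmp_minus[OF c(3,2)] cmp_eq[OF y] FL_cmp[OF p(2)] c(3) by (simp add: a_minus_def)
  ultimately show ?thesis using p(1) by blast
qed

text \<open>The lifts are inhomogeneous elements of \<open>P\<close> with leading forms
  \<open>x, y, z\<close>. Regularity passes from leading forms to elements through
  \<open>lift_nzd\<close>, and \<open>lf_sum\<close> identifies the leading forms of each partial
  ideal. A chain shorter than 3 uses a prefix.\<close>

lemma lift_regular3:
  assumes P: "maximalideal P R" and h: "Hn e \<subseteq> P \<boxplus> FL e" and xyz: "x \<in> Hn e" "y \<in> Hn e" "z \<in> Hn e"
    and nz: "nzd {\<zero>} x" "nzd ({\<zero>} \<boxplus> PIdl x) y" "nzd ({\<zero>} \<boxplus> PIdl x \<boxplus> PIdl y) z" and n: "n \<le> 3"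
  shows "\<exists>xs. length xs = n \<and> set xs \<subseteq> P \<and> regular_seq R xs"
proof -
  have iP: "idl P" using maximalideal.axioms(1)[OF P] .
  obtain a b c where f: "a \<in> P" "a \<in> FL (Suc e)" "cmp e a = x" "b \<in> P" "b \<in> FL (Suc e)" "cmp e b = y" "c \<in> P" "c \<in> FL (Suc e)" "cmp e c = z"
    using lift_form[OF iP h] xyz by meson
  have cc: "a \<in> \<A>" "b \<in> \<A>" "c \<in> \<A>" using f FL_c by auto
  have nz0: "nzd (lf {\<zero>}) x" unfolding lf_zero by (rule nz(1))
  have n1: "nzd {\<zero>} a" using lift_nzd[OF zeroideal nz0 f(2,3)] .
  have l1: "lf ({\<zero>} \<boxplus> PIdl a) = {\<zero>} \<boxplus> PIdl x" using lf_sum[OF zeroideal nz0 f(2,3)] unfolding lf_zero .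
  have ia: "idl ({\<zero>} \<boxplus> PIdl a)" using sum_PI_idl[OF zeroideal cc(1)] .
  have n2: "nzd ({\<zero>} \<boxplus> PIdl a) b" using lift_nzd[OF ia nz(2)[folded l1] f(5,6)] .
  have l2: "lf ({\<zero>} \<boxplus> PIdl a \<boxplus> PIdl b) = {\<zero>} \<boxplus> PIdl x \<boxplus> PIdl y" using lf_sum[OF ia nz(2)[folded l1] f(5,6)] unfolding l1 .
  have n3: "nzd ({\<zero>} \<boxplus> PIdl a \<boxplus> PIdl b) c" using lift_nzd[OF sum_PI_idl[OF ia cc(2)] nz(3)[folded l2] f(8,9)] .
  have g1: "Idl {a} = {\<zero>} \<boxplus> PIdl a" using Idl_insert[of "{}" a] Idl_empty cc by simp
  have g2: "Idl {a, b} = {\<zero>} \<boxplus> PIdl a \<boxplus> PIdl b" using Idl_insert[of "{a}" b] g1 cc by (simp add: insert_commute)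
  let ?l = "[a, b, c]"
  have "regular_seq R (take n ?l)" unfolding regular_seq_def
  proof (intro conjI allI impI ballI)
    have sP: "set (take n ?l) \<subseteq> P" using set_take_subset[of n ?l] f by auto
    then show "set (take n ?l) \<subseteq> \<A>" using idl_sub[OF iP] by blast
    show "Idl (set (take n ?l)) \<noteq> \<A>" using genideal_minimal[OF iP sP] maximalideal.I_notcarr[OF P] idl_sub[OF iP] by blast
    fix i y assume i: "i < length (take n ?l)" and y: "y \<in> \<A>" "take n ?l ! i \<otimes> y \<in> Idl (set (take i (take n ?l)))"
    have i': "i < n" "i < 3" using i n by auto
    have e: "take n ?l ! i = ?l ! i" "take i (take n ?l) = take i ?l" using i' by (auto simp: min_def)
    consider "i = 0" | "i = 1" | "i = 2" using i' by linarith
    then have "nzd (Idl (set (take i ?l))) (?l ! i)"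
    proof cases
      case 1 then show ?thesis using n1 Idl_empty by simp
    next
      case 2 then show ?thesis using n2 g1 by simp
    next
      case 3 then show ?thesis using n3 g2 by (simp add: numeral_2_eq_2)
    qed
    then show "y \<in> Idl (set (take i (take n ?l)))" using nzdD y unfolding e by blast
  qed
  moreover have "length (take n ?l) = n" using n by simp
  moreover have "set (take n ?l) \<subseteq> P" using set_take_subset[of n ?l] f by auto
  ultimately show ?thesis by blast
qed

end

context lgrd
begin

text \<open>The degree \<open>e\<close> in which all forms are leading forms from \<open>P\<close>
  depends on \<open>P\<close>; this is why powers \<open>x^e, y^e, z^e\<close> replace
  \<open>x, y, z\<close>.\<close>

lemma cm_of_V3:
  assumes V: "V3 K 1 x 1 y 1 z" and C: "\<And>d. col (D.kp d) \<le> C * (d + 1) ^ 3"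
  shows "cohen_macaulay D.G"
  unfolding cohen_macaulay_def
proof (intro conjI allI impI)
  show "cring D.G" by (rule D.G_cring)
  show "noetherian_ring D.G" by (rule G_noeth)
  interpret S: grg D.G D.Hn D.cmp nnK C
    using FL_len C le_trans by (intro grg.intro grg_axioms.intro Q.gr_axioms) blast+
  fix P E n assume P: "maximalideal P D.G" and E: "prime_chain D.G E n \<and> E n = P"
  obtain e where e: "e \<ge> 1" "D.Hn e \<subseteq> Q.sumI P (Q.FL e)" using S.maximal_leading_forms[OF P] by blast
  have V': "V3 K e (x [^] e) e (y [^] e) e (z [^] e)" using V3_pow[OF D.K V e(1)] .
  then have k: "x [^] e \<in> D.kp e" "y [^] e \<in> D.kp e" "z [^] e \<in> D.kp e" unfolding V3_def by auto
  have g: "goodl [(e, z [^] e), (e, y [^] e), (e, x [^] e)]" using V3_goodl[OF V' e(1) e(1) e(1)] .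
  show "\<exists>xs. length xs = n \<and> set xs \<subseteq> P \<and> regular_seq D.G xs"
  proof (rule Q.lift_regular3[OF P e(2)])
    show "D.eta e (x [^] e) \<in> D.Hn e" "D.eta e (y [^] e) \<in> D.Hn e" "D.eta e (z [^] e) \<in> D.Hn e" unfolding D.Hn_def using k by auto
    show "n \<le> 3" using S.prime_chain_le3 E by blast
  qed (use g in auto)
qed

end

theorem theorem4p2:
  fixes A :: "'a ring" and m I J :: "'a set"
  assumes "local_ring A m"
    and "cohen_macaulay A"
    and "krull_dim_is A 3"
    and "m_primary A m I" and "m_primary A m J"
    and "is_reduction A I J"
    and "cohen_macaulay (assoc_graded A I)"
    and "asymptotically_normal A J"
    and "hilbert_coeffs A J 3 = hilbert_coeffs A I 3"
  shows "\<exists>N. \<forall>n\<ge>N. cohen_macaulay (assoc_graded A (ipow A J n))"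
proof -
  have l: "lcr A m" using assms(1,2) unfolding local_ring_def cohen_macaulay_def
    by (intro lcr.intro ncr.intro cr.intro ncr_axioms.intro lcr_axioms.intro) (auto simp: local_ring_def)
  interpret H: hyp A m I
    using l assms by (intro hyp.intro lgrd.intro lgrd_axioms.intro hyp_axioms.intro)
  obtain N where N: "\<And>n. n \<ge> N \<Longrightarrow> \<exists>x y z. H.V3 (ipow A J n) 1 x 1 y 1 z \<and> (\<exists>C. \<forall>d. colength A (ipow A (ipow A J n) d) \<le> C * (d + 1) ^ 3)"
    using H.reduction_V3[OF assms(5,6,8,9)] by blast
  \<comment> \<open>The bound \<open>Suc N\<close> ensures \<open>n >= 1\<close>, so that
    \<open>J^n\<close> is contained in \<open>m\<close>.\<close>
  have "cohen_macaulay (assoc_graded A (ipow A J n))" if n: "n \<ge> Suc N" for n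
  proof -
    have J: "ideal J A" "J \<subseteq> m" using assms(5) unfolding m_primary_def by auto
    have "m_primary A m (ipow A J n)" unfolding m_primary_def
    proof (intro conjI ballI)
      show "ideal (ipow A J n) A" using H.pw_idl[OF J(1)] .
      show "ipow A J n \<subseteq> m" using H.pw_antimono[OF J(1), of 1 n] H.pw_one[OF J(1)] J(2) n by auto
      fix x assume x: "x \<in> m"
      then obtain k :: nat where "x [^]\<^bsub>A\<^esub> k \<in> J" using assms(5) unfolding m_primary_def by blast
      then have "(x [^]\<^bsub>A\<^esub> k) [^]\<^bsub>A\<^esub> n \<in> ipow A J n" using H.pw_nat_pow[OF J(1), of "x [^]\<^bsub>A\<^esub> k" 1 n] H.pw_one[OF J(1)] by simp
      then show "\<exists>k::nat. x [^]\<^bsub>A\<^esub> k \<in> ipow A J n" using H.nat_pow_pow[OF H.m_c[OF x]] by metis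
    qed
    then have g: "lgrd A m (ipow A J n)" using l by (intro lgrd.intro lgrd_axioms.intro)
    obtain x y z C where "H.V3 (ipow A J n) 1 x 1 y 1 z" "\<And>d. colength A (ipow A (ipow A J n) d) \<le> C * (d + 1) ^ 3"
      using N[of n] n by auto
    then show ?thesis using lgrd.cm_of_V3[OF g] by blast
  qed
  then show ?thesis by blast
qed

end
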